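(* Let $\gamma\in(0,1)$. For all $\alpha\in[0,\pi/2]$ we have $$\widetilde h^{(p(\alpha),q(\alpha))}=h^\alpha\quad\text{on }(0,\infty)^2.$$ The Martin boundary $\partial_M^{\mathbb{R}_+^2}Z$ of the process $Z$ killed at the boundary of the quadrant is minimal. It is homeomorphic to the arc of parabola $\overline{\mathcal{A}}=\{(p(\alpha),q(\alpha)):\alpha\in[0,\pi/2]\}$ through the map $$\overline{\mathcal{A}}\longrightarrow\partial_M^{\mathbb{R}_+^2}Z,\qquad(p(\alpha),q(\alpha))\longmapsto\frac{\widetilde h^{(p(\alpha),q(\alpha))}(\cdot)}{\widetilde h^{(p(\alpha),q(\alpha))}(1,1)}.$$
   Context: Let $W$ be a standard one-dimensional Brownian motion. For a starting point $z_0=(x_0,y_0)$ in the quadrant, let $Z(t)=(X(t),Y(t))=(x_0-W(t)+(1-\gamma)t,\ y_0+W(t)+\gamma t)$. Let $T_1=\inf\{t\ge0: Z(t)\in\{0\}\times\mathbb{R}_+\}$, $T_2=\inf\{t\ge0: Z(t)\in\mathbb{R}_+\times\{0\}\}$, $T=T_1\wedge T_2$. The generator is $\mathcal{G}=\frac12(\partial_x-\partial_y)^2+(1-\gamma)\partial_x+\gamma\partial_y$. The Green's density $g_{z_0}$ of the killed process is the density (assumed to exist) of $S\mapsto\int_0^\infty\mathbb{P}(Z(t)\in S,\ t<T)\,dt$, $S\subset(0,\infty)^2$. Saddle points: for $\alpha\in(0,\pi/2)$, $(p(\alpha),q(\alpha))=\mathrm{argmax}\{p\cos\alpha+q\sin\alpha:(p,q)\in\mathbb{R}^2,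 K(p,q)=0\}=\left(\frac{\gamma^2}{2}-\frac{1}{2(1+1/\tan\alpha)^2},\ \frac{(1-\gamma)^2}{2}-\frac{1}{2(1+\tan\alpha)^2}\right)$, where $K(p,q)=\frac12(p-q)^2+(1-\gamma)p+\gamma q$; extended by limits, $(p(0),q(0))=(\gamma^2/2,-\gamma+\gamma^2/2)$ and $(p(\pi/2),q(\pi/2))=((\gamma^2-1)/2,(1-\gamma)^2/2)$. Functions $h^\alpha$: let $L_1(q)=\mathbb{E}(e^{qY(T_1)}\mathbf{1}_{T_1<T_2})$ for $\Re q<0$, $L_2(p)=\mathbb{E}(e^{pX(T_2)}\mathbf{1}_{T_2<T_1})$ for $\Re p<0$ (depending on $z_0$). With $P^-(q)=\gamma-1+q-\sqrt{(1-\gamma)^2-2q}$ and $Q^-(p)=-\gamma+p-\sqrt{\gamma^2-2p}$, they are continued analytically by $L_1(q)=e^{P^-(q)x_0+qy_0}-L_2(P^-(q))$ for $\Re q<(1-\gamma)^2/2$ and $L_2(p)=e^{px_0+Q^-(p)y_0}-L_1(Q^-(p))$ for $\Re p<\gamma^2/2$. Then $h^\alpha(z_0)=e^{p(\alpha)x_0+q(\alpha)y_0}-L_1(q(\alpha))-L_2(p(\alpha))$ for $\alpha\in(0,\pi/2)$, $h^{\pi/2}(z_0)=x_0e^{x_0p(\pi/2)+y_0q(\pi/2)}-L_2'(p(\pi/2))$ and $h^0(z_0)=y_0e^{x_0p(0)+y_0q(0)}-L_1'(q(0))$. Functions $\widetilde h$: for $\alpha\in(0,\pi/2)$ and $(p_0,q_0)=(p(\alpha),q(\alpha))$,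 $\widetilde h^{(p_0,q_0)}(x,y)=\sum_{n\in\mathbb{Z}}(-1)^ne^{xp_n+yq_n}$, where for all $n\in\mathbb{Z}$, $p_{2n}=p_0+2n(p_0-q_0)-2n(n+\gamma)$, $q_{2n}=q_0+2n(p_0-q_0)-2n(n+\gamma-1)$ and $(p_{2n+1},q_{2n+1})=(p_{2n},q_{2n+2})$. For $\alpha=0$, $\widetilde h^{(p(0),q(0))}(x,y)=\sum_{n\in\mathbb{Z}}(-2nx+(1-2n)y)e^{x(\gamma^2/2-2n^2)+y(\gamma^2/2-\gamma-2n(n-1))}$. For $\alpha=\pi/2$, symmetrically (exchanging $x\leftrightarrow y$ and $\gamma\leftrightarrow1-\gamma$), $\widetilde h^{(p(\pi/2),q(\pi/2))}(x,y)=\sum_{n\in\mathbb{Z}}((1-2n)x-2ny)e^{x((1-\gamma)^2/2-(1-\gamma)-2n(n-1))+y((1-\gamma)^2/2-2n^2)}$. Martin boundary: the Martin kernel with reference point $(1,1)$ is $k(z_0,z)=g_{z_0}(z)/g_{(1,1)}(z)$ (for $z=(x,y)$ with $x+y>2$). The Martin boundary $\partial_M^{\mathbb{R}_+^2}Z$ is the set of functions on $(0,\infty)^2$ arising as pointwise limits of $k(\cdot,z_n)$ along sequences $z_n\in(0,\infty)^2$ with $|z_n|\to\infty$, with the topology of pointwise convergence. A harmonic function is a function $u$ with $\mathcal{G}u=0$ on $(0,\infty)^2$ and $u=0$ on $(0,\infty)\times\{0\}\cup\{0\}\times(0,\infty)$; a positive harmonic function $u$ is minimal if every positive harmonic function $v\le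 u$ is a constant multiple of $u$. The Martin boundary is called minimal if all its elements are minimal harmonic functions. *)

theory Defs
  imports "HOL-Probability.Probability" "HOL-Complex_Analysis.Complex_Analysis"
begin

section \<open>The process\<close>

locale standard_brownian_motion = prob_space M for M :: "'a measure" +
  fixes W :: "real \<Rightarrow> 'a \<Rightarrow> real"
  assumes W_measurable: "0 \<le> t \<Longrightarrow> W t \<in> borel_measurable M"
    and W_start: "\<omega> \<in> space M \<Longrightarrow> W 0 \<omega> = 0"
    and W_continuous: "\<omega> \<in> space M \<Longrightarrow> continuous_on {0..} (\<lambda>t. W t \<omega>)"
    and W_gaussian: "0 \<le> s \<Longrightarrow> s < t \<Longrightarrow>
      distributed M lborel (\<lambda>\<omega>. W t \<omega> - W s \<omega>) (normal_density 0 (sqrt (t - s)))"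
    and W_indep: "0 \<le> \<tau> 0 \<Longrightarrow> mono \<tau> \<Longrightarrow>
      indep_vars (\<lambda>_. borel) (\<lambda>i \<omega>. W (\<tau> (Suc i)) \<omega> - W (\<tau> i) \<omega>) {..<n::nat}"

definition quadrant :: "(real \<times> real) set" where
  "quadrant = {0<..} \<times> {0<..}"

definition Z :: "(real \<Rightarrow> 'a \<Rightarrow> real) \<Rightarrow> real \<Rightarrow> real \<times> real \<Rightarrow> real \<Rightarrow> 'a \<Rightarrow> real \<times> real" where
  "Z W \<gamma> z0 t \<omega> = (fst z0 - W t \<omega> + (1 - \<gamma>) * t, snd z0 + W t \<omega> + \<gamma> * t)"

text \<open>Hitting times are extended reals; \<open>Inf {} = \<infinity>\<close> when the set is never reached.\<close>

definition hitting_time :: "(real \<Rightarrow> 'a \<Rightarrow> 'b) \<Rightarrow> 'b set \<Rightarrow> 'a \<Rightarrow> ereal" where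
  "hitting_time X A \<omega> = Inf (ereal ` {t. 0 \<le> t \<and> X t \<omega> \<in> A})"

definition T1 :: "(real \<Rightarrow> 'a \<Rightarrow> real) \<Rightarrow> real \<Rightarrow> real \<times> real \<Rightarrow> 'a \<Rightarrow> ereal" where
  "T1 W \<gamma> z0 = hitting_time (Z W \<gamma> z0) ({0} \<times> {0..})"

definition T2 :: "(real \<Rightarrow> 'a \<Rightarrow> real) \<Rightarrow> real \<Rightarrow> real \<times> real \<Rightarrow> 'a \<Rightarrow> ereal" where
  "T2 W \<gamma> z0 = hitting_time (Z W \<gamma> z0) ({0..} \<times> {0})"

definition T :: "(real \<Rightarrow> 'a \<Rightarrow> real) \<Rightarrow> real \<Rightarrow> real \<times> real \<Rightarrow> 'a \<Rightarrow> ereal" where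
  "T W \<gamma> z0 \<omega> = min (T1 W \<gamma> z0 \<omega>) (T2 W \<gamma> z0 \<omega>)"

text \<open>
  A density is determined only almost everywhere, whereas the Martin kernel uses its values at
  points. We take the version that is continuous away from the starting point (where the density
  is singular); this determines it everywhere on the quadrant except at \<open>z0\<close>.
\<close>

definition is_green_density ::
  "'a measure \<Rightarrow> (real \<Rightarrow> 'a \<Rightarrow> real) \<Rightarrow> real \<Rightarrow> real \<times> real \<Rightarrow> (real \<times> real \<Rightarrow> real) \<Rightarrow> bool" where
  "is_green_density M W \<gamma> z0 f \<longleftrightarrow>
     (\<forall>z\<in>quadrant. 0 \<le> f z) \<and>
     continuous_on (quadrant - {z0}) f \<and>
     (\<forall>S\<in>sets borel. S \<subseteq> quadrant \<longrightarrow>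
        (\<integral>\<^sup>+t\<in>{0..}. emeasure M {\<omega> \<in> space M. Z W \<gamma> z0 t \<omega> \<in> S \<and> ereal t < T W \<gamma> z0 \<omega>} \<partial>lborel)
        = (\<integral>\<^sup>+z\<in>S. ennreal (f z) \<partial>lborel))"

section \<open>Saddle points\<close>

definition K :: "real \<Rightarrow> real \<Rightarrow> real \<Rightarrow> real" where
  "K \<gamma> p q = (p - q)\<^sup>2 / 2 + (1 - \<gamma>) * p + \<gamma> * q"

definition saddle :: "real \<Rightarrow> real \<Rightarrow> real \<times> real" where
  "saddle \<gamma> \<alpha> =
     (if \<alpha> = 0 then (\<gamma>\<^sup>2 / 2, - \<gamma> + \<gamma>\<^sup>2 / 2)
      else if \<alpha> = pi / 2 then ((\<gamma>\<^sup>2 - 1) / 2, (1 - \<gamma>)\<^sup>2 / 2)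
      else arg_max (\<lambda>(p, q). p * cos \<alpha> + q * sin \<alpha>) (\<lambda>(p, q). K \<gamma> p q = 0))"

lemma saddle_0: "saddle \<gamma> 0 = (\<gamma>\<^sup>2 / 2, - \<gamma> + \<gamma>\<^sup>2 / 2)"
  by (simp add: saddle_def)

lemma saddle_pi_half: "saddle \<gamma> (pi / 2) = ((\<gamma>\<^sup>2 - 1) / 2, (1 - \<gamma>)\<^sup>2 / 2)"
  by (simp add: saddle_def)

lemma K_eq_0_iff:
  "K \<gamma> p q = 0 \<longleftrightarrow> (\<exists>s. p = \<gamma>\<^sup>2 / 2 - (1 - s)\<^sup>2 / 2 \<and> q = (1 - \<gamma>)\<^sup>2 / 2 - s\<^sup>2 / 2)"
proof
  assume "K \<gamma> p q = 0"
  then have "p = \<gamma>\<^sup>2 / 2 - (1 - (p - q + (1 - \<gamma>)))\<^sup>2 / 2 \<and> q = (1 - \<gamma>)\<^sup>2 / 2 - (p - q + (1 - \<gamma>))\<^sup>2 / 2"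
    unfolding K_def by (auto simp: power2_eq_square algebra_simps divide_simps)
  then show "\<exists>s. p = \<gamma>\<^sup>2 / 2 - (1 - s)\<^sup>2 / 2 \<and> q = (1 - \<gamma>)\<^sup>2 / 2 - s\<^sup>2 / 2" by blast
next
  assume "\<exists>s. p = \<gamma>\<^sup>2 / 2 - (1 - s)\<^sup>2 / 2 \<and> q = (1 - \<gamma>)\<^sup>2 / 2 - s\<^sup>2 / 2"
  then obtain s where s: "p = \<gamma>\<^sup>2 / 2 - (1 - s)\<^sup>2 / 2" "q = (1 - \<gamma>)\<^sup>2 / 2 - s\<^sup>2 / 2" by blast
  have "p - q = s - (1 - \<gamma>)"
    unfolding s by (simp add: power2_eq_square algebra_simps divide_simps)
  then show "K \<gamma> p q = 0"
    unfolding K_def s by (simp add: power2_eq_square algebra_simps divide_simps)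
qed

lemma saddle_eq:
  assumes "0 < \<alpha>" "\<alpha> < pi / 2"
  shows "saddle \<gamma> \<alpha> =
    (\<gamma>\<^sup>2 / 2 - 1 / (2 * (1 + 1 / tan \<alpha>)\<^sup>2), (1 - \<gamma>)\<^sup>2 / 2 - 1 / (2 * (1 + tan \<alpha>)\<^sup>2))"
proof -
  define c d where "c = cos \<alpha>" and "d = sin \<alpha>"
  have c: "c > 0" and d: "d > 0"
    using assms by (auto simp: c_def d_def intro: cos_gt_zero sin_gt_zero2)
  define \<sigma> where "\<sigma> = c / (c + d)"
  define f where "f = (\<lambda>(p, q). p * cos \<alpha> + q * sin \<alpha>)"
  define P where "P = (\<lambda>(p, q). K \<gamma> p q = 0)"
  define pt where "pt = (\<lambda>s::real. (\<gamma>\<^sup>2 / 2 - (1 - s)\<^sup>2 / 2, (1 - \<gamma>)\<^sup>2 / 2 - s\<^sup>2 / 2))"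
  have P_iff: "P z \<longleftrightarrow> (\<exists>s. z = pt s)" for z
    by (cases z) (simp add: P_def pt_def K_eq_0_iff)
  have f_pt: "f (pt s) = f (pt \<sigma>) - (c + d) / 2 * (s - \<sigma>)\<^sup>2" for s
  proof -
    have "(c + d) * \<sigma> = c" using c d by (simp add: \<sigma>_def)
    have "(c + d) / 2 * (s - \<sigma>)\<^sup>2 = (c + d) / 2 * s\<^sup>2 - ((c + d) * \<sigma>) * s + (c + d) / 2 * \<sigma>\<^sup>2"
      by (simp add: power2_eq_square field_simps)
    then have A: "(c + d) / 2 * (s - \<sigma>)\<^sup>2 = (c + d) / 2 * s\<^sup>2 - c * s + (c + d) / 2 * \<sigma>\<^sup>2"
      using \<open>(c + d) * \<sigma> = c\<close> by simp
    have F: "f (pt s) = c * (\<gamma>\<^sup>2 / 2 - 1 / 2) + d * (1 - \<gamma>)\<^sup>2 / 2 + c * s - (c + d) / 2 * s\<^sup>2" for s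
      by (simp add: f_def pt_def c_def d_def power2_eq_square algebra_simps add_divide_distrib diff_divide_distrib)
    have Y: "(c + d) / 2 * \<sigma>\<^sup>2 = c * \<sigma> / 2"
      using \<open>(c + d) * \<sigma> = c\<close> by (simp add: power2_eq_square flip: mult.assoc)
    show ?thesis using A F[of s] F[of \<sigma>] Y by linarith
  qed
  have le: "f (pt s) < f (pt \<sigma>)" if "s \<noteq> \<sigma>" for s
    using that c d by (simp add: f_pt[of s] zero_less_mult_iff)
  have le': "f (pt s) \<le> f (pt \<sigma>)" for s
    using le[of s] by (cases "s = \<sigma>") auto
  have "is_arg_max f P z \<longleftrightarrow> z = pt \<sigma>" for z
    unfolding is_arg_max_def P_iff using le le' by (metis not_less)
  then have "arg_max f P = pt \<sigma>"
    unfolding arg_max_def by (intro some_equality) auto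
  then have "saddle \<gamma> \<alpha> = pt \<sigma>"
    using assms unfolding saddle_def f_def P_def by simp
  moreover have "\<sigma> = 1 / (1 + tan \<alpha>)" "1 - \<sigma> = 1 / (1 + 1 / tan \<alpha>)"
    using c d by (simp_all add: \<sigma>_def tan_def c_def[symmetric] d_def[symmetric] field_simps)
  then have "\<sigma>\<^sup>2 / 2 = 1 / (2 * (1 + tan \<alpha>)\<^sup>2)" "(1 - \<sigma>)\<^sup>2 / 2 = 1 / (2 * (1 + 1 / tan \<alpha>)\<^sup>2)"
    by (simp_all only: power_divide) simp_all
  ultimately show ?thesis
    by (simp only: pt_def)
qed

text \<open>The two endpoint values are the limits of the interior ones:\<close>

lemma continuous_on_saddle: "continuous_on {0..pi / 2} (saddle \<gamma>)"
proof -
  have eq: "saddle \<gamma> \<alpha> = (\<gamma>\<^sup>2 / 2 - (sin \<alpha> / (cos \<alpha> + sin \<alpha>))\<^sup>2 / 2,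
                     (1 - \<gamma>)\<^sup>2 / 2 - (cos \<alpha> / (cos \<alpha> + sin \<alpha>))\<^sup>2 / 2)"
    if "\<alpha> \<in> {0..pi / 2}" for \<alpha>
  proof -
    consider "\<alpha> = 0" | "\<alpha> = pi / 2" | "0 < \<alpha>" "\<alpha> < pi / 2" using \<open>\<alpha> \<in> {0..pi / 2}\<close> by fastforce
    then show ?thesis
    proof cases
      case 1
      then show ?thesis by (simp add: saddle_0 power2_eq_square field_simps)
    next
      case 2
      show ?thesis unfolding 2 by (simp add: saddle_pi_half diff_divide_distrib)
    next
      case 3
      then have c: "cos \<alpha> > 0" and d: "sin \<alpha> > 0"
        by (auto intro: cos_gt_zero sin_gt_zero2)
      have "1 + tan \<alpha> = (cos \<alpha> + sin \<alpha>) / cos \<alpha>" "1 + 1 / tan \<alpha> = (cos \<alpha> + sin \<alpha>) / sin \<alpha>"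
        using c d by (simp_all add: tan_def field_simps)
      then show ?thesis using 3 by (simp add: saddle_eq power_divide)
    qed
  qed
  have "cos \<alpha> + sin \<alpha> \<noteq> 0" if "\<alpha> \<in> {0..pi / 2}" for \<alpha>
  proof -
    have "cos \<alpha> \<ge> 0" "sin \<alpha> \<ge> 0"
      using \<open>\<alpha> \<in> {0..pi / 2}\<close> by (auto intro: cos_ge_zero sin_ge_zero)
    moreover have "sin \<alpha> ^ 2 + cos \<alpha> ^ 2 = 1" by simp
    ultimately show ?thesis by (metis add_nonneg_eq_0_iff add_0 power_zero_numeral zero_neq_one)
  qed
  then show ?thesis
    by (subst continuous_on_cong[OF refl eq]) (auto intro!: continuous_intros)
qed

definition saddle_arc :: "real \<Rightarrow> (real \<times> real) set" where
  "saddle_arc \<gamma> = saddle \<gamma> ` {0..pi / 2}"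

section \<open>The functions \<open>h\<close>\<close>

definition L1_exp :: "'a measure \<Rightarrow> (real \<Rightarrow> 'a \<Rightarrow> real) \<Rightarrow> real \<Rightarrow> real \<times> real \<Rightarrow> complex \<Rightarrow> complex" where
  "L1_exp M W \<gamma> z0 q =
     (LINT \<omega>:{\<omega>. T1 W \<gamma> z0 \<omega> < T2 W \<gamma> z0 \<omega>}|M.
        exp (q * complex_of_real (snd (Z W \<gamma> z0 (real_of_ereal (T1 W \<gamma> z0 \<omega>)) \<omega>))))"

definition L2_exp :: "'a measure \<Rightarrow> (real \<Rightarrow> 'a \<Rightarrow> real) \<Rightarrow> real \<Rightarrow> real \<times> real \<Rightarrow> complex \<Rightarrow> complex" where
  "L2_exp M W \<gamma> z0 p =
     (LINT \<omega>:{\<omega>. T2 W \<gamma> z0 \<omega> < T1 W \<gamma> z0 \<omega>}|M.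
        exp (p * complex_of_real (fst (Z W \<gamma> z0 (real_of_ereal (T2 W \<gamma> z0 \<omega>)) \<omega>))))"

definition P_minus :: "real \<Rightarrow> complex \<Rightarrow> complex" where
  "P_minus \<gamma> q = of_real \<gamma> - 1 + q - csqrt (of_real ((1 - \<gamma>)\<^sup>2) - 2 * q)"

definition Q_minus :: "real \<Rightarrow> complex \<Rightarrow> complex" where
  "Q_minus \<gamma> p = - of_real \<gamma> + p - csqrt (of_real (\<gamma>\<^sup>2) - 2 * p)"

text \<open>
  The continuation formulas are not circular: by the next two lemmas, the transform on their
  right-hand sides is evaluated in the half-plane where it is given by the expectation.
\<close>

lemma Re_P_minus_neg:
  assumes "0 < \<gamma>" "\<gamma> < 1" "Re q < (1 - \<gamma>)\<^sup>2 / 2"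
  shows "Re (P_minus \<gamma> q) < 0"
proof -
  define s where "s = csqrt (of_real ((1 - \<gamma>)\<^sup>2) - 2 * q)"
  have s2: "s\<^sup>2 = of_real ((1 - \<gamma>)\<^sup>2) - 2 * q" by (simp add: s_def)
  have q: "Re q = (1 - \<gamma>)\<^sup>2 / 2 - Re (s\<^sup>2) / 2" unfolding s2 by (simp add: field_simps)
  have "Re s \<ge> 0" using csqrt_principal[of "of_real ((1 - \<gamma>)\<^sup>2) - 2 * q"] unfolding s_def by linarith
  moreover have "Re (s\<^sup>2) > 0" using assms(3) q by simp
  moreover have "Re (P_minus \<gamma> q) = \<gamma> - 1 + Re q - Re s"
    by (simp add: P_minus_def s_def)
  moreover have "\<gamma> - 1 + (1 - \<gamma>)\<^sup>2 / 2 < 0"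
    using assms by (simp add: power2_eq_square algebra_simps divide_simps) (smt (verit) mult_less_cancel_left2)
  ultimately show ?thesis using q by linarith
qed

lemma Re_Q_minus_neg:
  assumes "0 < \<gamma>" "\<gamma> < 1" "Re p < \<gamma>\<^sup>2 / 2"
  shows "Re (Q_minus \<gamma> p) < 0"
proof -
  have "Q_minus \<gamma> p = P_minus (1 - \<gamma>) p" by (simp add: Q_minus_def P_minus_def)
  then show ?thesis using Re_P_minus_neg[of "1 - \<gamma>" p] assms by simp
qed

text \<open>
  \<open>L1\<close> and \<open>L2\<close> are meaningful for \<open>Re q < (1 - \<gamma>)\<^sup>2 / 2\<close> and \<open>Re p < \<gamma>\<^sup>2 / 2\<close> respectively.
\<close>

definition L1 :: "'a measure \<Rightarrow> (real \<Rightarrow> 'a \<Rightarrow> real) \<Rightarrow> real \<Rightarrow> real \<times> real \<Rightarrow> complex \<Rightarrow> complex" where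
  "L1 M W \<gamma> z0 q =
     (if Re q < 0 then L1_exp M W \<gamma> z0 q
      else exp (P_minus \<gamma> q * of_real (fst z0) + q * of_real (snd z0))
             - L2_exp M W \<gamma> z0 (P_minus \<gamma> q))"

definition L2 :: "'a measure \<Rightarrow> (real \<Rightarrow> 'a \<Rightarrow> real) \<Rightarrow> real \<Rightarrow> real \<times> real \<Rightarrow> complex \<Rightarrow> complex" where
  "L2 M W \<gamma> z0 p =
     (if Re p < 0 then L2_exp M W \<gamma> z0 p
      else exp (p * of_real (fst z0) + Q_minus \<gamma> p * of_real (snd z0))
             - L1_exp M W \<gamma> z0 (Q_minus \<gamma> p))"

definition h :: "'a measure \<Rightarrow> (real \<Rightarrow> 'a \<Rightarrow> real) \<Rightarrow> real \<Rightarrow> real \<Rightarrow> real \<times> real \<Rightarrow> complex" where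
  "h M W \<gamma> \<alpha> z0 =
     (let (x0, y0) = z0; (p, q) = saddle \<gamma> \<alpha>; e = complex_of_real (exp (p * x0 + q * y0)) in
      if \<alpha> = 0 then of_real y0 * e - deriv (L1 M W \<gamma> z0) (of_real q)
      else if \<alpha> = pi / 2 then of_real x0 * e - deriv (L2 M W \<gamma> z0) (of_real p)
      else e - L1 M W \<gamma> z0 (of_real q) - L2 M W \<gamma> z0 (of_real p))"

section \<open>The explicit functions \<open>htilde\<close>\<close>

definition p_even :: "real \<Rightarrow> real \<times> real \<Rightarrow> int \<Rightarrow> real" where
  "p_even \<gamma> pq n =
     (let (p0, q0) = pq in p0 + 2 * of_int n * (p0 - q0) - 2 * of_int n * (of_int n + \<gamma>))"

definition q_even :: "real \<Rightarrow> real \<times> real \<Rightarrow> int \<Rightarrow> real" where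
  "q_even \<gamma> pq n =
     (let (p0, q0) = pq in q0 + 2 * of_int n * (p0 - q0) - 2 * of_int n * (of_int n + \<gamma> - 1))"

definition pq_seq :: "real \<Rightarrow> real \<times> real \<Rightarrow> int \<Rightarrow> real \<times> real" where
  "pq_seq \<gamma> pq n =
     (if even n then (p_even \<gamma> pq (n div 2), q_even \<gamma> pq (n div 2))
      else (p_even \<gamma> pq (n div 2), q_even \<gamma> pq (n div 2 + 1)))"

definition htilde :: "real \<Rightarrow> real \<times> real \<Rightarrow> real \<times> real \<Rightarrow> real" where
  "htilde \<gamma> pq z =
     (let (x, y) = z in
      if pq = saddle \<gamma> 0 then
        (\<Sum>\<^sub>\<infinity>n::int. (- 2 * of_int n * x + (1 - 2 * of_int n) * y)
           * exp (x * (\<gamma>\<^sup>2 / 2 - 2 * (of_int n)\<^sup>2)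
                + y * (\<gamma>\<^sup>2 / 2 - \<gamma> - 2 * of_int n * (of_int n - 1))))
      else if pq = saddle \<gamma> (pi / 2) then
        (\<Sum>\<^sub>\<infinity>n::int. ((1 - 2 * of_int n) * x - 2 * of_int n * y)
           * exp (x * ((1 - \<gamma>)\<^sup>2 / 2 - (1 - \<gamma>) - 2 * of_int n * (of_int n - 1))
                + y * ((1 - \<gamma>)\<^sup>2 / 2 - 2 * (of_int n)\<^sup>2)))
      else
        (\<Sum>\<^sub>\<infinity>n::int. (- 1) powi n * exp (x * fst (pq_seq \<gamma> pq n) + y * snd (pq_seq \<gamma> pq n))))"

section \<open>Harmonic functions and the Martin boundary\<close>

definition partial_x :: "(real \<times> real \<Rightarrow> real) \<Rightarrow> real \<times> real \<Rightarrow> real" where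
  "partial_x u z = deriv (\<lambda>t. u (t, snd z)) (fst z)"

definition partial_y :: "(real \<times> real \<Rightarrow> real) \<Rightarrow> real \<times> real \<Rightarrow> real" where
  "partial_y u z = deriv (\<lambda>t. u (fst z, t)) (snd z)"

definition C1_on :: "(real \<times> real) set \<Rightarrow> (real \<times> real \<Rightarrow> real) \<Rightarrow> bool" where
  "C1_on S u \<longleftrightarrow>
     u differentiable_on S \<and> continuous_on S (partial_x u) \<and> continuous_on S (partial_y u)"

definition C2_on :: "(real \<times> real) set \<Rightarrow> (real \<times> real \<Rightarrow> real) \<Rightarrow> bool" where
  "C2_on S u \<longleftrightarrow> C1_on S u \<and> C1_on S (partial_x u) \<and> C1_on S (partial_y u)"

definition generator :: "real \<Rightarrow> (real \<times> real \<Rightarrow> real) \<Rightarrow> real \<times> real \<Rightarrow> real" where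
  "generator \<gamma> u z =
     (let D = (\<lambda>f w. partial_x f w - partial_y f w) in
      D (D u) z / 2 + (1 - \<gamma>) * partial_x u z + \<gamma> * partial_y u z)"

text \<open>
  Functions live on the open quadrant; having boundary value \<open>0\<close> means extending continuously
  by \<open>0\<close> to the two open half-axes (no condition is imposed at the origin).
\<close>

definition harmonic :: "real \<Rightarrow> (real \<times> real \<Rightarrow> real) \<Rightarrow> bool" where
  "harmonic \<gamma> u \<longleftrightarrow>
     C2_on quadrant u \<and>
     (\<forall>z\<in>quadrant. generator \<gamma> u z = 0) \<and>
     (\<forall>b\<in>{0<..} \<times> {0} \<union> {0} \<times> {0<..}. (u \<longlongrightarrow> 0) (at b within quadrant))"

definition positive_harmonic :: "real \<Rightarrow> (real \<times> real \<Rightarrow> real) \<Rightarrow> bool" where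
  "positive_harmonic \<gamma> u \<longleftrightarrow> harmonic \<gamma> u \<and> (\<forall>z\<in>quadrant. 0 < u z)"

definition minimal_harmonic :: "real \<Rightarrow> (real \<times> real \<Rightarrow> real) \<Rightarrow> bool" where
  "minimal_harmonic \<gamma> u \<longleftrightarrow>
     positive_harmonic \<gamma> u \<and>
     (\<forall>v. positive_harmonic \<gamma> v \<and> (\<forall>z\<in>quadrant. v z \<le> u z)
        \<longrightarrow> (\<exists>c. \<forall>z\<in>quadrant. v z = c * u z))"

definition martin_kernel ::
  "(real \<times> real \<Rightarrow> real \<times> real \<Rightarrow> real) \<Rightarrow> real \<times> real \<Rightarrow> real \<times> real \<Rightarrow> real" where
  "martin_kernel g z0 z = g z0 z / g (1, 1) z"

text \<open>
  Real functions on the quadrant are represented by elements of \<open>extensional quadrant\<close>. The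
  junk values of the kernel for \<open>x + y \<le> 2\<close> play no role, as \<open>norm (\<zeta> n) \<longlonglongrightarrow> \<infinity>\<close>.
\<close>

definition martin_boundary ::
  "(real \<times> real \<Rightarrow> real \<times> real \<Rightarrow> real) \<Rightarrow> (real \<times> real \<Rightarrow> real) set" where
  "martin_boundary g =
     {u \<in> extensional quadrant. \<exists>\<zeta> :: nat \<Rightarrow> real \<times> real.
        range \<zeta> \<subseteq> quadrant \<and> filterlim (\<lambda>n. norm (\<zeta> n)) at_top sequentially \<and>
        (\<forall>z\<in>quadrant. (\<lambda>n. martin_kernel g z (\<zeta> n)) \<longlonglongrightarrow> u z)}"

text \<open>The product topology is the topology of pointwise convergence on the quadrant.\<close>

definition martin_topology ::
  "(real \<times> real \<Rightarrow> real \<times> real \<Rightarrow> real) \<Rightarrow> (real \<times> real \<Rightarrow> real) topology" where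
  "martin_topology g =
     subtopology (product_topology (\<lambda>_. euclideanreal) quadrant) (martin_boundary g)"

end

theory Submission
  imports Defs "HOL-Real_Asymp.Real_Asymp"
begin

text \<open>
  The sum \<open>s = x + y\<close> grows at unit speed along the process, so only the ratio \<open>u = x / s\<close> is
  random. The arc of saddle points is \<open>parab \<gamma> a\<close>, \<open>0 \<le> a \<le> 1\<close>, with
  \<open>a = cos \<alpha> / (cos \<alpha> + sin \<alpha>)\<close>, and completing the square gives
  \<open>exp (p x + q y) = E(z) exp (- s (u - a)\<^sup>2 / 2)\<close> with a factor \<open>E\<close> that does not depend on \<open>a\<close>
  (lemma \<open>expo_eq_gauss\<close>). Up to \<open>E(z) / sqrt s\<close> these exponentials are heat kernels in the
  variable \<open>u\<close> at time \<open>\<tau> = 1 / s\<close>. Dividing by this factor and reading \<open>\<tau>\<close> as time turns the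
  generator into the heat operator, the two half-axes into the points \<open>u = 0\<close> and \<open>u = 1\<close>, and
  the infinity of the quadrant into the initial time \<open>\<tau> = 0\<close>. The problem is therefore the heat
  equation on \<open>[0, 1]\<close> with absorbing ends, and its Martin boundary is the set of starting
  points \<open>a \<in> [0, 1]\<close>.

  The functions \<open>h\<close> and \<open>htilde\<close> agree because both are the heat kernel written by the method of
  images: reflections of \<open>a\<close> at \<open>0\<close> and \<open>1\<close> give the points \<open>\<plusminus> a + 2n\<close>, with alternating signs.
  On the side of \<open>htilde\<close> this is a rearrangement of the series. On the side of \<open>h\<close>, a half-sided
  series of images (\<open>left_exit_fun\<close>) consists of exponential martingales, equals \<open>exp (q y)\<close> on the
  vertical axis and vanishes on the horizontal one, so optional stopping evaluates the transforms
  \<open>L1\<close> and \<open>L2\<close> (lemmas \<open>expectation_left_exit\<close>, \<open>L1_parabola\<close>, \<open>deriv_L1\<close>).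

  Integrating the same martingales over \<open>a\<close> against \<open>sin (k pi a)\<close> produces the separated
  solutions \<open>eigfun\<close>. They vanish on the axes, so they determine the law of the killed process:
  the Green density at \<open>z\<close> with \<open>sz z > sz z0\<close> is the Dirichlet heat kernel up to explicit factors
  (\<open>green_eq_kernel\<close>). Letting \<open>z\<close> go to infinity with \<open>uz z \<rightarrow> a\<close>, the quotient of
  two such kernels tends to \<open>mkern \<gamma> a z0 / mkern \<gamma> a (1, 1)\<close>, where the kernel with pole \<open>a\<close> has
  been divided by \<open>sin (pi a)\<close> so that it stays nonzero at the ends
  (\<open>martin_boundary_eq\<close>). The image series and the sine series have the same sine coefficients,
  so \<open>htilde\<close> is a positive multiple of \<open>mkern\<close> (\<open>htilde_eq_mkern\<close>).

  For minimality, a harmonic \<open>v\<close> is recovered from its values on \<open>x + y = s\<close> by the heat semigroup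
  (\<open>harmonic_representation\<close>, from a minimum principle). If \<open>v \<le> c * mkern \<gamma> a\<close>, these values
  are dominated by a kernel which concentrates at \<open>a\<close> as \<open>s\<close> grows, and in the limit only a multiple
  of \<open>mkern \<gamma> a\<close> is left (\<open>dominated_by_mkern\<close>). Finally, the parametrisation of the boundary is
  continuous on a compact arc, has values in a Hausdorff space, and is injective because two sine
  coefficients of \<open>mkern \<gamma> a\<close> determine \<open>a\<close>; hence it is a homeomorphism.
\<close>

section \<open>Sine polynomials\<close>

text \<open>
  Constants are excluded: all members vanish at both ends of \<open>[0, 1]\<close>.
\<close>

inductive sine_poly :: "(real \<Rightarrow> real) \<Rightarrow> bool" where
  basis: "k \<ge> 1 \<Longrightarrow> sine_poly (\<lambda>u. c * sin (real k * pi * u))"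
| add: "sine_poly f \<Longrightarrow> sine_poly g \<Longrightarrow> sine_poly (\<lambda>u. f u + g u)"

lemma sine_poly_zero: "sine_poly (\<lambda>u. 0)"
  using sine_poly.basis[of 1 0] by simp

lemma sine_poly_scale: "sine_poly f \<Longrightarrow> sine_poly (\<lambda>u. c * f u)"
proof (induction rule: sine_poly.induct)
  case (basis k d)
  then show ?case using sine_poly.basis[of k "c * d"] by (simp add: mult.assoc)
next
  case (add f g)
  then show ?case using sine_poly.add by (simp add: distrib_left)
qed

text \<open>
  By the addition formula \<open>2 cos x sin (k x) = sin ((k + 1) x) + sin ((k - 1)
  x)\<close>; hence sine polynomials contain \<open>sin (pi u)\<close> times any polynomial in
  \<open>cos (pi u)\<close>.
\<close>

lemma sine_poly_mult_cos: "sine_poly f \<Longrightarrow> sine_poly (\<lambda>u. cos (pi * u) * f u)"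
proof (induction rule: sine_poly.induct)
  case (basis k c)
  have "cos (pi * u) * (c * sin (real k * pi * u))
      = c / 2 * sin (real (k + 1) * pi * u) + c / 2 * sin (real (k - 1) * pi * u)" for u
  proof -
    have "sin (real (k + 1) * pi * u) = sin (real k * pi * u + pi * u)"
      by (simp add: algebra_simps)
    moreover have "sin (real (k - 1) * pi * u) = sin (real k * pi * u - pi * u)"
      using basis by (simp add: of_nat_diff algebra_simps)
    moreover have "cos a * (c * sin b) = c / 2 * sin (b + a) + c / 2 * sin (b - a)" for a b
      by (simp add: sin_add sin_diff algebra_simps)
    ultimately show ?thesis by metis
  qed
  moreover have "sine_poly (\<lambda>u. c / 2 * sin (real (k - 1) * pi * u))"
  proof (cases "k = 1")
    case True
    then show ?thesis using sine_poly_zero by simp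
  next
    case False
    then show ?thesis using basis by (intro sine_poly.basis) auto
  qed
  ultimately show ?case
    using sine_poly.add[OF sine_poly.basis[of "k + 1" "c / 2"]] by simp
next
  case (add f g)
  then show ?case using sine_poly.add by (simp add: distrib_left)
qed

lemma sine_poly_sin_power_cos: "sine_poly (\<lambda>u. sin (pi * u) * cos (pi * u) ^ j)"
proof (induction j)
  case 0
  then show ?case using sine_poly.basis[of 1 1] by simp
next
  case (Suc j)
  from sine_poly_mult_cos[OF this] show ?case by (simp add: mult_ac)
qed

lemma sine_poly_sin_polynomial:
  "sine_poly (\<lambda>u. sin (pi * u) * (\<Sum>j\<le>n. a j * cos (pi * u) ^ j))"
proof (induction n)
  case 0
  then show ?case
    using sine_poly_scale[OF sine_poly_sin_power_cos[of 0], of "a 0"] by (simp add: mult_ac)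
next
  case (Suc n)
  have "sine_poly (\<lambda>u. sin (pi * u) * (\<Sum>j\<le>n. a j * cos (pi * u) ^ j)
          + a (Suc n) * (sin (pi * u) * cos (pi * u) ^ Suc n))"
    by (intro sine_poly.add Suc sine_poly_scale sine_poly_sin_power_cos)
  then show ?case by (simp add: algebra_simps)
qed

text \<open>
  Uniform approximation with the right boundary values is obtained by factoring out \<open>sin
  (pi u)\<close> and applying the Weierstrass theorem in the variable \<open>cos (pi
  u)\<close>.
\<close>

lemma sine_poly_dense:
  assumes f: "continuous_on {0..1} f" "f 0 = 0" "f 1 = 0" and "0 < \<delta>"
  obtains p where "sine_poly p" "\<And>u. u \<in> {0..1} \<Longrightarrow> \<bar>f u - p u\<bar> \<le> \<delta>"
proof -
  obtain C where C: "C > 0" "\<And>u. u \<in> {0..1} \<Longrightarrow> \<bar>f u\<bar> \<le> C"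
  proof -
    have "bounded (f ` {0..1})"
      by (intro compact_imp_bounded compact_continuous_image f compact_Icc)
    then show ?thesis using that unfolding bounded_pos by auto
  qed
  have sin_pos: "sin (pi * u) > 0" if "u \<in> {0<..<1}" for u
    using that by (intro sin_gt_zero) auto
  have sin_nn: "sin (pi * u) \<ge> 0" if "u \<in> {0..1}" for u
    using that by (intro sin_ge_zero) (auto simp: mult_left_le)
  define S where "S = {u \<in> {0..1}. \<bar>f u\<bar> \<ge> \<delta> / 2}"
  have "compact S"
  proof -
    have "closed S"
      unfolding S_def by (intro continuous_closed_preimage_constant
        continuous_on_closed_Collect_le continuous_intros f) auto
    then show ?thesis
      by (rule compact_eq_bounded_closed[THEN iffD2, OF conjI, rotated])
         (rule bounded_subset[OF bounded_closed_interval[of 0 1]], auto simp: S_def)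
  qed
  obtain m where m: "m > 0" "\<And>u. u \<in> S \<Longrightarrow> sin (pi * u) \<ge> m"
  proof (cases "S = {}")
    case True
    then show ?thesis using that[of 1] by auto
  next
    case False
    have "continuous_on S (\<lambda>u. sin (pi * u))" by (intro continuous_intros)
    from continuous_attains_inf[OF \<open>compact S\<close> False this]
    obtain v where v: "v \<in> S" "\<And>u. u \<in> S \<Longrightarrow> sin (pi * v) \<le> sin (pi * u)" by blast
    have "v \<noteq> 0" "v \<noteq> 1" using v(1) f \<open>0 < \<delta>\<close> by (auto simp: S_def)
    then have "v \<in> {0<..<1}" using v(1) by (auto simp: S_def)
    then show ?thesis using that[of "sin (pi * v)"] v sin_pos by auto
  qed
  \<comment> \<open>The quotient \<open>f / sin\<close> is regularised by \<open>\<eta>\<close>: where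
      \<open>sin \<ge> m\<close> the error is at most \<open>C \<eta> / m\<close>, and
      elsewhere it is at most \<open>\<bar>f\<bar> < \<delta> / 2\<close>.\<close>
  define \<eta> where "\<eta> = \<delta> * m / (2 * C)"
  have "\<eta> > 0" using \<open>0 < \<delta>\<close> m C by (simp add: \<eta>_def)
  define r where "r = (\<lambda>u. f u / (sin (pi * u) + \<eta>))"
  have r_approx: "\<bar>f u - sin (pi * u) * r u\<bar> \<le> \<delta> / 2" if u: "u \<in> {0..1}" for u
  proof -
    have "f u - sin (pi * u) * r u = f u * (\<eta> / (sin (pi * u) + \<eta>))"
      using sin_nn[OF u] \<open>\<eta> > 0\<close> by (simp add: r_def field_simps)
    then have eq: "\<bar>f u - sin (pi * u) * r u\<bar> = \<bar>f u\<bar> * (\<eta> / (sin (pi * u) + \<eta>))"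
      using sin_nn[OF u] \<open>\<eta> > 0\<close> by (simp add: abs_mult)
    show ?thesis
    proof (cases "u \<in> S")
      case True
      have "\<eta> / (sin (pi * u) + \<eta>) \<le> \<eta> / m"
        using m(1) m(2)[OF True] \<open>\<eta> > 0\<close> by (intro divide_left_mono) auto
      then have "\<bar>f u\<bar> * (\<eta> / (sin (pi * u) + \<eta>)) \<le> C * (\<eta> / m)"
        using C u \<open>\<eta> > 0\<close> sin_nn[OF u] by (intro mult_mono) auto
      also have "\<dots> = \<delta> / 2" using C m by (simp add: \<eta>_def)
      finally show ?thesis using eq by simp
    next
      case False
      then have "\<bar>f u\<bar> \<le> \<delta> / 2" using u by (auto simp: S_def)
      moreover have "\<eta> / (sin (pi * u) + \<eta>) \<le> 1" using sin_nn[OF u] \<open>\<eta> > 0\<close> by simp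
      ultimately have "\<bar>f u\<bar> * (\<eta> / (sin (pi * u) + \<eta>)) \<le> \<delta> / 2 * 1"
        using \<open>0 < \<delta>\<close> \<open>\<eta> > 0\<close> sin_nn[OF u] by (intro mult_mono) auto
      then show ?thesis using eq by simp
    qed
  qed
  have r_cont: "continuous_on {0..1} r"
    unfolding r_def using sin_nn \<open>\<eta> > 0\<close>
    by (intro continuous_intros f ballI) (metis add_nonneg_pos less_irrefl)
  define g where "g = (\<lambda>c. r (arccos c / pi))"
  have "arccos c / pi \<in> {0..1}" if "c \<in> {-1..1}" for c
    using that arccos_lbound[of c] arccos_ubound[of c] by simp
  then have "continuous_on {-1..1} g"
    unfolding g_def
    by (intro continuous_on_compose2[OF r_cont] continuous_on_divide continuous_on_arccos' continuous_intros) auto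
  then obtain P where P: "real_polynomial_function P" "\<And>c. c \<in> {-1..1} \<Longrightarrow> \<bar>g c - P c\<bar> < \<delta> / 2"
    using Stone_Weierstrass_real_polynomial_function[OF compact_Icc, of "-1" 1 g "\<delta> / 2"] \<open>0 < \<delta>\<close>
    by (metis half_gt_zero)
  obtain a n where an: "P = (\<lambda>x. \<Sum>j\<le>n. a j * x ^ j)"
    using P(1) unfolding real_polynomial_function_iff_sum by blast
  define p where "p = (\<lambda>u. sin (pi * u) * (\<Sum>j\<le>n. a j * cos (pi * u) ^ j))"
  have "\<bar>f u - p u\<bar> \<le> \<delta>" if u: "u \<in> {0..1}" for u
  proof -
    have "arccos (cos (pi * u)) = pi * u" using u by (intro arccos_cos) (auto simp: mult_left_le)
    then have "g (cos (pi * u)) = r u" by (simp add: g_def)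
    then have *: "\<bar>r u - P (cos (pi * u))\<bar> < \<delta> / 2" using P(2)[of "cos (pi * u)"] by auto
    have "\<bar>sin (pi * u) * r u - p u\<bar> = sin (pi * u) * \<bar>r u - P (cos (pi * u))\<bar>"
      using sin_nn[OF u] by (simp add: p_def an abs_mult flip: right_diff_distrib)
    also have "\<dots> \<le> 1 * (\<delta> / 2)"
      using * sin_nn[OF u] by (intro mult_mono) auto
    finally show ?thesis using r_approx[OF u] by linarith
  qed
  moreover have "sine_poly p" unfolding p_def by (rule sine_poly_sin_polynomial)
  ultimately show ?thesis using that by blast
qed

section \<open>The heat kernel of an interval with absorbing ends\<close>

text \<open>
  The Chebyshev polynomial of the second kind of degree \<open>k - 1\<close> at \<open>cos (pi
  v)\<close>, that is \<open>sin (k pi v) / sin (pi v)\<close> continued to the zeros of the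
  denominator. The trigonometric sum makes continuity and the bound by \<open>k\<close>
  evident.
\<close>

definition chU :: "nat \<Rightarrow> real \<Rightarrow> real" where
  "chU k v = (\<Sum>j<k. cos ((real k - 1 - 2 * real j) * (pi * v)))"

lemma sin_mult_chU: "sin (pi * v) * chU k v = sin (real k * pi * v)"
proof -
  have *: "sin x * cos (m * x) = sin ((m + 1) * x) / 2 - sin ((m - 1) * x) / 2" for x m :: real
  proof -
    have "(m + 1) * x = m * x + x" "(m - 1) * x = m * x - x" by (simp_all add: algebra_simps)
    then show ?thesis by (simp add: sin_add sin_diff field_simps)
  qed
  have "sin (pi * v) * chU k v
      = (\<Sum>j<k. sin ((real k - 2 * real j) * (pi * v)) / 2 - sin ((real k - 2 * real (Suc j)) * (pi * v)) / 2)"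
    unfolding chU_def sum_distrib_left
    by (intro sum.cong refl, subst *) (simp add: algebra_simps)
  also have "\<dots> = sin (real k * (pi * v)) / 2 - sin (- (real k * (pi * v))) / 2"
    by (subst sum_lessThan_telescope') (simp add: algebra_simps)
  finally show ?thesis by (simp add: mult.assoc)
qed

lemma abs_chU_le: "\<bar>chU k v\<bar> \<le> real k"
  unfolding chU_def by (rule order.trans[OF sum_abs]) (rule order.trans[OF sum_bounded_above[of _ _ 1]], auto)

lemma continuous_on_chU [continuous_intros]:
  fixes S :: "'b::t2_space set"
  shows "continuous_on S f \<Longrightarrow> continuous_on S (\<lambda>x. chU k (f x))"
  unfolding chU_def by (auto intro!: continuous_intros)

lemma chU_1 [simp]: "chU (Suc 0) v = 1"
  by (simp add: chU_def)

lemma chU_2: "chU 2 v = 2 * cos (pi * v)"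
  by (simp add: chU_def numeral_2_eq_2)

lemma chU_3: "chU 3 v = 4 * cos (pi * v) ^ 2 - 1"
proof -
  have "chU 3 v = 1 + 2 * cos (2 * (pi * v))" 
    by (simp add: chU_def numeral_3_eq_3)
  then show ?thesis by (simp only: cos_double_cos) simp
qed

text \<open>
  The semigroup is generated by half the second derivative, as for Brownian motion.
\<close>

definition eig :: "real \<Rightarrow> nat \<Rightarrow> real" where
  "eig \<tau> k = exp (- ((real k * pi)\<^sup>2 * \<tau> / 2))"

lemma eig_pos [simp]: "eig \<tau> k > 0" and eig_nonneg [simp]: "eig \<tau> k \<ge> 0"
  by (simp_all add: eig_def)

lemma eig_add: "eig (\<tau> + \<sigma>) k = eig \<tau> k * eig \<sigma> k"
  by (simp add: eig_def flip: exp_add) (simp add: field_simps)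

definition qheat_term :: "nat \<Rightarrow> real \<Rightarrow> real \<Rightarrow> real \<Rightarrow> real" where
  "qheat_term k \<tau> u v = 2 * eig \<tau> (Suc k) * sin (real (Suc k) * pi * u) * chU (Suc k) v"

text \<open>
  The sine series of the heat kernel, divided by \<open>sin (pi v)\<close>. The quotient is
  regular and positive for \<open>v\<close> at the ends of the interval, where the kernel
  itself degenerates; these two values of \<open>v\<close> give the end points of the arc.
\<close>

definition qheat :: "real \<Rightarrow> real \<Rightarrow> real \<Rightarrow> real" where
  "qheat \<tau> u v = (\<Sum>k. qheat_term k \<tau> u v)"

definition qheat_bound :: "real \<Rightarrow> nat \<Rightarrow> real" where
  "qheat_bound \<tau> k = 2 * eig \<tau> (Suc k) * real (Suc k)"

lemma summable_qheat_bound: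
  assumes "0 < \<tau>"
  shows "summable (qheat_bound \<tau>)"
proof (rule summable_comparison_test)
  define r where "r = exp (- (pi\<^sup>2 * \<tau> / 2))"
  have "norm r < 1" using assms by (simp add: r_def)
  then show "summable (\<lambda>k. 2 * (of_nat (Suc k) * r ^ k))"
    using geometric_deriv_sums sums_summable by (intro summable_mult) blast
  have "eig \<tau> (Suc k) \<le> r ^ k" for k
  proof -
    have "real k \<le> (real (Suc k))\<^sup>2" by (simp add: power2_eq_square algebra_simps)
    then have "real k * (pi\<^sup>2 * \<tau> / 2) \<le> (real (Suc k))\<^sup>2 * (pi\<^sup>2 * \<tau> / 2)"
      using assms by (intro mult_right_mono) auto
    then show ?thesis
      by (simp add: eig_def r_def power_mult_distrib mult_ac flip: exp_of_nat_mult)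
  qed
  then show "\<exists>N. \<forall>k\<ge>N. norm (qheat_bound \<tau> k) \<le> 2 * (of_nat (Suc k) * r ^ k)"
    unfolding qheat_bound_def by (intro exI allI impI) (simp add: abs_mult mult.commute mult_left_mono)
qed

lemma qheat_term_le:
  assumes "0 < \<tau>" "\<tau> \<le> \<sigma>"
  shows "\<bar>qheat_term k \<sigma> u v\<bar> \<le> qheat_bound \<tau> k"
proof -
  have "eig \<sigma> (Suc k) \<le> eig \<tau> (Suc k)"
    using assms unfolding eig_def by (auto intro!: mult_left_mono)
  moreover have "\<bar>sin (real (Suc k) * pi * u)\<bar> \<le> 1" by (rule abs_sin_le_one)
  ultimately have "2 * eig \<sigma> (Suc k) * \<bar>sin (real (Suc k) * pi * u)\<bar> * \<bar>chU (Suc k) v\<bar>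
      \<le> 2 * eig \<tau> (Suc k) * 1 * real (Suc k)"
    by (intro mult_mono abs_chU_le mult_nonneg_nonneg) auto
  then show ?thesis by (simp add: qheat_term_def qheat_bound_def abs_mult)
qed

lemma qheat_term_sums:
  assumes "0 < \<tau>"
  shows "(\<lambda>k. qheat_term k \<tau> u v) sums qheat \<tau> u v"
  unfolding qheat_def
  by (rule summable_sums, rule summable_comparison_test[OF _ summable_qheat_bound[OF assms]])
     (use qheat_term_le[OF assms order.refl] in auto)

lemma qheat_uniform_limit:
  assumes "0 < \<tau>" "\<And>x. x \<in> S \<Longrightarrow> \<tau> \<le> t x"
  shows "uniform_limit S (\<lambda>n x. \<Sum>k<n. qheat_term k (t x) (u x) (v x))
           (\<lambda>x. qheat (t x) (u x) (v x)) sequentially"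
  unfolding qheat_def
  by (rule Weierstrass_m_test[OF _ summable_qheat_bound[OF assms(1)]])
     (use qheat_term_le assms in auto)

lemma continuous_on_qheat_term [continuous_intros]:
  fixes S :: "'b::t2_space set"
  shows "continuous_on S t \<Longrightarrow> continuous_on S u \<Longrightarrow> continuous_on S v \<Longrightarrow>
    continuous_on S (\<lambda>x. qheat_term k (t x) (u x) (v x))"
  unfolding qheat_term_def eig_def by (auto intro!: continuous_intros)

lemma continuous_on_qheat_aux:
  fixes S :: "'b::t2_space set"
  assumes "0 < \<tau>" "\<And>x. x \<in> S \<Longrightarrow> \<tau> \<le> t x"
    and "continuous_on S t" "continuous_on S u" "continuous_on S v"
  shows "continuous_on S (\<lambda>x. qheat (t x) (u x) (v x))"
  by (rule uniform_limit_theorem[OF _ qheat_uniform_limit[OF assms(1,2)]])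
     (auto intro!: always_eventually continuous_intros assms)

lemma tendsto_qheat:
  assumes "(t \<longlongrightarrow> \<tau>) F" "(u \<longlongrightarrow> \<mu>) F" "(v \<longlongrightarrow> \<nu>) F" "0 < \<tau>"
  shows "((\<lambda>x. qheat (t x) (u x) (v x)) \<longlongrightarrow> qheat \<tau> \<mu> \<nu>) F"
proof -
  define f where "f = (\<lambda>w::real \<times> real \<times> real. qheat (fst w) (fst (snd w)) (snd (snd w)))"
  have "continuous_on ({\<tau> / 2 <..} \<times> UNIV) f"
    unfolding f_def
    by (rule continuous_on_qheat_aux[of "\<tau> / 2"])
       (use assms in \<open>auto intro!: continuous_intros\<close>)
  moreover have "open ({\<tau> / 2 <..} \<times> (UNIV :: (real \<times> real) set))"
    by (intro open_Times) auto
  ultimately have "isCont f (\<tau>, \<mu>, \<nu>)"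
    using assms(4) by (auto simp: continuous_on_eq_continuous_at)
  then have "((\<lambda>x. f (t x, u x, v x)) \<longlongrightarrow> f (\<tau>, \<mu>, \<nu>)) F"
    by (rule isCont_tendsto_compose) (intro tendsto_intros assms)
  then show ?thesis by (simp add: f_def)
qed

lemma continuous_on_qheat [continuous_intros]:
  assumes "continuous_on S t" "continuous_on S u" "continuous_on S v" "\<And>x. x \<in> S \<Longrightarrow> 0 < t x"
  shows "continuous_on S (\<lambda>x. qheat (t x) (u x) (v x))"
  using assms unfolding continuous_on_def by (auto intro!: tendsto_qheat)

lemma qheat_0_left [simp]: "qheat \<tau> 0 v = 0"
  by (simp add: qheat_def qheat_term_def)

lemma qheat_1_left [simp]: "qheat \<tau> 1 v = 0"
proof -
  have "sin (real (Suc k) * pi) = 0" for k by (rule sin_npi)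
  then show ?thesis by (simp add: qheat_def qheat_term_def del: of_nat_Suc)
qed

definition heat :: "real \<Rightarrow> real \<Rightarrow> real \<Rightarrow> real" where
  "heat \<tau> u v = sin (pi * v) * qheat \<tau> u v"

lemma heat_commute: 
  assumes "0 < \<tau>"
  shows "heat \<tau> u v = heat \<tau> v u"
proof -
  have *: "sin (pi * v) * qheat_term k \<tau> u v = sin (pi * u) * qheat_term k \<tau> v u" for k u v
  proof -
    have "sin (pi * v) * qheat_term k \<tau> u v
        = 2 * eig \<tau> (Suc k) * sin (real (Suc k) * pi * u) * (sin (pi * v) * chU (Suc k) v)" for u v
      by (simp add: qheat_term_def)
    then show ?thesis by (simp add: sin_mult_chU del: of_nat_Suc)
  qed
  have "(\<lambda>k. sin (pi * v) * qheat_term k \<tau> u v) sums heat \<tau> u v" for u v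
    unfolding heat_def by (intro sums_mult qheat_term_sums assms)
  from this[of v u] this[of u v] show ?thesis unfolding * using sums_unique2 by blast
qed

lemma has_integral_cos_int:
  assumes "m \<noteq> (0::int)"
  shows "((\<lambda>u. cos (of_int m * pi * u)) has_integral 0) {0..1::real}"
proof -
  have "((\<lambda>u. cos (of_int m * pi * u)) has_integral
          (sin (of_int m * pi * 1) / (of_int m * pi) - sin (of_int m * pi * 0) / (of_int m * pi))) {0..1}"
    by (rule fundamental_theorem_of_calculus)
       (use assms in \<open>auto intro!: derivative_eq_intros simp flip: has_real_derivative_iff_has_vector_derivative\<close>)
  moreover have "sin (of_int m * pi) = 0" using sin_zero_iff_int2 by blast
  ultimately show ?thesis by simp
qed

lemma has_integral_sin_sin:
  assumes "j \<ge> 1" "k \<ge> 1"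
  shows "((\<lambda>u. sin (real j * pi * u) * sin (real k * pi * u)) has_integral (if j = k then 1 / 2 else 0)) {0..1}"
proof -
  have eq: "sin (real j * pi * u) * sin (real k * pi * u)
      = (cos (of_int (int j - int k) * pi * u) - cos (of_int (int j + int k) * pi * u)) / 2" for u
  proof -
    have "of_int (int j - int k) * pi * u = real j * pi * u - real k * pi * u"
      "of_int (int j + int k) * pi * u = real j * pi * u + real k * pi * u"
      by (simp_all add: algebra_simps)
    then show ?thesis by (simp add: sin_times_sin)
  qed
  have 1: "((\<lambda>u. cos (of_int (int j - int k) * pi * u)) has_integral (if j = k then 1 else 0)) {0..1}"
  proof (cases "j = k")
    case True
    then show ?thesis using has_integral_const_real[of "1::real" 0 1] by simp
  next
    case False
    then show ?thesis using has_integral_cos_int[of "int j - int k"] by auto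
  qed
  have "((\<lambda>u. (cos (of_int (int j - int k) * pi * u) - cos (of_int (int j + int k) * pi * u)) / 2)
      has_integral ((if j = k then 1 else 0) - 0) / 2) {0..1}"
    by (intro has_integral_divide has_integral_diff 1 has_integral_cos_int) (use assms in auto)
  then show ?thesis unfolding eq by (auto split: if_splits)
qed

lemma qheat_integral_sums:
  assumes "0 < \<sigma>" and g: "continuous_on {0..1} g"
  shows "(\<lambda>k. 2 * eig \<sigma> (Suc k) * chU (Suc k) a * integral {0..1} (\<lambda>v. sin (real (Suc k) * pi * v) * g v))
           sums integral {0..1} (\<lambda>v. qheat \<sigma> v a * g v)"
proof -
  obtain C where C: "\<And>v. v \<in> {0..1} \<Longrightarrow> \<bar>g v\<bar> \<le> C"
  proof -
    have "bounded (g ` {0..1})"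
      by (intro compact_imp_bounded compact_continuous_image g compact_Icc)
    then obtain b where "\<forall>x\<in>g ` {0..1}. norm x \<le> b" unfolding bounded_iff by blast
    then show ?thesis using that[of b] by auto
  qed
  have "uniform_limit {0..1} (\<lambda>n v. \<Sum>k<n. qheat_term k \<sigma> v a * g v) (\<lambda>v. \<Sum>k. qheat_term k \<sigma> v a * g v) sequentially"
  proof (rule Weierstrass_m_test)
    show "summable (\<lambda>k. qheat_bound \<sigma> k * C)"
      by (intro summable_mult2 summable_qheat_bound assms)
    show "norm (qheat_term k \<sigma> v a * g v) \<le> qheat_bound \<sigma> k * C" if "v \<in> {0..1}" for k v
      using C[OF that] qheat_term_le[OF assms(1) order.refl, of k v a]
      by (simp add: abs_mult) (intro mult_mono, auto)
  qed
  moreover have "(\<Sum>k. qheat_term k \<sigma> v a * g v) = qheat \<sigma> v a * g v" for v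
    using sums_mult2[OF qheat_term_sums[OF assms(1)]] by (rule sums_unique[symmetric])
  ultimately have lim: "uniform_limit {0..1} (\<lambda>n v. \<Sum>k<n. qheat_term k \<sigma> v a * g v) (\<lambda>v. qheat \<sigma> v a * g v) sequentially"
    by simp
  have cont: "continuous_on {0..1} (\<lambda>v. \<Sum>k<n. qheat_term k \<sigma> v a * g v)" for n
    by (intro continuous_intros g)
  obtain I J where IJ: "\<And>n. ((\<lambda>v. \<Sum>k<n. qheat_term k \<sigma> v a * g v) has_integral I n) {0..1}"
     "((\<lambda>v. qheat \<sigma> v a * g v) has_integral J) {0..1}" "I \<longlonglongrightarrow> J"
    by (rule uniform_limit_integral[OF lim cont]) auto
  have "I n = (\<Sum>k<n. 2 * eig \<sigma> (Suc k) * chU (Suc k) a * integral {0..1} (\<lambda>v. sin (real (Suc k) * pi * v) * g v))" for n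
  proof -
    have "I n = (\<Sum>k<n. integral {0..1} (\<lambda>v. qheat_term k \<sigma> v a * g v))"
      using IJ(1)[of n, THEN integral_unique, symmetric]
      by (simp, intro integral_sum integrable_continuous_interval continuous_intros g) auto
    also have "\<dots> = (\<Sum>k<n. 2 * eig \<sigma> (Suc k) * chU (Suc k) a * integral {0..1} (\<lambda>v. sin (real (Suc k) * pi * v) * g v))"
      unfolding qheat_term_def
      by (intro sum.cong refl, subst integral_mult_right[symmetric]) (simp add: mult_ac)
    finally show ?thesis .
  qed
  then have "I = (\<lambda>n. \<Sum>k<n. 2 * eig \<sigma> (Suc k) * chU (Suc k) a * integral {0..1} (\<lambda>v. sin (real (Suc k) * pi * v) * g v))"
    by blast
  then show ?thesis using IJ(2,3) by (simp add: sums_def integral_unique)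
qed

lemma integral_qheat_sin:
  assumes "0 < \<tau>" "k \<ge> 1"
  shows "integral {0..1} (\<lambda>u. qheat \<tau> u a * sin (real k * pi * u)) = eig \<tau> k * chU k a"
proof -
  have "continuous_on {0..1} (\<lambda>u. sin (real k * pi * u))" by (intro continuous_intros)
  from qheat_integral_sums[OF assms(1) this, of a]
  have "(\<lambda>j. 2 * eig \<tau> (Suc j) * chU (Suc j) a * (if Suc j = k then 1 / 2 else 0))
     sums integral {0..1} (\<lambda>u. qheat \<tau> u a * sin (real k * pi * u))"
    using has_integral_sin_sin[OF _ assms(2), THEN integral_unique] by (simp del: of_nat_Suc)
  moreover have "2 * eig \<tau> (Suc j) * chU (Suc j) a * (if Suc j = k then 1 / 2 else 0)
      = (if j = k - 1 then eig \<tau> k * chU k a else 0)" for j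
    using assms(2) by auto
  ultimately show ?thesis using sums_single[of "k - 1" "\<lambda>_. eig \<tau> k * chU k a"] sums_unique2 by simp
qed

lemma integral_heat_sin:
  assumes "0 < \<tau>" "k \<ge> 1"
  shows "integral {0..1} (\<lambda>v. heat \<tau> u v * sin (real k * pi * v)) = eig \<tau> k * sin (real k * pi * u)"
proof -
  have eq: "heat \<tau> u v * sin (real k * pi * v) = sin (pi * u) * (qheat \<tau> v u * sin (real k * pi * v))" for v
    unfolding heat_commute[OF assms(1), of u v] by (simp add: heat_def)
  have "integral {0..1} (\<lambda>v. heat \<tau> u v * sin (real k * pi * v)) = sin (pi * u) * (eig \<tau> k * chU k u)"
    by (simp only: eq integral_mult_right integral_qheat_sin[OF assms])
  also have "\<dots> = eig \<tau> k * (sin (pi * u) * chU k u)" by simp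
  finally show ?thesis by (simp only: sin_mult_chU)
qed

lemma continuous_on_heat [continuous_intros]:
  fixes S :: "'b::t2_space set"
  assumes "continuous_on S t" "continuous_on S u" "continuous_on S v" "\<And>x. x \<in> S \<Longrightarrow> 0 < t x"
  shows "continuous_on S (\<lambda>x. heat (t x) (u x) (v x))"
  unfolding heat_def by (intro continuous_intros assms)

text \<open>
  Termwise integration of the sine series, by orthogonality.
\<close>

lemma qheat_chapman_kolmogorov:
  assumes "0 < \<tau>" "0 < \<sigma>"
  shows "qheat (\<tau> + \<sigma>) u a = integral {0..1} (\<lambda>v. heat \<tau> u v * qheat \<sigma> v a)"
proof -
  have c: "continuous_on {0..1} (\<lambda>v. heat \<tau> u v)"
    by (intro continuous_intros) (use assms in auto)
  have "integral {0..1} (\<lambda>v. sin (real (Suc k) * pi * v) * heat \<tau> u v) = eig \<tau> (Suc k) * sin (real (Suc k) * pi * u)" for k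
    using integral_heat_sin[OF assms(1), of "Suc k" u] by (simp add: mult.commute)
  with qheat_integral_sums[OF assms(2) c, of a]
  have "(\<lambda>k. qheat_term k (\<tau> + \<sigma>) u a) sums integral {0..1} (\<lambda>v. qheat \<sigma> v a * heat \<tau> u v)"
    by (simp add: qheat_term_def eig_add mult_ac)
  moreover have "(\<lambda>k. qheat_term k (\<tau> + \<sigma>) u a) sums qheat (\<tau> + \<sigma>) u a"
    using assms by (intro qheat_term_sums) auto
  ultimately have "qheat (\<tau> + \<sigma>) u a = integral {0..1} (\<lambda>v. qheat \<sigma> v a * heat \<tau> u v)"
    using sums_unique2 by blast
  then show ?thesis by (simp add: mult.commute)
qed

section \<open>Optional stopping for exponential martingales\<close>

lemma exp_mult_normal_density:
  assumes "0 < \<sigma>"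
  shows "normal_density 0 \<sigma> x * exp (b * x) = exp (b\<^sup>2 * \<sigma>\<^sup>2 / 2) * normal_density (b * \<sigma>\<^sup>2) \<sigma> x"
proof -
  have "- (x\<^sup>2 / (2 * \<sigma>\<^sup>2)) + b * x = b\<^sup>2 * \<sigma>\<^sup>2 / 2 + - ((x - b * \<sigma>\<^sup>2)\<^sup>2 / (2 * \<sigma>\<^sup>2))"
    using assms by (simp add: power2_eq_square field_simps)
  then show ?thesis
    by (simp add: normal_density_def flip: exp_add)
qed

context standard_brownian_motion begin

text \<open>
  The exponential martingale with parameter \<open>b\<close>, as a function of time and of the
  path so that a random time can be inserted.
\<close>

definition exp_mart :: "real \<Rightarrow> real \<Rightarrow> 'a \<Rightarrow> real" where
  "exp_mart b t \<omega> = exp (b * W t \<omega> - b\<^sup>2 * t / 2)"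

lemma exp_increment:
  assumes "0 \<le> s" "s < t"
  shows "integrable M (\<lambda>\<omega>. exp (b * (W t \<omega> - W s \<omega>)))"
    and "expectation (\<lambda>\<omega>. exp (b * (W t \<omega> - W s \<omega>))) = exp (b\<^sup>2 * (t - s) / 2)"
proof -
  define \<sigma> where "\<sigma> = sqrt (t - s)"
  have \<sigma>: "\<sigma> > 0" "\<sigma>\<^sup>2 = t - s" using assms by (auto simp: \<sigma>_def)
  note D = W_gaussian[OF assms, folded \<sigma>_def]
  have eq: "(\<lambda>x. normal_density 0 \<sigma> x * exp (b * x))
      = (\<lambda>x. exp (b\<^sup>2 * \<sigma>\<^sup>2 / 2) * normal_density (b * \<sigma>\<^sup>2) \<sigma> x)"
    using exp_mult_normal_density[OF \<sigma>(1)] by blast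
  have "integrable lborel (\<lambda>x. normal_density 0 \<sigma> x * exp (b * x))"
    unfolding eq using \<sigma> by auto
  then show "integrable M (\<lambda>\<omega>. exp (b * (W t \<omega> - W s \<omega>)))"
    using distributed_integrable[OF D, of "\<lambda>x. exp (b * x)"] by simp
  have "expectation (\<lambda>\<omega>. exp (b * (W t \<omega> - W s \<omega>))) = (\<integral>x. normal_density 0 \<sigma> x * exp (b * x) \<partial>lborel)"
    using distributed_integral[OF D, of "\<lambda>x. exp (b * x)"] by simp
  also have "\<dots> = exp (b\<^sup>2 * \<sigma>\<^sup>2 / 2)" unfolding eq using \<sigma> by simp
  finally show "expectation (\<lambda>\<omega>. exp (b * (W t \<omega> - W s \<omega>))) = exp (b\<^sup>2 * (t - s) / 2)"
    using \<sigma> by simp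
qed

lemma exp_mart_expectation:
  assumes "0 \<le> t"
  shows "integrable M (exp_mart b t)" and "expectation (exp_mart b t) = 1"
proof -
  have "integrable M (exp_mart b t) \<and> expectation (exp_mart b t) = 1"
  proof (cases "t = 0")
    case True
    have "integrable M (exp_mart b t) \<longleftrightarrow> integrable M (\<lambda>_. 1::real)"
      using True W_start by (intro Bochner_Integration.integrable_cong) (auto simp: exp_mart_def)
    moreover have "expectation (exp_mart b t) = expectation (\<lambda>_. 1)"
      using True W_start by (intro Bochner_Integration.integral_cong) (auto simp: exp_mart_def)
    ultimately show ?thesis by (simp add: prob_space)
  next
    case False
    then have t: "0 < t" using assms by simp
    note * = exp_increment[OF order.refl t, of b]
    have eq: "exp_mart b t \<omega> = exp (b * (W t \<omega> - W 0 \<omega>)) * exp (- (b\<^sup>2 * t / 2))" if "\<omega> \<in> space M" for \<omega>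
      using W_start[OF that] by (simp add: exp_mart_def flip: exp_add)
    have "integrable M (exp_mart b t) \<longleftrightarrow> integrable M (\<lambda>\<omega>. exp (b * (W t \<omega> - W 0 \<omega>)) * exp (- (b\<^sup>2 * t / 2)))"
      by (intro Bochner_Integration.integrable_cong eq) auto
    moreover have "expectation (exp_mart b t) = expectation (\<lambda>\<omega>. exp (b * (W t \<omega> - W 0 \<omega>)) * exp (- (b\<^sup>2 * t / 2)))"
      by (intro Bochner_Integration.integral_cong eq) auto
    ultimately show ?thesis using * by (simp add: exp_minus)
  qed
  then show "integrable M (exp_mart b t)" "expectation (exp_mart b t) = 1" by auto
qed

text \<open>
  The first grid index \<open>l < n\<close> at which the path leaves \<open>G l\<close>, and
  \<open>n\<close> if there is none. The recursion over the horizon \<open>n\<close> matches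
  the induction in the optional stopping argument.
\<close>

fun exit_index :: "real \<Rightarrow> (nat \<Rightarrow> real set) \<Rightarrow> nat \<Rightarrow> 'a \<Rightarrow> nat" where
  "exit_index \<delta> G 0 \<omega> = 0"
| "exit_index \<delta> G (Suc n) \<omega> =
     (if \<forall>l\<le>n. W (real l * \<delta>) \<omega> \<in> G l then Suc n else exit_index \<delta> G n \<omega>)"

lemma exit_index_le: "exit_index \<delta> G n \<omega> \<le> n"
  by (induction n) (auto simp: le_SucI)

lemma exit_index_before: "l < exit_index \<delta> G n \<omega> \<Longrightarrow> W (real l * \<delta>) \<omega> \<in> G l"
  by (induction n) (auto split: if_splits)

lemma exit_index_at: "exit_index \<delta> G n \<omega> < n \<Longrightarrow> W (real (exit_index \<delta> G n \<omega>) * \<delta>) \<omega> \<notin> G (exit_index \<delta> G n \<omega>)"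
proof (induction n)
  case (Suc n)
  show ?case
  proof (cases "\<forall>l\<le>n. W (real l * \<delta>) \<omega> \<in> G l")
    case False
    show ?thesis
    proof (cases "exit_index \<delta> G n \<omega> < n")
      case True
      moreover have "exit_index \<delta> G (Suc n) \<omega> = exit_index \<delta> G n \<omega>" using False by auto
      ultimately show ?thesis using Suc.IH by metis
    next
      case nl: False
      then have eq: "exit_index \<delta> G n \<omega> = n" using exit_index_le[of \<delta> G n \<omega>] by simp
      from False obtain l where "l \<le> n" "W (real l * \<delta>) \<omega> \<notin> G l" by blast
      then have "l = n" using exit_index_before[of l \<delta> G n \<omega>] eq by fastforce
      then show ?thesis using False eq \<open>W (real l * \<delta>) \<omega> \<notin> G l\<close> by auto
    qed
  qed (use Suc.prems in auto)
qed auto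

lemma measurable_at_exit_index:
  assumes F: "\<And>l. F (real l * \<delta>) \<in> borel_measurable M" and "0 \<le> \<delta>" and [measurable]: "\<And>l. G l \<in> sets borel"
  shows "(\<lambda>\<omega>. F (real (exit_index \<delta> G n \<omega>) * \<delta>) \<omega> :: real) \<in> borel_measurable M"
proof (induction n)
  case 0
  then show ?case using F[of 0] by simp
next
  case (Suc n)
  have W[measurable]: "W (real l * \<delta>) \<in> borel_measurable M" for l using W_measurable assms by simp
  have "F (real (exit_index \<delta> G (Suc n) \<omega>) * \<delta>) \<omega> =
     (if \<forall>l\<le>n. W (real l * \<delta>) \<omega> \<in> G l then F (real (Suc n) * \<delta>) \<omega>
      else F (real (exit_index \<delta> G n \<omega>) * \<delta>) \<omega>)" for \<omega>
    by auto
  moreover have "(\<lambda>\<omega>. if \<forall>l\<le>n. W (real l * \<delta>) \<omega> \<in> G l then F (real (Suc n) * \<delta>) \<omega>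
      else F (real (exit_index \<delta> G n \<omega>) * \<delta>) \<omega>) \<in> borel_measurable M"
    using Suc F[of "Suc n"] by measurable
  ultimately show ?case by simp
qed

text \<open>
  Optional stopping on a grid. From horizon \<open>n\<close> to \<open>n + 1\<close> the
  stopped martingale changes only on the event of no exit up to time \<open>n\<close>, which
  is determined by the first \<open>n\<close> increments; the next increment is independent of
  them and contributes a factor with mean \<open>1\<close>.
\<close>

lemma exp_mart_at_exit_index:
  assumes "0 < \<delta>" and [measurable]: "\<And>l. G l \<in> sets borel"
  shows "integrable M (\<lambda>\<omega>. exp_mart b (real (exit_index \<delta> G n \<omega>) * \<delta>) \<omega>) \<and>
         expectation (\<lambda>\<omega>. exp_mart b (real (exit_index \<delta> G n \<omega>) * \<delta>) \<omega>) = 1"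
proof (induction n)
  case 0
  then show ?case using exp_mart_expectation[of 0 b] by simp
next
  case (Suc n)
  define r where "r = (\<lambda>i. real i * \<delta>)"
  have r: "0 \<le> r i" "r i < r (Suc i)" for i using assms by (auto simp: r_def)
  have "mono r" using assms by (auto simp: r_def mono_def mult_right_mono)
  define D where "D = (\<lambda>i \<omega>. W (r (Suc i)) \<omega> - W (r i) \<omega>)"
  have WD: "(\<Sum>i<l. D i \<omega>) = W (r l) \<omega>" if "\<omega> \<in> space M" for l \<omega>
    unfolding D_def using W_start[OF that] by (subst sum_lessThan_telescope) (simp add: r_def)
  have ind: "indep_vars (\<lambda>_. borel) D {..<Suc n}"
    unfolding D_def using W_indep[of r "Suc n"] r \<open>mono r\<close> by auto
  \<comment> \<open>\<open>\<Phi>\<close> depends on the first \<open>n\<close> increments,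
      \<open>\<Psi>\<close> on the last one and is centred; their product is the change of
      the stopped martingale.\<close>
  define \<Phi> where "\<Phi> = (\<lambda>d. (if \<forall>l\<le>n. (\<Sum>i<l. d i) \<in> G l then 1 else 0) * exp (b * (\<Sum>i<n. d i) - b\<^sup>2 * r n / 2) :: real)"
  define \<Psi> where "\<Psi> = (\<lambda>d. exp (b * d n - b\<^sup>2 * \<delta> / 2) - 1 :: real)"
  have iv: "indep_var (PiM {..<n} (\<lambda>_. borel)) (\<lambda>\<omega>. restrict (\<lambda>i. D i \<omega>) {..<n})
       (PiM {n} (\<lambda>_. borel)) (\<lambda>\<omega>. restrict (\<lambda>i. D i \<omega>) {n})"
    by (rule indep_var_restrict[OF ind]) auto
  have sm: "(\<lambda>d. \<Sum>i<l. d i :: real) \<in> borel_measurable (PiM {..<n} (\<lambda>_. borel))" if "l \<le> n" for l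
    using that by (intro borel_measurable_sum measurable_component_singleton) auto
  have "{d \<in> space (PiM {..<n} (\<lambda>_. borel)). \<forall>l\<le>n. (\<Sum>i<l. d i :: real) \<in> G l}
      = space (PiM {..<n} (\<lambda>_. borel)) \<inter> (\<Inter>l\<in>{..n}. (\<lambda>d. \<Sum>i<l. d i) -` G l \<inter> space (PiM {..<n} (\<lambda>_. borel)))"
    by auto
  also have "\<dots> \<in> sets (PiM {..<n} (\<lambda>_. borel))"
    by (intro sets.Int sets.top sets.finite_INT measurable_sets[OF sm]) auto
  finally have [measurable]: "Measurable.pred (PiM {..<n} (\<lambda>_. borel)) (\<lambda>d. \<forall>l\<le>n. (\<Sum>i<l. d i :: real) \<in> G l)"
    by (simp add: pred_def)
  have \<Phi>m: "\<Phi> \<in> borel_measurable (PiM {..<n} (\<lambda>_. borel))"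
    unfolding \<Phi>_def using sm[OF order.refl] by measurable
  have \<Psi>m: "\<Psi> \<in> borel_measurable (PiM {n} (\<lambda>_. borel))"
    unfolding \<Psi>_def by measurable
  define X where "X = \<Phi> \<circ> (\<lambda>\<omega>. restrict (\<lambda>i. D i \<omega>) {..<n})"
  define Y where "Y = \<Psi> \<circ> (\<lambda>\<omega>. restrict (\<lambda>i. D i \<omega>) {n})"
  have XY: "indep_var borel X borel Y"
    unfolding X_def Y_def by (rule indep_var_compose[OF iv \<Phi>m \<Psi>m])
  have X_eq: "X \<omega> = (if \<forall>l\<le>n. W (r l) \<omega> \<in> G l then 1 else 0) * exp_mart b (r n) \<omega>" if "\<omega> \<in> space M" for \<omega>
  proof -
    have "(\<Sum>i<l. restrict (\<lambda>i. D i \<omega>) {..<n} i) = W (r l) \<omega>" if "l \<le> n" for l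
      using WD[OF \<open>\<omega> \<in> space M\<close>, of l] that by (auto intro: sum.cong)
    then show ?thesis by (simp add: X_def \<Phi>_def exp_mart_def)
  qed
  have Y_eq: "Y \<omega> = exp (b * D n \<omega>) * exp (- (b\<^sup>2 * \<delta> / 2)) - 1" for \<omega>
    by (simp add: Y_def \<Psi>_def flip: exp_add)
  have rd: "r (Suc n) - r n = \<delta>" by (simp add: r_def algebra_simps)
  have inc': "integrable M (\<lambda>\<omega>. exp (b * D n \<omega>))" "expectation (\<lambda>\<omega>. exp (b * D n \<omega>)) = exp (b\<^sup>2 * \<delta> / 2)"
    using exp_increment[of "r n" "r (Suc n)" b, OF r(1) r(2)] by (simp_all add: D_def rd)
  have Y: "integrable M Y" "expectation Y = 0"
    unfolding Y_eq[abs_def] using inc' by (auto simp: prob_space exp_minus)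
  have X: "integrable M X"
  proof (rule Bochner_Integration.integrable_bound[OF exp_mart_expectation(1)[OF r(1)[of n], of b]])
    show "X \<in> borel_measurable M"
      using indep_var_rv1[OF XY] by simp
    show "AE \<omega> in M. norm (X \<omega>) \<le> norm (exp_mart b (r n) \<omega>)"
      by (rule AE_I2) (auto simp: X_eq exp_mart_def)
  qed
  have XY0: "integrable M (\<lambda>\<omega>. X \<omega> * Y \<omega>)" "expectation (\<lambda>\<omega>. X \<omega> * Y \<omega>) = 0"
    using indep_var_integrable[OF XY X Y(1)] indep_var_lebesgue_integral[OF XY X Y(1)] Y(2) by auto
  have step: "exp_mart b (real (exit_index \<delta> G (Suc n) \<omega>) * \<delta>) \<omega>
      = exp_mart b (real (exit_index \<delta> G n \<omega>) * \<delta>) \<omega> + X \<omega> * Y \<omega>" if "\<omega> \<in> space M" for \<omega>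
  proof (cases "\<forall>l\<le>n. W (real l * \<delta>) \<omega> \<in> G l")
    case True
    have "exit_index \<delta> G n \<omega> = n"
      using exit_index_at[of \<delta> G n \<omega>] exit_index_le[of \<delta> G n \<omega>] True
      by (meson linorder_not_less order_le_less)
    moreover have "exp_mart b (r n) \<omega> * (exp (b * D n \<omega>) * exp (- (b\<^sup>2 * \<delta> / 2))) = exp_mart b (r (Suc n)) \<omega>"
      by (simp add: exp_mart_def D_def r_def algebra_simps add_divide_distrib flip: exp_add)
    ultimately show ?thesis
      using True that by (simp add: X_eq Y_eq r_def algebra_simps)
  next
    case False
    have "exit_index \<delta> G (Suc n) \<omega> = exit_index \<delta> G n \<omega>" using False by auto
    moreover have "X \<omega> = 0" using False that by (auto simp: X_eq r_def)
    ultimately show ?thesis by (simp only: mult_zero_left add_0_right)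
  qed
  have "integrable M (\<lambda>\<omega>. exp_mart b (real (exit_index \<delta> G (Suc n) \<omega>) * \<delta>) \<omega>) \<longleftrightarrow>
      integrable M (\<lambda>\<omega>. exp_mart b (real (exit_index \<delta> G n \<omega>) * \<delta>) \<omega> + X \<omega> * Y \<omega>)"
    by (intro Bochner_Integration.integrable_cong step) auto
  moreover have "expectation (\<lambda>\<omega>. exp_mart b (real (exit_index \<delta> G (Suc n) \<omega>) * \<delta>) \<omega>) =
      expectation (\<lambda>\<omega>. exp_mart b (real (exit_index \<delta> G n \<omega>) * \<delta>) \<omega> + X \<omega> * Y \<omega>)"
    by (intro Bochner_Integration.integral_cong step) auto
  ultimately show ?case using Suc.IH XY0 by auto
qed

text \<open>
  Random times at which every exponential martingale can be stopped. This property passes to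
  pointwise limits, so it serves in place of a filtration.
\<close>

definition stopping_like :: "real \<Rightarrow> ('a \<Rightarrow> real) \<Rightarrow> bool" where
  "stopping_like t S \<longleftrightarrow> S \<in> borel_measurable M \<and> (\<lambda>\<omega>. W (S \<omega>) \<omega>) \<in> borel_measurable M \<and>
     (\<forall>\<omega>\<in>space M. 0 \<le> S \<omega> \<and> S \<omega> \<le> t) \<and>
     (\<forall>b. integrable M (\<lambda>\<omega>. exp_mart b (S \<omega>) \<omega>) \<and> expectation (\<lambda>\<omega>. exp_mart b (S \<omega>) \<omega>) = 1)"

text \<open>
  The martingales at bounded times are bounded in \<open>L\<^sup>2\<close>, because the square
  of the one with parameter \<open>b\<close> is at most \<open>e\<close> to the power
  \<open>b\<^sup>2 t\<close> times the one with parameter \<open>2 b\<close>. This uniform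
  integrability carries the expectation to the limit.
\<close>

lemma stopping_like_limit:
  assumes S: "\<And>n. stopping_like t (S n)" and lim: "\<And>\<omega>. \<omega> \<in> space M \<Longrightarrow> (\<lambda>n. S n \<omega>) \<longlonglongrightarrow> R \<omega>"
  shows "stopping_like t R"
proof -
  have range: "0 \<le> S n \<omega>" "S n \<omega> \<le> t" if "\<omega> \<in> space M" for n \<omega>
    using S that by (auto simp: stopping_like_def)
  have R: "0 \<le> R \<omega>" "R \<omega> \<le> t" if "\<omega> \<in> space M" for \<omega>
    using LIMSEQ_le_const[OF lim[OF that]] LIMSEQ_le_const2[OF lim[OF that]] range[OF that] by blast+
  have limW: "(\<lambda>n. W (S n \<omega>) \<omega>) \<longlonglongrightarrow> W (R \<omega>) \<omega>" if "\<omega> \<in> space M" for \<omega>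
    using continuous_on_tendsto_compose[OF W_continuous[OF that] lim[OF that]] R[OF that] range[OF that] by auto
  have Rm [measurable]: "R \<in> borel_measurable M"
    by (rule borel_measurable_LIMSEQ_real[OF lim]) (use S in \<open>auto simp: stopping_like_def\<close>)
  have WRm [measurable]: "(\<lambda>\<omega>. W (R \<omega>) \<omega>) \<in> borel_measurable M"
    by (rule borel_measurable_LIMSEQ_real[OF limW]) (use S in \<open>auto simp: stopping_like_def\<close>)
  have [measurable]: "S n \<in> borel_measurable M" "(\<lambda>\<omega>. W (S n \<omega>) \<omega>) \<in> borel_measurable M" for n
    using S by (auto simp: stopping_like_def)
  have "integrable M (\<lambda>\<omega>. exp_mart b (R \<omega>) \<omega>) \<and> expectation (\<lambda>\<omega>. exp_mart b (R \<omega>) \<omega>) = 1" for b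
  proof -
    define f where "f = (\<lambda>n \<omega>. exp_mart b (S n \<omega>) \<omega>)"
    define g where "g = (\<lambda>\<omega>. exp_mart b (R \<omega>) \<omega>)"
    have fm [measurable]: "f n \<in> borel_measurable M" for n unfolding f_def exp_mart_def by measurable
    have gm [measurable]: "g \<in> borel_measurable M" unfolding g_def exp_mart_def by measurable
    have f: "integrable M (f n)" "expectation (f n) = 1" for n
      using S unfolding f_def stopping_like_def by auto
    have pos: "f n \<omega> > 0" "g \<omega> > 0" for n \<omega> by (auto simp: f_def g_def exp_mart_def)
    have fg: "(\<lambda>n. f n \<omega>) \<longlonglongrightarrow> g \<omega>" if "\<omega> \<in> space M" for \<omega>
      unfolding f_def g_def exp_mart_def by (intro tendsto_intros limW lim that) auto
    \<comment> \<open>The upper bound is the lemma of Fatou.\<close>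
    have "(\<integral>\<^sup>+\<omega>. ennreal (g \<omega>) \<partial>M) = (\<integral>\<^sup>+\<omega>. liminf (\<lambda>n. ennreal (f n \<omega>)) \<partial>M)"
      using fg by (intro nn_integral_cong) (auto intro!: lim_imp_Liminf[symmetric] tendsto_ennrealI)
    also have "\<dots> \<le> liminf (\<lambda>n. \<integral>\<^sup>+\<omega>. ennreal (f n \<omega>) \<partial>M)"
      by (intro nn_integral_liminf) measurable
    also have "\<dots> = 1"
      using nn_integral_eq_integral[OF f(1)] pos f(2) by (simp add: less_imp_le Liminf_const)
    finally have le1: "(\<integral>\<^sup>+\<omega>. ennreal (g \<omega>) \<partial>M) \<le> 1" .
    have gi: "integrable M g"
      using le1 pos by (intro integrableI_nonneg) (auto simp: less_imp_le order.strict_trans1)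
    have g1: "expectation g \<le> 1"
      using le1 nn_integral_eq_integral[OF gi] pos by (simp add: less_imp_le)
    \<comment> \<open>The lower bound truncates at level \<open>K\<close> and controls the tail by
        \<open>f \<le> min f K + f\<^sup>2 / K\<close>.\<close>
    have lower: "1 \<le> expectation g + exp (b\<^sup>2 * t) / K" if "K > 0" for K
    proof -
      have mi: "integrable M (\<lambda>\<omega>. min (f n \<omega>) K)" for n
        using f(1)[of n] by auto
      have sq: "(f n \<omega>)\<^sup>2 \<le> exp (b\<^sup>2 * t) * exp_mart (2 * b) (S n \<omega>) \<omega>" if "\<omega> \<in> space M" for n \<omega>
      proof -
        have "(f n \<omega>)\<^sup>2 = exp (b\<^sup>2 * S n \<omega>) * exp_mart (2 * b) (S n \<omega>) \<omega>"
          by (simp add: f_def exp_mart_def flip: exp_add exp_double)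
        also have "\<dots> \<le> exp (b\<^sup>2 * t) * exp_mart (2 * b) (S n \<omega>) \<omega>"
          using range[OF that, of n] by (intro mult_right_mono) (auto simp: exp_mart_def intro: mult_left_mono)
        finally show ?thesis .
      qed
      have i2: "integrable M (\<lambda>\<omega>. exp_mart (2 * b) (S n \<omega>) \<omega>)" "expectation (\<lambda>\<omega>. exp_mart (2 * b) (S n \<omega>) \<omega>) = 1" for n
        using S unfolding stopping_like_def by auto
      have "1 \<le> expectation (\<lambda>\<omega>. min (f n \<omega>) K) + exp (b\<^sup>2 * t) / K" for n
      proof -
        have "1 = expectation (f n)" using f by simp
        also have "\<dots> \<le> expectation (\<lambda>\<omega>. min (f n \<omega>) K + exp (b\<^sup>2 * t) * exp_mart (2 * b) (S n \<omega>) \<omega> / K)"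
        proof (rule integral_mono)
          show "integrable M (f n)" by (rule f)
          show "integrable M (\<lambda>\<omega>. min (f n \<omega>) K + exp (b\<^sup>2 * t) * exp_mart (2 * b) (S n \<omega>) \<omega> / K)"
            using mi i2 by auto
          fix \<omega> assume "\<omega> \<in> space M"
          have "f n \<omega> \<le> min (f n \<omega>) K + (f n \<omega>)\<^sup>2 / K"
          proof (cases "f n \<omega> \<le> K")
            case False
            then have "f n \<omega> * K \<le> (f n \<omega>)\<^sup>2" using pos(1)[of n \<omega>] by (simp add: power2_eq_square)
            then have "f n \<omega> \<le> (f n \<omega>)\<^sup>2 / K" using \<open>K > 0\<close> by (simp add: field_simps)
            then show ?thesis using False \<open>K > 0\<close> by linarith
          qed (use \<open>K > 0\<close> in simp)
          also have "\<dots> \<le> min (f n \<omega>) K + exp (b\<^sup>2 * t) * exp_mart (2 * b) (S n \<omega>) \<omega> / K"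
            using sq[OF \<open>\<omega> \<in> space M\<close>, of n] \<open>K > 0\<close> by (intro add_left_mono divide_right_mono) auto
          finally show "f n \<omega> \<le> min (f n \<omega>) K + exp (b\<^sup>2 * t) * exp_mart (2 * b) (S n \<omega>) \<omega> / K" .
        qed
        also have "\<dots> = expectation (\<lambda>\<omega>. min (f n \<omega>) K) + exp (b\<^sup>2 * t) / K"
          using mi i2 by simp
        finally show ?thesis .
      qed
      moreover have "(\<lambda>n. expectation (\<lambda>\<omega>. min (f n \<omega>) K)) \<longlonglongrightarrow> expectation (\<lambda>\<omega>. min (g \<omega>) K)"
      proof (rule integral_dominated_convergence[where w = "\<lambda>_. K"])
        show "AE \<omega> in M. (\<lambda>n. min (f n \<omega>) K) \<longlonglongrightarrow> min (g \<omega>) K"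
          using fg by (auto intro!: tendsto_intros)
        show "AE \<omega> in M. norm (min (f n \<omega>) K) \<le> K" for n
        proof (rule AE_I2)
          fix \<omega> show "norm (min (f n \<omega>) K) \<le> K"
            using pos(1)[of n \<omega>] \<open>K > 0\<close> by (simp add: min_def)
        qed
      qed auto
      ultimately have "1 \<le> expectation (\<lambda>\<omega>. min (g \<omega>) K) + exp (b\<^sup>2 * t) / K"
        by (intro LIMSEQ_le_const[OF tendsto_add[OF _ tendsto_const]]) auto
      also have "expectation (\<lambda>\<omega>. min (g \<omega>) K) \<le> expectation g"
        using gi by (intro integral_mono) auto
      finally show ?thesis by simp
    qed
    have "expectation g \<ge> 1"
    proof (rule tendsto_le[OF trivial_limit_sequentially])
      show "(\<lambda>n. expectation g + exp (b\<^sup>2 * t) / real (Suc n)) \<longlonglongrightarrow> expectation g"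
        using tendsto_add[OF tendsto_const LIMSEQ_Suc[OF lim_const_over_n]] by fastforce
      show "\<forall>\<^sub>F n in sequentially. 1 \<le> expectation g + exp (b\<^sup>2 * t) / real (Suc n)"
        using lower by (intro always_eventually) auto
    qed (rule tendsto_const)
    then show ?thesis using g1 gi by (simp add: g_def)
  qed
  then show ?thesis unfolding stopping_like_def using R by auto
qed


text \<open>
  The first dyadic time at which \<open>d\<close>, evaluated along the path, is at most
  \<open>\<epsilon>\<close>, or \<open>t\<close> if there is none.
\<close>

definition grid_exit :: "real \<Rightarrow> (real \<Rightarrow> real \<Rightarrow> real) \<Rightarrow> nat \<Rightarrow> real \<Rightarrow> 'a \<Rightarrow> real" where
  "grid_exit t d m \<epsilon> \<omega> =
     real (exit_index (t / 2 ^ m) (\<lambda>l. {w. d (real l * (t / 2 ^ m)) w > \<epsilon>}) (2 ^ m) \<omega>) * (t / 2 ^ m)"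

lemma grid_exit_bounds:
  assumes "0 < t"
  shows "0 \<le> grid_exit t d m \<epsilon> \<omega>" "grid_exit t d m \<epsilon> \<omega> \<le> t"
proof -
  show "0 \<le> grid_exit t d m \<epsilon> \<omega>" using assms by (simp add: grid_exit_def)
  have "real (exit_index (t / 2 ^ m) (\<lambda>l. {w. d (real l * (t / 2 ^ m)) w > \<epsilon>}) (2 ^ m) \<omega>) \<le> real (2 ^ m)"
    using exit_index_le of_nat_le_iff by blast
  then have "grid_exit t d m \<epsilon> \<omega> \<le> real (2 ^ m) * (t / 2 ^ m)"
    unfolding grid_exit_def using assms by (intro mult_right_mono) auto
  then show "grid_exit t d m \<epsilon> \<omega> \<le> t" by simp
qed

lemma grid_exit_at:
  assumes "0 < t" "grid_exit t d m \<epsilon> \<omega> < t"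
  obtains l where "l \<le> 2 ^ m" "grid_exit t d m \<epsilon> \<omega> = real l * (t / 2 ^ m)"
    "d (grid_exit t d m \<epsilon> \<omega>) (W (grid_exit t d m \<epsilon> \<omega>) \<omega>) \<le> \<epsilon>"
proof -
  define l where "l = exit_index (t / 2 ^ m) (\<lambda>l. {w. d (real l * (t / 2 ^ m)) w > \<epsilon>}) (2 ^ m) \<omega>"
  have eq: "grid_exit t d m \<epsilon> \<omega> = real l * (t / 2 ^ m)" by (simp add: grid_exit_def l_def)
  have le: "l \<le> 2 ^ m" unfolding l_def by (rule exit_index_le)
  moreover have "l \<noteq> 2 ^ m" using assms eq by auto
  ultimately have "l < 2 ^ m" by simp
  from exit_index_at[OF this[unfolded l_def], folded l_def]
  show ?thesis using that[OF le eq] eq by simp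
qed

lemma grid_exit_le:
  assumes "0 < t" "d (real l * (t / 2 ^ m)) (W (real l * (t / 2 ^ m)) \<omega>) \<le> \<epsilon>"
  shows "grid_exit t d m \<epsilon> \<omega> \<le> real l * (t / 2 ^ m)"
proof -
  have "\<not> l < exit_index (t / 2 ^ m) (\<lambda>l. {w. d (real l * (t / 2 ^ m)) w > \<epsilon>}) (2 ^ m) \<omega>"
    using exit_index_before[of l "t / 2 ^ m" "\<lambda>l. {w. d (real l * (t / 2 ^ m)) w > \<epsilon>}" "2 ^ m" \<omega>] assms(2)
    by auto
  then show ?thesis
    unfolding grid_exit_def using assms(1) by (intro mult_right_mono) auto
qed

text \<open>
  Refining the grid adds candidate times, so the first of them can only become smaller.
\<close>

lemma grid_exit_decseq:
  assumes "0 < t"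
  shows "decseq (\<lambda>m. grid_exit t d m \<epsilon> \<omega>)"
proof (rule decseq_SucI)
  fix m
  show "grid_exit t d (Suc m) \<epsilon> \<omega> \<le> grid_exit t d m \<epsilon> \<omega>"
  proof (cases "grid_exit t d m \<epsilon> \<omega> < t")
    case True
    from grid_exit_at[OF assms True] obtain l where l: "grid_exit t d m \<epsilon> \<omega> = real l * (t / 2 ^ m)"
      "d (grid_exit t d m \<epsilon> \<omega>) (W (grid_exit t d m \<epsilon> \<omega>) \<omega>) \<le> \<epsilon>" by blast
    have "real l * (t / 2 ^ m) = real (2 * l) * (t / 2 ^ Suc m)" by simp
    then show ?thesis using grid_exit_le[OF assms, of d "2 * l" "Suc m" \<omega> \<epsilon>] l by metis
  next
    case False
    then show ?thesis using grid_exit_bounds[OF assms, of d _ \<epsilon> \<omega>] by (meson dual_order.trans not_less)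
  qed
qed

lemma stopping_like_grid_exit:
  assumes "0 < t" and d: "\<And>s. continuous_on UNIV (d s)"
  shows "stopping_like t (grid_exit t d m \<epsilon>)"
proof -
  have G: "{w. d s w > \<epsilon>} \<in> sets borel" for s
    by (intro borel_open open_Collect_less continuous_intros d)
  have pos: "0 < t / 2 ^ m" using assms by simp
  have "(\<lambda>\<omega>. grid_exit t d m \<epsilon> \<omega>) \<in> borel_measurable M"
    unfolding grid_exit_def
    using measurable_at_exit_index[where F = "\<lambda>s \<omega>. s", OF _ less_imp_le[OF pos] G] by simp
  moreover have "(\<lambda>\<omega>. W (grid_exit t d m \<epsilon> \<omega>) \<omega>) \<in> borel_measurable M"
    unfolding grid_exit_def
    using assms by (intro measurable_at_exit_index[where F = W, OF _ less_imp_le[OF pos] G] W_measurable) auto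
  moreover have "integrable M (\<lambda>\<omega>. exp_mart b (grid_exit t d m \<epsilon> \<omega>) \<omega>) \<and>
      expectation (\<lambda>\<omega>. exp_mart b (grid_exit t d m \<epsilon> \<omega>) \<omega>) = 1" for b
    unfolding grid_exit_def by (rule exp_mart_at_exit_index[OF pos G])
  ultimately show ?thesis
    unfolding stopping_like_def using grid_exit_bounds[OF assms(1)] by auto
qed

text \<open>
  The exit time from \<open>{d > 0}\<close> is reached by two limits: the dyadic exit times
  from \<open>{d > \<epsilon>}\<close> decrease to a time \<open>L \<epsilon>\<close>, and
  \<open>L \<epsilon>\<close> tends to the exit time as \<open>\<epsilon>\<close> goes to
  \<open>0\<close>. The positive margin \<open>\<epsilon>\<close> is what makes the exit
  visible at some nearby grid time.
\<close>

lemma stopping_like_exit: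
  fixes d :: "real \<Rightarrow> real \<Rightarrow> real"
  assumes "0 < t" and d: "continuous_on UNIV (\<lambda>(s, w). d s w)"
    and \<tau>: "\<And>\<omega>. \<omega> \<in> space M \<Longrightarrow> 0 \<le> \<tau> \<omega> \<and> \<tau> \<omega> \<le> t"
      "\<And>\<omega> r. \<omega> \<in> space M \<Longrightarrow> 0 \<le> r \<Longrightarrow> r < \<tau> \<omega> \<Longrightarrow> 0 < d r (W r \<omega>)"
      "\<And>\<omega>. \<omega> \<in> space M \<Longrightarrow> \<tau> \<omega> < t \<Longrightarrow> d (\<tau> \<omega>) (W (\<tau> \<omega>) \<omega>) = 0"
  shows "stopping_like t \<tau>"
proof -
  have ds: "continuous_on UNIV (d s)" for s
  proof -
    have "continuous_on UNIV ((\<lambda>(s, w). d s w) \<circ> (\<lambda>w. (s, w)))"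
      by (intro continuous_on_compose continuous_on_subset[OF d] continuous_intros) auto
    then show ?thesis by (simp add: o_def)
  qed
  define L where "L = (\<lambda>\<epsilon> \<omega>. lim (\<lambda>m. grid_exit t d m \<epsilon> \<omega>))"
  have L: "(\<lambda>m. grid_exit t d m \<epsilon> \<omega>) \<longlonglongrightarrow> L \<epsilon> \<omega>" for \<epsilon> \<omega>
  proof -
    obtain l where "(\<lambda>m. grid_exit t d m \<epsilon> \<omega>) \<longlonglongrightarrow> l"
      using decseq_convergent[OF grid_exit_decseq[OF assms(1)], of 0 d \<epsilon> \<omega>] grid_exit_bounds[OF assms(1)] by metis
    then show ?thesis unfolding L_def by (simp add: limI)
  qed
  have L_le: "L \<epsilon> \<omega> \<le> grid_exit t d m \<epsilon> \<omega>" for \<epsilon> \<omega> m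
    by (rule decseq_ge[OF grid_exit_decseq[OF assms(1)] L])
  have L_nn: "0 \<le> L \<epsilon> \<omega>" for \<epsilon> \<omega>
    using LIMSEQ_le_const[OF L] grid_exit_bounds[OF assms(1)] by blast
  have stop_L: "stopping_like t (L \<epsilon>)" for \<epsilon>
    by (rule stopping_like_limit[OF stopping_like_grid_exit[OF assms(1) ds] L])
  have cont: "continuous_on {0..} (\<lambda>s. d s (W s \<omega>))" if "\<omega> \<in> space M" for \<omega>
  proof -
    have "continuous_on {0..} ((\<lambda>(s, w). d s w) \<circ> (\<lambda>s. (s, W s \<omega>)))"
      by (intro continuous_on_compose continuous_on_subset[OF d] continuous_intros W_continuous that) auto
    then show ?thesis by (simp add: o_def)
  qed
  have L_at: "d (L \<epsilon> \<omega>) (W (L \<epsilon> \<omega>) \<omega>) \<le> \<epsilon>" if "\<omega> \<in> space M" "L \<epsilon> \<omega> < t" for \<epsilon> \<omega>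
  proof (rule tendsto_upperbound)
    show "(\<lambda>m. d (grid_exit t d m \<epsilon> \<omega>) (W (grid_exit t d m \<epsilon> \<omega>) \<omega>)) \<longlonglongrightarrow> d (L \<epsilon> \<omega>) (W (L \<epsilon> \<omega>) \<omega>)"
      using continuous_on_tendsto_compose[OF cont[OF that(1)] L] L_nn grid_exit_bounds[OF assms(1)] by auto
    have "\<forall>\<^sub>F m in sequentially. grid_exit t d m \<epsilon> \<omega> < t"
      using order_tendstoD(2)[OF L that(2)] .
    then show "\<forall>\<^sub>F m in sequentially. d (grid_exit t d m \<epsilon> \<omega>) (W (grid_exit t d m \<epsilon> \<omega>) \<omega>) \<le> \<epsilon>"
      by eventually_elim (metis grid_exit_at assms(1))
  qed simp
  have L_upper: "L \<epsilon> \<omega> \<le> \<tau> \<omega>" if \<omega>: "\<omega> \<in> space M" and "0 < \<epsilon>" for \<epsilon> \<omega>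
  proof (cases "\<tau> \<omega> < t")
    case False
    then show ?thesis using L_le[of \<epsilon> \<omega> 0] grid_exit_bounds(2)[OF assms(1), of d 0 \<epsilon> \<omega>] \<tau>(1)[OF \<omega>] by linarith
  next
    case True
    show ?thesis
    proof (rule field_le_epsilon)
      fix e :: real assume "0 < e"
      have "\<forall>\<^sub>F s in at (\<tau> \<omega>) within {0..}. d s (W s \<omega>) < \<epsilon>"
      proof (rule order_tendstoD(2))
        show "((\<lambda>s. d s (W s \<omega>)) \<longlongrightarrow> d (\<tau> \<omega>) (W (\<tau> \<omega>) \<omega>)) (at (\<tau> \<omega>) within {0..})"
          using cont[OF \<omega>] \<tau>(1)[OF \<omega>] unfolding continuous_on_def by auto
      qed (use \<tau>(3)[OF \<omega> True] \<open>0 < \<epsilon>\<close> in simp)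
      then obtain \<eta> where \<eta>: "\<eta> > 0" "\<And>s. 0 \<le> s \<Longrightarrow> s \<noteq> \<tau> \<omega> \<Longrightarrow> dist s (\<tau> \<omega>) < \<eta> \<Longrightarrow> d s (W s \<omega>) < \<epsilon>"
        unfolding eventually_at by auto
      have \<eta>': "d s (W s \<omega>) \<le> \<epsilon>" if "0 \<le> s" "dist s (\<tau> \<omega>) < \<eta>" for s
        using \<eta>(2)[of s] that \<tau>(3)[OF \<omega> True] \<open>0 < \<epsilon>\<close> by (cases "s = \<tau> \<omega>") auto
      define \<rho> where "\<rho> = min e \<eta>"
      have "\<rho> > 0" using \<open>0 < e\<close> \<eta> by (simp add: \<rho>_def)
      obtain m where m: "t / 2 ^ m < \<rho>"
      proof -
        obtain m where "t / \<rho> < 2 ^ m" using real_arch_pow[of 2 "t / \<rho>"] by auto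
        then show ?thesis using that[of m] \<open>\<rho> > 0\<close> by (simp add: field_simps)
      qed
      define l where "l = nat \<lceil>\<tau> \<omega> / (t / 2 ^ m)\<rceil>"
      have tm: "t / 2 ^ m > 0" using assms(1) by simp
      have "0 \<le> \<tau> \<omega> / (t / 2 ^ m)" using \<tau>(1)[OF \<omega>] tm by (metis divide_nonneg_pos)
      then have l: "\<tau> \<omega> / (t / 2 ^ m) \<le> real l" "real l < \<tau> \<omega> / (t / 2 ^ m) + 1"
        unfolding l_def by linarith+
      have l1: "\<tau> \<omega> \<le> real l * (t / 2 ^ m)" using l(1) by (subst (asm) pos_divide_le_eq[OF tm])
      have "real l * (t / 2 ^ m) < (\<tau> \<omega> / (t / 2 ^ m) + 1) * (t / 2 ^ m)"
        by (rule mult_strict_right_mono[OF l(2) tm])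
      also have "\<dots> = \<tau> \<omega> + t / 2 ^ m" using assms(1) by (simp add: field_simps)
      finally have l2: "real l * (t / 2 ^ m) < \<tau> \<omega> + \<rho>" using m by simp
      have "d (real l * (t / 2 ^ m)) (W (real l * (t / 2 ^ m)) \<omega>) \<le> \<epsilon>"
        using l1 l2 \<tau>(1)[OF \<omega>] by (intro \<eta>') (auto simp: dist_real_def \<rho>_def)
      from grid_exit_le[OF assms(1), of d l m \<omega> \<epsilon>, OF this] L_le[of \<epsilon> \<omega> m] l2
      show "L \<epsilon> \<omega> \<le> \<tau> \<omega> + e" by (simp add: \<rho>_def)
    qed
  qed
  have "(\<lambda>j. L (1 / real (Suc j)) \<omega>) \<longlonglongrightarrow> \<tau> \<omega>" if \<omega>: "\<omega> \<in> space M" for \<omega>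
  proof (rule LIMSEQ_I)
    fix e :: real assume "0 < e"
    \<comment> \<open>Before time \<open>\<tau> - e\<close> the function stays above a positive
        constant by compactness, which keeps \<open>L \<epsilon>\<close> from being too
        early.\<close>
    obtain c where c: "c > 0" "\<And>r. 0 \<le> r \<Longrightarrow> r \<le> \<tau> \<omega> - e \<Longrightarrow> c \<le> d r (W r \<omega>)"
    proof (cases "\<tau> \<omega> - e \<ge> 0")
      case True
      have "continuous_on {0..\<tau> \<omega> - e} (\<lambda>s. d s (W s \<omega>))"
        by (rule continuous_on_subset[OF cont[OF \<omega>]]) auto
      from continuous_attains_inf[OF compact_Icc _ this] True
      obtain r0 where r0: "r0 \<in> {0..\<tau> \<omega> - e}" "\<And>r. r \<in> {0..\<tau> \<omega> - e} \<Longrightarrow> d r0 (W r0 \<omega>) \<le> d r (W r \<omega>)"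
        by auto
      then show ?thesis using that[of "d r0 (W r0 \<omega>)"] \<tau>(2)[OF \<omega>, of r0] \<open>0 < e\<close> by auto
    next
      case False
      then show ?thesis using that[of 1] by auto
    qed
    obtain N where N: "1 / real (Suc N) < c" using c(1) nat_approx_posE by metis
    have "norm (L (1 / real (Suc j)) \<omega> - \<tau> \<omega>) < e" if "j \<ge> N" for j
    proof -
      have "1 / real (Suc j) \<le> 1 / real (Suc N)" using that by (intro divide_left_mono) auto
      then have "1 / real (Suc j) < c" using N by simp
      have "\<not> L (1 / real (Suc j)) \<omega> \<le> \<tau> \<omega> - e"
      proof
        assume *: "L (1 / real (Suc j)) \<omega> \<le> \<tau> \<omega> - e"
        then have "L (1 / real (Suc j)) \<omega> < t" using \<tau>(1)[OF \<omega>] \<open>0 < e\<close> by linarith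
        from L_at[OF \<omega> this] c(2)[OF L_nn *] \<open>1 / real (Suc j) < c\<close> show False by linarith
      qed
      moreover have "L (1 / real (Suc j)) \<omega> \<le> \<tau> \<omega>" by (rule L_upper[OF \<omega>]) simp
      ultimately show ?thesis by simp
    qed
    then show "\<exists>N. \<forall>j\<ge>N. norm (L (1 / real (Suc j)) \<omega> - \<tau> \<omega>) < e" by blast
  qed
  then show ?thesis by (rule stopping_like_limit[OF stop_L])
qed

end

lemma hitting_time_cases:
  fixes X :: "real \<Rightarrow> 'a \<Rightarrow> 'b::t1_space"
  assumes cont: "continuous_on {0..} (\<lambda>t. X t \<omega>)" and "closed A"
  obtains (never) "hitting_time X A \<omega> = \<infinity>" "\<And>t. 0 \<le> t \<Longrightarrow> X t \<omega> \<notin> A"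
  | (hit) r where "hitting_time X A \<omega> = ereal r" "0 \<le> r" "X r \<omega> \<in> A" "\<And>t. 0 \<le> t \<Longrightarrow> t < r \<Longrightarrow> X t \<omega> \<notin> A"
proof -
  define B where "B = {t. 0 \<le> t \<and> X t \<omega> \<in> A}"
  have "closed B"
  proof -
    have "closed ({0..} \<inter> (\<lambda>t. X t \<omega>) -` A)"
      by (rule continuous_closed_preimage[OF cont]) (use assms in auto)
    also have "{0..} \<inter> (\<lambda>t. X t \<omega>) -` A = B" by (auto simp: B_def)
    finally show ?thesis .
  qed
  have bdd: "bdd_below B" by (rule bdd_belowI[of _ 0]) (auto simp: B_def)
  show ?thesis
  proof (cases "B = {}")
    case True
    have "hitting_time X A \<omega> = Inf (ereal ` B)" by (simp add: hitting_time_def B_def)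
    then have "hitting_time X A \<omega> = \<infinity>" using True by (simp add: top_ereal_def)
    then show ?thesis using True never by (auto simp: B_def)
  next
    case False
    have "Inf B \<in> B" by (rule closed_contains_Inf[OF False bdd \<open>closed B\<close>])
    moreover have "hitting_time X A \<omega> = ereal (Inf B)"
      using ereal_Inf'[OF bdd False] by (simp add: hitting_time_def B_def)
    moreover have "X t \<omega> \<notin> A" if "0 \<le> t" "t < Inf B" for t
      using that cInf_lower[OF _ bdd, of t] by (auto simp: B_def)
    ultimately show ?thesis using hit[of "Inf B"] by (auto simp: B_def)
  qed
qed

context standard_brownian_motion begin

text \<open>
  The process cannot reach both axes at once, since the sum of its coordinates is positive;
  the first axis reached decides between \<open>left\<close> and \<open>down\<close>.
\<close>

lemma exit_cases:
  assumes "\<omega> \<in> space M" "z0 \<in> quadrant"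
  obtains (never) "T1 W \<gamma> z0 \<omega> = \<infinity>" "T2 W \<gamma> z0 \<omega> = \<infinity>" "\<And>s. 0 \<le> s \<Longrightarrow> Z W \<gamma> z0 s \<omega> \<in> quadrant"
  | (left) r where "T1 W \<gamma> z0 \<omega> = ereal r" "ereal r < T2 W \<gamma> z0 \<omega>" "0 < r"
      "fst (Z W \<gamma> z0 r \<omega>) = 0" "\<And>s. 0 \<le> s \<Longrightarrow> s < r \<Longrightarrow> Z W \<gamma> z0 s \<omega> \<in> quadrant"
  | (down) r where "T2 W \<gamma> z0 \<omega> = ereal r" "ereal r < T1 W \<gamma> z0 \<omega>" "0 < r"
      "snd (Z W \<gamma> z0 r \<omega>) = 0" "\<And>s. 0 \<le> s \<Longrightarrow> s < r \<Longrightarrow> Z W \<gamma> z0 s \<omega> \<in> quadrant"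
proof -
  define X where "X = (\<lambda>s. fst (Z W \<gamma> z0 s \<omega>))"
  define Y where "Y = (\<lambda>s. snd (Z W \<gamma> z0 s \<omega>))"
  have sum: "X s + Y s = fst z0 + snd z0 + s" for s
    by (simp add: X_def Y_def Z_def algebra_simps)
  have pos0: "fst z0 > 0" "snd z0 > 0" using assms(2) by (auto simp: quadrant_def)
  have contX: "continuous_on {0..} X" and contY: "continuous_on {0..} Y"
    unfolding X_def Y_def Z_def by (auto intro!: continuous_intros W_continuous assms)
  have contZ: "continuous_on {0..} (\<lambda>s. Z W \<gamma> z0 s \<omega>)"
    unfolding Z_def by (auto intro!: continuous_intros W_continuous assms)
  have zero: "X 0 = fst z0" "Y 0 = snd z0" using W_start[OF assms(1)] by (auto simp: X_def Y_def Z_def)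
  have cl1: "closed ({0::real} \<times> {0::real..})" and cl2: "closed ({0::real..} \<times> {0::real})"
    by (auto intro!: closed_Times)
  have in1: "Z W \<gamma> z0 s \<omega> \<in> {0} \<times> {0..} \<longleftrightarrow> X s = 0" if "0 \<le> s" for s
    using sum[of s] that pos0 by (auto simp: X_def Y_def mem_Times_iff)
  have in2: "Z W \<gamma> z0 s \<omega> \<in> {0..} \<times> {0} \<longleftrightarrow> Y s = 0" if "0 \<le> s" for s
    using sum[of s] that pos0 by (auto simp: X_def Y_def mem_Times_iff)
  have quad: "Z W \<gamma> z0 s \<omega> \<in> quadrant" if "0 \<le> r" "\<And>s. 0 \<le> s \<Longrightarrow> s \<le> r \<Longrightarrow> X s \<noteq> 0 \<and> Y s \<noteq> 0" "0 \<le> s" "s \<le> r" for r s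
  proof -
    have "X s > 0"
    proof (rule ccontr)
      assume "\<not> 0 < X s"
      then have "\<exists>x\<ge>0. x \<le> s \<and> X x = 0"
        using zero pos0 that by (intro IVT2' continuous_on_subset[OF contX]) auto
      then show False using that by force
    qed
    moreover have "Y s > 0"
    proof (rule ccontr)
      assume "\<not> 0 < Y s"
      then have "\<exists>x\<ge>0. x \<le> s \<and> Y x = 0"
        using zero pos0 that by (intro IVT2' continuous_on_subset[OF contY]) auto
      then show False using that by force
    qed
    ultimately show ?thesis by (simp add: quadrant_def X_def Y_def mem_Times_iff)
  qed
  have T1_cases: "(T1 W \<gamma> z0 \<omega> = \<infinity> \<and> (\<forall>s\<ge>0. X s \<noteq> 0)) \<or>
      (\<exists>r\<ge>0. T1 W \<gamma> z0 \<omega> = ereal r \<and> X r = 0 \<and> (\<forall>s\<ge>0. s < r \<longrightarrow> X s \<noteq> 0))"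
    using hitting_time_cases[where X = "Z W \<gamma> z0" and \<omega> = \<omega>, OF contZ cl1, folded T1_def] in1 by metis
  have T2_cases: "(T2 W \<gamma> z0 \<omega> = \<infinity> \<and> (\<forall>s\<ge>0. Y s \<noteq> 0)) \<or>
      (\<exists>r\<ge>0. T2 W \<gamma> z0 \<omega> = ereal r \<and> Y r = 0 \<and> (\<forall>s\<ge>0. s < r \<longrightarrow> Y s \<noteq> 0))"
    using hitting_time_cases[where X = "Z W \<gamma> z0" and \<omega> = \<omega>, OF contZ cl2, folded T2_def] in2 by metis
  consider (a) "T1 W \<gamma> z0 \<omega> = \<infinity>" "T2 W \<gamma> z0 \<omega> = \<infinity>" | (b) "T1 W \<gamma> z0 \<omega> < T2 W \<gamma> z0 \<omega>"
    | (c) "T2 W \<gamma> z0 \<omega> < T1 W \<gamma> z0 \<omega>" | (d) r where "T1 W \<gamma> z0 \<omega> = ereal r" "T2 W \<gamma> z0 \<omega> = ereal r"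
    using T1_cases T2_cases by (metis linorder_less_linear)
  then show ?thesis
  proof cases
    case a
    then have "X s \<noteq> 0 \<and> Y s \<noteq> 0" if "0 \<le> s" for s using T1_cases T2_cases that by auto
    then have "Z W \<gamma> z0 s \<omega> \<in> quadrant" if "0 \<le> s" for s using quad[of s s] that by auto
    then show ?thesis using never a by blast
  next
    case b
    then obtain r where r: "r \<ge> 0" "T1 W \<gamma> z0 \<omega> = ereal r" "X r = 0" "\<And>s. 0 \<le> s \<Longrightarrow> s < r \<Longrightarrow> X s \<noteq> 0"
      using T1_cases by auto
    have Y: "Y s \<noteq> 0" if "0 \<le> s" "s < r" for s using T2_cases b r that by auto
    have "Z W \<gamma> z0 s \<omega> \<in> quadrant" if "0 \<le> s" "s < r" for s
      using quad[of s s] r(4) Y that by auto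
    moreover have "r \<noteq> 0" using r zero pos0 by auto
    ultimately show ?thesis using left[of r] r b by (auto simp: X_def)
  next
    case c
    then obtain r where r: "r \<ge> 0" "T2 W \<gamma> z0 \<omega> = ereal r" "Y r = 0" "\<And>s. 0 \<le> s \<Longrightarrow> s < r \<Longrightarrow> Y s \<noteq> 0"
      using T2_cases by auto
    have X: "X s \<noteq> 0" if "0 \<le> s" "s < r" for s using T1_cases c r that by auto
    have "Z W \<gamma> z0 s \<omega> \<in> quadrant" if "0 \<le> s" "s < r" for s
      using quad[of s s] r(4) X that by auto
    moreover have "r \<noteq> 0" using r zero pos0 by auto
    ultimately show ?thesis using down[of r] r c by (auto simp: Y_def)
  next
    case d
    then have "X r = 0" "Y r = 0" "r \<ge> 0" using T1_cases T2_cases by auto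
    then show ?thesis using sum[of r] pos0 by auto
  qed
qed

definition exit_time :: "real \<Rightarrow> real \<times> real \<Rightarrow> real \<Rightarrow> 'a \<Rightarrow> real" where
  "exit_time \<gamma> z0 t \<omega> = real_of_ereal (min (T W \<gamma> z0 \<omega>) (ereal t))"

lemma exit_time_eq_t: "ereal t < T W \<gamma> z0 \<omega> \<Longrightarrow> exit_time \<gamma> z0 t \<omega> = t"
  by (auto simp: exit_time_def min_def)

text \<open>
  The smaller of the two coordinates, as a function of time and of the value of the Brownian
  motion, serves as the distance to the axes.
\<close>

lemma stopping_like_exit_time:
  assumes "z0 \<in> quadrant" "0 < t"
  shows "stopping_like t (exit_time \<gamma> z0 t)"
proof (rule stopping_like_exit[where d = "\<lambda>s w. min (fst z0 - w + (1 - \<gamma>) * s) (snd z0 + w + \<gamma> * s)"])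
  show "continuous_on UNIV (\<lambda>(s, w). min (fst z0 - w + (1 - \<gamma>) * s) (snd z0 + w + \<gamma> * s))"
    unfolding case_prod_unfold by (intro continuous_intros)
  have quad: "min (fst z0 - W s \<omega> + (1 - \<gamma>) * s) (snd z0 + W s \<omega> + \<gamma> * s) > 0 \<longleftrightarrow> Z W \<gamma> z0 s \<omega> \<in> quadrant" for s \<omega>
    by (auto simp: Z_def quadrant_def)
  fix \<omega> assume \<omega>: "\<omega> \<in> space M"
  have pos0: "fst z0 > 0" "snd z0 > 0" using assms(1) by (auto simp: quadrant_def)
  have main: "0 \<le> exit_time \<gamma> z0 t \<omega> \<and> exit_time \<gamma> z0 t \<omega> \<le> t \<and>
    (\<forall>s\<ge>0. s < exit_time \<gamma> z0 t \<omega> \<longrightarrow> Z W \<gamma> z0 s \<omega> \<in> quadrant) \<and>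
    (exit_time \<gamma> z0 t \<omega> < t \<longrightarrow> 
       (let r = exit_time \<gamma> z0 t \<omega> in min (fst z0 - W r \<omega> + (1 - \<gamma>) * r) (snd z0 + W r \<omega> + \<gamma> * r) = 0))"
  proof (cases rule: exit_cases[OF \<omega> assms(1), of \<gamma>, case_names never left down])
    case never
    then show ?thesis using assms(2) by (auto simp: exit_time_def T_def min_def)
  next
    case (left r)
    have "exit_time \<gamma> z0 t \<omega> = min r t"
      using left by (auto simp: exit_time_def T_def min_def)
    moreover have "snd (Z W \<gamma> z0 r \<omega>) > 0"
      using left pos0 by (auto simp: Z_def algebra_simps)
    ultimately show ?thesis using left assms(2) by (auto simp: Let_def Z_def)
  next
    case (down r)
    have "exit_time \<gamma> z0 t \<omega> = min r t"
      using down by (auto simp: exit_time_def T_def min_def)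
    moreover have "fst (Z W \<gamma> z0 r \<omega>) > 0"
      using down pos0 by (auto simp: Z_def algebra_simps)
    ultimately show ?thesis using down assms(2) by (auto simp: Let_def Z_def)
  qed
  show "0 \<le> exit_time \<gamma> z0 t \<omega> \<and> exit_time \<gamma> z0 t \<omega> \<le> t" using main by blast
  show "min (fst z0 - W r \<omega> + (1 - \<gamma>) * r) (snd z0 + W r \<omega> + \<gamma> * r) > 0" if "0 \<le> r" "r < exit_time \<gamma> z0 t \<omega>" for r
    unfolding quad using main that by blast
  show "min (fst z0 - W (exit_time \<gamma> z0 t \<omega>) \<omega> + (1 - \<gamma>) * exit_time \<gamma> z0 t \<omega>)
      (snd z0 + W (exit_time \<gamma> z0 t \<omega>) \<omega> + \<gamma> * exit_time \<gamma> z0 t \<omega>) = 0" if "exit_time \<gamma> z0 t \<omega> < t"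
    using main that by (simp add: Let_def)
qed (use assms in auto)

end

section \<open>Exponentials on the parabola and series of images\<close>

text \<open>
  The exponential \<open>exp (p x + q y)\<close> at the point of the parabola with parameter
  \<open>a\<close>; here \<open>a\<close> is any real number, the arc of saddle points being
  \<open>0 \<le> a \<le> 1\<close>.
\<close>

definition expo :: "real \<Rightarrow> real \<Rightarrow> real \<times> real \<Rightarrow> real" where
  "expo \<gamma> a z = exp ((\<gamma>\<^sup>2 - (1 - a)\<^sup>2) / 2 * fst z + ((1 - \<gamma>)\<^sup>2 - a\<^sup>2) / 2 * snd z)"

text \<open>
  Equal to \<open>exp (s (u - (1 - \<gamma>))\<^sup>2 / 2)\<close> in the coordinates
  \<open>sz\<close> and \<open>uz\<close>; it removes the drift, whose direction is \<open>u =
  1 - \<gamma>\<close>.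
\<close>

definition prefactor :: "real \<Rightarrow> real \<times> real \<Rightarrow> real" where
  "prefactor \<gamma> z = exp ((fst z - (1 - \<gamma>) * (fst z + snd z))\<^sup>2 / (2 * (fst z + snd z)))"

definition sz :: "real \<times> real \<Rightarrow> real" where "sz z = fst z + snd z"
definition uz :: "real \<times> real \<Rightarrow> real" where "uz z = fst z / (fst z + snd z)"

lemma prefactor_pos [simp]: "prefactor \<gamma> z > 0" by (simp add: prefactor_def)
lemma expo_pos [simp]: "expo \<gamma> a z > 0" by (simp add: expo_def)

text \<open>
  Completing the square in \<open>a\<close>. This identity turns sums over the parabola into
  sums of Gaussians with centres \<open>a\<close>.
\<close>

lemma expo_eq_gauss:
  assumes "sz z > 0"
  shows "expo \<gamma> a z = prefactor \<gamma> z * exp (- (sz z * (uz z - a)\<^sup>2 / 2))"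
proof -
  obtain x y where z: "z = (x, y)" by (cases z)
  have s: "x + y > 0" using assms by (simp add: z sz_def)
  define s u where "s = x + y" and "u = x / s"
  have "s > 0" using s by (simp add: s_def)
  have x: "x = u * s" using \<open>s > 0\<close> by (simp add: u_def)
  have y: "y = (1 - u) * s" using x s_def by (simp add: algebra_simps)
  have 1: "(x - (1 - \<gamma>) * s)\<^sup>2 / (2 * s) = s * (u - (1 - \<gamma>))\<^sup>2 / 2"
    unfolding x using \<open>s > 0\<close> by (simp add: power2_eq_square field_simps)
  have "(\<gamma>\<^sup>2 - (1 - a)\<^sup>2) / 2 * x + ((1 - \<gamma>)\<^sup>2 - a\<^sup>2) / 2 * y
      = (x - (1 - \<gamma>) * s)\<^sup>2 / (2 * s) + - (s * (u - a)\<^sup>2 / 2)"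
    unfolding 1 unfolding x y by (simp add: power2_eq_square field_simps)
  then show ?thesis
    by (simp add: z expo_def prefactor_def sz_def uz_def flip: exp_add s_def u_def)
qed

text \<open>
  Half of a theta series. All image sums are combinations of \<open>gsum\<close>, and
  \<open>gsum_step\<close> gives the cancellations on the axes.
\<close>

definition gsum :: "real \<Rightarrow> real \<Rightarrow> real" where
  "gsum s v = (\<Sum>n. exp (- (s * (v + 2 * real n)\<^sup>2 / 2)))"

lemma summable_gsum:
  assumes "0 < s"
  shows "summable (\<lambda>n. exp (- (s * (v + 2 * real n)\<^sup>2 / 2)))"
proof (rule summable_comparison_test)
  show "summable (\<lambda>n. exp (1 / (2 * s) - v) * exp (- 2) ^ n)"
    by (intro summable_mult summable_geometric) simp
  have "- (s * (v + 2 * real n)\<^sup>2 / 2) \<le> 1 / (2 * s) - v - 2 * real n" for n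
  proof -
    define w where "w = v + 2 * real n"
    have "0 \<le> (s * w - 1)\<^sup>2 / (2 * s)" using assms by simp
    also have "\<dots> = s * w\<^sup>2 / 2 - w + 1 / (2 * s)"
      using assms by (simp add: power2_eq_square field_simps)
    finally show ?thesis by (simp add: w_def)
  qed
  then have "exp (- (s * (v + 2 * real n)\<^sup>2 / 2)) \<le> exp (1 / (2 * s) - v - 2 * real n)" for n
    by simp
  also have "exp (1 / (2 * s) - v - 2 * real n) = exp (1 / (2 * s) - v) * exp (- 2) ^ n" for n
    by (simp add: mult_ac flip: exp_of_nat_mult exp_add)
  finally show "\<exists>N. \<forall>n\<ge>N. norm (exp (- (s * (v + 2 * real n)\<^sup>2 / 2))) \<le> exp (1 / (2 * s) - v) * exp (- 2) ^ n"
    by simp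
qed

lemma gsum_sums: "0 < s \<Longrightarrow> (\<lambda>n. exp (- (s * (v + 2 * real n)\<^sup>2 / 2))) sums gsum s v"
  unfolding gsum_def by (intro summable_sums summable_gsum)

lemma gsum_step: "0 < s \<Longrightarrow> gsum s v = exp (- (s * v\<^sup>2 / 2)) + gsum s (v + 2)"
  using suminf_split_head[OF summable_gsum, of s v] by (simp add: gsum_def algebra_simps)

lemma gsum_nonneg: "0 < s \<Longrightarrow> 0 \<le> gsum s v"
  unfolding gsum_def by (intro suminf_nonneg summable_gsum) auto

text \<open>
  Comparison with a geometric series, using \<open>(v + 2n)\<^sup>2 \<ge> v\<^sup>2 +
  4n\<close> for \<open>n \<ge> 1\<close> and \<open>v \<ge> 0\<close>.
\<close>

lemma gsum_le:
  assumes "0 < s0" "s0 \<le> s" "0 \<le> v"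
  shows "gsum s v \<le> exp (- (s * v\<^sup>2 / 2)) / (1 - exp (- 2 * s0))"
proof -
  have "exp (- (s * (v + 2 * real n)\<^sup>2 / 2)) \<le> exp (- (s * v\<^sup>2 / 2)) * exp (- 2 * s0) ^ n" for n
  proof -
    have "real n \<le> (real n)\<^sup>2" by (cases n) (auto simp: power2_eq_square)
    then have "v\<^sup>2 + 4 * real n \<le> (v + 2 * real n)\<^sup>2"
      using mult_nonneg_nonneg[OF assms(3), of "real n"] by (simp add: power2_eq_square algebra_simps)
    then have "s * (v\<^sup>2 + 4 * real n) \<le> s * (v + 2 * real n)\<^sup>2"
      using assms by (intro mult_left_mono) auto
    moreover have "s0 * real n \<le> s * real n" using assms by (intro mult_right_mono) auto
    ultimately have "- (s * (v + 2 * real n)\<^sup>2 / 2) \<le> - (s * v\<^sup>2 / 2) + real n * (- 2 * s0)"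
      by (simp add: algebra_simps)
    then have "exp (- (s * (v + 2 * real n)\<^sup>2 / 2)) \<le> exp (- (s * v\<^sup>2 / 2) + real n * (- 2 * s0))"
      by simp
    also have "\<dots> = exp (- (s * v\<^sup>2 / 2)) * exp (- 2 * s0) ^ n"
      by (simp only: exp_add exp_of_nat_mult)
    finally show ?thesis .
  qed
  then have "gsum s v \<le> (\<Sum>n. exp (- (s * v\<^sup>2 / 2)) * exp (- 2 * s0) ^ n)"
    unfolding gsum_def using assms
    by (intro suminf_le summable_gsum summable_mult summable_geometric) auto
  also have "\<dots> = exp (- (s * v\<^sup>2 / 2)) * (1 / (1 - exp (- 2 * s0)))"
    using assms by (subst suminf_mult) (auto intro!: summable_geometric simp: suminf_geometric)
  finally show ?thesis by simp
qed

lemma expo_series: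
  assumes "sz z > 0"
  shows "(\<lambda>n. expo \<gamma> (c - 2 * real n) z) sums (prefactor \<gamma> z * gsum (sz z) (uz z - c))"
    and "(\<lambda>n. expo \<gamma> (c + 2 * real n) z) sums (prefactor \<gamma> z * gsum (sz z) (c - uz z))"
proof -
  have *: "uz z - (c - 2 * real n) = (uz z - c) + 2 * real n"
    "(uz z - (c + 2 * real n))\<^sup>2 = ((c - uz z) + 2 * real n)\<^sup>2" for n
    by (simp_all add: power2_eq_square algebra_simps)
  show "(\<lambda>n. expo \<gamma> (c - 2 * real n) z) sums (prefactor \<gamma> z * gsum (sz z) (uz z - c))"
    "(\<lambda>n. expo \<gamma> (c + 2 * real n) z) sums (prefactor \<gamma> z * gsum (sz z) (c - uz z))"
    unfolding expo_eq_gauss[OF assms] * by (intro sums_mult gsum_sums assms)+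
qed

lemma quadrant_sz_pos: "z \<in> quadrant \<Longrightarrow> sz z > 0"
  by (auto simp: quadrant_def sz_def)

lemma sz_Z: "sz (Z W \<gamma> z0 t \<omega>) = sz z0 + t"
  by (simp add: Z_def sz_def algebra_simps)

context standard_brownian_motion begin

text \<open>
  Along the process each exponential on the parabola is an exponential martingale, with
  parameter linear in \<open>a\<close>.
\<close>

lemma expo_Z: "expo \<gamma> a (Z W \<gamma> z0 t \<omega>) = expo \<gamma> a z0 * exp_mart (1 - \<gamma> - a) t \<omega>"
  unfolding expo_def exp_mart_def Z_def fst_conv snd_conv
  by (simp add: power2_eq_square flip: exp_add) (simp add: field_simps)

lemma measurable_Z_exit [measurable]:
  assumes "z0 \<in> quadrant" "0 < t"
  shows "(\<lambda>\<omega>. Z W \<gamma> z0 (exit_time \<gamma> z0 t \<omega>) \<omega>) \<in> borel_measurable M"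
proof -
  have [measurable]: "exit_time \<gamma> z0 t \<in> borel_measurable M"
    "(\<lambda>\<omega>. W (exit_time \<gamma> z0 t \<omega>) \<omega>) \<in> borel_measurable M"
    using stopping_like_exit_time[OF assms] by (auto simp: stopping_like_def)
  show ?thesis unfolding Z_def by measurable
qed

lemma exit_time_range:
  assumes "z0 \<in> quadrant" "0 < t" "\<omega> \<in> space M"
  shows "0 \<le> exit_time \<gamma> z0 t \<omega>" "exit_time \<gamma> z0 t \<omega> \<le> t"
  using stopping_like_exit_time[OF assms(1,2)] assms(3) by (auto simp: stopping_like_def)

lemma expo_exit:
  assumes "z0 \<in> quadrant" "0 < t"
  shows "integrable M (\<lambda>\<omega>. expo \<gamma> a (Z W \<gamma> z0 (exit_time \<gamma> z0 t \<omega>) \<omega>))"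
    and "expectation (\<lambda>\<omega>. expo \<gamma> a (Z W \<gamma> z0 (exit_time \<gamma> z0 t \<omega>) \<omega>)) = expo \<gamma> a z0"
  using stopping_like_exit_time[OF assms, of \<gamma>] unfolding expo_Z stopping_like_def by auto

text \<open>
  All terms are positive, so monotone convergence lets a whole series of exponentials be
  stopped.
\<close>

lemma expo_series_exit:
  assumes "z0 \<in> quadrant" "0 < t" and f: "\<And>z. sz z > 0 \<Longrightarrow> (\<lambda>n. expo \<gamma> (a n) z) sums f z"
  shows "integrable M (\<lambda>\<omega>. f (Z W \<gamma> z0 (exit_time \<gamma> z0 t \<omega>) \<omega>))"
    and "expectation (\<lambda>\<omega>. f (Z W \<gamma> z0 (exit_time \<gamma> z0 t \<omega>) \<omega>)) = f z0"
proof -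
  define F where "F = (\<lambda>n \<omega>. expo \<gamma> (a n) (Z W \<gamma> z0 (exit_time \<gamma> z0 t \<omega>) \<omega>))"
  have Fi: "integrable M (F n)" "expectation (F n) = expo \<gamma> (a n) z0" for n
    unfolding F_def by (rule expo_exit[OF assms(1,2)])+
  have Fs: "(\<lambda>n. F n \<omega>) sums f (Z W \<gamma> z0 (exit_time \<gamma> z0 t \<omega>) \<omega>)" if "\<omega> \<in> space M" for \<omega>
    unfolding F_def using exit_time_range[OF assms(1,2) that, of \<gamma>] quadrant_sz_pos[OF assms(1)]
    by (intro f) (simp add: sz_Z)
  have norm: "norm (F n \<omega>) = F n \<omega>" for n \<omega>
    by (simp add: F_def less_imp_le)
  have z0: "(\<lambda>n. expo \<gamma> (a n) z0) sums f z0" using quadrant_sz_pos[OF assms(1)] by (rule f)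
  have 1: "AE \<omega> in M. summable (\<lambda>n. norm (F n \<omega>))"
    unfolding norm using Fs by (intro AE_I2) (auto simp: sums_iff)
  have 2: "summable (\<lambda>n. \<integral>\<omega>. norm (F n \<omega>) \<partial>M)"
    unfolding norm Fi(2) using z0 by (simp add: sums_iff)
  have eq: "(\<Sum>n. F n \<omega>) = f (Z W \<gamma> z0 (exit_time \<gamma> z0 t \<omega>) \<omega>)" if "\<omega> \<in> space M" for \<omega>
    using Fs[OF that] by (simp add: sums_iff)
  show "integrable M (\<lambda>\<omega>. f (Z W \<gamma> z0 (exit_time \<gamma> z0 t \<omega>) \<omega>))"
    using integrable_suminf[OF Fi(1) 1 2]
    by (rule iffD1[OF Bochner_Integration.integrable_cong, rotated -1]) (auto simp: eq)
  have "expectation (\<lambda>\<omega>. f (Z W \<gamma> z0 (exit_time \<gamma> z0 t \<omega>) \<omega>)) = expectation (\<lambda>\<omega>. \<Sum>n. F n \<omega>)"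
    by (intro Bochner_Integration.integral_cong) (auto simp: eq)
  also have "\<dots> = f z0"
    using integral_suminf[OF Fi(1) 1 2] z0 by (simp add: Fi sums_iff)
  finally show "expectation (\<lambda>\<omega>. f (Z W \<gamma> z0 (exit_time \<gamma> z0 t \<omega>) \<omega>)) = f z0" .
qed

lemma measurable_T_greater [measurable]:
  assumes "z0 \<in> quadrant" "0 < t"
  shows "Measurable.pred M (\<lambda>\<omega>. ereal t < T W \<gamma> z0 \<omega>)"
proof -
  have [measurable]: "exit_time \<gamma> z0 (t + 1) \<in> borel_measurable M"
    using stopping_like_exit_time[OF assms(1), of "t + 1" \<gamma>] assms(2) by (auto simp: stopping_like_def)
  have "ereal t < T W \<gamma> z0 \<omega> \<longleftrightarrow> t < exit_time \<gamma> z0 (t + 1) \<omega>" if "\<omega> \<in> space M" for \<omega>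
    by (cases rule: exit_cases[OF that assms(1), of \<gamma>, case_names never left down])
       (auto simp: exit_time_def T_def min_def)
  then show ?thesis
    by (subst measurable_cong[where g = "\<lambda>\<omega>. t < exit_time \<gamma> z0 (t + 1) \<omega>"]) auto
qed

lemma Z_exit_cases:
  assumes "\<omega> \<in> space M" "z0 \<in> quadrant" "0 < t"
  obtains (alive) "ereal t < T W \<gamma> z0 \<omega>" "\<not> T1 W \<gamma> z0 \<omega> \<le> ereal t" "\<not> T2 W \<gamma> z0 \<omega> \<le> ereal t" 
      "exit_time \<gamma> z0 t \<omega> = t" "Z W \<gamma> z0 t \<omega> \<in> quadrant"
  | (left) "\<not> ereal t < T W \<gamma> z0 \<omega>" "T1 W \<gamma> z0 \<omega> < T2 W \<gamma> z0 \<omega>" "T1 W \<gamma> z0 \<omega> \<le> ereal t"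
      "T1 W \<gamma> z0 \<omega> = ereal (exit_time \<gamma> z0 t \<omega>)" "fst (Z W \<gamma> z0 (exit_time \<gamma> z0 t \<omega>) \<omega>) = 0"
      "snd (Z W \<gamma> z0 (exit_time \<gamma> z0 t \<omega>) \<omega>) > 0"
  | (down) "\<not> ereal t < T W \<gamma> z0 \<omega>" "T2 W \<gamma> z0 \<omega> < T1 W \<gamma> z0 \<omega>" "T2 W \<gamma> z0 \<omega> \<le> ereal t"
      "T2 W \<gamma> z0 \<omega> = ereal (exit_time \<gamma> z0 t \<omega>)" "snd (Z W \<gamma> z0 (exit_time \<gamma> z0 t \<omega>) \<omega>) = 0"
      "fst (Z W \<gamma> z0 (exit_time \<gamma> z0 t \<omega>) \<omega>) > 0"
proof -
  have pos0: "fst z0 > 0" "snd z0 > 0" using assms by (auto simp: quadrant_def)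
  show ?thesis
  proof (cases rule: exit_cases[OF assms(1,2), of \<gamma>, case_names never left down])
    case never
    then show ?thesis using assms(3) by (intro alive) (auto simp: T_def exit_time_def)
  next
    case L: (left r)
    show ?thesis
    proof (cases "t < r")
      case True
      then have tT: "ereal t < T W \<gamma> z0 \<omega>" using L by (auto simp: T_def min_def)
      moreover have "ereal t < T2 W \<gamma> z0 \<omega>"
        using less_trans[OF _ L(2), of "ereal t"] True by simp
      ultimately show ?thesis using True L assms(3) exit_time_eq_t[OF tT] by (intro alive) auto
    next
      case False
      have e: "exit_time \<gamma> z0 t \<omega> = r" using L False by (auto simp: exit_time_def T_def min_def)
      have "snd (Z W \<gamma> z0 r \<omega>) > 0"
        using L pos0 by (auto simp: Z_def algebra_simps)
      then show ?thesis unfolding e[symmetric] using L False e by (intro left) (auto simp: T_def min_def)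
    qed
  next
    case L: (down r)
    show ?thesis
    proof (cases "t < r")
      case True
      then have tT: "ereal t < T W \<gamma> z0 \<omega>" using L by (auto simp: T_def min_def)
      moreover have "ereal t < T1 W \<gamma> z0 \<omega>"
        using less_trans[OF _ L(2), of "ereal t"] True by simp
      ultimately show ?thesis using True L assms(3) exit_time_eq_t[OF tT] by (intro alive) auto
    next
      case False
      have e: "exit_time \<gamma> z0 t \<omega> = r" using L False by (auto simp: exit_time_def T_def min_def)
      have "fst (Z W \<gamma> z0 r \<omega>) > 0"
        using L pos0 by (auto simp: Z_def algebra_simps)
      then show ?thesis unfolding e[symmetric] using L False e by (intro down) (auto simp: T_def min_def)
    qed
  qed
qed

end

section \<open>Transforms of the exit position\<close>

text \<open>
  The centre \<open>- r\<close>, to the left of the interval, and its repeated reflections at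
  \<open>1\<close> and \<open>0\<close>, with alternating signs. The value on the vertical
  axis is a single exponential and the value on the horizontal axis is \<open>0\<close>; for
  \<open>r > 1 - \<gamma>\<close> this is therefore the expectation of that exponential over
  the paths that leave through the vertical axis.
\<close>

definition left_exit_fun :: "real \<Rightarrow> real \<Rightarrow> real \<times> real \<Rightarrow> real" where
  "left_exit_fun \<gamma> r z = prefactor \<gamma> z * (gsum (sz z) (uz z + r) - gsum (sz z) (r + 2 - uz z))"

lemma left_exit_fun_left:
  assumes "fst z = 0" "snd z > 0"
  shows "left_exit_fun \<gamma> r z = exp (((1 - \<gamma>)\<^sup>2 - r\<^sup>2) / 2 * snd z)"
proof -
  have s: "sz z > 0" "uz z = 0" using assms by (auto simp: sz_def uz_def)
  have "left_exit_fun \<gamma> r z = prefactor \<gamma> z * exp (- (sz z * r\<^sup>2 / 2))"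
    using gsum_step[OF s(1), of r] by (simp add: left_exit_fun_def s add.commute)
  also have "\<dots> = expo \<gamma> r z" using expo_eq_gauss[OF s(1), of \<gamma> r] s by simp
  finally show ?thesis using assms by (simp add: expo_def)
qed

lemma left_exit_fun_down:
  assumes "snd z = 0" "fst z > 0"
  shows "left_exit_fun \<gamma> r z = 0"
  using assms by (simp add: left_exit_fun_def uz_def algebra_simps)

text \<open>
  For \<open>r > 1 - \<gamma>\<close> every exponent that occurs is negative in both
  coordinates.
\<close>

lemma left_exit_fun_bound:
  assumes "0 < \<gamma>" "\<gamma> < 1" "r > 1 - \<gamma>" "0 < s0"
  obtains C \<kappa> where "\<kappa> > 0" "C > 0" "\<And>z. z \<in> quadrant \<Longrightarrow> s0 \<le> sz z \<Longrightarrow> \<bar>left_exit_fun \<gamma> r z\<bar> \<le> C * exp (- \<kappa> * sz z)"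
proof -
  define \<kappa> where "\<kappa> = min ((r\<^sup>2 - (1 - \<gamma>)\<^sup>2) / 2) ((1 - \<gamma>\<^sup>2) / 2)"
  have g2: "\<gamma>\<^sup>2 < 1" using assms by (simp add: power_less_one_iff abs_square_less_1)
  have r2: "(1 - \<gamma>)\<^sup>2 < r\<^sup>2" using assms by (intro power_strict_mono) auto
  have \<kappa>: "\<kappa> > 0" using g2 r2 by (simp add: \<kappa>_def)
  define c where "c = 1 - exp (- 2 * s0)"
  have c: "c > 0" using assms by (simp add: c_def)
  have E: "expo \<gamma> a z \<le> exp (- \<kappa> * sz z)" if z: "z \<in> quadrant" and a: "(1 - a)\<^sup>2 \<ge> 1" "a\<^sup>2 \<ge> r\<^sup>2" for a z
  proof -
    have "(\<gamma>\<^sup>2 - (1 - a)\<^sup>2) / 2 \<le> - \<kappa>" "((1 - \<gamma>)\<^sup>2 - a\<^sup>2) / 2 \<le> - \<kappa>"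
      using a by (auto simp: \<kappa>_def min_def field_simps)
    then have "(\<gamma>\<^sup>2 - (1 - a)\<^sup>2) / 2 * fst z + ((1 - \<gamma>)\<^sup>2 - a\<^sup>2) / 2 * snd z \<le> - \<kappa> * fst z + - \<kappa> * snd z"
      using z by (intro add_mono mult_right_mono) (auto simp: quadrant_def)
    then show ?thesis by (simp add: expo_def sz_def algebra_simps)
  qed
  have B: "\<bar>left_exit_fun \<gamma> r z\<bar> \<le> 2 / c * exp (- \<kappa> * sz z)" if z: "z \<in> quadrant" "s0 \<le> sz z" for z
  proof -
    have s: "sz z > 0" using z assms by simp
    have u: "0 \<le> uz z" "uz z \<le> 1" using z by (auto simp: uz_def quadrant_def)
    have r: "r > 0" using assms by simp
    have "prefactor \<gamma> z * gsum (sz z) (uz z + r) \<le> prefactor \<gamma> z * (exp (- (sz z * (uz z + r)\<^sup>2 / 2)) / c)"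
      unfolding c_def using u r z assms by (intro mult_left_mono gsum_le) (auto simp: less_imp_le)
    also have "\<dots> = expo \<gamma> (- r) z / c" using expo_eq_gauss[OF s, of \<gamma> "- r"] by simp
    also have "\<dots> \<le> exp (- \<kappa> * sz z) / c"
      using c r power_mono[of 1 "1 + r" 2] by (intro divide_right_mono E z) auto
    finally have 1: "prefactor \<gamma> z * gsum (sz z) (uz z + r) \<le> exp (- \<kappa> * sz z) / c" .
    have "prefactor \<gamma> z * gsum (sz z) (r + 2 - uz z) \<le> prefactor \<gamma> z * (exp (- (sz z * (r + 2 - uz z)\<^sup>2 / 2)) / c)"
      unfolding c_def using u r z assms by (intro mult_left_mono gsum_le) (auto simp: less_imp_le)
    also have "\<dots> = expo \<gamma> (r + 2) z / c"
      using expo_eq_gauss[OF s, of \<gamma> "r + 2"] by (simp add: power2_commute[of "uz z"])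
    also have "\<dots> \<le> exp (- \<kappa> * sz z) / c"
      using c r power_mono[of 1 "1 + r" 2] power_mono[of r "r + 2" 2] power2_commute[of 1 "r + 2"]
      by (intro divide_right_mono E z) (auto simp: algebra_simps)
    finally have 2: "prefactor \<gamma> z * gsum (sz z) (r + 2 - uz z) \<le> exp (- \<kappa> * sz z) / c" .
    have "prefactor \<gamma> z * gsum (sz z) (uz z + r) \<ge> 0" "prefactor \<gamma> z * gsum (sz z) (r + 2 - uz z) \<ge> 0"
      using s by (simp_all add: gsum_nonneg less_imp_le)
    then show ?thesis using 1 2 by (simp add: left_exit_fun_def right_diff_distrib)
  qed
  show ?thesis by (rule that[OF \<kappa> _ B]) (use c in auto)
qed

context standard_brownian_motion begin

lemma left_exit_fun_exit:
  assumes "z0 \<in> quadrant" "0 < t"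
  shows "integrable M (\<lambda>\<omega>. left_exit_fun \<gamma> r (Z W \<gamma> z0 (exit_time \<gamma> z0 t \<omega>) \<omega>))"
    and "expectation (\<lambda>\<omega>. left_exit_fun \<gamma> r (Z W \<gamma> z0 (exit_time \<gamma> z0 t \<omega>) \<omega>)) = left_exit_fun \<gamma> r z0"
proof -
  define f where "f = (\<lambda>z. prefactor \<gamma> z * gsum (sz z) (uz z + r))"
  define g where "g = (\<lambda>z. prefactor \<gamma> z * gsum (sz z) (r + 2 - uz z))"
  have l1: "left_exit_fun \<gamma> r z = f z - g z" for z by (simp add: left_exit_fun_def f_def g_def right_diff_distrib)
  have f: "(\<lambda>n. expo \<gamma> (- r - 2 * real n) z) sums f z" if "sz z > 0" for z
    using expo_series(1)[OF that, of \<gamma> "- r"] by (simp add: f_def)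
  have g: "(\<lambda>n. expo \<gamma> (r + 2 + 2 * real n) z) sums g z" if "sz z > 0" for z
    using expo_series(2)[OF that, of \<gamma> "r + 2"] by (simp add: g_def)
  show "integrable M (\<lambda>\<omega>. left_exit_fun \<gamma> r (Z W \<gamma> z0 (exit_time \<gamma> z0 t \<omega>) \<omega>))"
    "expectation (\<lambda>\<omega>. left_exit_fun \<gamma> r (Z W \<gamma> z0 (exit_time \<gamma> z0 t \<omega>) \<omega>)) = left_exit_fun \<gamma> r z0"
    unfolding l1 using expo_series_exit[OF assms f] expo_series_exit[OF assms g] by simp_all
qed

text \<open>
  Optional stopping at the exit time truncated at \<open>n\<close>. On the axes the stopped
  value is the payoff; the paths still alive contribute a term that decays exponentially
  because \<open>sz\<close> grows at unit speed.
\<close>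

lemma expectation_left_exit:
  assumes "0 < \<gamma>" "\<gamma> < 1" "r > 1 - \<gamma>" "z0 \<in> quadrant"
  defines "q \<equiv> ((1 - \<gamma>)\<^sup>2 - r\<^sup>2) / 2"
  defines "G \<equiv> (\<lambda>\<omega>. if T1 W \<gamma> z0 \<omega> < T2 W \<gamma> z0 \<omega>
                     then exp (q * snd (Z W \<gamma> z0 (real_of_ereal (T1 W \<gamma> z0 \<omega>)) \<omega>)) else 0)"
  shows "integrable M G" "expectation G = left_exit_fun \<gamma> r z0"
proof -
  have q: "q < 0" unfolding q_def using assms(1-3) power_strict_mono[of "1 - \<gamma>" r 2] by auto
  define n1 where "n1 = (\<lambda>n::nat. real (Suc n))"
  have n1: "n1 n > 0" for n by (simp add: n1_def)
  define Gn where "Gn = (\<lambda>n \<omega>. if T1 W \<gamma> z0 \<omega> < T2 W \<gamma> z0 \<omega> \<and> T1 W \<gamma> z0 \<omega> \<le> ereal (n1 n)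
         then exp (q * snd (Z W \<gamma> z0 (real_of_ereal (T1 W \<gamma> z0 \<omega>)) \<omega>)) else 0)"
  define Ze where "Ze = (\<lambda>n \<omega>. Z W \<gamma> z0 (exit_time \<gamma> z0 (n1 n) \<omega>) \<omega>)"
  have [measurable]: "Ze n \<in> borel_measurable M" for n
    unfolding Ze_def by (rule measurable_Z_exit[OF assms(4) n1])
  have [measurable]: "(\<lambda>\<omega>. fst (Ze n \<omega>)) \<in> borel_measurable M" "(\<lambda>\<omega>. snd (Ze n \<omega>)) \<in> borel_measurable M" for n
    by (rule measurable_compose[of "Ze n" M borel], simp,
        rule borel_measurable_continuous_onI, intro continuous_intros)+
  have Zq: "Z W \<gamma> z0 t \<omega> \<in> quadrant \<Longrightarrow> fst (Z W \<gamma> z0 t \<omega>) \<noteq> 0" for t \<omega> by (auto simp: quadrant_def)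
  have Gn_eq: "Gn n \<omega> = (if fst (Ze n \<omega>) = 0 then exp (q * snd (Ze n \<omega>)) else 0)" if "\<omega> \<in> space M" for n \<omega>
    by (cases rule: Z_exit_cases[OF that assms(4) n1[of n], of \<gamma>, case_names alive left down])
       (use Zq in \<open>auto simp: Gn_def Ze_def\<close>)
  have Gn_m [measurable]: "Gn n \<in> borel_measurable M" for n
    by (subst measurable_cong[OF Gn_eq]) (assumption, measurable)
  have Gn_le: "0 \<le> Gn n \<omega>" "Gn n \<omega> \<le> 1" if "\<omega> \<in> space M" for n \<omega>
  proof -
    show "0 \<le> Gn n \<omega>" by (simp add: Gn_def)
    show "Gn n \<omega> \<le> 1"
      by (cases rule: Z_exit_cases[OF that assms(4) n1[of n], of \<gamma>, case_names alive left down])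
         (use q in \<open>auto simp: Gn_def mult_nonpos_nonneg\<close>)
  qed
  have Gn_lim: "(\<lambda>n. Gn n \<omega>) \<longlonglongrightarrow> G \<omega>" for \<omega>
  proof (cases "T1 W \<gamma> z0 \<omega> < T2 W \<gamma> z0 \<omega>")
    case True
    then have "T1 W \<gamma> z0 \<omega> \<noteq> \<infinity>" by auto
    then obtain N where N: "T1 W \<gamma> z0 \<omega> \<le> ereal (real N)" using less_PInf_Ex_of_nat[of "T1 W \<gamma> z0 \<omega>"] less_imp_le by auto
    have "\<forall>\<^sub>F n in sequentially. Gn n \<omega> = G \<omega>"
      using eventually_ge_at_top[of N]
    proof eventually_elim
      case (elim n)
      have "T1 W \<gamma> z0 \<omega> \<le> ereal (n1 n)" using order.trans[OF N, of "ereal (n1 n)"] elim by (simp add: n1_def)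
      then show ?case by (simp add: Gn_def G_def)
    qed
    then show ?thesis by (rule tendsto_eventually)
  qed (simp add: Gn_def G_def)
  have Gm: "G \<in> borel_measurable M"
    by (rule borel_measurable_LIMSEQ_real[OF Gn_lim]) simp
  have dom: "AE \<omega> in M. (\<lambda>n. Gn n \<omega>) \<longlonglongrightarrow> G \<omega>" "AE \<omega> in M. norm (Gn n \<omega>) \<le> 1" for n
    using Gn_lim Gn_le by (auto intro!: AE_I2)
  have int1: "integrable M (\<lambda>_. 1 :: real)" by simp
  have conv: "(\<lambda>n. expectation (Gn n)) \<longlonglongrightarrow> expectation G"
    by (rule integral_dominated_convergence[OF Gm Gn_m int1 dom])
  show "integrable M G"
    by (rule integrable_dominated_convergence[OF Gm Gn_m int1 dom])
  have s0: "sz z0 > 0" by (rule quadrant_sz_pos[OF assms(4)])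
  obtain C \<kappa> where CK: "\<kappa> > 0" "C > 0" "\<And>z. z \<in> quadrant \<Longrightarrow> sz z0 \<le> sz z \<Longrightarrow> \<bar>left_exit_fun \<gamma> r z\<bar> \<le> C * exp (- \<kappa> * sz z)"
    using left_exit_fun_bound[OF assms(1-3) s0] by metis
  \<comment> \<open>Only surviving paths contribute to the difference.\<close>
  have close: "\<bar>Gn n \<omega> - left_exit_fun \<gamma> r (Ze n \<omega>)\<bar> \<le> C * exp (- \<kappa> * (sz z0 + n1 n))" if "\<omega> \<in> space M" for n \<omega>
  proof (cases rule: Z_exit_cases[OF that assms(4) n1[of n], of \<gamma>, case_names alive left down])
    case alive
    then show ?thesis
      using CK(3)[of "Z W \<gamma> z0 (n1 n) \<omega>"] by (auto simp: Gn_def Ze_def sz_Z n1_def)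
  next
    case left
    then have "Gn n \<omega> = left_exit_fun \<gamma> r (Ze n \<omega>)"
      by (simp add: Gn_def Ze_def left_exit_fun_left q_def)
    then show ?thesis using CK by simp
  next
    case down
    then have "Gn n \<omega> = 0" "left_exit_fun \<gamma> r (Ze n \<omega>) = 0"
      by (auto simp: Gn_def Ze_def left_exit_fun_down)
    then show ?thesis using CK by simp
  qed
  have Gi: "integrable M (Gn n)" for n
    by (rule integrable_const_bound[where B = 1]) (use Gn_le in auto)
  have Li: "integrable M (\<lambda>\<omega>. left_exit_fun \<gamma> r (Ze n \<omega>))" "expectation (\<lambda>\<omega>. left_exit_fun \<gamma> r (Ze n \<omega>)) = left_exit_fun \<gamma> r z0" for n
    unfolding Ze_def by (rule left_exit_fun_exit[OF assms(4) n1])+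
  have bound: "\<bar>expectation (Gn n) - left_exit_fun \<gamma> r z0\<bar> \<le> C * exp (- \<kappa> * (sz z0 + n1 n))" for n
  proof -
    have "expectation (Gn n) - left_exit_fun \<gamma> r z0 = expectation (\<lambda>\<omega>. Gn n \<omega> - left_exit_fun \<gamma> r (Ze n \<omega>))"
      using Gi Li by simp
    also have "\<bar>\<dots>\<bar> \<le> expectation (\<lambda>\<omega>. \<bar>Gn n \<omega> - left_exit_fun \<gamma> r (Ze n \<omega>)\<bar>)" by (rule integral_abs_bound)
    also have "\<dots> \<le> expectation (\<lambda>\<omega>. C * exp (- \<kappa> * (sz z0 + n1 n)))"
      using Gi Li by (intro integral_mono close) auto
    finally show ?thesis by (simp add: prob_space)
  qed
  have lim0: "(\<lambda>n. C * exp (- \<kappa> * (sz z0 + n1 n))) \<longlonglongrightarrow> 0"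
    unfolding n1_def using CK(1) by real_asymp
  have "(\<lambda>n. expectation (Gn n) - left_exit_fun \<gamma> r z0) \<longlonglongrightarrow> 0"
    by (rule Lim_null_comparison[OF always_eventually lim0]) (simp only: real_norm_def bound, simp)
  then have "(\<lambda>n. expectation (Gn n)) \<longlonglongrightarrow> left_exit_fun \<gamma> r z0"
    by (simp add: LIM_zero_iff)
  then show "expectation G = left_exit_fun \<gamma> r z0" using conv LIMSEQ_unique by blast
qed

lemma L1_exp_eq:
  assumes "0 < \<gamma>" "\<gamma> < 1" "r > 1 - \<gamma>" "z0 \<in> quadrant"
  shows "L1_exp M W \<gamma> z0 (of_real (((1 - \<gamma>)\<^sup>2 - r\<^sup>2) / 2)) = of_real (left_exit_fun \<gamma> r z0)"
proof -
  define q where "q = ((1 - \<gamma>)\<^sup>2 - r\<^sup>2) / 2"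
  define G where "G = (\<lambda>\<omega>. if T1 W \<gamma> z0 \<omega> < T2 W \<gamma> z0 \<omega>
                     then exp (q * snd (Z W \<gamma> z0 (real_of_ereal (T1 W \<gamma> z0 \<omega>)) \<omega>)) else 0)"
  have "L1_exp M W \<gamma> z0 (of_real q) = (\<integral>\<omega>. complex_of_real (G \<omega>) \<partial>M)"
    unfolding L1_exp_def set_lebesgue_integral_def G_def
    by (intro Bochner_Integration.integral_cong) (auto simp: exp_of_real simp flip: of_real_mult)
  also have "\<dots> = of_real (expectation G)" by (rule integral_complex_of_real)
  finally show ?thesis
    using expectation_left_exit(2)[OF assms, folded q_def, folded G_def] by (simp only: q_def)
qed

text \<open>
  Exchanging the coordinates amounts to replacing \<open>W\<close> by \<open>- W\<close> and
  \<open>\<gamma>\<close> by \<open>1 - \<gamma>\<close>; every statement about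
  \<open>L2\<close> follows from one about \<open>L1\<close> in this way.
\<close>

lemma minus_standard_brownian_motion: "standard_brownian_motion M (\<lambda>t \<omega>. - W t \<omega>)"
proof unfold_locales
  fix s t :: real assume st: "0 \<le> s" "s < t"
  have "distributed M lborel (\<lambda>\<omega>. 0 + (- 1) * (W t \<omega> - W s \<omega>)) (normal_density (0 + (- 1) * 0) (\<bar>- 1\<bar> * sqrt (t - s)))"
    using st by (intro normal_density_affine W_gaussian) auto
  then show "distributed M lborel (\<lambda>\<omega>. - W t \<omega> - - W s \<omega>) (normal_density 0 (sqrt (t - s)))"
    by simp
next
  fix \<tau> :: "nat \<Rightarrow> real" and n :: nat assume "0 \<le> \<tau> 0" "mono \<tau>"
  from indep_vars_compose[OF W_indep[OF this, of n], of "\<lambda>_. uminus" "\<lambda>_. borel"]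
  show "indep_vars (\<lambda>_. borel) (\<lambda>i \<omega>. - W (\<tau> (Suc i)) \<omega> - - W (\<tau> i) \<omega>) {..<n}"
    by (simp add: o_def)
qed (auto intro!: W_measurable W_start continuous_intros W_continuous)

end

lemma Z_swap: "Z (\<lambda>t \<omega>. - W t \<omega>) (1 - \<gamma>) (prod.swap z0) t \<omega> = prod.swap (Z W \<gamma> z0 t \<omega>)"
  by (simp add: Z_def)

lemma T1_swap: "T1 (\<lambda>t \<omega>. - W t \<omega>) (1 - \<gamma>) (prod.swap z0) = T2 W \<gamma> z0"
  unfolding T1_def T2_def hitting_time_def fun_eq_iff Z_swap
  by (auto simp: mem_Times_iff intro!: arg_cong[where f = Inf] image_cong)

lemma T2_swap: "T2 (\<lambda>t \<omega>. - W t \<omega>) (1 - \<gamma>) (prod.swap z0) = T1 W \<gamma> z0"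
  unfolding T1_def T2_def hitting_time_def fun_eq_iff Z_swap
  by (auto simp: mem_Times_iff intro!: arg_cong[where f = Inf] image_cong)

lemma L1_exp_swap: "L1_exp M (\<lambda>t \<omega>. - W t \<omega>) (1 - \<gamma>) (prod.swap z0) = L2_exp M W \<gamma> z0"
  unfolding L1_exp_def L2_exp_def fun_eq_iff T1_swap T2_swap Z_swap by simp

lemma L2_exp_swap: "L2_exp M (\<lambda>t \<omega>. - W t \<omega>) (1 - \<gamma>) (prod.swap z0) = L1_exp M W \<gamma> z0"
  unfolding L1_exp_def L2_exp_def fun_eq_iff T1_swap T2_swap Z_swap by simp

lemma L1_swap: "L1 M (\<lambda>t \<omega>. - W t \<omega>) (1 - \<gamma>) (prod.swap z0) = L2 M W \<gamma> z0"
proof -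
  have "P_minus (1 - \<gamma>) q = Q_minus \<gamma> q" for q by (simp add: P_minus_def Q_minus_def)
  then show ?thesis
    unfolding L1_def L2_def fun_eq_iff L1_exp_swap L2_exp_swap by (auto simp: add.commute)
qed

lemma swap_quadrant [simp]: "prod.swap z \<in> quadrant \<longleftrightarrow> z \<in> quadrant"
  by (auto simp: quadrant_def prod.swap_def mem_Times_iff)

lemma sz_swap [simp]: "sz (prod.swap z) = sz z" by (simp add: sz_def)

lemma uz_swap: "sz z > 0 \<Longrightarrow> uz (prod.swap z) = 1 - uz z"
  by (simp add: uz_def sz_def field_simps)

lemma prefactor_swap: "prefactor (1 - \<gamma>) (prod.swap z) = prefactor \<gamma> z"
proof -
  have "(snd z - (1 - (1 - \<gamma>)) * (snd z + fst z)) = - (fst z - (1 - \<gamma>) * (fst z + snd z))"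
    by (simp add: algebra_simps)
  then show ?thesis
    unfolding prefactor_def by (simp add: add.commute[of "snd z"] power2_commute)
qed

lemma expo_swap: "expo (1 - \<gamma>) (1 - a) (prod.swap z) = expo \<gamma> a z"
  by (simp add: expo_def add.commute)

context standard_brownian_motion begin

lemma L2_exp_eq:
  assumes "0 < \<gamma>" "\<gamma> < 1" "r > \<gamma>" "z0 \<in> quadrant"
  shows "L2_exp M W \<gamma> z0 (of_real ((\<gamma>\<^sup>2 - r\<^sup>2) / 2)) = of_real (left_exit_fun (1 - \<gamma>) r (prod.swap z0))"
proof -
  interpret neg: standard_brownian_motion M "\<lambda>t \<omega>. - W t \<omega>" by (rule minus_standard_brownian_motion)
  show ?thesis
    using neg.L1_exp_eq[of "1 - \<gamma>" r "prod.swap z0"] assms by (simp add: L1_exp_swap)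
qed

text \<open>
  For \<open>q \<ge> 0\<close> the continuation refers to \<open>L2\<close> at the other point
  of the parabola with the same second coordinate, which has parameter \<open>- a\<close>; the
  two half-series then combine by \<open>gsum_step\<close>.
\<close>

lemma L1_parabola:
  assumes "0 < \<gamma>" "\<gamma> < 1" "0 \<le> a" "z0 \<in> quadrant"
  shows "L1 M W \<gamma> z0 (of_real (((1 - \<gamma>)\<^sup>2 - a\<^sup>2) / 2)) = of_real (left_exit_fun \<gamma> a z0)"
proof -
  define q where "q = ((1 - \<gamma>)\<^sup>2 - a\<^sup>2) / 2"
  show ?thesis
  proof (cases "q < 0")
    case True
    then have "(1 - \<gamma>)\<^sup>2 < a\<^sup>2" by (simp add: q_def)
    then have "1 - \<gamma> < a" using assms by (simp add: power2_less_imp_less)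
    then show ?thesis using L1_exp_eq[OF assms(1,2) _ assms(4)] True by (simp add: L1_def q_def)
  next
    case False
    have s: "sz z0 > 0" by (rule quadrant_sz_pos[OF assms(4)])
    have "(1 - \<gamma>)\<^sup>2 - 2 * q = a\<^sup>2" by (simp add: q_def field_simps)
    then have "csqrt (of_real ((1 - \<gamma>)\<^sup>2) - 2 * of_real q) = csqrt (of_real (a\<^sup>2))"
      by (metis of_real_diff of_real_mult of_real_numeral)
    also have "\<dots> = of_real a" using assms(3) by (subst csqrt_of_real_nonneg) auto
    finally have "P_minus \<gamma> (of_real q) = of_real (\<gamma> - 1 + q - a)"
      by (simp add: P_minus_def)
    also have "\<gamma> - 1 + q - a = (\<gamma>\<^sup>2 - (1 + a)\<^sup>2) / 2"
      by (simp add: q_def power2_eq_square field_simps)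
    finally have P: "P_minus \<gamma> (of_real q) = of_real ((\<gamma>\<^sup>2 - (1 + a)\<^sup>2) / 2)" .
    have E: "exp (of_real p * of_real x + of_real q * of_real y) = complex_of_real (exp (p * x + q * y))" for p q x y
      by (metis exp_of_real of_real_add of_real_mult)
    have "\<gamma> < 1 + a" using assms by simp
    note L2 = L2_exp_eq[OF assms(1,2) this assms(4)]
    have "L1 M W \<gamma> z0 (of_real q) = exp (P_minus \<gamma> (of_real q) * of_real (fst z0) + of_real q * of_real (snd z0))
         - L2_exp M W \<gamma> z0 (P_minus \<gamma> (of_real q))"
      using False by (simp add: L1_def)
    also have "\<dots> = of_real (expo \<gamma> (- a) z0) - of_real (left_exit_fun (1 - \<gamma>) (1 + a) (prod.swap z0))"
      unfolding P L2 E by (simp add: expo_def q_def)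
    also have "\<dots> = of_real (expo \<gamma> (- a) z0 - left_exit_fun (1 - \<gamma>) (1 + a) (prod.swap z0))" by simp
    also have "expo \<gamma> (- a) z0 - left_exit_fun (1 - \<gamma>) (1 + a) (prod.swap z0) = left_exit_fun \<gamma> a z0"
      using gsum_step[OF s, of "uz z0 + a"]
      by (simp add: expo_eq_gauss[OF s] left_exit_fun_def prefactor_swap uz_swap[OF s] algebra_simps)
    finally show ?thesis by (simp add: q_def)
  qed
qed

lemma L2_parabola:
  assumes "0 < \<gamma>" "\<gamma> < 1" "a \<le> 1" "z0 \<in> quadrant"
  shows "L2 M W \<gamma> z0 (of_real ((\<gamma>\<^sup>2 - (1 - a)\<^sup>2) / 2)) = of_real (left_exit_fun (1 - \<gamma>) (1 - a) (prod.swap z0))"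
proof -
  interpret neg: standard_brownian_motion M "\<lambda>t \<omega>. - W t \<omega>" by (rule minus_standard_brownian_motion)
  show ?thesis
    using neg.L1_parabola[of "1 - \<gamma>" "1 - a" "prod.swap z0"] assms by (simp add: L1_swap)
qed

end

text \<open>
  Up to sign, the derivative of \<open>gsum\<close>.
\<close>

definition gsumd :: "real \<Rightarrow> real \<Rightarrow> real" where
  "gsumd s v = (\<Sum>n. s * (v + 2 * real n) * exp (- (s * (v + 2 * real n)\<^sup>2 / 2)))"

lemma gsumd_term_bound:
  assumes "0 < s" "\<bar>w\<bar> \<le> c"
  shows "\<bar>s * (w + 2 * real n) * exp (- (s * (w + 2 * real n)\<^sup>2 / 2))\<bar> \<le> s * exp (2 / s + c) * exp (- 2) ^ n"
proof -
  define t where "t = w + 2 * real n"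
  have "0 \<le> (s * \<bar>t\<bar> - 2)\<^sup>2 / (2 * s)" using assms by simp
  also have "\<dots> = s * t\<^sup>2 / 2 - 2 * \<bar>t\<bar> + 2 / s"
    using assms by (simp add: power2_eq_square field_simps)
  finally have 1: "- (s * t\<^sup>2 / 2) \<le> 2 / s - 2 * \<bar>t\<bar>" by simp
  have "\<bar>t\<bar> \<le> exp \<bar>t\<bar>" using exp_ge_add_one_self[of "\<bar>t\<bar>"] by linarith
  then have "\<bar>t\<bar> * exp (- (s * t\<^sup>2 / 2)) \<le> exp \<bar>t\<bar> * exp (2 / s - 2 * \<bar>t\<bar>)"
    using 1 by (intro mult_mono) auto
  also have "\<dots> = exp (2 / s - \<bar>t\<bar>)" by (simp flip: exp_add)
  also have "\<dots> \<le> exp (2 / s + c + real n * (- 2))"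
    using assms(2) by (auto simp: t_def)
  also have "\<dots> = exp (2 / s + c) * exp (- 2) ^ n" by (simp only: exp_add exp_of_nat_mult)
  finally have "s * (\<bar>t\<bar> * exp (- (s * t\<^sup>2 / 2))) \<le> s * (exp (2 / s + c) * exp (- 2) ^ n)"
    using assms by (intro mult_left_mono) auto
  then show ?thesis using assms by (simp add: abs_mult t_def mult.assoc)
qed

lemma summable_gsumd_bound: "summable (\<lambda>n. s * exp (2 / s + c) * exp (- 2 :: real) ^ n)"
  by (intro summable_mult summable_geometric) simp

lemma summable_gsumd:
  assumes "0 < s"
  shows "summable (\<lambda>n. norm (s * (v + 2 * real n) * exp (- (s * (v + 2 * real n)\<^sup>2 / 2))))"
  by (rule summable_comparison_test[OF _ summable_gsumd_bound])
     (use gsumd_term_bound[OF assms order.refl] in auto)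

lemma gsumd_sums:
  "0 < s \<Longrightarrow> (\<lambda>n. s * (v + 2 * real n) * exp (- (s * (v + 2 * real n)\<^sup>2 / 2))) sums gsumd s v"
  unfolding gsumd_def by (intro summable_sums summable_norm_cancel[OF summable_gsumd])

lemma gsumd_has_derivative:
  assumes "0 < s"
  shows "(gsum s has_real_derivative - gsumd s v) (at v)"
proof -
  let ?S = "{v - 1..v + 1}"
  have "((\<lambda>v. \<Sum>n. exp (- (s * (v + 2 * real n)\<^sup>2 / 2))) has_field_derivative
          (\<Sum>n. - (s * (v + 2 * real n) * exp (- (s * (v + 2 * real n)\<^sup>2 / 2))))) (at v)"
  proof (rule has_field_derivative_series'(2)[where S = ?S and x0 = v])
    show "((\<lambda>v. exp (- (s * (v + 2 * real n)\<^sup>2 / 2))) has_field_derivative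
          - (s * (x + 2 * real n) * exp (- (s * (x + 2 * real n)\<^sup>2 / 2)))) (at x within ?S)" for n x
      by (auto intro!: derivative_eq_intros)
    show "uniformly_convergent_on ?S (\<lambda>n x. \<Sum>i<n. - (s * (x + 2 * real i) * exp (- (s * (x + 2 * real i)\<^sup>2 / 2))))"
    proof (rule Weierstrass_m_test'[OF _ summable_gsumd_bound])
      show "norm (- (s * (x + 2 * real n) * exp (- (s * (x + 2 * real n)\<^sup>2 / 2))))
          \<le> s * exp (2 / s + (\<bar>v\<bar> + 1)) * exp (- 2) ^ n" if "x \<in> ?S" for n x
      proof -
        have "\<bar>x\<bar> \<le> \<bar>v\<bar> + 1" using that by auto
        from gsumd_term_bound[OF assms this] show ?thesis by simp
      qed
    qed
  qed (use summable_gsum[OF assms] in auto)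
  moreover have "(\<Sum>n. - (s * (v + 2 * real n) * exp (- (s * (v + 2 * real n)\<^sup>2 / 2)))) = - gsumd s v"
    using sums_minus[OF gsumd_sums[OF assms, of v]] by (rule sums_unique[symmetric])
  ultimately show ?thesis by (simp add: gsum_def[abs_def])
qed

text \<open>
  Differentiation under the integral sign by dominated convergence: for \<open>Re q\<close>
  bounded away from \<open>0\<close> the difference quotients are bounded uniformly in
  \<open>Y \<ge> 0\<close>.
\<close>

lemma (in prob_space) laplace_transform_differentiable:
  fixes Y :: "'a \<Rightarrow> real" and q0 :: complex
  assumes [measurable]: "A \<in> sets M" "Y \<in> borel_measurable M" and Y: "\<And>\<omega>. \<omega> \<in> space M \<Longrightarrow> 0 \<le> Y \<omega>"
    and "Re q0 < 0"
  shows "(\<lambda>q. \<integral>\<omega>. indicator A \<omega> *\<^sub>R exp (q * of_real (Y \<omega>)) \<partial>M) field_differentiable at q0"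
proof -
  define F where "F = (\<lambda>q::complex. \<integral>\<omega>. indicator A \<omega> *\<^sub>R exp (q * of_real (Y \<omega>)) \<partial>M)"
  define D where "D = (\<integral>\<omega>. indicator A \<omega> *\<^sub>R (of_real (Y \<omega>) * exp (q0 * of_real (Y \<omega>))) \<partial>M)"
  define S where "S = {q::complex. Re q < Re q0 / 2}"
  define c where "c = - Re q0 / 2"
  have c: "c > 0" using assms(4) by (simp add: c_def)
  have S: "open S" "convex S" "q0 \<in> S"
  proof -
    show "open S" "convex S" unfolding S_def by (rule open_halfspace_Re_lt convex_halfspace_Re_lt)+
    show "q0 \<in> S" using assms(4) by (simp add: S_def)
  qed
  have bd: "norm (of_real y * exp (q * of_real y)) \<le> 1 / c" if "q \<in> S" "0 \<le> y" for q and y :: real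
  proof -
    have "c * y \<le> exp (c * y)" using exp_ge_add_one_self[of "c * y"] by linarith
    then have "y * exp (- (c * y)) \<le> 1 / c" using c by (simp add: exp_minus field_simps)
    moreover have "exp (Re q * y) \<le> exp (- (c * y))"
      using mult_right_mono[of "Re q" "- c" y] that by (simp add: S_def c_def)
    ultimately have "y * exp (Re q * y) \<le> 1 / c"
      using that(2) by (meson mult_left_mono order.trans)
    then show ?thesis using that(2) by (simp add: norm_mult)
  qed
  have int: "integrable M (\<lambda>\<omega>. indicator A \<omega> *\<^sub>R exp (q * of_real (Y \<omega>)))" if "q \<in> S" for q
  proof (rule integrable_const_bound[where B = 1])
    have "Re q < 0" using that assms(4) by (simp add: S_def)
    then show "AE \<omega> in M. norm (indicator A \<omega> *\<^sub>R exp (q * of_real (Y \<omega>))) \<le> 1"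
      using Y by (intro AE_I2) (auto simp: indicator_def mult_nonpos_nonneg)
  qed measurable
  have "(F has_field_derivative D) (at q0)"
    unfolding DERIV_def tendsto_at_iff_sequentially
  proof (intro allI impI)
    fix h :: "nat \<Rightarrow> complex" assume h: "\<forall>i. h i \<in> UNIV - {0}" "h \<longlonglongrightarrow> 0"
    have "(\<lambda>n. q0 + h n) \<longlonglongrightarrow> q0 + 0" by (intro tendsto_intros h)
    then have "\<forall>\<^sub>F n in sequentially. q0 + h n \<in> S"
      using S by (auto elim: topological_tendstoD)
    then obtain N where N: "\<And>n. n \<ge> N \<Longrightarrow> q0 + h n \<in> S" by (auto simp: eventually_sequentially)
    define k where "k = (\<lambda>n. h (n + N))"
    have k: "k n \<noteq> 0" "q0 + k n \<in> S" "k \<longlonglongrightarrow> 0" for n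
      using h N by (auto simp: k_def LIMSEQ_ignore_initial_segment)
    have "(\<lambda>n. \<integral>\<omega>. indicator A \<omega> *\<^sub>R ((exp ((q0 + k n) * of_real (Y \<omega>)) - exp (q0 * of_real (Y \<omega>))) / k n) \<partial>M) \<longlonglongrightarrow> D"
      unfolding D_def
    proof (rule integral_dominated_convergence[where w = "\<lambda>_. 1 / c"])
      show "AE \<omega> in M. (\<lambda>n. indicator A \<omega> *\<^sub>R ((exp ((q0 + k n) * of_real (Y \<omega>)) - exp (q0 * of_real (Y \<omega>))) / k n))
           \<longlonglongrightarrow> indicator A \<omega> *\<^sub>R (of_real (Y \<omega>) * exp (q0 * of_real (Y \<omega>)))"
      proof (intro AE_I2 tendsto_scaleR tendsto_const)
        fix \<omega>
        have "((\<lambda>q. exp (q * of_real (Y \<omega>))) has_field_derivative of_real (Y \<omega>) * exp (q0 * of_real (Y \<omega>))) (at q0)"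
          by (auto intro!: derivative_eq_intros)
        then show "(\<lambda>n. (exp ((q0 + k n) * of_real (Y \<omega>)) - exp (q0 * of_real (Y \<omega>))) / k n) \<longlonglongrightarrow> of_real (Y \<omega>) * exp (q0 * of_real (Y \<omega>))"
          unfolding DERIV_def tendsto_at_iff_sequentially using k by (auto simp: o_def)
      qed
      show "AE \<omega> in M. norm (indicator A \<omega> *\<^sub>R ((exp ((q0 + k n) * of_real (Y \<omega>)) - exp (q0 * of_real (Y \<omega>))) / k n)) \<le> 1 / c" for n
      proof (rule AE_I2)
        fix \<omega> assume \<omega>: "\<omega> \<in> space M"
        have "norm (exp ((q0 + k n) * of_real (Y \<omega>)) - exp (q0 * of_real (Y \<omega>))) \<le> 1 / c * norm (q0 + k n - q0)"
          by (rule field_differentiable_bound[OF S(2), where f' = "\<lambda>q. of_real (Y \<omega>) * exp (q * of_real (Y \<omega>))"])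
             (use bd Y[OF \<omega>] S k in \<open>auto intro!: derivative_eq_intros\<close>)
        then have "norm ((exp ((q0 + k n) * of_real (Y \<omega>)) - exp (q0 * of_real (Y \<omega>))) / k n) \<le> 1 / c"
          using k(1)[of n] by (simp add: norm_divide field_simps)
        then show "norm (indicator A \<omega> *\<^sub>R ((exp ((q0 + k n) * of_real (Y \<omega>)) - exp (q0 * of_real (Y \<omega>))) / k n)) \<le> 1 / c"
          using c by (auto simp: indicator_def)
      qed
    qed auto
    also have "(\<lambda>n. \<integral>\<omega>. indicator A \<omega> *\<^sub>R ((exp ((q0 + k n) * of_real (Y \<omega>)) - exp (q0 * of_real (Y \<omega>))) / k n) \<partial>M)
        = (\<lambda>n. (F (q0 + k n) - F q0) / k n)"
    proof
      fix n
      have "(F (q0 + k n) - F q0) / k n = (\<integral>\<omega>. (indicator A \<omega> *\<^sub>R exp ((q0 + k n) * of_real (Y \<omega>)) - indicator A \<omega> *\<^sub>R exp (q0 * of_real (Y \<omega>))) / k n \<partial>M)"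
        unfolding F_def using int[OF k(2)[of n]] int[OF S(3)]
        by (subst integral_divide_zero) (simp add: Bochner_Integration.integral_diff)
      moreover have "(indicator A \<omega> *\<^sub>R x - indicator A \<omega> *\<^sub>R y) / k n = indicator A \<omega> *\<^sub>R ((x - y) / k n)" for \<omega> x y
        by (simp add: indicator_def)
      ultimately show "(\<integral>\<omega>. indicator A \<omega> *\<^sub>R ((exp ((q0 + k n) * of_real (Y \<omega>)) - exp (q0 * of_real (Y \<omega>))) / k n) \<partial>M) = (F (q0 + k n) - F q0) / k n"
        by simp
    qed
    finally have "(\<lambda>n. (F (q0 + h (n + N)) - F q0) / h (n + N)) \<longlonglongrightarrow> D" by (simp add: k_def)
    then show "((\<lambda>h. (F (q0 + h) - F q0) / h) \<circ> h) \<longlonglongrightarrow> D"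
      unfolding o_def by (rule LIMSEQ_offset)
  qed
  then show ?thesis unfolding F_def field_differentiable_def by blast
qed

context standard_brownian_motion begin

text \<open>
  Complex differentiability is needed because the function \<open>h\<close> at the end points
  of the arc is defined by a complex derivative; its value is then found along the real axis.
\<close>

lemma L1_exp_differentiable:
  assumes "0 < \<gamma>" "\<gamma> < 1" "z0 \<in> quadrant" "Re q0 < 0"
  shows "L1_exp M W \<gamma> z0 field_differentiable at q0"
proof -
  have r: "1 > 1 - \<gamma>" using assms by simp
  define q where "q = ((1 - \<gamma>)\<^sup>2 - 1\<^sup>2) / 2"
  have q: "q < 0" unfolding q_def using assms power_strict_mono[of "1 - \<gamma>" 1 2] by auto
  define G where "G = (\<lambda>\<omega>. if T1 W \<gamma> z0 \<omega> < T2 W \<gamma> z0 \<omega>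
                     then exp (q * snd (Z W \<gamma> z0 (real_of_ereal (T1 W \<gamma> z0 \<omega>)) \<omega>)) else 0)"
  have "integrable M G" using expectation_left_exit(1)[OF assms(1,2) r assms(3), folded q_def, folded G_def] .
  then have Gm [measurable]: "G \<in> borel_measurable M" by auto
  define A where "A = {\<omega> \<in> space M. 0 < G \<omega>}"
  have [measurable]: "A \<in> sets M" unfolding A_def by measurable
  \<comment> \<open>The exit height is read off from the integrable function \<open>G\<close> by a
      logarithm, which also gives its measurability.\<close>
  define Y where "Y = (\<lambda>\<omega>. if 0 < G \<omega> then ln (G \<omega>) / q else 0)"
  have [measurable]: "Y \<in> borel_measurable M" unfolding Y_def by measurable
  have AY: "\<omega> \<in> A \<longleftrightarrow> T1 W \<gamma> z0 \<omega> < T2 W \<gamma> z0 \<omega>"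
    "T1 W \<gamma> z0 \<omega> < T2 W \<gamma> z0 \<omega> \<Longrightarrow> Y \<omega> = snd (Z W \<gamma> z0 (real_of_ereal (T1 W \<gamma> z0 \<omega>)) \<omega>)"
    if "\<omega> \<in> space M" for \<omega>
    using that q by (auto simp: A_def Y_def G_def)
  have "0 \<le> Y \<omega>" if \<omega>: "\<omega> \<in> space M" for \<omega>
  proof (cases "T1 W \<gamma> z0 \<omega> < T2 W \<gamma> z0 \<omega>")
    case True
    then have "0 \<le> snd (Z W \<gamma> z0 (real_of_ereal (T1 W \<gamma> z0 \<omega>)) \<omega>)"
    proof (cases rule: exit_cases[OF \<omega> assms(3), of \<gamma>, case_names never left down])
      case (left r)
      then show ?thesis using quadrant_sz_pos[OF assms(3)] sz_Z[of W \<gamma> z0 r \<omega>] by (simp add: sz_def)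
    qed auto
    then show ?thesis using AY(2)[OF \<omega> True] by simp
  qed (simp add: Y_def G_def)
  moreover have "L1_exp M W \<gamma> z0 = (\<lambda>q. \<integral>\<omega>. indicator A \<omega> *\<^sub>R exp (q * of_real (Y \<omega>)) \<partial>M)"
    unfolding L1_exp_def set_lebesgue_integral_def fun_eq_iff
    using AY by (intro allI Bochner_Integration.integral_cong) (auto simp: indicator_def)
  ultimately show ?thesis using laplace_transform_differentiable[of A Y q0] assms(4) by simp
qed

text \<open>
  The derivative of \<open>left_exit_fun\<close> in the transform variable, through \<open>r =
  sqrt ((1 - \<gamma>)\<^sup>2 - 2 q)\<close>, at the point with \<open>r = 1\<close>.
\<close>

lemma deriv_L1:
  assumes "0 < \<gamma>" "\<gamma> < 1" "z0 \<in> quadrant"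
  shows "deriv (L1 M W \<gamma> z0) (of_real (((1 - \<gamma>)\<^sup>2 - 1\<^sup>2) / 2))
      = of_real (prefactor \<gamma> z0 * (gsumd (sz z0) (uz z0 + 1) - gsumd (sz z0) (3 - uz z0)))"
proof -
  define q where "q = ((1 - \<gamma>)\<^sup>2 - 1\<^sup>2) / 2"
  have q: "q < 0" unfolding q_def using assms power_strict_mono[of "1 - \<gamma>" 1 2] by auto
  have s: "sz z0 > 0" by (rule quadrant_sz_pos[OF assms(3)])
  have op: "open {q::complex. Re q < 0}" by (rule open_halfspace_Re_lt)
  obtain D where D: "(L1_exp M W \<gamma> z0 has_field_derivative D) (at (of_real q))"
    using L1_exp_differentiable[OF assms, of "of_real q"] q by (auto simp: field_differentiable_def)
  have D': "(L1 M W \<gamma> z0 has_field_derivative D) (at (of_real q))"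
    by (rule has_field_derivative_transform_within_open[OF D op]) (use q in \<open>auto simp: L1_def\<close>)
  have "((\<lambda>x. L1_exp M W \<gamma> z0 (of_real x)) has_vector_derivative D) (at q)"
    using has_vector_derivative_real_field[OF D] .
  moreover have "((\<lambda>x. L1_exp M W \<gamma> z0 (of_real x)) has_vector_derivative
        of_real (prefactor \<gamma> z0 * (gsumd (sz z0) (uz z0 + 1) - gsumd (sz z0) (3 - uz z0)))) (at q)"
  proof -
    define r where "r = (\<lambda>x. sqrt ((1 - \<gamma>)\<^sup>2 - 2 * x))"
    have rq: "(1 - \<gamma>)\<^sup>2 - 2 * q = 1" by (simp add: q_def field_simps)
    then have r1: "r q = 1" by (simp add: r_def)
    have rd: "(r has_real_derivative - 1) (at q)"
      unfolding r_def using rq by (auto intro!: derivative_eq_intros)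
    have 1: "((\<lambda>x. gsum (sz z0) (uz z0 + r x)) has_real_derivative - gsumd (sz z0) (uz z0 + 1) * (0 + - 1)) (at q)"
      using gsumd_has_derivative[OF s, of "uz z0 + r q"] rd unfolding r1[symmetric]
      by (intro DERIV_chain2[of "gsum (sz z0)"] DERIV_add DERIV_const) (auto simp: r1)
    have 2: "((\<lambda>x. gsum (sz z0) (r x + 2 - uz z0)) has_real_derivative - gsumd (sz z0) (3 - uz z0) * (- 1 + 0 - 0)) (at q)"
    proof (rule DERIV_chain2[of "gsum (sz z0)"])
      show "(gsum (sz z0) has_real_derivative - gsumd (sz z0) (3 - uz z0)) (at (r q + 2 - uz z0))"
        using gsumd_has_derivative[OF s, of "3 - uz z0"] by (simp add: r1)
      show "((\<lambda>x. r x + 2 - uz z0) has_real_derivative - 1 + 0 - 0) (at q)"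
        by (intro DERIV_add DERIV_diff DERIV_const rd)
    qed
    have "((\<lambda>x. left_exit_fun \<gamma> (r x) z0) has_real_derivative
        prefactor \<gamma> z0 * (gsumd (sz z0) (uz z0 + 1) - gsumd (sz z0) (3 - uz z0))) (at q)"
      unfolding left_exit_fun_def using DERIV_cmult[OF DERIV_diff[OF 1 2], of "prefactor \<gamma> z0"] by simp
    then have "((\<lambda>x. complex_of_real (left_exit_fun \<gamma> (r x) z0)) has_vector_derivative
        of_real (prefactor \<gamma> z0 * (gsumd (sz z0) (uz z0 + 1) - gsumd (sz z0) (3 - uz z0)))) (at q)"
      by (intro has_vector_derivative_of_real) (simp add: has_real_derivative_iff_has_vector_derivative)
    then show ?thesis
    proof (rule has_vector_derivative_transform_within_open[of _ _ _ "{..<0}"])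
      fix x :: real assume x: "x \<in> {..<0}"
      have "(1 - \<gamma>)\<^sup>2 - 2 * x > (1 - \<gamma>)\<^sup>2" using x by simp
      then have "r x > 1 - \<gamma>" unfolding r_def by (rule real_less_rsqrt)
      moreover have "(1 - \<gamma>)\<^sup>2 - 2 * x \<ge> 0"
        using order.trans[of "2 * x" 0 "(1 - \<gamma>)\<^sup>2"] x by auto
      then have "((1 - \<gamma>)\<^sup>2 - (r x)\<^sup>2) / 2 = x" by (simp add: r_def)
      ultimately show "complex_of_real (left_exit_fun \<gamma> (r x) z0) = L1_exp M W \<gamma> z0 (of_real x)"
        using L1_exp_eq[OF assms(1,2), of "r x" z0] assms(3) by simp
    qed (use q in auto)
  qed
  ultimately have "D = of_real (prefactor \<gamma> z0 * (gsumd (sz z0) (uz z0 + 1) - gsumd (sz z0) (3 - uz z0)))"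
    by (rule vector_derivative_unique_at)
  then show ?thesis using DERIV_imp_deriv[OF D'] by (simp only: q_def)
qed

end

section \<open>The functions \<open>h\<close> and \<open>htilde\<close> coincide\<close>

text \<open>
  The parametrisation of the parabola by the centre \<open>a\<close> of the Gaussian.
\<close>

definition parab :: "real \<Rightarrow> real \<Rightarrow> real \<times> real" where
  "parab \<gamma> a = ((\<gamma>\<^sup>2 - (1 - a)\<^sup>2) / 2, ((1 - \<gamma>)\<^sup>2 - a\<^sup>2) / 2)"

text \<open>
  The parameter on the parabola of the saddle point in direction \<open>\<alpha>\<close>; also
  the value of \<open>uz\<close> on the ray in that direction.
\<close>

definition slope :: "real \<Rightarrow> real" where
  "slope \<alpha> = cos \<alpha> / (cos \<alpha> + sin \<alpha>)"

lemma slope_0 [simp]: "slope 0 = 1" and slope_pi_half [simp]: "slope (pi / 2) = 0"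
  by (simp_all add: slope_def)

lemma parab_inj: "parab \<gamma> a = parab \<gamma> b \<longleftrightarrow> a = b"
proof
  assume "parab \<gamma> a = parab \<gamma> b"
  then have "(1 - a)\<^sup>2 = (1 - b)\<^sup>2" "a\<^sup>2 = b\<^sup>2" by (auto simp: parab_def)
  then show "a = b" by (simp add: power2_eq_square algebra_simps)
qed simp

lemma cos_sin_pos:
  assumes "\<alpha> \<in> {0..pi / 2}"
  shows "cos \<alpha> + sin \<alpha> > 0" "cos \<alpha> \<ge> 0" "sin \<alpha> \<ge> 0"
proof -
  show 1: "cos \<alpha> \<ge> 0" "sin \<alpha> \<ge> 0" using assms by (auto intro: cos_ge_zero sin_ge_zero)
  have "cos \<alpha> + sin \<alpha> \<noteq> 0"
  proof
    assume "cos \<alpha> + sin \<alpha> = 0"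
    then have "cos \<alpha> = 0" "sin \<alpha> = 0" using 1 by auto
    then show False using sin_cos_squared_add[of \<alpha>] by simp
  qed
  then show "cos \<alpha> + sin \<alpha> > 0" using 1 by linarith
qed

lemma slope_range: "\<alpha> \<in> {0..pi / 2} \<Longrightarrow> slope \<alpha> \<in> {0..1}"
  using cos_sin_pos[of \<alpha>] by (auto simp: slope_def)

lemma slope_interior:
  assumes "0 < \<alpha>" "\<alpha> < pi / 2"
  shows "slope \<alpha> \<in> {0<..<1}"
proof -
  have "cos \<alpha> > 0" "sin \<alpha> > 0" using assms by (auto intro: cos_gt_zero sin_gt_zero2)
  then show ?thesis by (simp add: slope_def)
qed

lemma saddle_eq_parab:
  assumes "\<alpha> \<in> {0..pi / 2}"
  shows "saddle \<gamma> \<alpha> = parab \<gamma> (slope \<alpha>)"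
proof -
  consider "\<alpha> = 0" | "\<alpha> = pi / 2" | "0 < \<alpha>" "\<alpha> < pi / 2" using assms by fastforce
  then show ?thesis
  proof cases
    case 1
    then show ?thesis by (simp add: saddle_0 parab_def power2_eq_square field_simps)
  next
    case 2
    show ?thesis unfolding 2 by (simp add: saddle_pi_half parab_def)
  next
    case 3
    then have c: "cos \<alpha> > 0" and d: "sin \<alpha> > 0"
      by (auto intro: cos_gt_zero sin_gt_zero2)
    have "1 + tan \<alpha> = (cos \<alpha> + sin \<alpha>) / cos \<alpha>" "1 + 1 / tan \<alpha> = (cos \<alpha> + sin \<alpha>) / sin \<alpha>"
      using c d by (simp_all add: tan_def field_simps)
    then have "1 / (2 * (1 + 1 / tan \<alpha>)\<^sup>2) = (1 - slope \<alpha>)\<^sup>2 / 2" "1 / (2 * (1 + tan \<alpha>)\<^sup>2) = (slope \<alpha>)\<^sup>2 / 2"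
      using cos_sin_pos[OF assms] by (simp_all add: slope_def power_divide diff_divide_eq_iff)
    then show ?thesis using saddle_eq[OF 3, of \<gamma>] by (simp add: parab_def diff_divide_distrib)
  qed
qed

lemma slope_surj:
  assumes "a \<in> {0..1}"
  obtains \<alpha> where "\<alpha> \<in> {0..pi / 2}" "slope \<alpha> = a"
proof -
  have "continuous_on {0..pi / 2} slope"
    unfolding slope_def using cos_sin_pos(1) by (intro continuous_intros) fastforce
  then have "\<exists>x\<ge>0. x \<le> pi / 2 \<and> slope x = a"
    using assms by (intro IVT2') auto
  then show ?thesis using that by auto
qed

lemma saddle_arc_eq: "saddle_arc \<gamma> = parab \<gamma> ` {0..1}"
proof -
  have "saddle \<gamma> ` {0..pi / 2} = parab \<gamma> ` slope ` {0..pi / 2}"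
    unfolding image_image using saddle_eq_parab by (intro image_cong refl)
  also have "slope ` {0..pi / 2} = {0..1}"
  proof (intro equalityI subsetI)
    fix a assume "a \<in> {0..1 :: real}"
    then obtain \<alpha> where "\<alpha> \<in> {0..pi / 2}" "slope \<alpha> = a" by (rule slope_surj)
    then show "a \<in> slope ` {0..pi / 2}" by blast
  qed (use slope_range in blast)
  finally show ?thesis by (simp add: saddle_arc_def)
qed

text \<open>
  Sums over the integers are treated as two one-sided series, the negative indices being
  written as \<open>- 1 - n\<close>.
\<close>

lemma has_sum_int_split:
  fixes f :: "int \<Rightarrow> real"
  assumes "(\<lambda>n. f (int n)) sums a" "summable (\<lambda>n. norm (f (int n)))"
    and "(\<lambda>n. f (- 1 - int n)) sums b" "summable (\<lambda>n. norm (f (- 1 - int n)))"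
  shows "(f has_sum (a + b)) UNIV"
proof -
  have inj: "inj int" "inj (\<lambda>n. - 1 - int n)" by (auto simp: inj_on_def)
  have "((\<lambda>n. f (int n)) has_sum a) UNIV" "((\<lambda>n. f (- 1 - int n)) has_sum b) UNIV"
    using assms by (auto intro: norm_summable_imp_has_sum)
  then have "(f has_sum a) (range int)" "(f has_sum b) (range (\<lambda>n. - 1 - int n))"
    by (simp_all add: has_sum_reindex inj o_def)
  moreover have "range int \<inter> range (\<lambda>n. - 1 - int n) = {}" by auto
  ultimately have "(f has_sum (a + b)) (range int \<union> range (\<lambda>n. - 1 - int n))"
    by (intro has_sum_Un_disjoint)
  also have "range int \<union> range (\<lambda>n. - 1 - int n) = UNIV"
  proof -
    have "k \<in> range int \<union> range (\<lambda>n. - 1 - int n)" for k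
    proof (cases "k \<ge> 0")
      case True
      then have "k = int (nat k)" by simp
      then show ?thesis by blast
    next
      case False
      then have "k = - 1 - int (nat (- 1 - k))" by simp
      then show ?thesis by blast
    qed
    then show ?thesis by auto
  qed
  finally show ?thesis .
qed

lemma has_sum_int_parity:
  fixes f :: "int \<Rightarrow> real"
  assumes "((\<lambda>m. f (2 * m)) has_sum a) UNIV" "((\<lambda>m. f (2 * m + 1)) has_sum b) UNIV"
  shows "(f has_sum (a + b)) UNIV"
proof -
  have inj: "inj (\<lambda>m::int. 2 * m)" "inj (\<lambda>m::int. 2 * m + 1)" by (auto simp: inj_on_def)
  have "(f has_sum a) (range (\<lambda>m. 2 * m))" "(f has_sum b) (range (\<lambda>m. 2 * m + 1))"
    using assms by (simp_all add: has_sum_reindex inj o_def)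
  moreover have "range (\<lambda>m::int. 2 * m) \<inter> range (\<lambda>m. 2 * m + 1) = {}" by auto presburger
  ultimately have "(f has_sum (a + b)) (range (\<lambda>m. 2 * m) \<union> range (\<lambda>m. 2 * m + 1))"
    by (intro has_sum_Un_disjoint)
  also have "range (\<lambda>m::int. 2 * m) \<union> range (\<lambda>m. 2 * m + 1) = UNIV"
  proof -
    have "k \<in> range (\<lambda>m. 2 * m) \<union> range (\<lambda>m. 2 * m + 1)" for k :: int
      by (cases "even k") (auto elim!: evenE oddE)
    then show ?thesis by auto
  qed
  finally show ?thesis .
qed

lemma has_sum_expo_even:
  assumes "sz z > 0"
  shows "((\<lambda>m. expo \<gamma> (c - 2 * of_int m) z) has_sum
     (prefactor \<gamma> z * gsum (sz z) (uz z - c) + prefactor \<gamma> z * gsum (sz z) (c + 2 - uz z))) UNIV"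
proof (rule has_sum_int_split)
  show 1: "(\<lambda>n. expo \<gamma> (c - 2 * of_int (int n)) z) sums (prefactor \<gamma> z * gsum (sz z) (uz z - c))"
    using expo_series(1)[OF assms, of \<gamma> c] by simp
  show 2: "(\<lambda>n. expo \<gamma> (c - 2 * of_int (- 1 - int n)) z) sums (prefactor \<gamma> z * gsum (sz z) (c + 2 - uz z))"
    using expo_series(2)[OF assms, of \<gamma> "c + 2"] by (simp add: algebra_simps)
  show "summable (\<lambda>n. norm (expo \<gamma> (c - 2 * of_int (int n)) z))"
    using 1 by (simp add: sums_iff abs_of_pos)
  show "summable (\<lambda>n. norm (expo \<gamma> (c - 2 * of_int (- 1 - int n)) z))"
    using 2 by (simp add: sums_iff abs_of_pos)
qed

text \<open>
  The four half-series carry the images \<open>a + 2n\<close> with sign plus and \<open>- a +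
  2n\<close> with sign minus.
\<close>

definition image_series :: "real \<Rightarrow> real \<Rightarrow> real \<times> real \<Rightarrow> real" where
  "image_series \<gamma> a z = prefactor \<gamma> z * (gsum (sz z) (uz z - a) + gsum (sz z) (a + 2 - uz z)
      - gsum (sz z) (uz z + a) - gsum (sz z) (2 - a - uz z))"

text \<open>
  Minus half of the derivative of \<open>image_series\<close> with respect to \<open>a\<close>
  at \<open>a = 1\<close>, where the image series itself vanishes.
\<close>

definition image_series_deriv :: "real \<Rightarrow> real \<times> real \<Rightarrow> real" where
  "image_series_deriv \<gamma> z = prefactor \<gamma> z * (sz z * (1 - uz z) * exp (- (sz z * (uz z - 1)\<^sup>2 / 2))
      - gsumd (sz z) (uz z + 1) + gsumd (sz z) (3 - uz z))"

text \<open>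
  The recursion for \<open>(p\<^sub>n, q\<^sub>n)\<close> is reflection and translation of the
  parameter \<open>a\<close>.
\<close>

lemma pq_seq_parab:
  "pq_seq \<gamma> (parab \<gamma> a) (2 * m) = parab \<gamma> (a - 2 * of_int m)"
  "pq_seq \<gamma> (parab \<gamma> a) (2 * m + 1) = parab \<gamma> (2 - a + 2 * of_int m)"
  by (simp_all add: pq_seq_def p_even_def q_even_def parab_def Let_def power2_eq_square field_simps)

lemma htilde_interior:
  assumes "0 < a" "a < 1" "z \<in> quadrant"
  shows "htilde \<gamma> (parab \<gamma> a) z = image_series \<gamma> a z"
proof -
  have s: "sz z > 0" by (rule quadrant_sz_pos[OF assms(3)])
  have ne: "parab \<gamma> a \<noteq> saddle \<gamma> 0" "parab \<gamma> a \<noteq> saddle \<gamma> (pi / 2)"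
    using assms by (auto simp: saddle_eq_parab parab_inj)
  define f where "f = (\<lambda>n::int. (- 1) powi n * exp (fst z * fst (pq_seq \<gamma> (parab \<gamma> a) n) + snd z * snd (pq_seq \<gamma> (parab \<gamma> a) n)) :: real)"
  have E: "exp (fst z * fst (parab \<gamma> c) + snd z * snd (parab \<gamma> c)) = expo \<gamma> c z" for c
    by (simp add: expo_def parab_def mult.commute)
  have sgn: "(- 1 :: real) powi (2 * m) = 1" "(- 1 :: real) powi (2 * m + 1) = - 1" for m
    by (simp_all add: power_int_minus_left)
  have f: "f (2 * m) = expo \<gamma> (a - 2 * of_int m) z" "f (2 * m + 1) = - expo \<gamma> (2 - a + 2 * of_int m) z" for m
    unfolding f_def pq_seq_parab E sgn by simp_all
  have 1: "((\<lambda>m. f (2 * m)) has_sum (prefactor \<gamma> z * gsum (sz z) (uz z - a) + prefactor \<gamma> z * gsum (sz z) (a + 2 - uz z))) UNIV"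
    unfolding f by (rule has_sum_expo_even[OF s])
  have "((\<lambda>m. expo \<gamma> (- a - 2 * of_int m) z) has_sum
     (prefactor \<gamma> z * gsum (sz z) (uz z - - a) + prefactor \<gamma> z * gsum (sz z) (- a + 2 - uz z))) UNIV"
    by (rule has_sum_expo_even[OF s])
  moreover have "bij (\<lambda>m::int. - 1 - m)" by (rule bij_betw_byWitness[where f' = "\<lambda>m. - 1 - m"]) auto
  ultimately have "((\<lambda>m. expo \<gamma> (- a - 2 * of_int (- 1 - m)) z) has_sum
     (prefactor \<gamma> z * gsum (sz z) (uz z - - a) + prefactor \<gamma> z * gsum (sz z) (- a + 2 - uz z))) UNIV"
    using has_sum_reindex_bij_betw[of "\<lambda>m::int. - 1 - m" UNIV UNIV "\<lambda>m. expo \<gamma> (- a - 2 * of_int m) z"] by simp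
  then have "((\<lambda>m. f (2 * m + 1)) has_sum - (prefactor \<gamma> z * gsum (sz z) (uz z + a) + prefactor \<gamma> z * gsum (sz z) (2 - a - uz z))) UNIV"
    unfolding f by (intro has_sum_uminusI) (simp add: algebra_simps)
  from has_sum_int_parity[OF 1 this]
  have "(f has_sum image_series \<gamma> a z) UNIV" by (simp add: image_series_def algebra_simps)
  moreover have "htilde \<gamma> (parab \<gamma> a) z = infsum f UNIV"
    using ne by (simp add: htilde_def f_def case_prod_beta)
  ultimately show ?thesis by (simp add: infsumI)
qed

lemma htilde_0:
  assumes "z \<in> quadrant"
  shows "htilde \<gamma> (parab \<gamma> 1) z = image_series_deriv \<gamma> z"
proof -
  have s: "sz z > 0" by (rule quadrant_sz_pos[OF assms(1)])
  have eq: "parab \<gamma> 1 = saddle \<gamma> 0" by (simp add: saddle_eq_parab)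
  define f where "f = (\<lambda>n::int. (- 2 * of_int n * fst z + (1 - 2 * of_int n) * snd z)
           * exp (fst z * (\<gamma>\<^sup>2 / 2 - 2 * (of_int n)\<^sup>2) + snd z * (\<gamma>\<^sup>2 / 2 - \<gamma> - 2 * of_int n * (of_int n - 1))) :: real)"
  have f: "f n = prefactor \<gamma> z * (sz z * (1 - 2 * of_int n - uz z) * exp (- (sz z * (uz z - (1 - 2 * of_int n))\<^sup>2 / 2)))" for n
  proof -
    have "- 2 * of_int n * fst z + (1 - 2 * of_int n) * snd z = sz z * (1 - 2 * of_int n - uz z)"
      using s by (simp add: sz_def uz_def field_simps)
    moreover have "exp (fst z * (\<gamma>\<^sup>2 / 2 - 2 * (of_int n)\<^sup>2) + snd z * (\<gamma>\<^sup>2 / 2 - \<gamma> - 2 * of_int n * (of_int n - 1)))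
       = expo \<gamma> (1 - 2 * of_int n) z"
      by (simp add: expo_def) (simp add: power2_eq_square field_simps)
    ultimately show ?thesis using expo_eq_gauss[OF s, of \<gamma> "1 - 2 * of_int n"] by (simp add: f_def)
  qed
  have pos: "f (int (Suc m)) = - (prefactor \<gamma> z * (sz z * (uz z + 1 + 2 * real m) * exp (- (sz z * (uz z + 1 + 2 * real m)\<^sup>2 / 2))))" for m
    unfolding f by (simp add: algebra_simps)
  have neg: "f (- 1 - int m) = prefactor \<gamma> z * (sz z * (3 - uz z + 2 * real m) * exp (- (sz z * (3 - uz z + 2 * real m)\<^sup>2 / 2)))" for m
  proof -
    have "(uz z - (1 - 2 * of_int (- 1 - int m)))\<^sup>2 = (3 - uz z + 2 * real m)\<^sup>2"
      by (simp add: power2_eq_square algebra_simps)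
    then show ?thesis unfolding f by (simp add: algebra_simps)
  qed
  have f0: "f (int 0) = prefactor \<gamma> z * (sz z * (1 - uz z) * exp (- (sz z * (uz z - 1)\<^sup>2 / 2)))"
    unfolding f by simp
  have "(\<lambda>m. f (int (Suc m))) sums - (prefactor \<gamma> z * gsumd (sz z) (uz z + 1))"
    unfolding pos by (intro sums_minus sums_mult gsumd_sums s)
  then have 1: "(\<lambda>m. f (int m)) sums (- (prefactor \<gamma> z * gsumd (sz z) (uz z + 1)) + f (int 0))"
    by (subst (asm) sums_Suc_iff) simp
  have "summable (\<lambda>m. norm (f (int (Suc m))))"
    unfolding pos norm_minus_cancel norm_mult[of "prefactor \<gamma> z"] by (intro summable_mult summable_gsumd s)
  then have 2: "summable (\<lambda>m. norm (f (int m)))" by (subst (asm) summable_Suc_iff)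
  have 3: "(\<lambda>m. f (- 1 - int m)) sums (prefactor \<gamma> z * gsumd (sz z) (3 - uz z))"
    unfolding neg by (intro sums_mult gsumd_sums s)
  have 4: "summable (\<lambda>m. norm (f (- 1 - int m)))"
    unfolding neg norm_mult[of "prefactor \<gamma> z"] by (intro summable_mult summable_gsumd s)
  have "- (prefactor \<gamma> z * gsumd (sz z) (uz z + 1)) + f (int 0) + prefactor \<gamma> z * gsumd (sz z) (3 - uz z) = image_series_deriv \<gamma> z"
    unfolding f0 image_series_deriv_def by (simp add: algebra_simps)
  then have "(f has_sum image_series_deriv \<gamma> z) UNIV"
    using has_sum_int_split[OF 1 2 3 4] by simp
  moreover have "htilde \<gamma> (parab \<gamma> 1) z = infsum f UNIV"
    unfolding eq by (simp add: htilde_def f_def case_prod_beta)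
  ultimately show ?thesis by (simp add: infsumI)
qed

text \<open>
  The two end points are exchanged by the symmetry between the coordinates.
\<close>

lemma htilde_pi_half:
  "htilde \<gamma> (parab \<gamma> 0) z = htilde (1 - \<gamma>) (parab (1 - \<gamma>) 1) (prod.swap z)"
proof -
  have eq: "parab \<gamma> 0 = saddle \<gamma> (pi / 2)" "parab (1 - \<gamma>) 1 = saddle (1 - \<gamma>) 0" by (simp_all add: saddle_eq_parab)
  have ne: "saddle \<gamma> (pi / 2) \<noteq> saddle \<gamma> 0" by (simp add: saddle_eq_parab parab_inj)
  show ?thesis
    unfolding eq using ne by (simp add: htilde_def case_prod_beta algebra_simps)
qed

context standard_brownian_motion begin

lemma h_eq_htilde_0:
  assumes "0 < \<gamma>" "\<gamma> < 1" "z \<in> quadrant"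
  shows "complex_of_real (htilde \<gamma> (parab \<gamma> 1) z) = h M W \<gamma> 0 z"
proof -
  have s: "sz z > 0" by (rule quadrant_sz_pos[OF assms(3)])
  have y: "sz z * (1 - uz z) = snd z" using s by (simp add: sz_def uz_def field_simps)
  have sa: "saddle \<gamma> 0 = parab \<gamma> 1" by (simp add: saddle_eq_parab)
  have q: "snd (parab \<gamma> 1) = ((1 - \<gamma>)\<^sup>2 - 1\<^sup>2) / 2" by (simp add: parab_def)
  have "exp (fst (parab \<gamma> 1) * fst z + snd (parab \<gamma> 1) * snd z) = expo \<gamma> 1 z"
    by (simp add: expo_def parab_def)
  then have "h M W \<gamma> 0 z = of_real (snd z) * of_real (expo \<gamma> 1 z) - deriv (L1 M W \<gamma> z) (of_real (((1 - \<gamma>)\<^sup>2 - 1\<^sup>2) / 2))"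
    unfolding h_def sa Let_def case_prod_beta q by simp
  also have "\<dots> = of_real (snd z * expo \<gamma> 1 z - prefactor \<gamma> z * (gsumd (sz z) (uz z + 1) - gsumd (sz z) (3 - uz z)))"
    unfolding deriv_L1[OF assms] by simp
  also have "snd z * expo \<gamma> 1 z - prefactor \<gamma> z * (gsumd (sz z) (uz z + 1) - gsumd (sz z) (3 - uz z)) = image_series_deriv \<gamma> z"
    unfolding expo_eq_gauss[OF s] image_series_deriv_def y by (simp add: algebra_simps)
  finally show ?thesis by (simp add: htilde_0[OF assms(3)])
qed

text \<open>
  In the interior of the arc the two exit transforms subtract from the exponential exactly the
  images other than \<open>a\<close> itself; at the ends the same holds for the derivatives.
\<close>

theorem h_eq_htilde:
  assumes "0 < \<gamma>" "\<gamma> < 1" "z \<in> quadrant" "\<alpha> \<in> {0..pi / 2}"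
  shows "complex_of_real (htilde \<gamma> (saddle \<gamma> \<alpha>) z) = h M W \<gamma> \<alpha> z"
proof -
  consider "\<alpha> = 0" | "\<alpha> = pi / 2" | "0 < \<alpha>" "\<alpha> < pi / 2" using assms by fastforce
  then show ?thesis
  proof cases
    case 1
    then show ?thesis using h_eq_htilde_0[OF assms(1-3)] by (simp add: saddle_eq_parab)
  next
    case 2
    interpret neg: standard_brownian_motion M "\<lambda>t \<omega>. - W t \<omega>" by (rule minus_standard_brownian_motion)
    have "h M (\<lambda>t \<omega>. - W t \<omega>) (1 - \<gamma>) 0 (prod.swap z) = h M W \<gamma> (pi / 2) z"
      by (simp add: h_def case_prod_beta Let_def L1_swap saddle_0 saddle_pi_half add.commute)
         (simp add: power2_eq_square field_simps)
    then show ?thesis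
      using neg.h_eq_htilde_0[of "1 - \<gamma>" "prod.swap z"] assms
      unfolding 2 by (simp add: saddle_eq_parab htilde_pi_half)
  next
    case 3
    have a: "0 < slope \<alpha>" "slope \<alpha> < 1" using slope_interior[OF 3] by auto
    have s: "sz z > 0" by (rule quadrant_sz_pos[OF assms(3)])
    define a where "a = slope \<alpha>"
    have sa: "saddle \<gamma> \<alpha> = parab \<gamma> a" using assms by (simp add: saddle_eq_parab a_def)
    have E: "exp (fst (parab \<gamma> a) * fst z + snd (parab \<gamma> a) * snd z) = expo \<gamma> a z"
      by (simp add: expo_def parab_def)
    have "h M W \<gamma> \<alpha> z = of_real (expo \<gamma> a z) - L1 M W \<gamma> z (of_real (((1 - \<gamma>)\<^sup>2 - a\<^sup>2) / 2))
        - L2 M W \<gamma> z (of_real ((\<gamma>\<^sup>2 - (1 - a)\<^sup>2) / 2))"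
      using 3 E unfolding h_def sa by (simp add: Let_def case_prod_beta parab_def)
    also have "\<dots> = of_real (expo \<gamma> a z - left_exit_fun \<gamma> a z - left_exit_fun (1 - \<gamma>) (1 - a) (prod.swap z))"
      using L1_parabola[OF assms(1,2) _ assms(3), of a] L2_parabola[OF assms(1,2) _ assms(3), of a] a
      by (simp add: a_def)
    also have "expo \<gamma> a z - left_exit_fun \<gamma> a z - left_exit_fun (1 - \<gamma>) (1 - a) (prod.swap z) = image_series \<gamma> a z"
      using gsum_step[OF s, of "uz z - a"]
      by (simp add: expo_eq_gauss[OF s] left_exit_fun_def image_series_def prefactor_swap uz_swap[OF s] algebra_simps)
    also have "\<dots> = htilde \<gamma> (saddle \<gamma> \<alpha>) z"
      using a htilde_interior[of a z \<gamma>] assms(3) unfolding sa by (simp add: a_def)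
    finally show ?thesis by simp
  qed
qed

end

section \<open>The Green density\<close>

lemma std_normal_trig:
  shows "(\<integral>x. std_normal_density x * cos (t * x) \<partial>lborel) = exp (- t\<^sup>2 / 2)"
    and "(\<integral>x. std_normal_density x * sin (t * x) \<partial>lborel) = 0"
    and "integrable lborel (\<lambda>x. std_normal_density x * cos (t * x))"
    and "integrable lborel (\<lambda>x. std_normal_density x * sin (t * x))"
proof -
  interpret real_distribution std_normal_distribution by (rule real_dist_normal_dist)
  have i: "integrable std_normal_distribution (\<lambda>x. iexp (t * x))"
    by (rule integrable_iexp) auto
  have "(\<integral>x. iexp (t * x) \<partial>std_normal_distribution) = of_real (exp (- t\<^sup>2 / 2))"
    using char_std_normal_distribution by (simp add: char_def fun_eq_iff)
  then have "(\<integral>x. Re (iexp (t * x)) \<partial>std_normal_distribution) = exp (- t\<^sup>2 / 2)"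
    "(\<integral>x. Im (iexp (t * x)) \<partial>std_normal_distribution) = 0"
    using integral_Re[OF i] integral_Im[OF i] by simp_all
  then show "(\<integral>x. std_normal_density x * cos (t * x) \<partial>lborel) = exp (- t\<^sup>2 / 2)"
    "(\<integral>x. std_normal_density x * sin (t * x) \<partial>lborel) = 0"
    by (simp_all add: integral_density Re_exp Im_exp)
  have "integrable lborel (\<lambda>x. std_normal_density x *\<^sub>R cos (t * x))"
    "integrable lborel (\<lambda>x. std_normal_density x *\<^sub>R sin (t * x))"
    by (rule Bochner_Integration.integrable_bound[OF integrable_normal_density[of 1 0]];
        auto simp: abs_mult mult_left_le)+
  then show "integrable lborel (\<lambda>x. std_normal_density x * cos (t * x))"
    "integrable lborel (\<lambda>x. std_normal_density x * sin (t * x))" by simp_all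
qed

lemma integrable_gauss:
  fixes s u :: real
  assumes "0 < s"
  shows "integrable lborel (\<lambda>a. exp (- (s * (u - a)\<^sup>2 / 2)))"
proof -
  have "exp (- (s * (u - a)\<^sup>2 / 2)) = sqrt (2 * pi / s) * normal_density u (1 / sqrt s) a" for a
    using assms by (simp add: normal_density_def power_divide real_sqrt_divide power2_commute[of u] field_simps)
  then show ?thesis using assms by (simp only:) (intro integrable_mult_right integrable_normal_density, simp)
qed

text \<open>
  Up to normalisation, the Gaussian average of a sine is the sine at the centre times the
  characteristic function; this is the factor of decay under the heat flow.
\<close>

lemma integral_gauss_sin:
  fixes s u \<kappa> :: real
  assumes "0 < s"
  shows "integrable lborel (\<lambda>a. exp (- (s * (u - a)\<^sup>2 / 2)) * sin (\<kappa> * a))"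
    and "(\<integral>a. exp (- (s * (u - a)\<^sup>2 / 2)) * sin (\<kappa> * a) \<partial>lborel)
           = sqrt (2 * pi / s) * exp (- (\<kappa>\<^sup>2 / (2 * s))) * sin (\<kappa> * u)"
proof -
  show "integrable lborel (\<lambda>a. exp (- (s * (u - a)\<^sup>2 / 2)) * sin (\<kappa> * a))"
    by (rule Bochner_Integration.integrable_bound[OF integrable_gauss[OF assms, of u]])
       (auto simp: abs_mult mult_left_le)
  define c where "c = 1 / sqrt s"
  have c: "c > 0" "s * c\<^sup>2 = 1" using assms by (auto simp: c_def power_divide)
  have "(\<integral>a. exp (- (s * (u - a)\<^sup>2 / 2)) * sin (\<kappa> * a) \<partial>lborel)
      = c * (\<integral>x. exp (- (s * (u - (u + c * x))\<^sup>2 / 2)) * sin (\<kappa> * (u + c * x)) \<partial>lborel)"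
    using lborel_integral_real_affine[of c "\<lambda>a. exp (- (s * (u - a)\<^sup>2 / 2)) * sin (\<kappa> * a)" u] c by simp
  also have "(\<lambda>x. exp (- (s * (u - (u + c * x))\<^sup>2 / 2)) * sin (\<kappa> * (u + c * x)))
      = (\<lambda>x. sqrt (2 * pi) * (sin (\<kappa> * u) * (std_normal_density x * cos (\<kappa> * c * x)) + cos (\<kappa> * u) * (std_normal_density x * sin (\<kappa> * c * x))))"
  proof
    fix x
    have "s * (u - (u + c * x))\<^sup>2 = (s * c\<^sup>2) * x\<^sup>2" by (simp add: power_mult_distrib)
    then have "exp (- (s * (u - (u + c * x))\<^sup>2 / 2)) = sqrt (2 * pi) * std_normal_density x"
      using c by (simp add: std_normal_density_def)
    moreover have "sin (\<kappa> * (u + c * x)) = sin (\<kappa> * u) * cos (\<kappa> * c * x) + cos (\<kappa> * u) * sin (\<kappa> * c * x)"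
      by (simp add: distrib_left sin_add mult.assoc)
    ultimately show "exp (- (s * (u - (u + c * x))\<^sup>2 / 2)) * sin (\<kappa> * (u + c * x)) =
      sqrt (2 * pi) * (sin (\<kappa> * u) * (std_normal_density x * cos (\<kappa> * c * x)) + cos (\<kappa> * u) * (std_normal_density x * sin (\<kappa> * c * x)))"
      by (simp only: distrib_left mult_ac)
  qed
  also have "(\<integral>x. sqrt (2 * pi) * (sin (\<kappa> * u) * (std_normal_density x * cos (\<kappa> * c * x)) + cos (\<kappa> * u) * (std_normal_density x * sin (\<kappa> * c * x))) \<partial>lborel)
     = sqrt (2 * pi) * (sin (\<kappa> * u) * exp (- (\<kappa> * c)\<^sup>2 / 2))"
    using std_normal_trig[of "\<kappa> * c"] by simp
  also have "(\<kappa> * c)\<^sup>2 = \<kappa>\<^sup>2 / s" using assms by (simp add: c_def power_mult_distrib power_divide)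
  also have "c * (sqrt (2 * pi) * (sin (\<kappa> * u) * exp (- (\<kappa>\<^sup>2 / s) / 2)))
      = sqrt (2 * pi / s) * exp (- (\<kappa>\<^sup>2 / (2 * s))) * sin (\<kappa> * u)"
    by (simp add: c_def real_sqrt_divide)
  finally show "(\<integral>a. exp (- (s * (u - a)\<^sup>2 / 2)) * sin (\<kappa> * a) \<partial>lborel)
           = sqrt (2 * pi / s) * exp (- (\<kappa>\<^sup>2 / (2 * s))) * sin (\<kappa> * u)" .
qed

text \<open>
  The separated solution of the heat equation with wave number \<open>k\<close>, transported
  to the quadrant.
\<close>

definition eigfun :: "real \<Rightarrow> nat \<Rightarrow> real \<times> real \<Rightarrow> real" where
  "eigfun \<gamma> k z = prefactor \<gamma> z / sqrt (sz z) * eig (1 / sz z) k * sin (real k * pi * uz z)"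

text \<open>
  Integrating \<open>expo_eq_gauss\<close> over the centre \<open>a\<close>.
\<close>

lemma eigfun_superposition:
  assumes "sz z > 0"
  shows "integrable lborel (\<lambda>a. expo \<gamma> a z * sin (real k * pi * a))"
    and "(\<integral>a. expo \<gamma> a z * sin (real k * pi * a) \<partial>lborel) = sqrt (2 * pi) * eigfun \<gamma> k z"
  unfolding expo_eq_gauss[OF assms] mult.assoc[of "prefactor \<gamma> z"]
  using integral_gauss_sin[OF assms, of "uz z" "real k * pi"] assms
  by (simp_all add: eigfun_def eig_def real_sqrt_divide)

lemma integrable_expo:
  assumes "sz z > 0"
  shows "integrable lborel (\<lambda>a. expo \<gamma> a z)"
  unfolding expo_eq_gauss[OF assms] by (intro integrable_mult_right integrable_gauss assms)

context standard_brownian_motion begin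

text \<open>
  Optional stopping for each \<open>a\<close> and the theorem of Fubini in \<open>a\<close>.
\<close>

lemma eigfun_exit:
  assumes "z0 \<in> quadrant" "0 < t"
  shows "integrable M (\<lambda>\<omega>. eigfun \<gamma> k (Z W \<gamma> z0 (exit_time \<gamma> z0 t \<omega>) \<omega>))"
    and "expectation (\<lambda>\<omega>. eigfun \<gamma> k (Z W \<gamma> z0 (exit_time \<gamma> z0 t \<omega>) \<omega>)) = eigfun \<gamma> k z0"
proof -
  define Ze where "Ze = (\<lambda>\<omega>. Z W \<gamma> z0 (exit_time \<gamma> z0 t \<omega>) \<omega>)"
  have Zm [measurable]: "Ze \<in> borel_measurable M"
    unfolding Ze_def by (rule measurable_Z_exit[OF assms])
  have [measurable]: "(\<lambda>\<omega>. fst (Ze \<omega>)) \<in> borel_measurable M" "(\<lambda>\<omega>. snd (Ze \<omega>)) \<in> borel_measurable M"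
    by (rule measurable_compose[of "Ze" M borel], simp,
        rule borel_measurable_continuous_onI, intro continuous_intros)+
  have s: "sz (Ze \<omega>) > 0" if "\<omega> \<in> space M" for \<omega>
    unfolding Ze_def sz_Z using exit_time_range[OF assms that, of \<gamma>] quadrant_sz_pos[OF assms(1)] by simp
  have s0: "sz z0 > 0" by (rule quadrant_sz_pos[OF assms(1)])
  define f where "f = (\<lambda>a \<omega>. expo \<gamma> a (Ze \<omega>) * sin (real k * pi * a))"
  interpret P: pair_sigma_finite lborel M by unfold_locales
  have fm [measurable]: "(\<lambda>(a, \<omega>). f a \<omega>) \<in> borel_measurable (lborel \<Otimes>\<^sub>M M)"
    unfolding f_def expo_def by measurable
  have Ei: "integrable M (\<lambda>\<omega>. expo \<gamma> a (Ze \<omega>))" "expectation (\<lambda>\<omega>. expo \<gamma> a (Ze \<omega>)) = expo \<gamma> a z0" for a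
    unfolding Ze_def by (rule expo_exit[OF assms])+
  have fi: "integrable M (\<lambda>\<omega>. f a \<omega>)" "expectation (\<lambda>\<omega>. f a \<omega>) = expo \<gamma> a z0 * sin (real k * pi * a)" for a
    unfolding f_def using Ei[of a] by simp_all
  have nf: "norm (f a \<omega>) = expo \<gamma> a (Ze \<omega>) * \<bar>sin (real k * pi * a)\<bar>" for a \<omega>
    by (simp add: f_def abs_mult less_imp_le)
  have pair: "integrable (lborel \<Otimes>\<^sub>M M) (\<lambda>(a, \<omega>). f a \<omega>)"
  proof (rule P.Fubini_integrable[OF fm])
    show "AE a in lborel. integrable M (\<lambda>\<omega>. case (a, \<omega>) of (a, \<omega>) \<Rightarrow> f a \<omega>)"
      using fi by simp
    have eq: "(\<integral>\<omega>. norm (case (a, \<omega>) of (a, \<omega>) \<Rightarrow> f a \<omega>) \<partial>M) = expo \<gamma> a z0 * \<bar>sin (real k * pi * a)\<bar>" for a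
      unfolding case_prod_conv nf using Ei[of a] by simp
    show "integrable lborel (\<lambda>a. \<integral>\<omega>. norm (case (a, \<omega>) of (a, \<omega>) \<Rightarrow> f a \<omega>) \<partial>M)"
      unfolding eq
      by (rule Bochner_Integration.integrable_bound[OF integrable_expo[OF s0, of \<gamma>]])
         (auto simp: abs_mult expo_def mult_left_le)
  qed
  have int_a: "(\<integral>a. f a \<omega> \<partial>lborel) = sqrt (2 * pi) * eigfun \<gamma> k (Ze \<omega>)" if "\<omega> \<in> space M" for \<omega>
    unfolding f_def by (rule eigfun_superposition(2)[OF s[OF that]])
  have "integrable M (\<lambda>\<omega>. \<integral>a. f a \<omega> \<partial>lborel)"
    using P.integrable_snd[OF pair] .
  then have "integrable M (\<lambda>\<omega>. sqrt (2 * pi) * eigfun \<gamma> k (Ze \<omega>))"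
    by (rule iffD1[OF Bochner_Integration.integrable_cong, rotated -1]) (auto simp: int_a)
  then show "integrable M (\<lambda>\<omega>. eigfun \<gamma> k (Z W \<gamma> z0 (exit_time \<gamma> z0 t \<omega>) \<omega>))"
    by (simp add: Ze_def)
  have "sqrt (2 * pi) * expectation (\<lambda>\<omega>. eigfun \<gamma> k (Ze \<omega>)) = expectation (\<lambda>\<omega>. \<integral>a. f a \<omega> \<partial>lborel)"
    by (subst Bochner_Integration.integral_cong[OF refl int_a]) simp_all
  also have "\<dots> = (\<integral>a. \<integral>\<omega>. f a \<omega> \<partial>M \<partial>lborel)"
    using P.Fubini_integral[of f] pair by simp
  also have "\<dots> = sqrt (2 * pi) * eigfun \<gamma> k z0"
    unfolding fi(2) by (rule eigfun_superposition(2)[OF s0])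
  finally show "expectation (\<lambda>\<omega>. eigfun \<gamma> k (Z W \<gamma> z0 (exit_time \<gamma> z0 t \<omega>) \<omega>)) = eigfun \<gamma> k z0"
    by (simp add: Ze_def)
qed

definition alive :: "real \<Rightarrow> real \<times> real \<Rightarrow> real \<Rightarrow> 'a set" where
  "alive \<gamma> z0 t = {\<omega> \<in> space M. ereal t < T W \<gamma> z0 \<omega>}"

lemma alive_in_events: "z0 \<in> quadrant \<Longrightarrow> 0 < t \<Longrightarrow> alive \<gamma> z0 t \<in> events"
  unfolding alive_def using measurable_T_greater[of z0 t \<gamma>] by measurable

lemma alive_quadrant:
  assumes "\<omega> \<in> alive \<gamma> z0 t" "z0 \<in> quadrant" "0 < t"
  shows "Z W \<gamma> z0 t \<omega> \<in> quadrant"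
  using assms(1) Z_exit_cases[OF _ assms(2,3), of \<omega> \<gamma>] by (auto simp: alive_def)

text \<open>
  On the axes \<open>uz\<close> is \<open>0\<close> or \<open>1\<close>, so
  \<open>eigfun\<close> vanishes there and only surviving paths contribute.
\<close>

lemma eigfun_alive:
  assumes "z0 \<in> quadrant" "0 < t"
  shows "expectation (\<lambda>\<omega>. indicator (alive \<gamma> z0 t) \<omega> * eigfun \<gamma> k (Z W \<gamma> z0 t \<omega>)) = eigfun \<gamma> k z0"
    and "integrable M (\<lambda>\<omega>. indicator (alive \<gamma> z0 t) \<omega> * eigfun \<gamma> k (Z W \<gamma> z0 t \<omega>))"
proof -
  have eq: "indicator (alive \<gamma> z0 t) \<omega> * eigfun \<gamma> k (Z W \<gamma> z0 t \<omega>) = eigfun \<gamma> k (Z W \<gamma> z0 (exit_time \<gamma> z0 t \<omega>) \<omega>)"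
    if \<omega>: "\<omega> \<in> space M" for \<omega>
  proof (cases rule: Z_exit_cases[OF \<omega> assms, of \<gamma>, case_names alive left down])
    case alive
    then show ?thesis using \<omega> by (simp add: alive_def)
  next
    case left
    then show ?thesis using \<omega> by (simp add: alive_def eigfun_def uz_def)
  next
    case down
    then have "uz (Z W \<gamma> z0 (exit_time \<gamma> z0 t \<omega>) \<omega>) = 1" by (simp add: uz_def)
    then show ?thesis using \<omega> down by (simp add: alive_def eigfun_def)
  qed
  show "expectation (\<lambda>\<omega>. indicator (alive \<gamma> z0 t) \<omega> * eigfun \<gamma> k (Z W \<gamma> z0 t \<omega>)) = eigfun \<gamma> k z0"
    using eigfun_exit(2)[OF assms, of \<gamma> k] by (subst Bochner_Integration.integral_cong[OF refl eq]) auto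
  show "integrable M (\<lambda>\<omega>. indicator (alive \<gamma> z0 t) \<omega> * eigfun \<gamma> k (Z W \<gamma> z0 t \<omega>))"
    using eigfun_exit(1)[OF assms, of \<gamma> k]
    by (subst Bochner_Integration.integrable_cong[OF refl eq]) auto
qed

end

lemma prefactor_alt: "sz z > 0 \<Longrightarrow> prefactor \<gamma> z = exp (sz z * (uz z - (1 - \<gamma>))\<^sup>2 / 2)"
proof -
  assume s: "sz z > 0"
  have x: "fst z = uz z * sz z" using s by (simp add: uz_def sz_def)
  have "(fst z - (1 - \<gamma>) * sz z)\<^sup>2 / (2 * sz z) = sz z * (uz z - (1 - \<gamma>))\<^sup>2 / 2"
    unfolding x using s by (simp add: power2_eq_square field_simps)
  then show ?thesis by (simp add: prefactor_def sz_def)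
qed

lemma uz_quadrant: "z \<in> quadrant \<Longrightarrow> uz z \<in> {0<..<1}"
  by (auto simp: uz_def quadrant_def)

text \<open>
  For fixed \<open>x + y = s\<close> this is the density in \<open>x\<close> of the process
  alive at time \<open>s - sz z0\<close>. Since \<open>sz\<close> has unit speed, it is at the
  same time the Green density at \<open>z\<close>.
\<close>

definition green_kernel :: "real \<Rightarrow> real \<times> real \<Rightarrow> real \<times> real \<Rightarrow> real" where
  "green_kernel \<gamma> z0 z = prefactor \<gamma> z0 / prefactor \<gamma> z / sqrt (sz z0 * sz z) * heat (1 / sz z0 - 1 / sz z) (uz z0) (uz z)"

context standard_brownian_motion begin

lemma measurable_Z_coords [measurable]:
  assumes "0 \<le> t"
  shows "(\<lambda>\<omega>. fst (Z W \<gamma> z0 t \<omega>)) \<in> borel_measurable M"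
    "(\<lambda>\<omega>. snd (Z W \<gamma> z0 t \<omega>)) \<in> borel_measurable M"
  using W_measurable[OF assms] unfolding Z_def by simp_all

text \<open>
  The law of the surviving process tested against functions that vanish at both ends. For
  sines this is \<open>eigfun_alive\<close>, and sine polynomials are dense.
\<close>

lemma alive_test:
  assumes z0: "z0 \<in> quadrant" "0 < t" and "0 < \<gamma>" "\<gamma> < 1"
    and f: "continuous_on UNIV f" "f 0 = 0" "f 1 = 0"
  shows "expectation (\<lambda>\<omega>. indicator (alive \<gamma> z0 t) \<omega> * (prefactor \<gamma> (Z W \<gamma> z0 t \<omega>) * f (uz (Z W \<gamma> z0 t \<omega>))))
     = prefactor \<gamma> z0 * sqrt ((sz z0 + t) / sz z0) *
       integral {0..1} (\<lambda>v. heat (1 / sz z0 - 1 / (sz z0 + t)) (uz z0) v * f v)"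
proof -
  define s where "s = sz z0 + t"
  define \<tau> where "\<tau> = 1 / sz z0 - 1 / s"
  have s0: "sz z0 > 0" by (rule quadrant_sz_pos[OF z0(1)])
  have s: "s > 0" "s > sz z0" using s0 z0 by (auto simp: s_def)
  have \<tau>: "\<tau> > 0" using s s0 by (simp add: \<tau>_def field_simps)
  define c where "c = prefactor \<gamma> z0 * sqrt (s / sz z0)"
  have c: "c > 0" using s s0 by (simp add: c_def)
  define U where "U = (\<lambda>\<omega>. uz (Z W \<gamma> z0 t \<omega>))"
  have szZ: "sz (Z W \<gamma> z0 t \<omega>) = s" for \<omega> by (simp add: sz_Z s_def)
  note [measurable] = measurable_Z_coords[OF less_imp_le[OF z0(2)]]
  have Um [measurable]: "U \<in> borel_measurable M"
    unfolding U_def uz_def using z0(2) by measurable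
  have am [measurable]: "alive \<gamma> z0 t \<in> events" by (rule alive_in_events[OF z0])
  define w where "w = (\<lambda>\<omega>. indicator (alive \<gamma> z0 t) \<omega> * prefactor \<gamma> (Z W \<gamma> z0 t \<omega>))"
  have wm [measurable]: "w \<in> borel_measurable M"
    unfolding w_def prefactor_def using z0(2) by measurable
  have w: "0 \<le> w \<omega>" "w \<omega> \<le> exp s" for \<omega>
  proof -
    show "0 \<le> w \<omega>" by (simp add: w_def indicator_def less_imp_le)
    show "w \<omega> \<le> exp s"
    proof (cases "\<omega> \<in> alive \<gamma> z0 t")
      case True
      from alive_quadrant[OF True z0] have q: "Z W \<gamma> z0 t \<omega> \<in> quadrant" .
      have u: "0 < uz (Z W \<gamma> z0 t \<omega>)" "uz (Z W \<gamma> z0 t \<omega>) < 1" using uz_quadrant[OF q] by auto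
      have "(uz (Z W \<gamma> z0 t \<omega>) - (1 - \<gamma>))\<^sup>2 \<le> 1"
        unfolding abs_square_le_1 using u assms(3,4) by auto
      then have "s * (uz (Z W \<gamma> z0 t \<omega>) - (1 - \<gamma>))\<^sup>2 \<le> s * 1" using s by (intro mult_left_mono) auto
      then have "s * (uz (Z W \<gamma> z0 t \<omega>) - (1 - \<gamma>))\<^sup>2 / 2 \<le> s" using s by simp
      then show ?thesis using True prefactor_alt[of "Z W \<gamma> z0 t \<omega>" \<gamma>] s by (simp add: w_def szZ)
    qed (simp add: w_def)
  qed
  have U01: "U \<omega> \<in> {0..1}" if "w \<omega> \<noteq> 0" for \<omega>
  proof -
    have "\<omega> \<in> alive \<gamma> z0 t" using that by (auto simp: w_def indicator_def)
    from uz_quadrant[OF alive_quadrant[OF this z0]] show ?thesis by (simp add: U_def)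
  qed
  have int: "integrable M (\<lambda>\<omega>. w \<omega> * g (U \<omega>))" if g: "continuous_on UNIV g" for g :: "real \<Rightarrow> real"
  proof -
    have [measurable]: "g \<in> borel_measurable borel" by (rule borel_measurable_continuous_onI[OF g])
    have "bounded (g ` {0..1})"
      by (intro compact_imp_bounded compact_continuous_image continuous_on_subset[OF g]) auto
    then obtain B where "\<forall>x\<in>g ` {0..1}. norm x \<le> B" unfolding bounded_iff by blast
    then have B: "\<And>u. u \<in> {0..1} \<Longrightarrow> \<bar>g u\<bar> \<le> B" by auto
    have B0: "B \<ge> 0" using B[of 0] by simp
    have "norm (w \<omega> * g (U \<omega>)) \<le> exp s * B" for \<omega>
    proof (cases "w \<omega> = 0")
      case False
      then show ?thesis using w[of \<omega>] B[OF U01[OF False]] by (simp add: abs_mult mult_mono)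
    qed (use B0 in simp)
    then show ?thesis by (intro integrable_const_bound[where B = "exp s * B"]) auto
  qed
  define A where "A = (\<lambda>g. expectation (\<lambda>\<omega>. w \<omega> * g (U \<omega>)))"
  define R where "R = (\<lambda>g. c * integral {0..1} (\<lambda>v. heat \<tau> (uz z0) v * g v))"
  have hc: "continuous_on {0..1} (\<lambda>v. heat \<tau> (uz z0) v)"
    by (intro continuous_intros) (use \<tau> in auto)
  have hi: "(\<lambda>v. heat \<tau> (uz z0) v * g v) integrable_on {0..1}" if "continuous_on UNIV g" for g
    by (intro integrable_continuous_interval continuous_intros hc continuous_on_subset[OF that]) auto
  have sp_cont: "continuous_on UNIV p" if "sine_poly p" for p
    using that by induction (auto intro!: continuous_intros)
  have poly: "A p = R p" if "sine_poly p" for p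
    using that
  proof induction
    case (basis k d)
    have "A (\<lambda>u. sin (real k * pi * u)) = sqrt s / eig (1 / s) k * eigfun \<gamma> k z0"
    proof -
      have "w \<omega> * sin (real k * pi * U \<omega>) = sqrt s / eig (1 / s) k * (indicator (alive \<gamma> z0 t) \<omega> * eigfun \<gamma> k (Z W \<gamma> z0 t \<omega>))" for \<omega>
        using s eig_pos[of "1 / s" k] by (simp add: w_def eigfun_def szZ U_def del: eig_pos)
      then show ?thesis unfolding A_def using eigfun_alive(1)[OF z0, of \<gamma> k] by simp
    qed
    also have "\<dots> = c * (eig \<tau> k * sin (real k * pi * uz z0))"
    proof -
      have "eig (1 / sz z0) k = eig \<tau> k * eig (1 / s) k" by (simp add: \<tau>_def flip: eig_add)
      moreover have "eig (1 / s) k \<noteq> 0" by (simp add: eig_def)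
      ultimately show ?thesis using s s0 by (simp add: eigfun_def c_def real_sqrt_divide)
    qed
    also have "\<dots> = R (\<lambda>u. sin (real k * pi * u))"
      using integral_heat_sin[OF \<tau> basis, of "uz z0"] by (simp add: R_def)
    finally have eq: "A (\<lambda>u. sin (real k * pi * u)) = R (\<lambda>u. sin (real k * pi * u))" .
    have "A (\<lambda>u. d * sin (real k * pi * u)) = d * A (\<lambda>u. sin (real k * pi * u))"
      unfolding A_def by (subst integral_mult_right_zero[symmetric]) (simp add: mult_ac)
    moreover have "R (\<lambda>u. d * sin (real k * pi * u)) = d * R (\<lambda>u. sin (real k * pi * u))"
    proof -
      have "integral {0..1} (\<lambda>v. heat \<tau> (uz z0) v * (d * sin (real k * pi * v)))
        = integral {0..1} (\<lambda>v. d * (heat \<tau> (uz z0) v * sin (real k * pi * v)))"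
        by (simp add: mult_ac)
      then show ?thesis unfolding R_def by (simp only: Henstock_Kurzweil_Integration.integral_mult_right) simp
    qed
    ultimately show ?case using eq by simp
  next
    case (add p q)
    have "A (\<lambda>u. p u + q u) = A p + A q"
      unfolding A_def distrib_left
      by (rule Bochner_Integration.integral_add) (use add int sp_cont in blast)+
    moreover have "R (\<lambda>u. p u + q u) = R p + R q"
      unfolding R_def distrib_left
      by (subst Henstock_Kurzweil_Integration.integral_add) (use add hi sp_cont in \<open>auto simp: distrib_left\<close>)
    ultimately show ?case using add by simp
  qed
  obtain B where B: "B > 0" "\<And>v. v \<in> {0..1} \<Longrightarrow> \<bar>heat \<tau> (uz z0) v\<bar> \<le> B"
  proof -
    have "bounded ((\<lambda>v. heat \<tau> (uz z0) v) ` {0..1})"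
      by (intro compact_imp_bounded compact_continuous_image hc) auto
    then obtain B where "\<forall>x\<in>(\<lambda>v. heat \<tau> (uz z0) v) ` {0..1}. norm x \<le> B" "B > 0" unfolding bounded_pos by blast
    then show ?thesis using that[of B] by auto
  qed
  have close: "\<bar>A f - R f\<bar> \<le> \<delta> * (exp s + c * B)" if \<delta>: "\<delta> > 0" for \<delta>
  proof -
    obtain p where p: "sine_poly p" "\<And>u. u \<in> {0..1} \<Longrightarrow> \<bar>f u - p u\<bar> \<le> \<delta>"
      using sine_poly_dense[OF continuous_on_subset[OF f(1) subset_UNIV] f(2,3) \<delta>] by auto
    note pc = sp_cont[OF p(1)]
    have "\<bar>A f - A p\<bar> \<le> \<delta> * exp s"
    proof -
      have "A f - A p = expectation (\<lambda>\<omega>. w \<omega> * f (U \<omega>) - w \<omega> * p (U \<omega>))"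
        unfolding A_def by (intro Bochner_Integration.integral_diff[symmetric] int f pc)
      also have "\<bar>\<dots>\<bar> \<le> expectation (\<lambda>\<omega>. \<bar>w \<omega> * f (U \<omega>) - w \<omega> * p (U \<omega>)\<bar>)" by (rule integral_abs_bound)
      also have "\<dots> \<le> expectation (\<lambda>\<omega>. \<delta> * exp s)"
      proof (rule integral_mono)
        show "integrable M (\<lambda>\<omega>. \<bar>w \<omega> * f (U \<omega>) - w \<omega> * p (U \<omega>)\<bar>)"
          using int[OF f(1)] int[OF pc] by auto
        show "\<bar>w \<omega> * f (U \<omega>) - w \<omega> * p (U \<omega>)\<bar> \<le> \<delta> * exp s" for \<omega>
        proof (cases "w \<omega> = 0")
          case False
          have "\<bar>w \<omega> * f (U \<omega>) - w \<omega> * p (U \<omega>)\<bar> = w \<omega> * \<bar>f (U \<omega>) - p (U \<omega>)\<bar>"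
            using w[of \<omega>] by (simp add: abs_mult flip: right_diff_distrib)
          also have "\<dots> \<le> exp s * \<delta>" using w[of \<omega>] p(2)[OF U01[OF False]] by (intro mult_mono) auto
          finally show ?thesis by (simp add: mult.commute)
        qed (use \<delta> in simp)
      qed simp
      finally show ?thesis by (simp add: prob_space)
    qed
    moreover have "\<bar>R f - R p\<bar> \<le> \<delta> * (c * B)"
    proof -
      have "R f - R p = c * integral {0..1} (\<lambda>v. heat \<tau> (uz z0) v * f v - heat \<tau> (uz z0) v * p v)"
        unfolding R_def using hi[OF f(1)] hi[OF pc] by (simp add: Henstock_Kurzweil_Integration.integral_diff right_diff_distrib)
      moreover have "norm (integral {0..1} (\<lambda>v. heat \<tau> (uz z0) v * f v - heat \<tau> (uz z0) v * p v)) \<le> integral {0..1} (\<lambda>v::real. B * \<delta>)"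
      proof (rule integral_norm_bound_integral)
        show "(\<lambda>v. heat \<tau> (uz z0) v * f v - heat \<tau> (uz z0) v * p v) integrable_on {0..1}"
          using hi[OF f(1)] hi[OF pc] by (intro integrable_diff)
        show "(\<lambda>v::real. B * \<delta>) integrable_on {0..1}" by (intro integrable_continuous_interval continuous_intros)
        fix v :: real assume v: "v \<in> {0..1}"
        have "norm (heat \<tau> (uz z0) v * f v - heat \<tau> (uz z0) v * p v) = \<bar>heat \<tau> (uz z0) v\<bar> * \<bar>f v - p v\<bar>"
          by (simp add: abs_mult flip: right_diff_distrib)
        also have "\<dots> \<le> B * \<delta>" using B p(2)[OF v] v by (intro mult_mono) auto
        finally show "norm (heat \<tau> (uz z0) v * f v - heat \<tau> (uz z0) v * p v) \<le> B * \<delta>" .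
      qed
      ultimately show ?thesis using c by (simp add: abs_mult mult_ac)
    qed
    ultimately show ?thesis using poly[OF p(1)] by (simp add: algebra_simps)
  qed
  have "A f = R f"
  proof (rule ccontr)
    assume ne: "A f \<noteq> R f"
    define K where "K = exp s + c * B"
    have K: "K > 0" using c B by (simp add: K_def add_pos_pos)
    have "\<bar>A f - R f\<bar> \<le> \<bar>A f - R f\<bar> / (2 * K) * K"
      using close[of "\<bar>A f - R f\<bar> / (2 * K)"] ne K by (simp add: K_def)
    then show False using ne K by simp
  qed
  then show ?thesis
    unfolding A_def R_def by (simp add: w_def U_def c_def \<tau>_def s_def mult.assoc)
qed

text \<open>
  If the kernel were negative near some \<open>v\<close>, a bump function there would give a
  negative expectation of a nonnegative random variable in \<open>alive_test\<close>.
\<close>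

lemma heat_nonneg:
  assumes "0 < \<tau>" "u \<in> {0..1}" "v \<in> {0..1}"
  shows "0 \<le> heat \<tau> u v"
proof (rule ccontr)
  assume "\<not> 0 \<le> heat \<tau> u v"
  then have neg: "heat \<tau> u v < 0" by simp
  have "u \<noteq> 0" "u \<noteq> 1" using neg by (auto simp: heat_def)
  then have u: "0 < u" "u < 1" using assms by auto
  have "v \<noteq> 0" using neg by (auto simp: heat_def)
  moreover have "v \<noteq> 1" using neg by (auto simp: heat_def)
  ultimately have v: "0 < v" "v < 1" using assms by auto
  have hc: "continuous_on UNIV (\<lambda>v. heat \<tau> u v)"
    by (intro continuous_intros) (use assms in auto)
  have "open {w. heat \<tau> u w < 0}" by (intro open_Collect_less hc continuous_intros)
  then have "open ({w. heat \<tau> u w < 0} \<inter> {0<..<1})" by auto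
  then obtain \<eta> where \<eta>: "\<eta> > 0" "ball v \<eta> \<subseteq> {w. heat \<tau> u w < 0} \<inter> {0<..<1}"
    using v neg unfolding open_contains_ball by fastforce
  define f where "f = (\<lambda>w. max 0 (\<eta> - \<bar>w - v\<bar>))"
  have fc: "continuous_on S f" for S unfolding f_def by (intro continuous_intros)
  have f_pos: "f w \<ge> 0" for w by (simp add: f_def)
  have f_zero: "f w = 0" if "w \<notin> ball v \<eta>" for w using that by (simp add: f_def dist_real_def)
  have f01: "f 0 = 0" "f 1 = 0" using \<eta>(2) by (auto intro!: f_zero)
  \<comment> \<open>Starting on the level \<open>s0\<close> and running for time \<open>s0\<close> gives
      the heat time \<open>1 / s0 - 1 / (2 s0) = \<tau>\<close>; the value
      \<open>1/2\<close> for the drift parameter is an arbitrary choice.\<close>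
  define s0 where "s0 = 1 / (2 * \<tau>)"
  define z0 where "z0 = (u * s0, (1 - u) * s0)"
  have s0: "s0 > 0" using assms by (simp add: s0_def)
  have z0: "z0 \<in> quadrant" "sz z0 = s0" "uz z0 = u"
    using u s0 by (auto simp: z0_def quadrant_def sz_def uz_def algebra_simps)
  have \<tau>: "1 / sz z0 - 1 / (sz z0 + s0) = \<tau>"
    using assms(1) by (simp add: z0 s0_def field_simps)
  have half: "0 < (1/2::real)" "(1/2::real) < 1" by auto
  have "0 \<le> expectation (\<lambda>\<omega>. indicator (alive (1/2) z0 s0) \<omega> * (prefactor (1/2) (Z W (1/2) z0 s0 \<omega>) * f (uz (Z W (1/2) z0 s0 \<omega>))))"
    by (intro Bochner_Integration.integral_nonneg) (auto simp: f_pos less_imp_le)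
  also have "\<dots> = prefactor (1/2) z0 * sqrt ((sz z0 + s0) / sz z0) * integral {0..1} (\<lambda>v. heat \<tau> u v * f v)"
    using alive_test[OF z0(1) s0 half fc f01] unfolding \<tau> z0(3) .
  finally have prod: "0 \<le> prefactor (1/2) z0 * sqrt ((sz z0 + s0) / sz z0) * integral {0..1} (\<lambda>v. heat \<tau> u v * f v)" .
  have "0 < prefactor (1/2) z0 * sqrt ((sz z0 + s0) / sz z0)" using s0 by (simp add: z0)
  then have "0 \<le> integral {0..1} (\<lambda>v. heat \<tau> u v * f v)" using prod by (meson linorder_not_le mult_pos_neg)
  have int: "(\<lambda>v. heat \<tau> u v * f v) integrable_on {0..1}"
    by (intro integrable_continuous_interval continuous_intros fc continuous_on_subset[OF hc]) auto
  have np: "0 \<le> - (heat \<tau> u w * f w)" for w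
  proof (cases "w \<in> ball v \<eta>")
    case True
    then have "heat \<tau> u w \<le> 0" using \<eta>(2) by auto
    then show ?thesis using f_pos[of w] by (simp add: mult_nonpos_nonneg)
  qed (simp add: f_zero)
  have cont: "continuous_on {0..1} (\<lambda>w. - (heat \<tau> u w * f w))"
    by (intro continuous_intros fc continuous_on_subset[OF hc]) auto
  have "integral {0..1} (\<lambda>w. - (heat \<tau> u w * f w)) \<ge> 0"
    using np by (intro Henstock_Kurzweil_Integration.integral_nonneg integrable_neg int) auto
  then have "integral {0..1} (\<lambda>w. - (heat \<tau> u w * f w)) = 0"
    using \<open>0 \<le> integral {0..1} (\<lambda>v. heat \<tau> u v * f v)\<close> by simp
  then have "\<forall>w\<in>{0..1}. - (heat \<tau> u w * f w) = 0"
    using integral_eq_0_iff[OF cont] np by simp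
  then have "heat \<tau> u v * f v = 0" using v by auto
  then show False using neg \<eta> by (simp add: f_def)
qed

end

lemma continuous_on_sz [continuous_intros]: "continuous_on S sz"
  unfolding sz_def by (intro continuous_intros)

lemma continuous_on_uz: "(\<And>z. z \<in> S \<Longrightarrow> sz z > 0) \<Longrightarrow> continuous_on S uz"
  unfolding uz_def sz_def by (intro continuous_intros) (metis less_irrefl)

lemma continuous_on_prefactor: "(\<And>z. z \<in> S \<Longrightarrow> sz z > 0) \<Longrightarrow> continuous_on S (prefactor \<gamma>)"
  unfolding prefactor_def sz_def by (intro continuous_intros) (metis less_irrefl mult_eq_0_iff zero_neq_numeral)

lemma continuous_on_green_kernel:
  assumes "sz z0 > 0" "\<And>z. z \<in> S \<Longrightarrow> sz z0 < sz z"
  shows "continuous_on S (green_kernel \<gamma> z0)"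
proof -
  have pos: "sz z > 0" "1 / sz z0 - 1 / sz z > 0" "sqrt (sz z0 * sz z) \<noteq> 0" "sz z \<noteq> 0" if "z \<in> S" for z
    using assms(1) assms(2)[OF that] by (auto simp: field_simps)
  have ne: "prefactor \<gamma> z \<noteq> 0" for z by (simp add: prefactor_def)
  show ?thesis
    unfolding green_kernel_def
    by (intro continuous_on_mult continuous_on_divide continuous_on_const continuous_on_heat
          continuous_on_diff continuous_on_real_sqrt continuous_on_sz continuous_on_prefactor continuous_on_uz ballI pos ne)
qed

text \<open>
  Otherwise the difference exceeds a positive constant on a small open set, and integrating
  over it contradicts the equality of the measures. Boundedness of \<open>g\<close> on that
  set keeps the integrals finite.
\<close>

lemma continuous_densities_le:
  fixes f g :: "real \<times> real \<Rightarrow> real"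
  assumes "open \<Omega>" "continuous_on \<Omega> f" "continuous_on \<Omega> g" "\<And>z. z \<in> \<Omega> \<Longrightarrow> 0 \<le> g z"
    and eq: "\<And>S. S \<in> sets borel \<Longrightarrow> S \<subseteq> \<Omega> \<Longrightarrow> (\<integral>\<^sup>+z\<in>S. ennreal (f z) \<partial>lborel) = (\<integral>\<^sup>+z\<in>S. ennreal (g z) \<partial>lborel)"
    and "z \<in> \<Omega>"
  shows "f z \<le> g z"
proof (rule ccontr)
  assume "\<not> f z \<le> g z"
  define \<eta> where "\<eta> = (f z - g z) / 2"
  have \<eta>: "\<eta> > 0" "g z + \<eta> < f z" using \<open>\<not> f z \<le> g z\<close> by (auto simp: \<eta>_def field_simps)
  define V where "V = {w \<in> \<Omega>. 0 < f w - g w - \<eta>} \<inter> {w \<in> \<Omega>. g w < g z + 1} \<inter> ball z 1"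
  have "open V"
  proof -
    have "open (\<Omega> \<inter> (\<lambda>w. f w - g w - \<eta>) -` {0<..})" "open (\<Omega> \<inter> g -` {..<g z + 1})"
      by (intro continuous_open_preimage continuous_intros assms; simp)+
    moreover have "{w \<in> \<Omega>. 0 < f w - g w - \<eta>} = \<Omega> \<inter> (\<lambda>w. f w - g w - \<eta>) -` {0<..}"
      "{w \<in> \<Omega>. g w < g z + 1} = \<Omega> \<inter> g -` {..<g z + 1}" by auto
    ultimately show ?thesis unfolding V_def by auto
  qed
  have zV: "z \<in> V" using \<open>z \<in> \<Omega>\<close> \<eta> by (simp add: V_def)
  have V\<Omega>: "V \<subseteq> \<Omega>" by (auto simp: V_def)
  have Vm [measurable]: "V \<in> sets borel" using \<open>open V\<close> by auto
  have gm: "(\<lambda>w. g w * indicator V w) \<in> borel_measurable borel"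
    using borel_measurable_continuous_on_indicator[OF Vm continuous_on_subset[OF assms(3) V\<Omega>]]
    by (simp add: mult.commute)
  have gm': "(\<lambda>w. ennreal (g w) * indicator V w) \<in> borel_measurable lborel"
  proof -
    have "(\<lambda>w. ennreal (g w) * indicator V w) = (\<lambda>w. ennreal (g w * indicator V w))"
      by (auto simp: indicator_def fun_eq_iff)
    then show ?thesis using gm by simp
  qed
  have fin: "emeasure lborel V < \<infinity>"
    by (rule order.strict_trans1[OF emeasure_mono emeasure_lborel_ball_finite[of z 1]]) (auto simp: V_def)
  have "(\<integral>\<^sup>+w\<in>V. ennreal (g w) \<partial>lborel) \<le> (\<integral>\<^sup>+w. ennreal (g z + 1) * indicator V w \<partial>lborel)"
    by (intro nn_integral_mono) (auto simp: indicator_def V_def intro!: ennreal_leI)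
  also have "\<dots> = ennreal (g z + 1) * emeasure lborel V" by (simp add: nn_integral_cmult)
  also have "\<dots> < \<infinity>" using fin by (simp add: ennreal_mult_less_top)
  finally have gfin: "(\<integral>\<^sup>+w\<in>V. ennreal (g w) \<partial>lborel) < \<infinity>" .
  have "(\<integral>\<^sup>+w\<in>V. ennreal (g w) \<partial>lborel) + ennreal \<eta> * emeasure lborel V
      = (\<integral>\<^sup>+w. ennreal (g w) * indicator V w + ennreal \<eta> * indicator V w \<partial>lborel)"
    using gm' by (subst nn_integral_add) (auto simp: nn_integral_cmult)
  also have "\<dots> \<le> (\<integral>\<^sup>+w\<in>V. ennreal (f w) \<partial>lborel)"
  proof (intro nn_integral_mono)
    fix w
    show "ennreal (g w) * indicator V w + ennreal \<eta> * indicator V w \<le> ennreal (f w) * indicator V w"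
    proof (cases "w \<in> V")
      case True
      then have "g w + \<eta> \<le> f w" "0 \<le> g w" using assms(4) by (auto simp: V_def)
      then show ?thesis using True \<eta> by (simp flip: ennreal_plus add: ennreal_leI)
    qed simp
  qed
  also have "\<dots> = (\<integral>\<^sup>+w\<in>V. ennreal (g w) \<partial>lborel)" by (rule eq[OF Vm V\<Omega>])
  finally have "(\<integral>\<^sup>+w\<in>V. ennreal (g w) \<partial>lborel) + ennreal \<eta> * emeasure lborel V
      \<le> (\<integral>\<^sup>+w\<in>V. ennreal (g w) \<partial>lborel) + 0" by simp
  from this[unfolded ennreal_add_left_cancel_le] have "ennreal \<eta> * emeasure lborel V = 0"
    using gfin by auto
  then have "emeasure lborel V = 0" using \<eta> by simp
  then have "V \<in> null_sets lborel" using Vm by (auto simp: null_sets_def)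
  then have "negligible V" using negligible_iff_null_sets null_sets_completionI by blast
  then show False using open_not_negligible[OF \<open>open V\<close>] zV by blast
qed

lemma continuous_densities_eq:
  fixes f g :: "real \<times> real \<Rightarrow> real"
  assumes "open \<Omega>" "continuous_on \<Omega> f" "continuous_on \<Omega> g" "\<And>z. z \<in> \<Omega> \<Longrightarrow> 0 \<le> f z" "\<And>z. z \<in> \<Omega> \<Longrightarrow> 0 \<le> g z"
    and eq: "\<And>S. S \<in> sets borel \<Longrightarrow> S \<subseteq> \<Omega> \<Longrightarrow> (\<integral>\<^sup>+z\<in>S. ennreal (f z) \<partial>lborel) = (\<integral>\<^sup>+z\<in>S. ennreal (g z) \<partial>lborel)"
    and "z \<in> \<Omega>"
  shows "f z = g z"
  by (rule order_antisym[OF continuous_densities_le[OF assms(1,2,3,5) eq assms(7)]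
        continuous_densities_le[OF assms(1,3,2,4) eq[symmetric] assms(7)]])

context standard_brownian_motion begin

lemma green_kernel_nonneg:
  assumes "z0 \<in> quadrant" "z \<in> quadrant" "sz z0 < sz z"
  shows "0 \<le> green_kernel \<gamma> z0 z"
proof -
  have "0 < sz z0" by (rule quadrant_sz_pos[OF assms(1)])
  then have "0 < 1 / sz z0 - 1 / sz z" "0 < sz z" using assms(3) by (auto simp: field_simps)
  then show ?thesis
    unfolding green_kernel_def using uz_quadrant[OF assms(1)] uz_quadrant[OF assms(2)] \<open>0 < sz z0\<close>
    by (intro mult_nonneg_nonneg divide_nonneg_nonneg heat_nonneg) (auto simp: less_imp_le)
qed

text \<open>
  \<open>alive_test\<close> for continuous functions that increase to the indicator of
  \<open>(c / s, 1)\<close> identifies the two measures on half-lines.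
\<close>

lemma alive_slice:
  assumes z0: "z0 \<in> quadrant" "0 < t" and \<gamma>: "0 < \<gamma>" "\<gamma> < 1" and B: "B \<in> sets borel"
  defines "s \<equiv> sz z0 + t"
  shows "emeasure M {\<omega> \<in> alive \<gamma> z0 t. fst (Z W \<gamma> z0 t \<omega>) \<in> B}
     = (\<integral>\<^sup>+x. ennreal (indicator {0<..<s} x * green_kernel \<gamma> z0 (x, s - x)) * indicator B x \<partial>lborel)"
proof -
  have s0: "sz z0 > 0" by (rule quadrant_sz_pos[OF z0(1)])
  have s: "s > 0" "s > sz z0" using s0 z0 by (auto simp: s_def)
  note [measurable] = measurable_Z_coords[OF less_imp_le[OF z0(2)]]
  have am [measurable]: "alive \<gamma> z0 t \<in> events" by (rule alive_in_events[OF z0])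
  define X where "X = (\<lambda>\<omega>. fst (Z W \<gamma> z0 t \<omega>))"
  have Xm [measurable]: "X \<in> borel_measurable M" unfolding X_def by measurable
  have szZ: "sz (Z W \<gamma> z0 t \<omega>) = s" for \<omega> by (simp add: sz_Z s_def)
  have uzZ: "uz (Z W \<gamma> z0 t \<omega>) = X \<omega> / s" for \<omega>
    using szZ[of \<omega>] by (simp add: uz_def sz_def X_def)
  have aliveX: "X \<omega> / s \<in> {0<..<1}" if "\<omega> \<in> alive \<gamma> z0 t" for \<omega>
    using uz_quadrant[OF alive_quadrant[OF that z0]] uzZ by simp
  define \<kappa> where "\<kappa> = (\<lambda>x. indicator {0<..<s} x * green_kernel \<gamma> z0 (x, s - x))"
  have szx: "sz (x, s - x) = s" "uz (x, s - x) = x / s" for x by (auto simp: sz_def uz_def)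
  have hk_c: "continuous_on S (\<lambda>x. green_kernel \<gamma> z0 (x, s - x))" for S
    by (rule continuous_on_compose2[OF continuous_on_green_kernel[of z0 "{z. sz z = s}"]])
       (use s0 s szx in \<open>auto intro!: continuous_intros\<close>)
  have \<kappa>_alt: "\<kappa> x = indicator {0..s} x * green_kernel \<gamma> z0 (x, s - x)" for x
  proof (cases "x = 0 \<or> x = s")
    case True
    then have "green_kernel \<gamma> z0 (x, s - x) = 0" using s by (auto simp: green_kernel_def szx heat_def)
    then show ?thesis by (simp add: \<kappa>_def)
  qed (auto simp: \<kappa>_def indicator_def)
  have \<kappa>_nn: "0 \<le> \<kappa> x" for x
    using green_kernel_nonneg[OF z0(1), of "(x, s - x)" \<gamma>] s szx by (auto simp: \<kappa>_def indicator_def quadrant_def)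
  have \<kappa>_int: "integrable lborel \<kappa>"
    unfolding \<kappa>_alt[abs_def]
    using borel_integrable_atLeastAtMost'[OF hk_c, of 0 s] by (simp add: set_integrable_def)
  have \<kappa>m [measurable]: "\<kappa> \<in> borel_measurable borel" using \<kappa>_int by auto
  define \<mu>1 where "\<mu>1 = distr (density M (indicator (alive \<gamma> z0 t))) borel X"
  define \<mu>2 where "\<mu>2 = density lborel (\<lambda>x. ennreal (\<kappa> x))"
  have \<mu>1: "emeasure \<mu>1 C = emeasure M {\<omega> \<in> alive \<gamma> z0 t. X \<omega> \<in> C}" if [measurable]: "C \<in> sets borel" for C
  proof -
    have "emeasure \<mu>1 C = (\<integral>\<^sup>+\<omega>. indicator (alive \<gamma> z0 t) \<omega> * indicator (X -` C \<inter> space M) \<omega> \<partial>M)"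
      unfolding \<mu>1_def by (simp add: emeasure_distr emeasure_density)
    also have "\<dots> = (\<integral>\<^sup>+\<omega>. indicator {\<omega> \<in> alive \<gamma> z0 t. X \<omega> \<in> C} \<omega> \<partial>M)"
      by (intro nn_integral_cong) (auto simp: indicator_def)
    also have "\<dots> = emeasure M {\<omega> \<in> alive \<gamma> z0 t. X \<omega> \<in> C}"
    proof (rule nn_integral_indicator)
      have "{\<omega> \<in> alive \<gamma> z0 t. X \<omega> \<in> C} = alive \<gamma> z0 t \<inter> (X -` C \<inter> space M)"
        by (auto simp: alive_def)
      then show "{\<omega> \<in> alive \<gamma> z0 t. X \<omega> \<in> C} \<in> events" using measurable_sets[OF Xm that] by auto
    qed
    finally show ?thesis .
  qed
  have \<mu>2: "emeasure \<mu>2 C = (\<integral>\<^sup>+x. ennreal (\<kappa> x) * indicator C x \<partial>lborel)" if "C \<in> sets borel" for C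
    unfolding \<mu>2_def using that by (simp add: emeasure_density)
  have "\<mu>1 = \<mu>2"
  proof (rule measure_eqI_lessThan)
    fix c :: real
    show "emeasure \<mu>1 {c<..} < \<infinity>"
      by (subst \<mu>1) (auto simp: emeasure_eq_measure)
    define c' where "c' = max 0 (c / s)"
    define F where "F = (\<lambda>(n::nat) u. min 1 (real n * max 0 (min (u - c') (1 - u))))"
    have F01: "0 \<le> F n u" "F n u \<le> 1" for n u by (auto simp: F_def)
    have Fc: "continuous_on S (F n)" for S n unfolding F_def by (intro continuous_intros)
    have "0 \<le> c'" by (simp add: c'_def)
    then have Fz: "F n 0 = 0" "F n 1 = 0" for n
      by (simp_all add: F_def max_absorb1 min_le_iff_disj)
    have Flim: "(\<lambda>n. F n u) \<longlonglongrightarrow> indicator {c'<..<1} u" for u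
    proof (cases "u \<in> {c'<..<1}")
      case True
      define m where "m = min (u - c') (1 - u)"
      have m: "m > 0" using True by (simp add: m_def)
      obtain N :: nat where N: "1 / m < real N" using reals_Archimedean2 by blast
      have "\<forall>\<^sub>F n in sequentially. F n u = 1"
        using eventually_ge_at_top[of N]
      proof eventually_elim
        case (elim n)
        then have "1 / m < real n" using N by (metis of_nat_le_iff order_less_le_trans)
        then have "1 < real n * m" using m by (simp add: field_simps)
        then show ?case using m unfolding F_def m_def[symmetric] by simp
      qed
      then show ?thesis using True by (simp add: tendsto_eventually)
    next
      case False
      then have "min (u - c') (1 - u) \<le> 0" by auto
      then have "F n u = 0" for n by (simp add: F_def max_absorb1)
      then show ?thesis using False by simp
    qed
    define e where "e = (\<lambda>u. exp (s * (u - (1 - \<gamma>))\<^sup>2 / 2))"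
    have e: "e u > 0" for u by (simp add: e_def)
    have ec: "continuous_on S e" for S unfolding e_def by (intro continuous_intros) auto
    have key: "expectation (\<lambda>\<omega>. indicator (alive \<gamma> z0 t) \<omega> * F n (X \<omega> / s)) = (\<integral>x. F n (x / s) * \<kappa> x \<partial>lborel)" for n
    proof -
      define f where "f = (\<lambda>u. F n u / e u)"
      have fc: "continuous_on S f" for S
        unfolding f_def using e by (intro continuous_intros Fc ec) (metis less_irrefl)
      have f01: "f 0 = 0" "f 1 = 0" by (simp_all add: f_def Fz)
      define \<tau> where "\<tau> = 1 / sz z0 - 1 / s"
      have \<tau>: "\<tau> > 0" using s s0 by (simp add: \<tau>_def field_simps)
      have "expectation (\<lambda>\<omega>. indicator (alive \<gamma> z0 t) \<omega> * F n (X \<omega> / s))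
        = expectation (\<lambda>\<omega>. indicator (alive \<gamma> z0 t) \<omega> * (prefactor \<gamma> (Z W \<gamma> z0 t \<omega>) * f (uz (Z W \<gamma> z0 t \<omega>))))"
      proof (intro Bochner_Integration.integral_cong refl)
        fix \<omega>
        have "prefactor \<gamma> (Z W \<gamma> z0 t \<omega>) = e (X \<omega> / s)"
          using prefactor_alt[of "Z W \<gamma> z0 t \<omega>" \<gamma>] s by (simp add: szZ uzZ e_def)
        then show "indicator (alive \<gamma> z0 t) \<omega> * F n (X \<omega> / s)
          = indicator (alive \<gamma> z0 t) \<omega> * (prefactor \<gamma> (Z W \<gamma> z0 t \<omega>) * f (uz (Z W \<gamma> z0 t \<omega>)))"
          using e[of "X \<omega> / s"] by (simp add: f_def uzZ)
      qed
      also have "\<dots> = prefactor \<gamma> z0 * sqrt (s / sz z0) * integral {0..1} (\<lambda>v. heat \<tau> (uz z0) v * f v)"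
        using alive_test[OF z0 \<gamma> fc f01] by (simp add: \<tau>_def s_def)
      also have "integral {0..1} (\<lambda>v. heat \<tau> (uz z0) v * f v) = (\<integral>v. indicator {0..1} v * (heat \<tau> (uz z0) v * f v) \<partial>lborel)"
      proof -
        have "continuous_on {0..1} (\<lambda>v. heat \<tau> (uz z0) v * f v)"
          by (intro continuous_intros fc) (use \<tau> in auto)
        from set_borel_integral_eq_integral(2)[OF borel_integrable_atLeastAtMost'[OF this]]
        show ?thesis by (simp add: set_lebesgue_integral_def)
      qed
      also have "prefactor \<gamma> z0 * sqrt (s / sz z0) * \<dots>
         = (\<integral>v. s * (F n v * \<kappa> (s * v)) \<partial>lborel)"
      proof (subst integral_mult_right_zero[symmetric], intro Bochner_Integration.integral_cong refl)
        fix v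
        have "green_kernel \<gamma> z0 (s * v, s - s * v) = prefactor \<gamma> z0 / e v / sqrt (sz z0 * s) * heat \<tau> (uz z0) v"
          unfolding green_kernel_def szx using s prefactor_alt[of "(s * v, s - s * v)" \<gamma>] by (simp add: szx e_def \<tau>_def)
        moreover have "indicator {0..s} (s * v) = (indicator {0..1} v :: real)"
          using s by (auto simp: indicator_def zero_le_mult_iff)
        moreover have "sqrt (s / sz z0) = s / sqrt (sz z0 * s)"
          using s s0 by (simp add: real_sqrt_divide real_sqrt_mult field_simps)
        ultimately show "prefactor \<gamma> z0 * sqrt (s / sz z0) * (indicator {0..1} v * (heat \<tau> (uz z0) v * f v)) = s * (F n v * \<kappa> (s * v))"
          by (simp add: \<kappa>_alt f_def mult_ac)
      qed
      also have "\<dots> = (\<integral>x. F n (x / s) * \<kappa> x \<partial>lborel)"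
        using lborel_integral_real_affine[of s "\<lambda>x. F n (x / s) * \<kappa> x" 0] s by simp
      finally show ?thesis .
    qed
    have [measurable]: "F n \<in> borel_measurable borel" for n by (rule borel_measurable_continuous_onI[OF Fc])
    have L: "(\<lambda>n. expectation (\<lambda>\<omega>. indicator (alive \<gamma> z0 t) \<omega> * F n (X \<omega> / s)))
        \<longlonglongrightarrow> expectation (\<lambda>\<omega>. indicator (alive \<gamma> z0 t) \<omega> * indicator {c'<..<1} (X \<omega> / s))"
    proof (rule integral_dominated_convergence[where w = "\<lambda>_. 1"])
      show "AE \<omega> in M. (\<lambda>n. indicator (alive \<gamma> z0 t) \<omega> * F n (X \<omega> / s)) \<longlonglongrightarrow> indicator (alive \<gamma> z0 t) \<omega> * indicator {c'<..<1} (X \<omega> / s)"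
        by (intro AE_I2 tendsto_mult tendsto_const Flim)
      show "AE \<omega> in M. norm (indicator (alive \<gamma> z0 t) \<omega> * F n (X \<omega> / s)) \<le> 1" for n
        using F01 by (intro AE_I2) (auto simp: indicator_def)
    qed (simp_all add: s)
    have R: "(\<lambda>n. \<integral>x. F n (x / s) * \<kappa> x \<partial>lborel) \<longlonglongrightarrow> (\<integral>x. indicator {c'<..<1} (x / s) * \<kappa> x \<partial>lborel)"
    proof (rule integral_dominated_convergence[OF _ _ \<kappa>_int])
      show "AE x in lborel. (\<lambda>n. F n (x / s) * \<kappa> x) \<longlonglongrightarrow> indicator {c'<..<1} (x / s) * \<kappa> x"
        by (intro AE_I2 tendsto_mult tendsto_const Flim)
      show "AE x in lborel. norm (F n (x / s) * \<kappa> x) \<le> \<kappa> x" for n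
        using mult_right_mono[OF F01(2) \<kappa>_nn] F01(1) \<kappa>_nn by (intro AE_I2) (simp add: abs_mult)
    qed measurable
    have eq: "expectation (\<lambda>\<omega>. indicator (alive \<gamma> z0 t) \<omega> * indicator {c'<..<1} (X \<omega> / s))
        = (\<integral>x. indicator {c'<..<1} (x / s) * \<kappa> x \<partial>lborel)"
      using L R unfolding key by (rule LIMSEQ_unique)
    have "emeasure \<mu>1 {c<..} = ennreal (expectation (\<lambda>\<omega>. indicator (alive \<gamma> z0 t) \<omega> * indicator {c'<..<1} (X \<omega> / s)))"
    proof -
      have "{\<omega> \<in> alive \<gamma> z0 t. X \<omega> \<in> {c<..}} = alive \<gamma> z0 t \<inter> (X -` {c<..} \<inter> space M)"
        by (auto simp: alive_def)
      then have ev: "{\<omega> \<in> alive \<gamma> z0 t. X \<omega> \<in> {c<..}} \<in> events" by simp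
      have "indicator (alive \<gamma> z0 t) \<omega> * indicator {c'<..<1} (X \<omega> / s) = (indicator {\<omega> \<in> alive \<gamma> z0 t. X \<omega> \<in> {c<..}} \<omega> :: real)" for \<omega>
      proof (cases "\<omega> \<in> alive \<gamma> z0 t")
        case True
        have "c / s < X \<omega> / s \<longleftrightarrow> c < X \<omega>" using s by (simp add: divide_less_cancel)
        then show ?thesis using aliveX[OF True] True by (auto simp: indicator_def c'_def)
      qed simp
      then have "expectation (\<lambda>\<omega>. indicator (alive \<gamma> z0 t) \<omega> * indicator {c'<..<1} (X \<omega> / s)) = prob {\<omega> \<in> alive \<gamma> z0 t. X \<omega> \<in> {c<..}}"
        using ev by simp
      then show ?thesis by (simp add: \<mu>1 emeasure_eq_measure)
    qed
    also have "\<dots> = ennreal (\<integral>x. \<kappa> x * indicator {c<..} x \<partial>lborel)"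
      unfolding eq
    proof (intro arg_cong[where f = ennreal] Bochner_Integration.integral_cong refl)
      fix x
      have "c / s < x / s \<longleftrightarrow> c < x" using s by (simp add: divide_less_cancel)
      then show "indicator {c'<..<1} (x / s) * \<kappa> x = \<kappa> x * indicator {c<..} x"
        using s by (auto simp: indicator_def \<kappa>_def c'_def)
    qed
    also have "\<dots> = (\<integral>\<^sup>+x. ennreal (\<kappa> x * indicator {c<..} x) \<partial>lborel)"
      using \<kappa>_nn by (intro nn_integral_eq_integral[symmetric] integrable_mult_indicator[where A = "{c<..}", simplified, OF _ \<kappa>_int, folded mult.commute] AE_I2)
        (auto intro!: integrable_real_mult_indicator \<kappa>_int)
    also have "\<dots> = emeasure \<mu>2 {c<..}"
      by (subst \<mu>2) (auto intro!: nn_integral_cong simp: indicator_def)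
    finally show "emeasure \<mu>1 {c<..} = emeasure \<mu>2 {c<..}" .
  qed (simp_all add: \<mu>1_def \<mu>2_def)
  then show ?thesis using \<mu>1[OF B] \<mu>2[OF B] by (simp add: X_def \<kappa>_def)
qed

text \<open>
  The time integral of the densities on the levels \<open>x + y = sz z0 + t\<close> is an
  integral over the plane, by the shear \<open>(x, t) \<mapsto> (x, sz z0 + t - x)\<close>;
  two continuous densities of the same measure agree pointwise.
\<close>

lemma green_eq_kernel:
  assumes z0: "z0 \<in> quadrant" and \<gamma>: "0 < \<gamma>" "\<gamma> < 1" and g: "is_green_density M W \<gamma> z0 g"
    and z: "z \<in> quadrant" "sz z0 < sz z"
  shows "g z = green_kernel \<gamma> z0 z"
proof -
  define \<Omega> where "\<Omega> = {z \<in> quadrant. sz z0 < sz z}"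
  have s0: "sz z0 > 0" by (rule quadrant_sz_pos[OF z0(1)])
  have "open \<Omega>"
  proof -
    have "\<Omega> = {0<..} \<times> {0<..} \<inter> {z. sz z0 < sz z}" by (auto simp: \<Omega>_def quadrant_def)
    then show ?thesis by (auto intro!: open_Int open_Times open_Collect_less continuous_intros)
  qed
  have gc: "continuous_on \<Omega> g"
  proof (rule continuous_on_subset)
    show "continuous_on (quadrant - {z0}) g" using g by (simp add: is_green_density_def)
  qed (auto simp: \<Omega>_def)
  have hc: "continuous_on \<Omega> (green_kernel \<gamma> z0)"
    by (rule continuous_on_green_kernel[OF s0]) (auto simp: \<Omega>_def)
  have eq: "(\<integral>\<^sup>+z\<in>S. ennreal (g z) \<partial>lborel) = (\<integral>\<^sup>+z\<in>S. ennreal (green_kernel \<gamma> z0 z) \<partial>lborel)"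
    if S [measurable]: "S \<in> sets borel" and S\<Omega>: "S \<subseteq> \<Omega>" for S
  proof -
    define k where "k = (\<lambda>z. ennreal (indicator S z * green_kernel \<gamma> z0 z))"
    have km [measurable]: "k \<in> borel_measurable borel"
      unfolding k_def
      using borel_measurable_continuous_on_indicator[OF S continuous_on_subset[OF hc S\<Omega>]] by simp
    have km2 [measurable]: "k \<in> borel_measurable (borel \<Otimes>\<^sub>M borel)" using km by (simp add: borel_prod)
    have k_zero: "k z = 0" if "z \<notin> \<Omega>" for z using that S\<Omega> by (auto simp: k_def indicator_def)
    have "(\<integral>\<^sup>+z\<in>S. ennreal (g z) \<partial>lborel) =
        (\<integral>\<^sup>+t\<in>{0..}. emeasure M {\<omega> \<in> space M. Z W \<gamma> z0 t \<omega> \<in> S \<and> ereal t < T W \<gamma> z0 \<omega>} \<partial>lborel)"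
    proof -
      have "S \<subseteq> quadrant" using S\<Omega> by (auto simp: \<Omega>_def)
      then show ?thesis using g S by (simp add: is_green_density_def)
    qed
    also have "\<dots> = (\<integral>\<^sup>+t. (\<integral>\<^sup>+x. k (x, sz z0 + t - x) \<partial>lborel) \<partial>lborel)"
    proof (intro nn_integral_cong_AE)
      have "AE t in lborel. t \<noteq> (0::real)" by (rule AE_lborel_singleton)
      then show "AE t in lborel. emeasure M {\<omega> \<in> space M. Z W \<gamma> z0 t \<omega> \<in> S \<and> ereal t < T W \<gamma> z0 \<omega>} * indicator {0..} t
         = (\<integral>\<^sup>+x. k (x, sz z0 + t - x) \<partial>lborel)"
      proof eventually_elim
        case (elim t)
        show ?case
        proof (cases "t > 0")
          case True
          define s where "s = sz z0 + t"
          define B where "B = (\<lambda>x. (x, s - x)) -` S"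
          have "(\<lambda>x. (x, s - x)) \<in> borel_measurable borel" by (intro borel_measurable_continuous_onI continuous_intros)
          from measurable_sets[OF this S] have Bm: "B \<in> sets borel" by (simp add: B_def)
          have "Z W \<gamma> z0 t \<omega> = (fst (Z W \<gamma> z0 t \<omega>), s - fst (Z W \<gamma> z0 t \<omega>))" for \<omega>
            using sz_Z[of W \<gamma> z0 t \<omega>] by (simp add: sz_def s_def prod_eq_iff)
          then have "{\<omega> \<in> space M. Z W \<gamma> z0 t \<omega> \<in> S \<and> ereal t < T W \<gamma> z0 \<omega>} = {\<omega> \<in> alive \<gamma> z0 t. fst (Z W \<gamma> z0 t \<omega>) \<in> B}"
            by (auto simp: alive_def B_def)
          then have "emeasure M {\<omega> \<in> space M. Z W \<gamma> z0 t \<omega> \<in> S \<and> ereal t < T W \<gamma> z0 \<omega>}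
             = (\<integral>\<^sup>+x. ennreal (indicator {0<..<s} x * green_kernel \<gamma> z0 (x, s - x)) * indicator B x \<partial>lborel)"
            using alive_slice[OF z0 True \<gamma> Bm] by (simp add: s_def)
          also have "\<dots> = (\<integral>\<^sup>+x. k (x, s - x) \<partial>lborel)"
          proof (intro nn_integral_cong)
            fix x
            have "x \<in> {0<..<s}" if "(x, s - x) \<in> S" using that S\<Omega> by (auto simp: \<Omega>_def quadrant_def)
            then show "ennreal (indicator {0<..<s} x * green_kernel \<gamma> z0 (x, s - x)) * indicator B x = k (x, s - x)"
              by (auto simp: k_def B_def indicator_def)
          qed
          finally show ?thesis using True by (simp add: s_def)
        next
          case False
          then have "k (x, sz z0 + t - x) = 0" for x
            by (intro k_zero) (auto simp: \<Omega>_def sz_def)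
          then show ?thesis using False elim by simp
        qed
      qed
    qed
    also have "\<dots> = (\<integral>\<^sup>+x. (\<integral>\<^sup>+t. k (x, sz z0 + t - x) \<partial>lborel) \<partial>lborel)"
      by (rule lborel_pair.Fubini') measurable
    also have "\<dots> = (\<integral>\<^sup>+x. (\<integral>\<^sup>+y. k (x, y) \<partial>lborel) \<partial>lborel)"
    proof (rule nn_integral_cong)
      fix x
      have "(\<lambda>y. k (x, y)) \<in> borel_measurable borel" by measurable
      from nn_integral_real_affine[OF this, of 1 "sz z0 - x"]
      show "(\<integral>\<^sup>+t. k (x, sz z0 + t - x) \<partial>lborel) = (\<integral>\<^sup>+y. k (x, y) \<partial>lborel)"
        by (simp add: algebra_simps)
    qed
    also have "\<dots> = (\<integral>\<^sup>+z. k z \<partial>(lborel \<Otimes>\<^sub>M lborel))"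
      by (rule lborel.nn_integral_fst) simp
    also have "\<dots> = (\<integral>\<^sup>+z\<in>S. ennreal (green_kernel \<gamma> z0 z) \<partial>lborel)"
      unfolding lborel_prod by (intro nn_integral_cong) (auto simp: k_def indicator_def)
    finally show ?thesis .
  qed
  show ?thesis
  proof (rule continuous_densities_eq[OF \<open>open \<Omega>\<close> gc hc _ _ eq])
    show "0 \<le> g z" if "z \<in> \<Omega>" for z using g that by (auto simp: is_green_density_def \<Omega>_def)
    show "0 \<le> green_kernel \<gamma> z0 z" if "z \<in> \<Omega>" for z
      using that green_kernel_nonneg[OF z0] by (auto simp: \<Omega>_def)
    show "z \<in> \<Omega>" using z by (simp add: \<Omega>_def)
  qed
qed

end

section \<open>From images to the heat kernel\<close>

text \<open>
  Then \<open>f\<close> is orthogonal to all sine polynomials, hence to itself by density.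
\<close>

lemma sine_coefficients_zero:
  assumes f: "continuous_on {0..1} f" "f 0 = 0" "f 1 = 0"
    and mom: "\<And>k. k \<ge> 1 \<Longrightarrow> integral {0..1} (\<lambda>u. f u * sin (real k * pi * u)) = 0"
    and "u \<in> {0..1}"
  shows "f u = 0"
proof -
  have int: "(\<lambda>u. f u * g u) integrable_on {0..1}" if "continuous_on {0..1} g" for g :: "real \<Rightarrow> real"
    by (intro integrable_continuous_interval continuous_intros f that)
  have sp: "continuous_on {0..1} p \<and> integral {0..1} (\<lambda>u. f u * p u) = 0" if "sine_poly p" for p
    using that
  proof induction
    case (basis k c)
    have "integral {0..1} (\<lambda>u. f u * (c * sin (real k * pi * u))) = integral {0..1} (\<lambda>u. c * (f u * sin (real k * pi * u)))"
      by (simp add: mult_ac)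
    also have "\<dots> = 0" using mom[OF basis] by (simp only: Henstock_Kurzweil_Integration.integral_mult_right mult_zero_right)
    finally show ?case by (auto intro!: continuous_intros)
  next
    case (add p q)
    then show ?case
      using int[of p] int[of q] by (auto intro!: continuous_intros simp: distrib_left Henstock_Kurzweil_Integration.integral_add)
  qed
  obtain C where C: "C > 0" "\<And>u. u \<in> {0..1} \<Longrightarrow> \<bar>f u\<bar> \<le> C"
  proof -
    have "bounded (f ` {0..1})"
      by (intro compact_imp_bounded compact_continuous_image f compact_Icc)
    then obtain B where "B > 0" "\<forall>x\<in>f ` {0..1}. norm x \<le> B" unfolding bounded_pos by blast
    then show ?thesis using that[of B] by auto
  qed
  have "integral {0..1} (\<lambda>u. f u * f u) \<le> 0"
  proof (rule field_le_epsilon)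
    fix e :: real assume e: "0 < e"
    define \<delta> where "\<delta> = e / C"
    have \<delta>: "0 < \<delta>" using e C by (simp add: \<delta>_def)
    obtain p where p: "sine_poly p" "\<And>u. u \<in> {0..1} \<Longrightarrow> \<bar>f u - p u\<bar> \<le> \<delta>"
      using sine_poly_dense[OF f \<delta>] by auto
    have pc: "continuous_on {0..1} p" using sp[OF p(1)] by simp
    have "integral {0..1} (\<lambda>u. f u * f u) = integral {0..1} (\<lambda>u. f u * f u) - integral {0..1} (\<lambda>u. f u * p u)"
      using sp[OF p(1)] by simp
    also have "\<dots> = integral {0..1} (\<lambda>u. f u * f u - f u * p u)"
      by (intro Henstock_Kurzweil_Integration.integral_diff[symmetric] int f pc)
    also have "\<dots> \<le> integral {0..1} (\<lambda>u::real. C * \<delta>)"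
    proof (rule integral_le)
      show "(\<lambda>u. f u * f u - f u * p u) integrable_on {0..1}" by (intro integrable_diff int f pc)
      show "(\<lambda>u::real. C * \<delta>) integrable_on {0..1}" by (intro integrable_continuous_interval continuous_intros)
      show "f u * f u - f u * p u \<le> C * \<delta>" if u: "u \<in> {0..1}" for u
      proof -
        have "f u * f u - f u * p u \<le> \<bar>f u\<bar> * \<bar>f u - p u\<bar>"
          by (simp flip: right_diff_distrib abs_mult)
        also have "\<dots> \<le> C * \<delta>" using C p(2)[OF u] u by (intro mult_mono) auto
        finally show ?thesis .
      qed
    qed
    also have "\<dots> = e" using C by (simp add: \<delta>_def)
    finally show "integral {0..1} (\<lambda>u. f u * f u) \<le> 0 + e" by simp
  qed
  moreover have "integral {0..1} (\<lambda>u. f u * f u) \<ge> 0"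
    by (intro Henstock_Kurzweil_Integration.integral_nonneg int f) auto
  ultimately have "integral {0..1} (\<lambda>u. f u * f u) = 0" by simp
  moreover have "continuous_on {0..1} (\<lambda>u. f u * f u)" by (intro continuous_intros f)
  ultimately have "\<forall>u\<in>{0..1}. f u * f u = 0"
    using integral_eq_0_iff[of 0 1 "\<lambda>u. f u * f u"] by simp
  then show ?thesis using assms(5) by simp
qed

lemma gsum_uniform_limit:
  assumes "0 < s" "\<And>u. u \<in> S \<Longrightarrow> - 1 \<le> v u"
  shows "uniform_limit S (\<lambda>N u. \<Sum>n<N. exp (- (s * (v u + 2 * real n)\<^sup>2 / 2))) (\<lambda>u. gsum s (v u)) sequentially"
  unfolding gsum_def
proof (rule Weierstrass_m_test)
  show "summable (\<lambda>n. exp (1 / (2 * s) + 1) * exp (- 2 :: real) ^ n)"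
    by (intro summable_mult summable_geometric) simp
  fix n u assume "u \<in> S"
  define w where "w = v u + 2 * real n"
  have "0 \<le> (s * w - 1)\<^sup>2 / (2 * s)" using assms by simp
  also have "\<dots> = s * w\<^sup>2 / 2 - w + 1 / (2 * s)"
    using assms by (simp add: power2_eq_square field_simps)
  finally have "- (s * w\<^sup>2 / 2) \<le> 1 / (2 * s) + 1 + real n * (- 2)"
    using assms(2)[OF \<open>u \<in> S\<close>] by (simp add: w_def)
  then have "exp (- (s * w\<^sup>2 / 2)) \<le> exp (1 / (2 * s) + 1 + real n * (- 2))" by simp
  also have "\<dots> = exp (1 / (2 * s) + 1) * exp (- 2) ^ n" by (simp only: exp_add exp_of_nat_mult)
  finally show "norm (exp (- (s * (v u + 2 * real n)\<^sup>2 / 2))) \<le> exp (1 / (2 * s) + 1) * exp (- 2) ^ n"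
    by (simp add: w_def)
qed

lemma continuous_on_gsum [continuous_intros]:
  assumes "0 < s" "continuous_on S f"
  shows "continuous_on S (\<lambda>x. gsum s (f x))"
proof -
  have "continuous_on UNIV (gsum s)"
    using gsumd_has_derivative[OF assms(1)] by (auto intro!: DERIV_isCont simp: continuous_on_eq_continuous_at)
  then show ?thesis by (rule continuous_on_compose2[OF _ assms(2)]) simp
qed

lemma integral_translate:
  fixes q :: "real \<Rightarrow> real"
  assumes "continuous_on UNIV q"
  shows "integral {0..1} (\<lambda>u. q (u + c)) = integral {c..c + 1} q"
    and "integral {0..1} (\<lambda>u. q (c - u)) = integral {c - 1..c} q"
proof -
  have L: "integral {a..b} r = (\<integral>x. indicator {a..b} x * r x \<partial>lborel)" if "continuous_on UNIV r" for r :: "real \<Rightarrow> real" and a b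
    using set_borel_integral_eq_integral(2)[OF borel_integrable_atLeastAtMost'[OF continuous_on_subset[OF that subset_UNIV]]]
    by (simp add: set_lebesgue_integral_def)
  have 1: "continuous_on UNIV (\<lambda>u. q (u + c))" "continuous_on UNIV (\<lambda>u. q (c - u))"
    by (intro continuous_on_compose2[OF assms] continuous_intros; simp)+
  show "integral {0..1} (\<lambda>u. q (u + c)) = integral {c..c + 1} q"
    unfolding L[OF 1(1)] L[OF assms]
    by (subst lborel_integral_real_affine[of 1 _ c]) (auto intro!: Bochner_Integration.integral_cong simp: indicator_def add.commute)
  show "integral {0..1} (\<lambda>u. q (c - u)) = integral {c - 1..c} q"
    unfolding L[OF 1(2)] L[OF assms]
    by (subst lborel_integral_real_affine[of "- 1" _ c]) (auto intro!: Bochner_Integration.integral_cong simp: indicator_def)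
qed

text \<open>
  The image series without its prefactor, as a function on the interval.
\<close>

definition image_sum :: "real \<Rightarrow> real \<Rightarrow> real \<Rightarrow> real" where
  "image_sum s a u = gsum s (u - a) + gsum s (a + 2 - u) - gsum s (u + a) - gsum s (2 - a - u)"

text \<open>
  The images unfold the interval: integrating the image sum over \<open>[0, 1]\<close> against
  an odd function of period \<open>2\<close> is integrating a single Gaussian over the line.
  This plays the role of Poisson summation.
\<close>

lemma integral_image_sum_sin:
  assumes "0 < s" "a \<in> {0..1}" "k \<ge> 1"
  shows "integral {0..1} (\<lambda>u. image_sum s a u * sin (real k * pi * u))
      = sqrt (2 * pi / s) * (eig (1 / s) k * sin (real k * pi * a))"
proof -
  define \<psi> where "\<psi> = (\<lambda>x. exp (- (s * (x - a)\<^sup>2 / 2)))"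
  define q where "q = (\<lambda>x. \<psi> x * sin (real k * pi * x))"
  have qc: "continuous_on S q" for S unfolding q_def \<psi>_def by (intro continuous_intros) auto
  have qint: "q integrable_on {c..d}" for c d by (intro integrable_continuous_interval qc)
  define S where "S = (\<lambda>N u. (\<Sum>n<N. \<psi> (u + 2 * real n)) + (\<Sum>n<N. \<psi> (u - 2 - 2 * real n))
     - (\<Sum>n<N. \<psi> (- u - 2 * real n)) - (\<Sum>n<N. \<psi> (2 - u + 2 * real n)))"
  have Slim: "uniform_limit {0..1} (\<lambda>N u. S N u * sin (real k * pi * u)) (\<lambda>u. image_sum s a u * sin (real k * pi * u)) sequentially"
  proof -
    have e: "\<psi> (u + 2 * real n) = exp (- (s * ((u - a) + 2 * real n)\<^sup>2 / 2))"
      "\<psi> (u - 2 - 2 * real n) = exp (- (s * ((a + 2 - u) + 2 * real n)\<^sup>2 / 2))"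
      "\<psi> (- u - 2 * real n) = exp (- (s * ((u + a) + 2 * real n)\<^sup>2 / 2))"
      "\<psi> (2 - u + 2 * real n) = exp (- (s * ((2 - a - u) + 2 * real n)\<^sup>2 / 2))" for u n
      by (simp_all add: \<psi>_def power2_eq_square algebra_simps)
    have "uniform_limit {0..1} S (image_sum s a) sequentially"
      unfolding S_def[abs_def] image_sum_def[abs_def] e(4) unfolding e(2,3) unfolding e(1)
      by (intro uniform_limit_add uniform_limit_minus gsum_uniform_limit) (use assms in auto)
    moreover have "bounded (image_sum s a ` {0..1})"
      unfolding image_sum_def
      by (intro compact_imp_bounded compact_continuous_image continuous_intros assms(1)) auto
    moreover have "bounded ((\<lambda>u. sin (real k * pi * u)) ` {0..1})"
      by (intro compact_imp_bounded compact_continuous_image continuous_intros) auto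
    ultimately show ?thesis by (intro uniform_lim_mult uniform_limit_const)
  qed
  have \<psi>c: "continuous_on A \<psi>" for A unfolding \<psi>_def by (intro continuous_intros) auto
  have c2: "continuous_on A (\<lambda>u. \<psi> (f u))" if "continuous_on A f" for A and f :: "real \<Rightarrow> real"
    by (rule continuous_on_compose2[OF \<psi>c[of UNIV] that]) simp
  have Scont: "continuous_on {0..1} (\<lambda>u. S N u * sin (real k * pi * u))" for N
    unfolding S_def by (intro continuous_intros c2)
  obtain I J where IJ: "\<And>N. ((\<lambda>u. S N u * sin (real k * pi * u)) has_integral I N) {0..1}"
     "((\<lambda>u. image_sum s a u * sin (real k * pi * u)) has_integral J) {0..1}" "I \<longlonglongrightarrow> J"
    by (rule uniform_limit_integral[OF Slim Scont]) auto
  \<comment> \<open>The partial sum with \<open>N\<close> terms in each half-series covers the interval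
      \<open>[- 2N, 2N]\<close> exactly once.\<close>
  have I_eq: "I N = integral {- 2 * real N..2 * real N} q" for N
  proof (induction N)
    case 0
    then show ?case using IJ(1)[of 0] by (simp add: S_def has_integral_iff)
  next
    case (Suc N)
    have per: "sin (real k * pi * (u + 2 * real n)) = sin (real k * pi * u)"
       "sin (real k * pi * (u + (- 2 - 2 * real n))) = sin (real k * pi * u)"
       "sin (real k * pi * (- (2 * real n) - u)) = - sin (real k * pi * u)"
       "sin (real k * pi * (2 + 2 * real n - u)) = - sin (real k * pi * u)" for u n
    proof -
      have p: "sin (x + real m * (2 * pi)) = sin x" "sin (x - real m * (2 * pi)) = sin x" for x and m :: nat
      proof -
        have e: "real m * (2 * pi) = 2 * real m * pi" by simp
        show "sin (x + real m * (2 * pi)) = sin x" "sin (x - real m * (2 * pi)) = sin x"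
          unfolding e sin_add sin_diff sin_2npi cos_2npi by simp_all
      qed
      show "sin (real k * pi * (u + 2 * real n)) = sin (real k * pi * u)"
        using p(1)[of "real k * pi * u" "k * n"] by (simp add: algebra_simps)
      show "sin (real k * pi * (u + (- 2 - 2 * real n))) = sin (real k * pi * u)"
        using p(2)[of "real k * pi * u" "k * (n + 1)"] by (simp add: algebra_simps)
      show "sin (real k * pi * (- (2 * real n) - u)) = - sin (real k * pi * u)"
      proof -
        have "real k * pi * (- (2 * real n) - u) = - (real k * pi * u) - real (k * n) * (2 * pi)"
          by (simp add: algebra_simps)
        then show ?thesis by (simp only: p(2) sin_minus)
      qed
      show "sin (real k * pi * (2 + 2 * real n - u)) = - sin (real k * pi * u)"
      proof -
        have "real k * pi * (2 + 2 * real n - u) = - (real k * pi * u) + real (k * (n + 1)) * (2 * pi)"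
          by (simp add: algebra_simps)
        then show ?thesis by (simp only: p(1) sin_minus)
      qed
    qed
    have eq: "S (Suc N) u * sin (real k * pi * u) = S N u * sin (real k * pi * u)
        + q (u + 2 * real N) + q (u + (- 2 - 2 * real N)) + q (- (2 * real N) - u) + q (2 + 2 * real N - u)" for u
    proof -
      have "\<psi> (- u - 2 * real N) = \<psi> (- (2 * real N) - u)" "\<psi> (2 - u + 2 * real N) = \<psi> (2 + 2 * real N - u)"
        "\<psi> (u - 2 - 2 * real N) = \<psi> (u + (- 2 - 2 * real N))"
        by (rule arg_cong[where f = \<psi>], simp)+
      then have "S (Suc N) u = S N u + \<psi> (u + 2 * real N) + \<psi> (u + (- 2 - 2 * real N))
          - \<psi> (- (2 * real N) - u) - \<psi> (2 + 2 * real N - u)"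
        by (simp only: S_def sum.lessThan_Suc)
      then show ?thesis unfolding q_def per by (simp only: left_diff_distrib distrib_right)
    qed
    have qi: "(\<lambda>u. q (f u)) integrable_on {0..1}" if "continuous_on {0..1} f" for f :: "real \<Rightarrow> real"
      by (intro integrable_continuous_interval continuous_on_compose2[OF qc[of UNIV] that]) auto
    have "I (Suc N) = I N + integral {0..1} (\<lambda>u. q (u + 2 * real N)) + integral {0..1} (\<lambda>u. q (u + (- 2 - 2 * real N)))
        + integral {0..1} (\<lambda>u. q (- (2 * real N) - u)) + integral {0..1} (\<lambda>u. q (2 + 2 * real N - u))"
    proof -
      have "((\<lambda>u. S (Suc N) u * sin (real k * pi * u)) has_integral
        (I N + integral {0..1} (\<lambda>u. q (u + 2 * real N)) + integral {0..1} (\<lambda>u. q (u + (- 2 - 2 * real N)))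
        + integral {0..1} (\<lambda>u. q (- (2 * real N) - u)) + integral {0..1} (\<lambda>u. q (2 + 2 * real N - u)))) {0..1}"
        unfolding eq by (intro has_integral_add IJ(1) integrable_integral qi continuous_intros)
      then show ?thesis using IJ(1)[of "Suc N"] has_integral_unique by blast
    qed
    also have "\<dots> = integral {- 2 * real N..2 * real N} q + integral {2 * real N..2 * real N + 1} q
        + integral {- 2 - 2 * real N..- 1 - 2 * real N} q
        + integral {- (2 * real N) - 1..- (2 * real N)} q + integral {2 * real N + 1..2 * real N + 2} q"
      unfolding Suc integral_translate[OF qc] by (simp add: algebra_simps)
    also have "\<dots> = integral {- 2 * real (Suc N)..2 * real (Suc N)} q"
    proof -
      have 1: "integral {- 2 - 2 * real N..- 1 - 2 * real N} q + integral {- 1 - 2 * real N..- (2 * real N)} q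
          = integral {- 2 - 2 * real N..- (2 * real N)} q"
        by (intro Henstock_Kurzweil_Integration.integral_combine qint) auto
      have 2: "integral {2 * real N..2 * real N + 1} q + integral {2 * real N + 1..2 * real N + 2} q
          = integral {2 * real N..2 * real N + 2} q"
        by (intro Henstock_Kurzweil_Integration.integral_combine qint) auto
      have 3: "integral {- 2 - 2 * real N..- (2 * real N)} q + integral {- (2 * real N)..2 * real N} q
          = integral {- 2 - 2 * real N..2 * real N} q"
        by (intro Henstock_Kurzweil_Integration.integral_combine qint) auto
      have 4: "integral {- 2 - 2 * real N..2 * real N} q + integral {2 * real N..2 * real N + 2} q
          = integral {- 2 - 2 * real N..2 * real N + 2} q"
        by (intro Henstock_Kurzweil_Integration.integral_combine qint) auto
      have "- (2 * real N) - 1 = - 1 - 2 * real N" "- 2 * real (Suc N) = - 2 - 2 * real N"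
        "2 * real (Suc N) = 2 * real N + 2" "- 2 * real N = - (2 * real N)" by simp_all
      then show ?thesis using 1 2 3 4 by (simp only:)
    qed
    finally show ?case .
  qed
  have "(\<lambda>N. integral {- 2 * real N..2 * real N} q) \<longlonglongrightarrow> (\<integral>x. q x \<partial>lborel)"
  proof -
    have gi: "integrable lborel q"
      using integral_gauss_sin(1)[OF assms(1), of a "real k * pi"] unfolding q_def \<psi>_def by (simp add: power2_commute)
    have "integral {- 2 * real N..2 * real N} q = (\<integral>x. indicator {- 2 * real N..2 * real N} x * q x \<partial>lborel)" for N
      using set_borel_integral_eq_integral(2)[OF borel_integrable_atLeastAtMost'[OF qc]]
      by (simp add: set_lebesgue_integral_def)
    moreover have "(\<lambda>N. \<integral>x. indicator {- 2 * real N..2 * real N} x * q x \<partial>lborel) \<longlonglongrightarrow> (\<integral>x. q x \<partial>lborel)"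
    proof (rule integral_dominated_convergence[where w = "\<lambda>x. norm (q x)"])
      show "AE x in lborel. (\<lambda>N. indicator {- 2 * real N..2 * real N} x * q x) \<longlonglongrightarrow> q x"
      proof (rule AE_I2)
        fix x :: real
        obtain m :: nat where m: "\<bar>x\<bar> < real m" using reals_Archimedean2 by blast
        have "\<forall>\<^sub>F N in sequentially. indicator {- 2 * real N..2 * real N} x * q x = q x"
          using eventually_ge_at_top[of m]
        proof eventually_elim
          case (elim N)
          then have "real m \<le> real N" by simp
          then show ?case using m by (auto simp: indicator_def)
        qed
        then show "(\<lambda>N. indicator {- 2 * real N..2 * real N} x * q x) \<longlonglongrightarrow> q x" by (rule tendsto_eventually)
      qed
      show "q \<in> borel_measurable lborel" using gi by auto
      then show "(\<lambda>x. indicator {- 2 * real N..2 * real N} x * q x) \<in> borel_measurable lborel" for N by auto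
      show "integrable lborel (\<lambda>x. norm (q x))" using gi by auto
      show "AE x in lborel. norm (indicator {- 2 * real N..2 * real N} x * q x) \<le> norm (q x)" for N
        by (intro AE_I2) (auto simp: indicator_def)
    qed
    ultimately show ?thesis by simp
  qed
  moreover have "I = (\<lambda>N. integral {- 2 * real N..2 * real N} q)" using I_eq by blast
  ultimately have "I \<longlonglongrightarrow> (\<integral>x. q x \<partial>lborel)" by simp
  then have "J = (\<integral>x. q x \<partial>lborel)" by (rule LIMSEQ_unique[OF IJ(3)])
  also have "\<dots> = sqrt (2 * pi / s) * exp (- ((real k * pi)\<^sup>2 / (2 * s))) * sin (real k * pi * a)"
    using integral_gauss_sin(2)[OF assms(1), of a "real k * pi"] unfolding q_def \<psi>_def by (simp add: power2_commute)
  also have "\<dots> = sqrt (2 * pi / s) * (eig (1 / s) k * sin (real k * pi * a))"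
    by (simp add: eig_def)
  finally show ?thesis using IJ(2) by (simp add: integral_unique)
qed

text \<open>
  Both sides are continuous, vanish at the ends and have the same sine coefficients.
\<close>

lemma image_sum_eq_heat:
  assumes "0 < s" "a \<in> {0..1}" "u \<in> {0..1}"
  shows "image_sum s a u = sqrt (2 * pi / s) * heat (1 / s) u a"
proof -
  define D where "D = (\<lambda>u. image_sum s a u - sqrt (2 * pi / s) * heat (1 / s) u a)"
  have ic: "continuous_on {0..1} (image_sum s a)"
    unfolding image_sum_def by (intro continuous_intros assms(1))
  have hc: "continuous_on {0..1} (\<lambda>u. heat (1 / s) u a)"
    by (intro continuous_intros) (use assms in auto)
  have "D u = 0"
  proof (rule sine_coefficients_zero[OF _ _ _ _ assms(3)])
    show "continuous_on {0..1} D" unfolding D_def by (intro continuous_intros ic hc)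
    show "D 0 = 0" using gsum_step[OF assms(1), of a] gsum_step[OF assms(1), of "- a"]
      by (simp add: D_def image_sum_def heat_def)
    show "D 1 = 0" by (simp add: D_def image_sum_def heat_def algebra_simps)
    fix k :: nat assume k: "k \<ge> 1"
    have "integral {0..1} (\<lambda>u. D u * sin (real k * pi * u)) = integral {0..1} (\<lambda>u. image_sum s a u * sin (real k * pi * u))
       - integral {0..1} (\<lambda>u. sqrt (2 * pi / s) * (sin (pi * a) * (qheat (1 / s) u a * sin (real k * pi * u))))"
      unfolding D_def left_diff_distrib
      by (subst Henstock_Kurzweil_Integration.integral_diff)
         (auto intro!: integrable_continuous_interval continuous_intros ic hc simp: heat_def mult_ac assms(1))
    also have "integral {0..1} (\<lambda>u. sqrt (2 * pi / s) * (sin (pi * a) * (qheat (1 / s) u a * sin (real k * pi * u))))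
       = sqrt (2 * pi / s) * (sin (pi * a) * (eig (1 / s) k * chU k a))"
      using integral_qheat_sin[OF _ k, of "1 / s" a] assms(1)
      by (simp only: Henstock_Kurzweil_Integration.integral_mult_right zero_less_divide_1_iff)
    also have "sin (pi * a) * (eig (1 / s) k * chU k a) = eig (1 / s) k * (sin (pi * a) * chU k a)" by simp
    finally show "integral {0..1} (\<lambda>u. D u * sin (real k * pi * u)) = 0"
      using integral_image_sum_sin[OF assms(1,2) k] by (simp only: sin_mult_chU diff_self)
  qed
  then show ?thesis by (simp add: D_def)
qed

lemma gsumd_step: "0 < s \<Longrightarrow> gsumd s v = s * v * exp (- (s * v\<^sup>2 / 2)) + gsumd s (v + 2)"
  using suminf_split_head[OF summable_norm_cancel[OF summable_gsumd], of s v] by (simp add: gsumd_def algebra_simps)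

text \<open>
  The Martin kernel with pole \<open>a\<close> before normalisation at \<open>(1, 1)\<close>:
  the solution of the heat equation that starts from a point mass at \<open>a\<close>, divided
  by \<open>sin (pi a)\<close>.
\<close>

definition mkern :: "real \<Rightarrow> real \<Rightarrow> real \<times> real \<Rightarrow> real" where
  "mkern \<gamma> a z = prefactor \<gamma> z / sqrt (sz z) * qheat (1 / sz z) (uz z) a"

lemma image_series_eq_mkern:
  assumes "a \<in> {0..1}" "z \<in> quadrant"
  shows "image_series \<gamma> a z = sqrt (2 * pi) * sin (pi * a) * mkern \<gamma> a z"
proof -
  have s: "sz z > 0" by (rule quadrant_sz_pos[OF assms(2)])
  have u: "uz z \<in> {0..1}" using uz_quadrant[OF assms(2)] by auto
  have "image_series \<gamma> a z = prefactor \<gamma> z * image_sum (sz z) a (uz z)" by (simp add: image_series_def image_sum_def)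
  then show ?thesis
    using image_sum_eq_heat[OF s assms(1) u] s by (simp add: mkern_def heat_def real_sqrt_divide)
qed

text \<open>
  Differentiating \<open>image_sum_eq_heat\<close> in \<open>a\<close> at \<open>a =
  1\<close>: the kernel is \<open>sin (pi a)\<close> times \<open>qheat\<close>, so its
  derivative there is \<open>- pi\<close> times \<open>qheat\<close>.
\<close>

lemma image_series_deriv_eq_mkern:
  assumes "z \<in> quadrant"
  shows "image_series_deriv \<gamma> z = sqrt (2 * pi) * (pi / 2) * mkern \<gamma> 1 z"
proof -
  define s u where "s = sz z" and "u = uz z"
  have s: "s > 0" using quadrant_sz_pos[OF assms] by (simp add: s_def)
  have u: "u \<in> {0..1}" using uz_quadrant[OF assms] by (auto simp: u_def)
  define \<phi> where "\<phi> = (\<lambda>a. image_sum s a u)"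
  define d where "d = gsumd s (u - 1) - gsumd s (3 - u) + gsumd s (u + 1) - gsumd s (1 - u)"
  have chain: "((\<lambda>a. gsum s (c + e * a)) has_real_derivative - gsumd s (c + e * 1) * e) (at 1)" for c e
    by (rule DERIV_chain2[OF gsumd_has_derivative[OF s]]) (auto intro!: derivative_eq_intros)
  have "(\<phi> has_real_derivative d) (at 1)"
  proof -
    have "((\<lambda>a. gsum s (u + (- 1) * a) + gsum s ((2 - u) + 1 * a) - gsum s (u + 1 * a) - gsum s ((2 - u) + (- 1) * a)) has_real_derivative
       (- gsumd s (u + (- 1) * 1) * (- 1) + - gsumd s ((2 - u) + 1 * 1) * 1 - - gsumd s (u + 1 * 1) * 1 - - gsumd s ((2 - u) + (- 1) * 1) * (- 1))) (at 1)"
      by (intro DERIV_add DERIV_diff chain)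
    then show ?thesis by (simp add: \<phi>_def image_sum_def d_def algebra_simps)
  qed
  then have "((\<lambda>a. (\<phi> a - \<phi> 1) / (a - 1)) \<longlongrightarrow> d) (at 1)"
    unfolding has_field_derivative_iff .
  then have lim1: "((\<lambda>a. (\<phi> a - \<phi> 1) / (a - 1)) \<longlongrightarrow> d) (at_left 1)"
    by (rule tendsto_within_subset[OF _ subset_UNIV])
  have "((\<lambda>a. sin (pi * a)) has_real_derivative cos (pi * 1) * pi) (at 1)"
    by (auto intro!: derivative_eq_intros)
  then have "((\<lambda>a. (sin (pi * a) - sin (pi * 1)) / (a - 1)) \<longlongrightarrow> cos (pi * 1) * pi) (at 1)"
    unfolding has_field_derivative_iff .
  then have "((\<lambda>a. sin (pi * a) / (a - 1)) \<longlongrightarrow> - pi) (at 1)" by simp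
  then have sl: "((\<lambda>a. sin (pi * a) / (a - 1)) \<longlongrightarrow> - pi) (at_left 1)"
    by (rule tendsto_within_subset[OF _ subset_UNIV])
  have "((\<lambda>a. sqrt (2 * pi / s) * (sin (pi * a) / (a - 1)) * qheat (1 / s) u a) \<longlongrightarrow> sqrt (2 * pi / s) * (- pi) * qheat (1 / s) u 1) (at_left 1)"
    by (intro tendsto_mult tendsto_const sl tendsto_qheat tendsto_ident_at) (use s in auto)
  moreover have "\<forall>\<^sub>F a in at_left 1. sqrt (2 * pi / s) * (sin (pi * a) / (a - 1)) * qheat (1 / s) u a = (\<phi> a - \<phi> 1) / (a - 1)"
  proof -
    have ev: "\<forall>\<^sub>F a in at_left 1. a \<in> {0<..<1::real}" by (rule eventually_at_leftI[of 0]) auto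
    have "\<phi> 1 = 0" using image_sum_eq_heat[OF s, of 1 u] u by (simp add: \<phi>_def heat_def)
    then have "sqrt (2 * pi / s) * (sin (pi * a) / (a - 1)) * qheat (1 / s) u a = (\<phi> a - \<phi> 1) / (a - 1)"
      if "a \<in> {0<..<1}" for a
      using image_sum_eq_heat[OF s _ u, of a] that by (simp add: \<phi>_def heat_def)
    then show ?thesis by (rule eventually_mono[OF ev])
  qed
  ultimately have "((\<lambda>a. (\<phi> a - \<phi> 1) / (a - 1)) \<longlongrightarrow> sqrt (2 * pi / s) * (- pi) * qheat (1 / s) u 1) (at_left 1)"
    by (rule Lim_transform_eventually)
  then have d_eq: "d = sqrt (2 * pi / s) * (- pi) * qheat (1 / s) u 1"
    using lim1 by (intro tendsto_unique[of "at_left 1"]) auto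
  have "d = - 2 * (s * (1 - u) * exp (- (s * (u - 1)\<^sup>2 / 2)) - gsumd s (u + 1) + gsumd s (3 - u))"
  proof -
    have e1: "gsumd s (u - 1) = s * (u - 1) * exp (- (s * (u - 1)\<^sup>2 / 2)) + gsumd s (u + 1)"
      using gsumd_step[OF s, of "u - 1"] by (simp add: algebra_simps)
    have e2: "gsumd s (1 - u) = s * (1 - u) * exp (- (s * (u - 1)\<^sup>2 / 2)) + gsumd s (3 - u)"
      using gsumd_step[OF s, of "1 - u"] by (simp add: algebra_simps power2_commute[of 1 u])
    show ?thesis unfolding d_def e1 e2 by (simp add: algebra_simps)
  qed
  then have "image_series_deriv \<gamma> z = prefactor \<gamma> z * (- d / 2)" by (simp add: image_series_deriv_def s_def u_def)
  then show ?thesis unfolding d_eq using s by (simp add: mkern_def s_def[symmetric] u_def[symmetric] real_sqrt_divide mult_ac)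
qed

lemma qheat_reflect: "qheat \<tau> (1 - u) (1 - a) = qheat \<tau> u a"
proof -
  have c: "cos (real_of_int m * pi - x) = (- 1) powi m * cos x" "sin (real_of_int m * pi - x) = - ((- 1) powi m * sin x)" for m x
    by (simp_all add: cos_diff sin_diff cos_int_times_real sin_int_times_real mult.commute[of _ pi])
  have "qheat_term k \<tau> (1 - u) (1 - a) = qheat_term k \<tau> u a" for k
  proof -
    have "chU (Suc k) (1 - a) = (- 1) ^ k * chU (Suc k) a"
      unfolding chU_def sum_distrib_left
    proof (intro sum.cong refl)
      fix j
      have "(real (Suc k) - 1 - 2 * real j) * (pi * (1 - a)) = real_of_int (int k - 2 * int j) * pi - (real (Suc k) - 1 - 2 * real j) * (pi * a)"
        by (simp add: algebra_simps)
      moreover have "(- 1 :: real) powi (int k - 2 * int j) = (- 1) ^ k"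
        by (simp add: power_int_diff power_int_mult)
      ultimately show "cos ((real (Suc k) - 1 - 2 * real j) * (pi * (1 - a))) = (- 1) ^ k * cos ((real (Suc k) - 1 - 2 * real j) * (pi * a))"
        by (simp only: c)
    qed
    moreover have "sin (real (Suc k) * pi * (1 - u)) = (- 1) ^ k * sin (real (Suc k) * pi * u)"
    proof -
      have "real (Suc k) * pi * (1 - u) = real_of_int (int (Suc k)) * pi - real (Suc k) * pi * u"
        by (simp add: algebra_simps)
      moreover have "(- 1 :: real) powi int (Suc k) = - ((- 1) ^ k)" by (simp only: power_int_of_nat power_Suc)
      ultimately show ?thesis by (simp only: c)
    qed
    moreover have "(- 1 :: real) ^ k * (- 1) ^ k = 1" by (simp flip: power_mult_distrib)
    ultimately show ?thesis unfolding qheat_term_def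
      by (metis (no_types, lifting) mult.assoc mult.left_commute mult_1)
  qed
  then show ?thesis by (simp add: qheat_def)
qed

lemma mkern_swap: "sz z > 0 \<Longrightarrow> mkern (1 - \<gamma>) (1 - a) (prod.swap z) = mkern \<gamma> a z"
  by (simp add: mkern_def prefactor_swap uz_swap qheat_reflect)

text \<open>
  At the ends of the arc \<open>htilde\<close> is half of a derivative in \<open>a\<close> of
  the image series, so the factor \<open>sin (pi a)\<close> is replaced by \<open>pi /
  2\<close>, half of its slope.
\<close>

definition hconst :: "real \<Rightarrow> real" where
  "hconst a = (if a = 0 \<or> a = 1 then sqrt (2 * pi) * (pi / 2) else sqrt (2 * pi) * sin (pi * a))"

lemma hconst_pos: "a \<in> {0..1} \<Longrightarrow> hconst a > 0"
  by (auto simp: hconst_def intro!: mult_pos_pos sin_gt_zero)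

theorem htilde_eq_mkern:
  assumes "a \<in> {0..1}" "z \<in> quadrant"
  shows "htilde \<gamma> (parab \<gamma> a) z = hconst a * mkern \<gamma> a z"
proof -
  consider "a = 0" | "a = 1" | "0 < a" "a < 1" using assms by fastforce
  then show ?thesis
  proof cases
    case 1
    have "prod.swap z \<in> quadrant" using assms by simp
    then show ?thesis
      using mkern_swap[OF quadrant_sz_pos[OF assms(2)], of \<gamma> 0] unfolding 1
      by (simp add: htilde_pi_half htilde_0 image_series_deriv_eq_mkern hconst_def)
  next
    case 2
    then show ?thesis using assms by (simp add: htilde_0 image_series_deriv_eq_mkern hconst_def)
  next
    case 3
    then show ?thesis using assms by (simp add: htilde_interior image_series_eq_mkern hconst_def)
  qed
qed

text \<open>
  Away from the ends all images of \<open>v\<close> with negative sign are farther from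
  \<open>u\<close> than \<open>v\<close> itself, and for small time they are dominated by the
  direct term.
\<close>

lemma heat_pos_small_time:
  assumes "0 < d"
  obtains \<tau>0 where "\<tau>0 > 0" "\<And>\<tau> u v. 0 < \<tau> \<Longrightarrow> \<tau> < \<tau>0 \<Longrightarrow> u \<in> {d..1 - d} \<Longrightarrow> v \<in> {d..1 - d} \<Longrightarrow> 0 < heat \<tau> u v"
proof -
  define C where "C = 1 / (1 - exp (- 2 * 1 :: real))"
  have C: "C > 0" by (simp add: C_def)
  have "((\<lambda>s. 2 * C * exp (- (2 * d\<^sup>2 * s))) \<longlongrightarrow> 0) at_top"
    using assms by real_asymp
  then have "\<forall>\<^sub>F s in at_top. 2 * C * exp (- (2 * d\<^sup>2 * s)) < 1" by (rule order_tendstoD) simp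
  then obtain s0 where s0: "\<And>s. s \<ge> s0 \<Longrightarrow> 2 * C * exp (- (2 * d\<^sup>2 * s)) < 1"
    by (auto simp: eventually_at_top_linorder)
  define s1 where "s1 = max 1 s0"
  show ?thesis
  proof (rule that[of "1 / s1"])
    show "1 / s1 > 0" by (simp add: s1_def)
    fix \<tau> u v :: real assume \<tau>: "0 < \<tau>" "\<tau> < 1 / s1" and uv: "u \<in> {d..1 - d}" "v \<in> {d..1 - d}"
    define s where "s = 1 / \<tau>"
    have s1: "s1 > 0" by (simp add: s1_def)
    have ss: "s > s1" using \<tau> s1 by (simp add: s_def field_simps)
    then have s: "s > 0" "s \<ge> 1" "s \<ge> s0" using s1 by (auto simp: s1_def)
    have uv01: "u \<in> {0..1}" "v \<in> {0..1}" using uv assms by auto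
    have g: "gsum s w \<le> C * exp (- (2 * d\<^sup>2 * s)) * exp (- (s * (u - v)\<^sup>2 / 2))" if "0 \<le> w" "w\<^sup>2 \<ge> (u - v)\<^sup>2 + 4 * d\<^sup>2" for w
    proof -
      have "gsum s w \<le> exp (- (s * w\<^sup>2 / 2)) * C"
        using gsum_le[of 1 s w] s that(1) by (simp add: C_def)
      also have "\<dots> \<le> exp (- (s * ((u - v)\<^sup>2 + 4 * d\<^sup>2) / 2)) * C"
        using that(2) s C by (intro mult_right_mono) auto
      also have "\<dots> = C * exp (- (2 * d\<^sup>2 * s)) * exp (- (s * (u - v)\<^sup>2 / 2))"
        by (simp add: algebra_simps add_divide_distrib flip: exp_add)
      finally show ?thesis .
    qed
    have "d\<^sup>2 \<le> u * v" "d\<^sup>2 \<le> (1 - u) * (1 - v)"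
      unfolding power2_eq_square using uv assms by (auto intro!: mult_mono)
    then have "(u + v)\<^sup>2 \<ge> (u - v)\<^sup>2 + 4 * d\<^sup>2" "(2 - v - u)\<^sup>2 \<ge> (u - v)\<^sup>2 + 4 * d\<^sup>2"
      by (simp_all add: power2_eq_square algebra_simps)
    then have "gsum s (u + v) + gsum s (2 - v - u) \<le> 2 * C * exp (- (2 * d\<^sup>2 * s)) * exp (- (s * (u - v)\<^sup>2 / 2))"
      using g[of "u + v"] g[of "2 - v - u"] uv01 by simp
    also have "\<dots> < 1 * exp (- (s * (u - v)\<^sup>2 / 2))" using s0[OF s(3)] by (intro mult_strict_right_mono) auto
    also have "\<dots> \<le> gsum s (u - v) + gsum s (v + 2 - u)"
      using gsum_step[OF s(1), of "u - v"] gsum_nonneg[OF s(1)] by (simp add: add_nonneg_nonneg)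
    finally have "image_sum s v u > 0" by (simp add: image_sum_def)
    then show "0 < heat \<tau> u v"
      using image_sum_eq_heat[OF s(1) uv01(2,1)] s zero_less_mult_pos[of "sqrt (2 * pi / s)" "heat (1 / s) u v"]
      by (simp add: s_def)
  qed
qed

context standard_brownian_motion begin

lemma qheat_nonneg:
  assumes "0 < \<tau>" "u \<in> {0..1}" "a \<in> {0..1}"
  shows "0 \<le> qheat \<tau> u a"
proof -
  have int: "0 \<le> qheat \<tau> u b" if "b \<in> {0<..<1}" for b
  proof -
    have "sin (pi * b) > 0" using that by (intro sin_gt_zero) auto
    then show ?thesis using heat_nonneg[OF assms(1,2), of b] that by (simp add: heat_def zero_le_mult_iff)
  qed
  have c: "continuous_on UNIV (\<lambda>b. qheat \<tau> u b)" by (intro continuous_intros) (use assms in auto)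
  have "closed {b. 0 \<le> qheat \<tau> u b}" by (intro closed_Collect_le c continuous_intros)
  moreover have "{0<..<1} \<subseteq> {b. 0 \<le> qheat \<tau> u b}" using int by auto
  ultimately have "closure {0<..<1} \<subseteq> {b. 0 \<le> qheat \<tau> u b}" by (rule closure_minimal[rotated])
  then show ?thesis using assms(3) by auto
qed

text \<open>
  A zero at \<open>(\<tau>, u)\<close> spreads by the Chapman-Kolmogorov equation, whose
  integrand is nonnegative: for \<open>\<sigma>\<close> slightly smaller than
  \<open>\<tau>\<close> the factor \<open>heat (\<tau> - \<sigma>) u v\<close> is positive, so
  \<open>qheat \<sigma> v a = 0\<close>. Letting \<open>\<sigma>\<close> tend to
  \<open>\<tau>\<close> gives zero for all \<open>v\<close>, against the first sine
  coefficient.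
\<close>

lemma qheat_pos:
  assumes "0 < \<tau>" "u \<in> {0<..<1}" "a \<in> {0..1}"
  shows "0 < qheat \<tau> u a"
proof (rule ccontr)
  assume "\<not> 0 < qheat \<tau> u a"
  then have zero: "qheat \<tau> u a = 0" using qheat_nonneg[OF assms(1) _ assms(3), of u] assms(2) by auto
  have prod0: "heat (\<tau> - \<sigma>) u v * qheat \<sigma> v a = 0" if "0 < \<sigma>" "\<sigma> < \<tau>" "v \<in> {0..1}" for \<sigma> v
  proof -
    have c: "continuous_on {0..1} (\<lambda>v. heat (\<tau> - \<sigma>) u v * qheat \<sigma> v a)"
      by (intro continuous_intros) (use that in auto)
    have "integral {0..1} (\<lambda>v. heat (\<tau> - \<sigma>) u v * qheat \<sigma> v a) = 0"
      using qheat_chapman_kolmogorov[of "\<tau> - \<sigma>" \<sigma> u a] that zero by simp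
    moreover have "0 \<le> heat (\<tau> - \<sigma>) u w * qheat \<sigma> w a" if "w \<in> {0..1}" for w
      using that assms \<open>0 < \<sigma>\<close> \<open>\<sigma> < \<tau>\<close> by (intro mult_nonneg_nonneg heat_nonneg qheat_nonneg) auto
    ultimately show ?thesis using integral_eq_0_iff[OF c] that by auto
  qed
  have allzero: "qheat \<tau> v a = 0" if v: "v \<in> {0<..<1}" for v
  proof -
    define d where "d = min (min u (1 - u)) (min v (1 - v))"
    have d: "d > 0" "u \<in> {d..1 - d}" "v \<in> {d..1 - d}" using assms v by (auto simp: d_def)
    obtain \<tau>0 where \<tau>0: "\<tau>0 > 0" "\<And>\<tau> u v. 0 < \<tau> \<Longrightarrow> \<tau> < \<tau>0 \<Longrightarrow> u \<in> {d..1 - d} \<Longrightarrow> v \<in> {d..1 - d} \<Longrightarrow> 0 < heat \<tau> u v"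
      using heat_pos_small_time[OF d(1)] by metis
    have "\<forall>\<^sub>F \<sigma> in at_left \<tau>. \<sigma> \<in> {max 0 (\<tau> - \<tau>0)<..<\<tau>}"
      using assms \<tau>0 by (intro eventually_at_leftI[of "max 0 (\<tau> - \<tau>0)"]) auto
    then have "\<forall>\<^sub>F \<sigma> in at_left \<tau>. qheat \<sigma> v a = 0"
    proof eventually_elim
      case (elim \<sigma>)
      then have "0 < heat (\<tau> - \<sigma>) u v" by (intro \<tau>0(2) d) auto
      then show ?case using prod0[of \<sigma> v] elim v by auto
    qed
    then have "((\<lambda>\<sigma>. qheat \<sigma> v a) \<longlongrightarrow> 0) (at_left \<tau>)" by (rule tendsto_eventually)
    moreover have "((\<lambda>\<sigma>. qheat \<sigma> v a) \<longlongrightarrow> qheat \<tau> v a) (at_left \<tau>)"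
      by (intro tendsto_qheat tendsto_const tendsto_ident_at assms)
    ultimately show ?thesis by (intro tendsto_unique[of "at_left \<tau>"]) auto
  qed
  have "integral {0..1} (\<lambda>v. qheat \<tau> v a * sin (real 1 * pi * v)) = integral {0..1} (\<lambda>v::real. 0)"
  proof (intro Henstock_Kurzweil_Integration.integral_cong)
    fix v :: real assume "v \<in> {0..1}"
    then consider "v = 0" | "v = 1" | "v \<in> {0<..<1}" by fastforce
    then show "qheat \<tau> v a * sin (real 1 * pi * v) = 0" using allzero by cases auto
  qed
  then show False using integral_qheat_sin[OF assms(1), of 1 a] by (simp add: eig_def)
qed

end

section \<open>Kernels with a boundary pole are harmonic\<close>

lemma open_quadrant: "open quadrant"
  unfolding quadrant_def by (intro open_Times) auto

text \<open>
  The differential with partial derivatives \<open>a\<close> and \<open>b\<close>, as a linear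
  map on pairs.
\<close>

definition grad :: "real \<Rightarrow> real \<Rightarrow> real \<times> real \<Rightarrow> real" where
  "grad a b d = a * fst d + b * snd d"

lemma partials_of_gradient:
  assumes "(f has_derivative grad a b) (at z)"
  shows "partial_x f z = a" "partial_y f z = b"
proof -
  have "((f \<circ> (\<lambda>t. (t, snd z))) has_derivative (grad a b \<circ> (\<lambda>t. (t, 0)))) (at (fst z))"
    by (rule diff_chain_at) (use assms in \<open>auto intro!: derivative_eq_intros\<close>)
  then have "((\<lambda>t. f (t, snd z)) has_real_derivative a) (at (fst z))"
    unfolding has_field_derivative_def o_def grad_def by simp
  then show "partial_x f z = a" unfolding partial_x_def by (rule DERIV_imp_deriv)
  have "((f \<circ> (\<lambda>t. (fst z, t))) has_derivative (grad a b \<circ> (\<lambda>t. (0, t)))) (at (snd z))"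
    by (rule diff_chain_at) (use assms in \<open>auto intro!: derivative_eq_intros\<close>)
  then have "((\<lambda>t. f (fst z, t)) has_real_derivative b) (at (snd z))"
    unfolding has_field_derivative_def o_def grad_def by simp
  then show "partial_y f z = b" unfolding partial_y_def by (rule DERIV_imp_deriv)
qed

lemma gradient_of_differentiable:
  assumes "f differentiable_on quadrant" "z \<in> quadrant"
  shows "(f has_derivative grad (partial_x f z) (partial_y f z)) (at z)"
proof -
  have "f differentiable (at z)"
    using assms open_quadrant by (simp add: differentiable_on_eq_differentiable_at)
  then obtain f' where f': "(f has_derivative f') (at z)" by (auto simp: differentiable_def)
  interpret bounded_linear f' by (rule has_derivative_bounded_linear[OF f'])
  have "f' h = grad (f' (1, 0)) (f' (0, 1)) h" for h
  proof -
    have "h = fst h *\<^sub>R (1, 0) + snd h *\<^sub>R (0, 1)" by (simp add: prod_eq_iff)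
    then have "f' h = f' (fst h *\<^sub>R (1, 0) + snd h *\<^sub>R (0, 1))" by simp
    then show ?thesis by (simp only: add scaleR) (simp add: grad_def)
  qed
  then have "f' = grad (f' (1, 0)) (f' (0, 1))" by blast
  then have "(f has_derivative grad (f' (1, 0)) (f' (0, 1))) (at z)" using f' by simp
  with partials_of_gradient[OF this] show ?thesis by simp
qed

text \<open>
  A certificate for \<open>C2_on\<close> and \<open>generator = 0\<close> that names the
  derivatives explicitly and is therefore stable under linear combinations and series.
\<close>

definition solves_generator :: "real \<Rightarrow> (real \<times> real \<Rightarrow> real) \<Rightarrow> bool" where
  "solves_generator \<gamma> u \<longleftrightarrow> (\<exists>ux uy uxx uxy uyx uyy. \<forall>z\<in>quadrant.
     (u has_derivative grad (ux z) (uy z)) (at z) \<and>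
     (ux has_derivative grad (uxx z) (uxy z)) (at z) \<and>
     (uy has_derivative grad (uyx z) (uyy z)) (at z) \<and>
     isCont uxx z \<and> isCont uxy z \<and> isCont uyx z \<and> isCont uyy z \<and>
     (uxx z - uxy z - (uyx z - uyy z)) / 2 + (1 - \<gamma>) * ux z + \<gamma> * uy z = 0)"

lemma grad_lin: "(\<lambda>h. c * grad a b h + d * grad a' b' h) = grad (c * a + d * a') (c * b + d * b')"
  by (simp add: grad_def fun_eq_iff algebra_simps)

lemma has_derivative_lincomb:
  assumes "(f has_derivative grad a b) (at z)" "(g has_derivative grad a' b') (at z)"
  shows "((\<lambda>z. c * f z + d * g z) has_derivative grad (c * a + d * a') (c * b + d * b')) (at z)"
  unfolding grad_lin[symmetric]
  by (intro has_derivative_add has_derivative_mult_right assms)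

lemma solves_generator_lincomb:
  assumes "solves_generator \<gamma> u" "solves_generator \<gamma> v"
  shows "solves_generator \<gamma> (\<lambda>z. c * u z + d * v z)"
proof -
  obtain ux uy uxx uxy uyx uyy where u: "\<And>z. z \<in> quadrant \<Longrightarrow>
     (u has_derivative grad (ux z) (uy z)) (at z) \<and>
     (ux has_derivative grad (uxx z) (uxy z)) (at z) \<and>
     (uy has_derivative grad (uyx z) (uyy z)) (at z) \<and>
     isCont uxx z \<and> isCont uxy z \<and> isCont uyx z \<and> isCont uyy z \<and>
     (uxx z - uxy z - (uyx z - uyy z)) / 2 + (1 - \<gamma>) * ux z + \<gamma> * uy z = 0"
    using assms(1) unfolding solves_generator_def by blast
  obtain vx vy vxx vxy vyx vyy where v: "\<And>z. z \<in> quadrant \<Longrightarrow>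
     (v has_derivative grad (vx z) (vy z)) (at z) \<and>
     (vx has_derivative grad (vxx z) (vxy z)) (at z) \<and>
     (vy has_derivative grad (vyx z) (vyy z)) (at z) \<and>
     isCont vxx z \<and> isCont vxy z \<and> isCont vyx z \<and> isCont vyy z \<and>
     (vxx z - vxy z - (vyx z - vyy z)) / 2 + (1 - \<gamma>) * vx z + \<gamma> * vy z = 0"
    using assms(2) unfolding solves_generator_def by blast
  show ?thesis
    unfolding solves_generator_def
  proof (intro exI ballI conjI)
    fix z assume z: "z \<in> quadrant"
    note uz = u[OF z] and vz = v[OF z]
    show "((\<lambda>z. c * u z + d * v z) has_derivative grad (c * ux z + d * vx z) (c * uy z + d * vy z)) (at z)"
      "((\<lambda>z. c * ux z + d * vx z) has_derivative grad (c * uxx z + d * vxx z) (c * uxy z + d * vxy z)) (at z)"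
      "((\<lambda>z. c * uy z + d * vy z) has_derivative grad (c * uyx z + d * vyx z) (c * uyy z + d * vyy z)) (at z)"
      using uz vz by (blast intro: has_derivative_lincomb)+
    show "isCont (\<lambda>z. c * uxx z + d * vxx z) z" "isCont (\<lambda>z. c * uxy z + d * vxy z) z"
      "isCont (\<lambda>z. c * uyx z + d * vyx z) z" "isCont (\<lambda>z. c * uyy z + d * vyy z) z"
      using uz vz by (auto intro!: continuous_intros)
    have "(c * uxx z + d * vxx z - (c * uxy z + d * vxy z) - (c * uyx z + d * vyx z - (c * uyy z + d * vyy z))) / 2
       + (1 - \<gamma>) * (c * ux z + d * vx z) + \<gamma> * (c * uy z + d * vy z)
     = c * ((uxx z - uxy z - (uyx z - uyy z)) / 2 + (1 - \<gamma>) * ux z + \<gamma> * uy z)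
     + d * ((vxx z - vxy z - (vyx z - vyy z)) / 2 + (1 - \<gamma>) * vx z + \<gamma> * vy z)"
      by (simp add: field_simps)
    also have "\<dots> = c * 0 + d * 0" using uz vz by (simp only:)
    finally show "(c * uxx z + d * vxx z - (c * uxy z + d * vxy z) - (c * uyx z + d * vyx z - (c * uyy z + d * vyy z))) / 2
       + (1 - \<gamma>) * (c * ux z + d * vx z) + \<gamma> * (c * uy z + d * vy z) = 0" by simp
  qed
qed

lemma solves_generator_cong:
  assumes "solves_generator \<gamma> u" "\<And>z. z \<in> quadrant \<Longrightarrow> v z = u z"
  shows "solves_generator \<gamma> v"
proof -
  have "(v has_derivative D) (at z)" if "(u has_derivative D) (at z)" "z \<in> quadrant" for D z
    by (rule has_derivative_transform_within_open[OF that(1) open_quadrant that(2)]) (simp add: assms(2))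
  then have tr: "\<And>D z. (u has_derivative D) (at z) \<Longrightarrow> z \<in> quadrant \<Longrightarrow> (v has_derivative D) (at z)" .
  obtain ux uy uxx uxy uyx uyy where u: "\<And>z. z \<in> quadrant \<Longrightarrow>
     (u has_derivative grad (ux z) (uy z)) (at z) \<and>
     (ux has_derivative grad (uxx z) (uxy z)) (at z) \<and>
     (uy has_derivative grad (uyx z) (uyy z)) (at z) \<and>
     isCont uxx z \<and> isCont uxy z \<and> isCont uyx z \<and> isCont uyy z \<and>
     (uxx z - uxy z - (uyx z - uyy z)) / 2 + (1 - \<gamma>) * ux z + \<gamma> * uy z = 0"
    using assms(1) unfolding solves_generator_def by blast
  show ?thesis
    unfolding solves_generator_def
    by (rule exI[of _ ux], rule exI[of _ uy], rule exI[of _ uxx], rule exI[of _ uxy], rule exI[of _ uyx], rule exI[of _ uyy])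
       (use u tr in simp)
qed

lemma solves_generator_imp_classical:
  assumes "solves_generator \<gamma> u"
  shows "C2_on quadrant u" "\<And>z. z \<in> quadrant \<Longrightarrow> generator \<gamma> u z = 0"
proof -
  obtain ux uy uxx uxy uyx uyy where u: "\<And>z. z \<in> quadrant \<Longrightarrow>
     (u has_derivative grad (ux z) (uy z)) (at z) \<and>
     (ux has_derivative grad (uxx z) (uxy z)) (at z) \<and>
     (uy has_derivative grad (uyx z) (uyy z)) (at z) \<and>
     isCont uxx z \<and> isCont uxy z \<and> isCont uyx z \<and> isCont uyy z \<and>
     (uxx z - uxy z - (uyx z - uyy z)) / 2 + (1 - \<gamma>) * ux z + \<gamma> * uy z = 0"
    using assms unfolding solves_generator_def by blast
  have p: "partial_x u z = ux z" "partial_y u z = uy z" if "z \<in> quadrant" for z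
    using partials_of_gradient u[OF that] by blast+
  have tr: "(f has_derivative D) (at z)" if "(g has_derivative D) (at z)" "z \<in> quadrant" "\<And>z. z \<in> quadrant \<Longrightarrow> f z = g z"
    for f g :: "real \<times> real \<Rightarrow> real" and D z
    by (rule has_derivative_transform_within_open[OF that(1) open_quadrant that(2)]) (simp add: that(3))
  have dx: "(partial_x u has_derivative grad (uxx z) (uxy z)) (at z)"
    and dy: "(partial_y u has_derivative grad (uyx z) (uyy z)) (at z)" if "z \<in> quadrant" for z
    using tr[of ux _ z "partial_x u"] tr[of uy _ z "partial_y u"] u[OF that] that p by blast+
  have pp: "partial_x (partial_x u) z = uxx z" "partial_y (partial_x u) z = uxy z"
    "partial_x (partial_y u) z = uyx z" "partial_y (partial_y u) z = uyy z" if "z \<in> quadrant" for z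
    using partials_of_gradient[OF dx[OF that]] partials_of_gradient[OF dy[OF that]] by auto
  have dd: "f differentiable_on quadrant" if "\<And>z. z \<in> quadrant \<Longrightarrow> \<exists>D. (f has_derivative D) (at z)"
    for f :: "real \<times> real \<Rightarrow> real"
    using that by (auto simp: differentiable_on_eq_differentiable_at[OF open_quadrant] differentiable_def)
  have cc: "continuous_on quadrant f" if "\<And>z. z \<in> quadrant \<Longrightarrow> f z = g z" "\<And>z. z \<in> quadrant \<Longrightarrow> isCont g z"
    for f g :: "real \<times> real \<Rightarrow> real"
  proof -
    have "continuous_on quadrant g" using that(2) by (simp add: continuous_at_imp_continuous_on)
    then show ?thesis using that(1) by (simp cong: continuous_on_cong)
  qed
  have "C1_on quadrant u"
    unfolding C1_on_def
  proof (intro conjI)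
    show "u differentiable_on quadrant" using u by (intro dd) blast
    show "continuous_on quadrant (partial_x u)" "continuous_on quadrant (partial_y u)"
      using dx dy by (auto intro!: continuous_at_imp_continuous_on has_derivative_continuous)
  qed
  moreover have "C1_on quadrant (partial_x u)"
    unfolding C1_on_def
  proof (intro conjI dd exI)
    show "continuous_on quadrant (partial_x (partial_x u))" by (rule cc[of _ uxx]) (use u pp in simp_all)
    show "continuous_on quadrant (partial_y (partial_x u))" by (rule cc[of _ uxy]) (use u pp in simp_all)
  qed (rule dx)
  moreover have "C1_on quadrant (partial_y u)"
    unfolding C1_on_def
  proof (intro conjI dd exI)
    show "continuous_on quadrant (partial_x (partial_y u))" by (rule cc[of _ uyx]) (use u pp in simp_all)
    show "continuous_on quadrant (partial_y (partial_y u))" by (rule cc[of _ uyy]) (use u pp in simp_all)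
  qed (rule dy)
  ultimately show "C2_on quadrant u" by (simp add: C2_on_def)
  fix z assume z: "z \<in> quadrant"
  have "((\<lambda>w. 1 * partial_x u w + (- 1) * partial_y u w) has_derivative
     grad (1 * uxx z + (- 1) * uyx z) (1 * uxy z + (- 1) * uyy z)) (at z)"
    by (intro has_derivative_lincomb dx dy z)
  then have "((\<lambda>w. partial_x u w - partial_y u w) has_derivative grad (uxx z - uyx z) (uxy z - uyy z)) (at z)"
    by simp
  from partials_of_gradient[OF this] p[OF z]
  have "generator \<gamma> u z = (uxx z - uyx z - (uxy z - uyy z)) / 2 + (1 - \<gamma>) * ux z + \<gamma> * uy z"
    by (simp add: generator_def Let_def)
  also have "uxx z - uyx z - (uxy z - uyy z) = uxx z - uxy z - (uyx z - uyy z)" by simp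
  finally show "generator \<gamma> u z = 0" using u[OF z] by (simp only:)
qed

text \<open>
  Coefficients of at most exponential growth. The class is an algebra, contains all
  polynomials in \<open>n\<close>, and is summable against every Gaussian, so series can be
  differentiated repeatedly without new estimates.
\<close>

definition expbdd :: "(nat \<Rightarrow> real) \<Rightarrow> bool" where
  "expbdd c \<longleftrightarrow> (\<exists>K\<ge>0. \<forall>n. \<bar>c n\<bar> \<le> exp (K * (real n + 1)))"

lemma expbdd_const: "expbdd (\<lambda>n. c)"
proof -
  have "\<bar>c\<bar> \<le> exp (\<bar>c\<bar> * (real n + 1))" for n
  proof -
    have "\<bar>c\<bar> \<le> exp \<bar>c\<bar>" using exp_ge_add_one_self[of "\<bar>c\<bar>"] by linarith
    also have "\<dots> \<le> exp (\<bar>c\<bar> * (real n + 1))" by (simp add: algebra_simps)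
    finally show ?thesis .
  qed
  then show ?thesis unfolding expbdd_def by (intro exI[of _ "\<bar>c\<bar>"]) auto
qed

lemma expbdd_real: "expbdd real"
proof -
  have "real n \<le> exp (1 * (real n + 1))" for n
    using exp_ge_add_one_self[of "real n + 1"] by simp
  then show ?thesis unfolding expbdd_def by (intro exI[of _ 1]) auto
qed

lemma expbdd_mult: "expbdd c \<Longrightarrow> expbdd d \<Longrightarrow> expbdd (\<lambda>n. c n * d n)"
  unfolding expbdd_def
proof (elim exE conjE)
  fix K L assume *: "0 \<le> K" "0 \<le> L" "\<forall>n. \<bar>c n\<bar> \<le> exp (K * (real n + 1))" "\<forall>n. \<bar>d n\<bar> \<le> exp (L * (real n + 1))"
  have "\<bar>c n * d n\<bar> \<le> exp ((K + L) * (real n + 1))" for n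
  proof -
    have "\<bar>c n * d n\<bar> \<le> exp (K * (real n + 1)) * exp (L * (real n + 1))"
      unfolding abs_mult using * by (intro mult_mono) auto
    then show ?thesis by (simp add: distrib_right exp_add)
  qed
  then show "\<exists>K\<ge>0. \<forall>n. \<bar>c n * d n\<bar> \<le> exp (K * (real n + 1))" using * by (intro exI[of _ "K + L"]) auto
qed

lemma expbdd_add: "expbdd c \<Longrightarrow> expbdd d \<Longrightarrow> expbdd (\<lambda>n. c n + d n)"
  unfolding expbdd_def
proof (elim exE conjE)
  fix K L assume *: "0 \<le> K" "0 \<le> L" "\<forall>n. \<bar>c n\<bar> \<le> exp (K * (real n + 1))" "\<forall>n. \<bar>d n\<bar> \<le> exp (L * (real n + 1))"
  have "\<bar>c n + d n\<bar> \<le> exp ((K + L + 1) * (real n + 1))" for n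
  proof -
    have "exp (K * (real n + 1)) \<le> exp ((K + L) * (real n + 1))" "exp (L * (real n + 1)) \<le> exp ((K + L) * (real n + 1))"
      using * by (auto intro!: mult_right_mono)
    then have "\<bar>c n + d n\<bar> \<le> 2 * exp ((K + L) * (real n + 1))"
      using *(3,4)[rule_format, of n] by linarith
    also have "(2::real) \<le> exp (real n + 1)" using exp_ge_add_one_self[of "real n + 1"] by linarith
    then have "2 * exp ((K + L) * (real n + 1)) \<le> exp (real n + 1) * exp ((K + L) * (real n + 1))"
      by (intro mult_right_mono) auto
    also have "\<dots> = exp ((K + L + 1) * (real n + 1))" by (simp add: algebra_simps flip: exp_add)
    finally show ?thesis .
  qed
  then show "\<exists>K\<ge>0. \<forall>n. \<bar>c n + d n\<bar> \<le> exp (K * (real n + 1))" using * by (intro exI[of _ "K + L + 1"]) auto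
qed

lemma expbdd_uminus: "expbdd c \<Longrightarrow> expbdd (\<lambda>n. - c n)"
  by (simp add: expbdd_def)

lemma expbdd_diff: "expbdd c \<Longrightarrow> expbdd d \<Longrightarrow> expbdd (\<lambda>n. c n - d n)"
  using expbdd_add[OF _ expbdd_uminus] by simp

lemmas expbdd_intros = expbdd_const expbdd_real expbdd_mult expbdd_add expbdd_diff expbdd_uminus

lemma expbdd_gauss_summable:
  assumes "expbdd c" "0 < \<delta>"
  shows "summable (\<lambda>n. \<bar>c n\<bar> * exp (- (\<delta> * (real n)\<^sup>2)))"
proof -
  obtain K where K: "K \<ge> 0" "\<And>n. \<bar>c n\<bar> \<le> exp (K * (real n + 1))" using assms(1) by (auto simp: expbdd_def)
  define C where "C = exp (K + (K + 1)\<^sup>2 / (4 * \<delta>))"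
  show ?thesis
  proof (rule summable_comparison_test)
    show "summable (\<lambda>n. C * exp (- 1) ^ n)" by (intro summable_mult summable_geometric) simp
    have "\<bar>c n\<bar> * exp (- (\<delta> * (real n)\<^sup>2)) \<le> C * exp (- 1) ^ n" for n
    proof -
      have "0 \<le> (2 * \<delta> * real n - (K + 1))\<^sup>2 / (4 * \<delta>)" using assms(2) by simp
      also have "\<dots> = \<delta> * (real n)\<^sup>2 - (K + 1) * real n + (K + 1)\<^sup>2 / (4 * \<delta>)"
        using assms(2) by (simp add: power2_eq_square field_simps)
      finally have 1: "K * (real n + 1) - \<delta> * (real n)\<^sup>2 \<le> K + (K + 1)\<^sup>2 / (4 * \<delta>) + real n * (- 1)"
        by (simp add: algebra_simps)
      have "\<bar>c n\<bar> * exp (- (\<delta> * (real n)\<^sup>2)) \<le> exp (K * (real n + 1)) * exp (- (\<delta> * (real n)\<^sup>2))"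
        using K(2) by (intro mult_right_mono) auto
      also have "\<dots> = exp (K * (real n + 1) - \<delta> * (real n)\<^sup>2)" by (simp flip: exp_add)
      also have "\<dots> \<le> exp (K + (K + 1)\<^sup>2 / (4 * \<delta>) + real n * (- 1))" using 1 by simp
      also have "\<dots> = C * exp (- 1) ^ n" unfolding C_def exp_add[of _ "real n * - 1"] exp_of_nat_mult ..
      finally show ?thesis .
    qed
    then show "\<exists>N. \<forall>n\<ge>N. norm (\<bar>c n\<bar> * exp (- (\<delta> * (real n)\<^sup>2))) \<le> C * exp (- 1) ^ n" by auto
  qed
qed

definition pc :: "real \<Rightarrow> real \<Rightarrow> real" where "pc \<gamma> b = (\<gamma>\<^sup>2 - (1 - b)\<^sup>2) / 2"
definition qc :: "real \<Rightarrow> real \<Rightarrow> real" where "qc \<gamma> b = ((1 - \<gamma>)\<^sup>2 - b\<^sup>2) / 2"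

lemma expo_pc_qc: "expo \<gamma> b z = exp (pc \<gamma> b * fst z + qc \<gamma> b * snd z)"
  by (simp add: expo_def pc_def qc_def)

lemma pc_qc_parabola: "(pc \<gamma> b - qc \<gamma> b)\<^sup>2 / 2 + (1 - \<gamma>) * pc \<gamma> b + \<gamma> * qc \<gamma> b = 0"
  and pc_minus_qc: "pc \<gamma> b - qc \<gamma> b = b - (1 - \<gamma>)"
  unfolding pc_def qc_def by (simp_all add: power2_eq_square field_simps)

text \<open>
  Affine coefficients appear in the series at the end points of the arc; differentiation
  preserves this form.
\<close>

definition affine_exp_term :: "real \<Rightarrow> (nat \<Rightarrow> real) \<Rightarrow> (nat \<Rightarrow> real) \<Rightarrow> (nat \<Rightarrow> real) \<Rightarrow> (nat \<Rightarrow> real) \<Rightarrow> nat \<Rightarrow> real \<times> real \<Rightarrow> real" where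
  "affine_exp_term \<gamma> A B C b n z = (A n * fst z + B n * snd z + C n) * expo \<gamma> (b n) z"

definition affine_exp_series :: "real \<Rightarrow> (nat \<Rightarrow> real) \<Rightarrow> (nat \<Rightarrow> real) \<Rightarrow> (nat \<Rightarrow> real) \<Rightarrow> (nat \<Rightarrow> real) \<Rightarrow> real \<times> real \<Rightarrow> real" where
  "affine_exp_series \<gamma> A B C b z = (\<Sum>n. affine_exp_term \<gamma> A B C b n z)"

text \<open>
  Boxes away from the axes, on which the series converge uniformly together with their
  derivatives.
\<close>

definition boxq :: "real \<Rightarrow> real \<Rightarrow> (real \<times> real) set" where
  "boxq \<delta> R = {\<delta><..<R} \<times> {\<delta><..<R}"

lemma boxq_cover: "z \<in> quadrant \<Longrightarrow> \<exists>\<delta>>0. \<exists>R>0. z \<in> boxq \<delta> R"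
proof -
  assume "z \<in> quadrant"
  then have "z \<in> boxq (min (fst z) (snd z) / 2) (max (fst z) (snd z) + 1)" "min (fst z) (snd z) / 2 > 0" "max (fst z) (snd z) + 1 > 0"
    by (auto simp: boxq_def quadrant_def mem_Times_iff min_def max_def split: if_splits)
  then show ?thesis by blast
qed

text \<open>
  On the parabola both exponents are at most \<open>K - n\<^sup>2\<close>, so on the box the
  terms decay like \<open>exp (- 2 \<delta> n\<^sup>2)\<close>.
\<close>

lemma affine_exp_series_uniform_limit:
  assumes "expbdd A" "expbdd B" "expbdd C" and b: "b = (\<lambda>n. c + 2 * \<sigma> * real n)" "\<sigma>\<^sup>2 = 1" and "0 < \<delta>" "0 < R"
  shows "uniform_limit (boxq \<delta> R) (\<lambda>N z. \<Sum>n<N. affine_exp_term \<gamma> A B C b n z) (affine_exp_series \<gamma> A B C b) sequentially"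
    and "z \<in> boxq \<delta> R \<Longrightarrow> (\<lambda>n. affine_exp_term \<gamma> A B C b n z) sums affine_exp_series \<gamma> A B C b z"
proof -
  define K where "K = (\<gamma>\<^sup>2 + (1 - c)\<^sup>2) / 2 + ((1 - \<gamma>)\<^sup>2 + c\<^sup>2) / 2"
  have PQ: "pc \<gamma> (b n) \<le> K - (real n)\<^sup>2" "qc \<gamma> (b n) \<le> K - (real n)\<^sup>2" for n
  proof -
    have lin: "(r - B) / 2 \<le> (r + t) / 2 + (r' + t') / 2 - N" if "2 * N - t \<le> B" "0 \<le> r'" "0 \<le> t'" for N t B r' t' r :: real
      using that by (simp add: field_simps)
    have sq: "(d + 2 * \<sigma> * real n)\<^sup>2 \<ge> 2 * (real n)\<^sup>2 - d\<^sup>2" for d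
    proof -
      have "0 \<le> 2 * (d + \<sigma> * real n)\<^sup>2" by simp
      also have "\<dots> = (d + 2 * \<sigma> * real n)\<^sup>2 + d\<^sup>2 - 2 * \<sigma>\<^sup>2 * (real n)\<^sup>2" by (simp add: power2_eq_square algebra_simps)
      finally show ?thesis using b(2) by simp
    qed
    have "(1 - b n)\<^sup>2 = ((c - 1) + 2 * \<sigma> * real n)\<^sup>2" "(b n)\<^sup>2 = (c + 2 * \<sigma> * real n)\<^sup>2"
      unfolding b by (simp_all add: power2_eq_square algebra_simps)
    then have "(1 - b n)\<^sup>2 \<ge> 2 * (real n)\<^sup>2 - (1 - c)\<^sup>2" "(b n)\<^sup>2 \<ge> 2 * (real n)\<^sup>2 - c\<^sup>2"
      using sq[of "c - 1"] sq[of c] by (simp_all add: power2_commute[of 1 c])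
    then show "pc \<gamma> (b n) \<le> K - (real n)\<^sup>2" "qc \<gamma> (b n) \<le> K - (real n)\<^sup>2"
      unfolding pc_def qc_def K_def
      using lin[of "(real n)\<^sup>2" "(1 - c)\<^sup>2" "(1 - b n)\<^sup>2" "(1 - \<gamma>)\<^sup>2" "c\<^sup>2" "\<gamma>\<^sup>2"]
        lin[of "(real n)\<^sup>2" "c\<^sup>2" "(b n)\<^sup>2" "\<gamma>\<^sup>2" "(1 - c)\<^sup>2" "(1 - \<gamma>)\<^sup>2"] by (simp_all add: add.commute)
  qed
  have K: "K \<ge> 0" by (simp add: K_def)
  define e where "e = (\<lambda>n. \<bar>A n\<bar> * R + \<bar>B n\<bar> * R + \<bar>C n\<bar>)"
  have abs: "expbdd (\<lambda>n. \<bar>f n\<bar>)" if "expbdd f" for f using that by (simp add: expbdd_def)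
  have "expbdd e" unfolding e_def by (intro expbdd_intros abs assms)
  have e_nn: "e n \<ge> 0" for n using \<open>0 < R\<close> by (simp add: e_def)
  define Mb where "Mb = (\<lambda>n. exp (2 * K * R) * (\<bar>e n\<bar> * exp (- (2 * \<delta> * (real n)\<^sup>2))))"
  have sm: "summable Mb"
    unfolding Mb_def using expbdd_gauss_summable[OF \<open>expbdd e\<close>, of "2 * \<delta>"] \<open>0 < \<delta>\<close> by (intro summable_mult) auto
  have bound: "norm (affine_exp_term \<gamma> A B C b n z) \<le> Mb n" if z: "z \<in> boxq \<delta> R" for n z
  proof -
    have xy: "\<delta> < fst z" "fst z < R" "\<delta> < snd z" "snd z < R" using z by (auto simp: boxq_def)
    have one: "p * x \<le> K * R - \<delta> * (real n)\<^sup>2" if "p \<le> K - (real n)\<^sup>2" "\<delta> < x" "x < R" for p x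
    proof -
      have "p * x \<le> (K - (real n)\<^sup>2) * x" using that \<open>0 < \<delta>\<close> by (intro mult_right_mono) auto
      moreover have "K * x \<le> K * R" using K that by (intro mult_left_mono) auto
      moreover have "\<delta> * (real n)\<^sup>2 \<le> x * (real n)\<^sup>2" using that by (intro mult_right_mono) auto
      ultimately show ?thesis by (simp add: algebra_simps)
    qed
    have "expo \<gamma> (b n) z \<le> exp (2 * K * R + - (2 * \<delta> * (real n)\<^sup>2))"
      unfolding expo_pc_qc using one[OF PQ(1)[of n] xy(1,2)] one[OF PQ(2)[of n] xy(3,4)] by simp
    then have E: "expo \<gamma> (b n) z \<le> exp (2 * K * R) * exp (- (2 * \<delta> * (real n)\<^sup>2))" by (simp only: exp_add)
    have "\<bar>A n * fst z + B n * snd z + C n\<bar> \<le> \<bar>A n * fst z\<bar> + \<bar>B n * snd z\<bar> + \<bar>C n\<bar>" by linarith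
    also have "\<dots> \<le> e n" unfolding e_def abs_mult using xy \<open>0 < \<delta>\<close> by (intro add_mono mult_left_mono) auto
    finally have "\<bar>A n * fst z + B n * snd z + C n\<bar> * expo \<gamma> (b n) z \<le> e n * (exp (2 * K * R) * exp (- (2 * \<delta> * (real n)\<^sup>2)))"
      using E e_nn by (intro mult_mono) (auto simp: less_imp_le[OF expo_pos])
    then show ?thesis using e_nn[of n] by (simp add: affine_exp_term_def Mb_def abs_mult mult_ac less_imp_le[OF expo_pos])
  qed
  show "uniform_limit (boxq \<delta> R) (\<lambda>N z. \<Sum>n<N. affine_exp_term \<gamma> A B C b n z) (affine_exp_series \<gamma> A B C b) sequentially"
    unfolding affine_exp_series_def[abs_def] by (rule Weierstrass_m_test[OF bound sm])
  show "(\<lambda>n. affine_exp_term \<gamma> A B C b n z) sums affine_exp_series \<gamma> A B C b z" if "z \<in> boxq \<delta> R"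
    unfolding affine_exp_series_def using bound[OF that] by (intro summable_sums summable_comparison_test[OF _ sm]) auto
qed

lemma affine_exp_series_sums:
  assumes "expbdd A" "expbdd B" "expbdd C" "b = (\<lambda>n. c + 2 * \<sigma> * real n)" "\<sigma>\<^sup>2 = 1" "z \<in> quadrant"
  shows "(\<lambda>n. affine_exp_term \<gamma> A B C b n z) sums affine_exp_series \<gamma> A B C b z"
  using boxq_cover[OF assms(6)] affine_exp_series_uniform_limit(2)[OF assms(1-5)] by blast

lemma has_derivative_affine_exp:
  fixes z :: "real \<times> real"
  shows "((\<lambda>z. (A * fst z + B * snd z + C) * exp (p * fst z + q * snd z)) has_derivative
     grad ((A * p * fst z + B * p * snd z + (C * p + A)) * exp (p * fst z + q * snd z))
          ((A * q * fst z + B * q * snd z + (C * q + B)) * exp (p * fst z + q * snd z))) (at z within S)"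
proof -
  have lin: "((\<lambda>z. a * fst z + b * snd z + c) has_derivative (\<lambda>d. a * fst d + b * snd d)) (at z within S)" for a b c :: real
    by (auto intro!: derivative_eq_intros)
  have "((\<lambda>z. exp (p * fst z + q * snd z)) has_derivative (\<lambda>d. (p * fst d + q * snd d) * exp (p * fst z + q * snd z))) (at z within S)"
    using has_derivative_exp[OF lin[of p q 0]] by simp
  from has_derivative_mult[OF lin[of A B C] this] show ?thesis
  proof (rule has_derivative_eq_rhs)
    show "(\<lambda>h. (A * fst z + B * snd z + C) * ((p * fst h + q * snd h) * exp (p * fst z + q * snd z)) +
        (A * fst h + B * snd h) * exp (p * fst z + q * snd z)) =
      grad ((A * p * fst z + B * p * snd z + (C * p + A)) * exp (p * fst z + q * snd z))
        ((A * q * fst z + B * q * snd z + (C * q + B)) * exp (p * fst z + q * snd z))"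
    proof
      fix d :: "real \<times> real"
      have "(A * x + B * y + C) * ((p * u + q * v) * E) + (A * u + B * v) * E
          = (A * p * x + B * p * y + (C * p + A)) * E * u + (A * q * x + B * q * y + (C * q + B)) * E * v" for x y u v E
        by (simp add: algebra_simps)
      then show "(A * fst z + B * snd z + C) * ((p * fst d + q * snd d) * exp (p * fst z + q * snd z)) +
        (A * fst d + B * snd d) * exp (p * fst z + q * snd z) =
        grad ((A * p * fst z + B * p * snd z + (C * p + A)) * exp (p * fst z + q * snd z))
        ((A * q * fst z + B * q * snd z + (C * q + B)) * exp (p * fst z + q * snd z)) d"
        unfolding grad_def .
    qed
  qed
qed

lemma affine_exp_series_has_derivative:
  assumes bd: "expbdd A" "expbdd B" "expbdd C" and b: "b = (\<lambda>n. c + 2 * \<sigma> * real n)" "\<sigma>\<^sup>2 = 1" and z: "z \<in> quadrant"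
  shows "(affine_exp_series \<gamma> A B C b has_derivative
     grad (affine_exp_series \<gamma> (\<lambda>n. A n * pc \<gamma> (b n)) (\<lambda>n. B n * pc \<gamma> (b n)) (\<lambda>n. C n * pc \<gamma> (b n) + A n) b z)
          (affine_exp_series \<gamma> (\<lambda>n. A n * qc \<gamma> (b n)) (\<lambda>n. B n * qc \<gamma> (b n)) (\<lambda>n. C n * qc \<gamma> (b n) + B n) b z)) (at z)"
proof -
  define Ax Bx Cx where "Ax = (\<lambda>n. A n * pc \<gamma> (b n))" "Bx = (\<lambda>n. B n * pc \<gamma> (b n))" "Cx = (\<lambda>n. C n * pc \<gamma> (b n) + A n)"
  define Ay By Cy where "Ay = (\<lambda>n. A n * qc \<gamma> (b n))" "By = (\<lambda>n. B n * qc \<gamma> (b n))" "Cy = (\<lambda>n. C n * qc \<gamma> (b n) + B n)"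
  have bb: "expbdd (\<lambda>n. pc \<gamma> (b n))" "expbdd (\<lambda>n. qc \<gamma> (b n))"
    unfolding pc_def qc_def b power2_eq_square divide_inverse by (intro expbdd_intros)+
  have bx: "expbdd Ax" "expbdd Bx" "expbdd Cx" "expbdd Ay" "expbdd By" "expbdd Cy"
    unfolding Ax_Bx_Cx_def Ay_By_Cy_def by (intro expbdd_intros bb bd)+
  obtain \<delta> R where dR: "\<delta> > 0" "R > 0" "z \<in> boxq \<delta> R" using boxq_cover[OF z] by blast
  have op: "open (boxq \<delta> R)" and cv: "convex (boxq \<delta> R)"
    unfolding boxq_def by (auto intro!: open_Times convex_Times)
  note ulx = affine_exp_series_uniform_limit(1)[OF bx(1-3) b dR(1,2), of \<gamma>]
  note uly = affine_exp_series_uniform_limit(1)[OF bx(4-6) b dR(1,2), of \<gamma>]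
  have "\<exists>g. \<forall>x\<in>boxq \<delta> R. (\<lambda>n. affine_exp_term \<gamma> A B C b n x) sums g x \<and>
      (g has_derivative grad (affine_exp_series \<gamma> Ax Bx Cx b x) (affine_exp_series \<gamma> Ay By Cy b x)) (at x within boxq \<delta> R)"
  proof (rule has_derivative_series[OF cv _ _ dR(3)])
    show "(\<lambda>n. affine_exp_term \<gamma> A B C b n z) sums affine_exp_series \<gamma> A B C b z" by (rule affine_exp_series_uniform_limit(2)[OF bd b dR(1,2,3)])
  next
    fix n x assume "x \<in> boxq \<delta> R"
    show "(affine_exp_term \<gamma> A B C b n has_derivative grad (affine_exp_term \<gamma> Ax Bx Cx b n x) (affine_exp_term \<gamma> Ay By Cy b n x)) (at x within boxq \<delta> R)"
      unfolding affine_exp_term_def[abs_def] expo_pc_qc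
      using has_derivative_affine_exp unfolding Ax_Bx_Cx_def Ay_By_Cy_def .
  next
    fix e :: real assume "e > 0"
    then have "\<forall>\<^sub>F n in sequentially. \<forall>x\<in>boxq \<delta> R. dist (\<Sum>i<n. affine_exp_term \<gamma> Ax Bx Cx b i x) (affine_exp_series \<gamma> Ax Bx Cx b x) < e / 2"
      "\<forall>\<^sub>F n in sequentially. \<forall>x\<in>boxq \<delta> R. dist (\<Sum>i<n. affine_exp_term \<gamma> Ay By Cy b i x) (affine_exp_series \<gamma> Ay By Cy b x) < e / 2"
      using uniform_limitD[OF ulx, of "e / 2"] uniform_limitD[OF uly, of "e / 2"] by auto
    then show "\<forall>\<^sub>F n in sequentially. \<forall>x\<in>boxq \<delta> R. \<forall>h.
       norm ((\<Sum>i<n. grad (affine_exp_term \<gamma> Ax Bx Cx b i x) (affine_exp_term \<gamma> Ay By Cy b i x) h) - grad (affine_exp_series \<gamma> Ax Bx Cx b x) (affine_exp_series \<gamma> Ay By Cy b x) h) \<le> e * norm h"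
    proof eventually_elim
      case (elim n)
      show ?case
      proof (intro ballI allI)
        fix x h assume x: "x \<in> boxq \<delta> R"
        define D1 D2 where "D1 = (\<Sum>i<n. affine_exp_term \<gamma> Ax Bx Cx b i x) - affine_exp_series \<gamma> Ax Bx Cx b x"
          and "D2 = (\<Sum>i<n. affine_exp_term \<gamma> Ay By Cy b i x) - affine_exp_series \<gamma> Ay By Cy b x"
        have D: "\<bar>D1\<bar> \<le> e / 2" "\<bar>D2\<bar> \<le> e / 2" using elim x unfolding D1_def D2_def dist_real_def by (blast intro: less_imp_le)+
        have "(\<Sum>i<n. grad (affine_exp_term \<gamma> Ax Bx Cx b i x) (affine_exp_term \<gamma> Ay By Cy b i x) h) - grad (affine_exp_series \<gamma> Ax Bx Cx b x) (affine_exp_series \<gamma> Ay By Cy b x) h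
            = D1 * fst h + D2 * snd h"
          by (simp add: grad_def D1_def D2_def sum.distrib left_diff_distrib sum_distrib_right)
        also have "norm \<dots> \<le> \<bar>D1\<bar> * \<bar>fst h\<bar> + \<bar>D2\<bar> * \<bar>snd h\<bar>" unfolding real_norm_def abs_mult[symmetric] by (rule abs_triangle_ineq)
        also have "\<dots> \<le> e / 2 * norm h + e / 2 * norm h"
          using D norm_fst_le[of "fst h" "snd h"] norm_snd_le[of "snd h" "fst h"] \<open>e > 0\<close>
          by (intro add_mono mult_mono) auto
        finally show "norm ((\<Sum>i<n. grad (affine_exp_term \<gamma> Ax Bx Cx b i x) (affine_exp_term \<gamma> Ay By Cy b i x) h) - grad (affine_exp_series \<gamma> Ax Bx Cx b x) (affine_exp_series \<gamma> Ay By Cy b x) h) \<le> e * norm h"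
          by simp
      qed
    qed
  qed
  then obtain g where g: "\<And>x. x \<in> boxq \<delta> R \<Longrightarrow> (\<lambda>n. affine_exp_term \<gamma> A B C b n x) sums g x"
     "\<And>x. x \<in> boxq \<delta> R \<Longrightarrow> (g has_derivative grad (affine_exp_series \<gamma> Ax Bx Cx b x) (affine_exp_series \<gamma> Ay By Cy b x)) (at x within boxq \<delta> R)"
    by blast
  have eq: "g x = affine_exp_series \<gamma> A B C b x" if "x \<in> boxq \<delta> R" for x
    using sums_unique2[OF g(1)[OF that] affine_exp_series_uniform_limit(2)[OF bd b dR(1,2) that]] .
  have "(g has_derivative grad (affine_exp_series \<gamma> Ax Bx Cx b z) (affine_exp_series \<gamma> Ay By Cy b z)) (at z)"
    using g(2)[OF dR(3)] at_within_open[OF dR(3) op] by simp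
  then have "(affine_exp_series \<gamma> A B C b has_derivative grad (affine_exp_series \<gamma> Ax Bx Cx b z) (affine_exp_series \<gamma> Ay By Cy b z)) (at z)"
    by (rule has_derivative_transform_within_open[OF _ op dR(3) eq])
  then show ?thesis by (simp add: Ax_Bx_Cx_def Ay_By_Cy_def)
qed

text \<open>
  Applied to \<open>(A x + B y + C) exp (p x + q y)\<close>, the generator gives the
  coefficient times \<open>K p q = 0\<close> plus the pairing of \<open>(A, B)\<close> with
  the gradient of \<open>K\<close>, which is \<open>(b, 1 - b)\<close> at the point with
  parameter \<open>b\<close>. The last assumption says that \<open>(A, B)\<close> is tangent
  to the parabola.
\<close>

lemma solves_generator_affine_exp_series:
  assumes bd: "expbdd A" "expbdd B" "expbdd C" and b: "b = (\<lambda>n. c + 2 * \<sigma> * real n)" "\<sigma>\<^sup>2 = 1"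
    and K: "\<And>n. A n * b n + B n * (1 - b n) = 0"
  shows "solves_generator \<gamma> (affine_exp_series \<gamma> A B C b)"
proof -
  define P Q where "P = (\<lambda>n. pc \<gamma> (b n))" and "Q = (\<lambda>n. qc \<gamma> (b n))"
  have bb: "expbdd P" "expbdd Q"
    unfolding P_def Q_def pc_def qc_def b power2_eq_square divide_inverse by (intro expbdd_intros)+
  have d: "(affine_exp_series \<gamma> A B C b has_derivative
     grad (affine_exp_series \<gamma> (\<lambda>n. A n * P n) (\<lambda>n. B n * P n) (\<lambda>n. C n * P n + A n) b z)
          (affine_exp_series \<gamma> (\<lambda>n. A n * Q n) (\<lambda>n. B n * Q n) (\<lambda>n. C n * Q n + B n) b z)) (at z)"
    if "expbdd A" "expbdd B" "expbdd C" "z \<in> quadrant" for A B C z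
    using affine_exp_series_has_derivative[OF that(1-3) b that(4)] unfolding P_def Q_def .
  have cont: "isCont (affine_exp_series \<gamma> A B C b) z" if "expbdd A" "expbdd B" "expbdd C" "z \<in> quadrant" for A B C z
    using d[OF that] by (rule has_derivative_continuous)
  show ?thesis
    unfolding solves_generator_def
  proof (intro exI ballI conjI)
    fix z assume z: "z \<in> quadrant"
    let ?ux = "affine_exp_series \<gamma> (\<lambda>n. A n * P n) (\<lambda>n. B n * P n) (\<lambda>n. C n * P n + A n) b"
    let ?uy = "affine_exp_series \<gamma> (\<lambda>n. A n * Q n) (\<lambda>n. B n * Q n) (\<lambda>n. C n * Q n + B n) b"
    let ?uxx = "affine_exp_series \<gamma> (\<lambda>n. A n * P n * P n) (\<lambda>n. B n * P n * P n) (\<lambda>n. (C n * P n + A n) * P n + A n * P n) b"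
    let ?uxy = "affine_exp_series \<gamma> (\<lambda>n. A n * P n * Q n) (\<lambda>n. B n * P n * Q n) (\<lambda>n. (C n * P n + A n) * Q n + B n * P n) b"
    let ?uyx = "affine_exp_series \<gamma> (\<lambda>n. A n * Q n * P n) (\<lambda>n. B n * Q n * P n) (\<lambda>n. (C n * Q n + B n) * P n + A n * Q n) b"
    let ?uyy = "affine_exp_series \<gamma> (\<lambda>n. A n * Q n * Q n) (\<lambda>n. B n * Q n * Q n) (\<lambda>n. (C n * Q n + B n) * Q n + B n * Q n) b"
    show "(affine_exp_series \<gamma> A B C b has_derivative grad (?ux z) (?uy z)) (at z)"
      by (rule d[OF bd z])
    show "(?ux has_derivative grad (?uxx z) (?uxy z)) (at z)" "(?uy has_derivative grad (?uyx z) (?uyy z)) (at z)"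
      by (rule d; intro expbdd_intros bd bb z)+
    show "isCont ?uxx z" "isCont ?uxy z" "isCont ?uyx z" "isCont ?uyy z"
      by (rule cont; intro expbdd_intros bd bb z)+
    have s: "(\<lambda>n. affine_exp_term \<gamma> A B C b n z) sums affine_exp_series \<gamma> A B C b z" if "expbdd A" "expbdd B" "expbdd C" for A B C
      by (rule affine_exp_series_sums[OF that b z])
    have "(\<lambda>n. (affine_exp_term \<gamma> (\<lambda>n. A n * P n * P n) (\<lambda>n. B n * P n * P n) (\<lambda>n. (C n * P n + A n) * P n + A n * P n) b n z
         - affine_exp_term \<gamma> (\<lambda>n. A n * P n * Q n) (\<lambda>n. B n * P n * Q n) (\<lambda>n. (C n * P n + A n) * Q n + B n * P n) b n z
         - (affine_exp_term \<gamma> (\<lambda>n. A n * Q n * P n) (\<lambda>n. B n * Q n * P n) (\<lambda>n. (C n * Q n + B n) * P n + A n * Q n) b n z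
          - affine_exp_term \<gamma> (\<lambda>n. A n * Q n * Q n) (\<lambda>n. B n * Q n * Q n) (\<lambda>n. (C n * Q n + B n) * Q n + B n * Q n) b n z)) / 2
         + (1 - \<gamma>) * affine_exp_term \<gamma> (\<lambda>n. A n * P n) (\<lambda>n. B n * P n) (\<lambda>n. C n * P n + A n) b n z
         + \<gamma> * affine_exp_term \<gamma> (\<lambda>n. A n * Q n) (\<lambda>n. B n * Q n) (\<lambda>n. C n * Q n + B n) b n z)
       sums ((?uxx z - ?uxy z - (?uyx z - ?uyy z)) / 2 + (1 - \<gamma>) * ?ux z + \<gamma> * ?uy z)"
      by (intro sums_add sums_diff sums_divide sums_mult s expbdd_intros bd bb)
    also have "(\<lambda>n. (affine_exp_term \<gamma> (\<lambda>n. A n * P n * P n) (\<lambda>n. B n * P n * P n) (\<lambda>n. (C n * P n + A n) * P n + A n * P n) b n z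
         - affine_exp_term \<gamma> (\<lambda>n. A n * P n * Q n) (\<lambda>n. B n * P n * Q n) (\<lambda>n. (C n * P n + A n) * Q n + B n * P n) b n z
         - (affine_exp_term \<gamma> (\<lambda>n. A n * Q n * P n) (\<lambda>n. B n * Q n * P n) (\<lambda>n. (C n * Q n + B n) * P n + A n * Q n) b n z
          - affine_exp_term \<gamma> (\<lambda>n. A n * Q n * Q n) (\<lambda>n. B n * Q n * Q n) (\<lambda>n. (C n * Q n + B n) * Q n + B n * Q n) b n z)) / 2
         + (1 - \<gamma>) * affine_exp_term \<gamma> (\<lambda>n. A n * P n) (\<lambda>n. B n * P n) (\<lambda>n. C n * P n + A n) b n z
         + \<gamma> * affine_exp_term \<gamma> (\<lambda>n. A n * Q n) (\<lambda>n. B n * Q n) (\<lambda>n. C n * Q n + B n) b n z) = (\<lambda>n. 0)"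
    proof
      fix n
      have id: "((x * P * P + (r * P + a) * P + a * P) - (x * P * Q + (r * P + a) * Q + d * P)
           - ((x * Q * P + (r * Q + d) * P + a * Q) - (x * Q * Q + (r * Q + d) * Q + d * Q))) / 2
          + (1 - \<gamma>) * (x * P + r * P + a) + \<gamma> * (x * Q + r * Q + d)
         = (x + r) * ((P - Q)\<^sup>2 / 2 + (1 - \<gamma>) * P + \<gamma> * Q) + (a * (P - Q + (1 - \<gamma>)) + d * (\<gamma> - (P - Q)))"
        for x r a d P Q :: real by (simp add: power2_eq_square field_simps)
      define x where "x = A n * fst z + B n * snd z"
      define E where "E = expo \<gamma> (b n) z"
      have "A n * (P n - Q n + (1 - \<gamma>)) + B n * (\<gamma> - (P n - Q n)) = A n * b n + B n * (1 - b n)"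
        unfolding P_def Q_def pc_minus_qc by simp
      then have z0: "(x + C n) * ((P n - Q n)\<^sup>2 / 2 + (1 - \<gamma>) * P n + \<gamma> * Q n) + (A n * (P n - Q n + (1 - \<gamma>)) + B n * (\<gamma> - (P n - Q n))) = 0"
        using K pc_qc_parabola unfolding P_def Q_def by simp
      have t: "affine_exp_term \<gamma> (\<lambda>n. A n * f n) (\<lambda>n. B n * f n) G b n z = (x * f n + G n) * E" for f G
        by (simp add: affine_exp_term_def x_def E_def algebra_simps)
      have t2: "affine_exp_term \<gamma> (\<lambda>n. A n * f n * g n) (\<lambda>n. B n * f n * g n) G b n z = (x * f n * g n + G n) * E" for f g G
        by (simp add: affine_exp_term_def x_def E_def algebra_simps)
      show "(affine_exp_term \<gamma> (\<lambda>n. A n * P n * P n) (\<lambda>n. B n * P n * P n) (\<lambda>n. (C n * P n + A n) * P n + A n * P n) b n z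
         - affine_exp_term \<gamma> (\<lambda>n. A n * P n * Q n) (\<lambda>n. B n * P n * Q n) (\<lambda>n. (C n * P n + A n) * Q n + B n * P n) b n z
         - (affine_exp_term \<gamma> (\<lambda>n. A n * Q n * P n) (\<lambda>n. B n * Q n * P n) (\<lambda>n. (C n * Q n + B n) * P n + A n * Q n) b n z
          - affine_exp_term \<gamma> (\<lambda>n. A n * Q n * Q n) (\<lambda>n. B n * Q n * Q n) (\<lambda>n. (C n * Q n + B n) * Q n + B n * Q n) b n z)) / 2
         + (1 - \<gamma>) * affine_exp_term \<gamma> (\<lambda>n. A n * P n) (\<lambda>n. B n * P n) (\<lambda>n. C n * P n + A n) b n z
         + \<gamma> * affine_exp_term \<gamma> (\<lambda>n. A n * Q n) (\<lambda>n. B n * Q n) (\<lambda>n. C n * Q n + B n) b n z = 0"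
      proof -
        have "(\<lambda>X1 X2 X3 X4 X5 X6. (X1 * E - X2 * E - (X3 * E - X4 * E)) / 2 + (1 - \<gamma>) * (X5 * E) + \<gamma> * (X6 * E))
           = (\<lambda>X1 X2 X3 X4 X5 X6. ((X1 - X2 - (X3 - X4)) / 2 + (1 - \<gamma>) * X5 + \<gamma> * X6) * E)"
          by (intro ext) (simp add: field_simps)
        note f = this[THEN fun_cong, THEN fun_cong, THEN fun_cong, THEN fun_cong, THEN fun_cong, THEN fun_cong]
        show ?thesis
          unfolding t2 t f
          using id[of x "P n" "C n" "A n" "Q n" "B n"] z0 by (simp add: add.assoc)
      qed
    qed
    finally show "(?uxx z - ?uxy z - (?uyx z - ?uyy z)) / 2 + (1 - \<gamma>) * ?ux z + \<gamma> * ?uy z = 0"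
      using sums_unique2 sums_zero by blast
  qed
qed

lemma solves_generator_expo_series:
  assumes "\<sigma>\<^sup>2 = 1"
  shows "solves_generator \<gamma> (\<lambda>z. \<Sum>n. expo \<gamma> (c + 2 * \<sigma> * real n) z)"
  using solves_generator_affine_exp_series[where \<gamma> = \<gamma> and c = c and \<sigma> = \<sigma>, OF expbdd_const[of 0] expbdd_const[of 0] expbdd_const[of 1] refl assms]
  by (simp add: affine_exp_series_def[abs_def] affine_exp_term_def)

lemma solves_generator_image_series: "solves_generator \<gamma> (image_series \<gamma> a)"
proof -
  define f where "f = (\<lambda>c \<sigma> z. \<Sum>n. expo \<gamma> (c + 2 * \<sigma> * real n) z)"
  have f: "solves_generator \<gamma> (f c 1)" "solves_generator \<gamma> (f c (- 1))" for c
    unfolding f_def by (rule solves_generator_expo_series, simp)+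
  have "solves_generator \<gamma> (\<lambda>z. 1 * (1 * f a (- 1) z + 1 * f (a + 2) 1 z) + (- 1) * (1 * f (- a) (- 1) z + 1 * f (2 - a) 1 z))"
    by (intro solves_generator_lincomb f)
  then show ?thesis
  proof (rule solves_generator_cong)
    fix z assume "z \<in> quadrant"
    then have s: "sz z > 0" by (rule quadrant_sz_pos)
    have e: "f c (- 1) z = prefactor \<gamma> z * gsum (sz z) (uz z - c)" "f c 1 z = prefactor \<gamma> z * gsum (sz z) (c - uz z)" for c
      using sums_unique[OF expo_series(1)[OF s, of \<gamma> c]] sums_unique[OF expo_series(2)[OF s, of \<gamma> c]] by (simp_all add: f_def)
    show "image_series \<gamma> a z = 1 * (1 * f a (- 1) z + 1 * f (a + 2) 1 z) + (- 1) * (1 * f (- a) (- 1) z + 1 * f (2 - a) 1 z)"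
      unfolding e image_series_def by (simp add: algebra_simps)
  qed
qed

lemma solves_generator_image_series_deriv: "solves_generator \<gamma> (image_series_deriv \<gamma>)" and solves_generator_image_series_deriv_swap: "solves_generator \<gamma> (\<lambda>z. image_series_deriv (1 - \<gamma>) (prod.swap z))"
proof -
  have bd: "expbdd (\<lambda>n. 2 * real n)" "expbdd (\<lambda>n. 2 * real n - 1)" "expbdd (\<lambda>n. 2 * real n + 2)" "expbdd (\<lambda>n. 2 * real n + 3)" "expbdd (\<lambda>n. 0)"
    by (intro expbdd_intros)+
  define f1 where "f1 = (\<lambda>\<gamma>. affine_exp_series \<gamma> (\<lambda>n. 2 * real n) (\<lambda>n. 2 * real n - 1) (\<lambda>n. 0) (\<lambda>n. 1 + 2 * (- 1) * real n))"
  define f2 where "f2 = (\<lambda>\<gamma>. affine_exp_series \<gamma> (\<lambda>n. 2 * real n + 2) (\<lambda>n. 2 * real n + 3) (\<lambda>n. 0) (\<lambda>n. 3 + 2 * 1 * real n))"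
  define g1 where "g1 = affine_exp_series \<gamma> (\<lambda>n. 2 * real n - 1) (\<lambda>n. 2 * real n) (\<lambda>n. 0) (\<lambda>n. 0 + 2 * 1 * real n)"
  define g2 where "g2 = affine_exp_series \<gamma> (\<lambda>n. 2 * real n + 3) (\<lambda>n. 2 * real n + 2) (\<lambda>n. 0) (\<lambda>n. - 2 + 2 * (- 1) * real n)"
  have n: "solves_generator \<gamma> (f1 \<gamma>)" "solves_generator \<gamma> (f2 \<gamma>)" "solves_generator \<gamma> g1" "solves_generator \<gamma> g2"
    unfolding f1_def f2_def g1_def g2_def by (rule solves_generator_affine_exp_series[OF bd(1,2,5) refl] solves_generator_affine_exp_series[OF bd(3,4,5) refl]
       solves_generator_affine_exp_series[OF bd(2,1,5) refl] solves_generator_affine_exp_series[OF bd(4,3,5) refl]; simp add: algebra_simps)+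
  have val: "image_series_deriv \<gamma> z = (- 1) * f1 \<gamma> z + 1 * f2 \<gamma> z" if z: "z \<in> quadrant" for z \<gamma>
  proof -
    have s: "sz z > 0" by (rule quadrant_sz_pos[OF z])
    have x: "fst z = uz z * sz z" "snd z = (1 - uz z) * sz z" using s by (simp_all add: uz_def sz_def field_simps)
    have 1: "(\<lambda>n. affine_exp_term \<gamma> (\<lambda>n. 2 * real n) (\<lambda>n. 2 * real n - 1) (\<lambda>n. 0) (\<lambda>n. 1 + 2 * (- 1) * real n) n z) sums (prefactor \<gamma> z * gsumd (sz z) (uz z - 1))"
    proof -
      have "affine_exp_term \<gamma> (\<lambda>n. 2 * real n) (\<lambda>n. 2 * real n - 1) (\<lambda>n. 0) (\<lambda>n. 1 + 2 * (- 1) * real n) n z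
          = prefactor \<gamma> z * (sz z * (uz z - 1 + 2 * real n) * exp (- (sz z * (uz z - 1 + 2 * real n)\<^sup>2 / 2)))" for n
      proof -
        have E: "uz z - (1 + 2 * (- 1) * real n) = uz z - 1 + 2 * real n" by simp
        have X: "2 * real n * fst z + (2 * real n - 1) * snd z + 0 = sz z * (uz z - 1 + 2 * real n)"
          unfolding x by (simp add: algebra_simps)
        show ?thesis unfolding affine_exp_term_def expo_eq_gauss[OF s] E X by (simp only: mult_ac)
      qed
      then show ?thesis by (simp only:) (intro sums_mult gsumd_sums s)
    qed
    have 2: "(\<lambda>n. affine_exp_term \<gamma> (\<lambda>n. 2 * real n + 2) (\<lambda>n. 2 * real n + 3) (\<lambda>n. 0) (\<lambda>n. 3 + 2 * 1 * real n) n z) sums (prefactor \<gamma> z * gsumd (sz z) (3 - uz z))"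
    proof -
      have "affine_exp_term \<gamma> (\<lambda>n. 2 * real n + 2) (\<lambda>n. 2 * real n + 3) (\<lambda>n. 0) (\<lambda>n. 3 + 2 * 1 * real n) n z
          = prefactor \<gamma> z * (sz z * (3 - uz z + 2 * real n) * exp (- (sz z * (3 - uz z + 2 * real n)\<^sup>2 / 2)))" for n
      proof -
        have E: "(uz z - (3 + 2 * 1 * real n))\<^sup>2 = (3 - uz z + 2 * real n)\<^sup>2" by (simp add: power2_eq_square algebra_simps)
        have X: "(2 * real n + 2) * fst z + (2 * real n + 3) * snd z + 0 = sz z * (3 - uz z + 2 * real n)"
          unfolding x by (simp add: algebra_simps)
        show ?thesis unfolding affine_exp_term_def expo_eq_gauss[OF s] E X by (simp only: mult_ac)
      qed
      then show ?thesis by (simp only:) (intro sums_mult gsumd_sums s)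
    qed
    have "f1 \<gamma> z = prefactor \<gamma> z * gsumd (sz z) (uz z - 1)" "f2 \<gamma> z = prefactor \<gamma> z * gsumd (sz z) (3 - uz z)"
      unfolding f1_def f2_def affine_exp_series_def using sums_unique[OF 1] sums_unique[OF 2] by simp_all
    moreover have "gsumd (sz z) (uz z - 1) = sz z * (uz z - 1) * exp (- (sz z * (uz z - 1)\<^sup>2 / 2)) + gsumd (sz z) (uz z + 1)"
      using gsumd_step[OF s, of "uz z - 1"] by (simp add: algebra_simps)
    ultimately show ?thesis by (simp add: image_series_deriv_def algebra_simps)
  qed
  show "solves_generator \<gamma> (image_series_deriv \<gamma>)" by (rule solves_generator_cong[OF solves_generator_lincomb[OF n(1,2)] val])
  show "solves_generator \<gamma> (\<lambda>z. image_series_deriv (1 - \<gamma>) (prod.swap z))"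
  proof (rule solves_generator_cong[OF solves_generator_lincomb[OF n(3,4), of "- 1" 1]])
    fix z assume z: "z \<in> quadrant"
    have ex: "expo (1 - \<gamma>) b (prod.swap z) = expo \<gamma> (1 - b) z" for b
      using expo_swap[of \<gamma> "1 - b" z] by simp
    have "f1 (1 - \<gamma>) (prod.swap z) = g1 z" "f2 (1 - \<gamma>) (prod.swap z) = g2 z"
      unfolding f1_def f2_def g1_def g2_def affine_exp_series_def affine_exp_term_def ex by (simp_all add: add.commute)
    then show "image_series_deriv (1 - \<gamma>) (prod.swap z) = - 1 * g1 z + 1 * g2 z"
      using val[of "prod.swap z" "1 - \<gamma>"] z by simp
  qed
qed

lemma solves_generator_mkern:
  assumes "a \<in> {0..1}"
  shows "solves_generator \<gamma> (mkern \<gamma> a)"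
proof -
  have pos: "hconst a > 0" by (rule hconst_pos[OF assms])
  have ht: "mkern \<gamma> a z = (1 / hconst a) * htilde \<gamma> (parab \<gamma> a) z + 0 * htilde \<gamma> (parab \<gamma> a) z" if "z \<in> quadrant" for z
    using htilde_eq_mkern[OF assms that, of \<gamma>] pos by simp
  have "solves_generator \<gamma> (htilde \<gamma> (parab \<gamma> a))"
  proof -
    consider "a = 0" | "a = 1" | "0 < a" "a < 1" using assms by fastforce
    then show ?thesis
    proof cases
      case 1
      show ?thesis
        by (rule solves_generator_cong[OF solves_generator_image_series_deriv_swap]) (simp add: 1 htilde_pi_half htilde_0)
    next
      case 2
      show ?thesis by (rule solves_generator_cong[OF solves_generator_image_series_deriv]) (simp add: 2 htilde_0)
    next
      case 3
      show ?thesis by (rule solves_generator_cong[OF solves_generator_image_series]) (simp add: 3 htilde_interior)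
    qed
  qed
  from solves_generator_lincomb[OF this this] show ?thesis by (rule solves_generator_cong) (rule ht)
qed

text \<open>
  The formula for \<open>mkern\<close> is continuous up to the axes, and the heat kernel
  vanishes at \<open>u = 0\<close> and \<open>u = 1\<close>.
\<close>

lemma mkern_boundary:
  assumes "b \<in> {0<..} \<times> {0} \<union> {0} \<times> {0<..}"
  shows "(mkern \<gamma> a \<longlongrightarrow> 0) (at b within quadrant)"
proof -
  have s: "sz b > 0" and u: "uz b = 0 \<or> uz b = 1" using assms by (auto simp: sz_def uz_def)
  have "((\<lambda>z. prefactor \<gamma> z / sqrt (sz z) * qheat (1 / sz z) (uz z) a) \<longlongrightarrow> prefactor \<gamma> b / sqrt (sz b) * qheat (1 / sz b) (uz b) a) (at b within quadrant)"
  proof -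
    have fs: "((\<lambda>z. fst z) \<longlongrightarrow> fst b) (at b within quadrant)" "((\<lambda>z. snd z) \<longlongrightarrow> snd b) (at b within quadrant)"
      by (intro tendsto_intros)+
    have sl: "(sz \<longlongrightarrow> sz b) (at b within quadrant)" unfolding sz_def by (intro tendsto_intros)
    have ul: "(uz \<longlongrightarrow> uz b) (at b within quadrant)"
      unfolding uz_def using s by (intro tendsto_intros) (simp add: sz_def)
    have el: "(prefactor \<gamma> \<longlongrightarrow> prefactor \<gamma> b) (at b within quadrant)"
      unfolding prefactor_def using s by (intro tendsto_intros) (simp add: sz_def)
    show ?thesis
      using s by (intro tendsto_mult tendsto_divide tendsto_real_sqrt tendsto_qheat tendsto_const sl ul el) auto
  qed
  then show ?thesis using u by (auto simp: mkern_def[abs_def])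
qed

context standard_brownian_motion begin

lemma mkern_pos: "z \<in> quadrant \<Longrightarrow> a \<in> {0..1} \<Longrightarrow> mkern \<gamma> a z > 0"
  using quadrant_sz_pos[of z] uz_quadrant[of z] qheat_pos[of "1 / sz z" "uz z" a]
  by (simp add: mkern_def)

lemma positive_harmonic_mkern:
  assumes "a \<in> {0..1}" "c > 0" "\<And>z. z \<in> quadrant \<Longrightarrow> f z = c * mkern \<gamma> a z"
  shows "positive_harmonic \<gamma> f"
proof -
  have "solves_generator \<gamma> f"
    by (rule solves_generator_cong[OF solves_generator_lincomb[OF solves_generator_mkern[OF assms(1)] solves_generator_mkern[OF assms(1)], of \<gamma> c 0]])
       (simp add: assms(3))
  moreover have "(f \<longlongrightarrow> 0) (at b within quadrant)" if "b \<in> {0<..} \<times> {0} \<union> {0} \<times> {0<..}" for b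
  proof (rule Lim_transform_eventually)
    show "((\<lambda>z. c * mkern \<gamma> a z) \<longlongrightarrow> 0) (at b within quadrant)"
      using tendsto_mult[OF tendsto_const mkern_boundary[OF that]] by simp
    show "\<forall>\<^sub>F z in at b within quadrant. c * mkern \<gamma> a z = f z"
      by (auto simp: eventually_at_filter assms(3))
  qed
  ultimately have "harmonic \<gamma> f" unfolding harmonic_def using solves_generator_imp_classical[of \<gamma> f] by blast
  then show ?thesis
    unfolding positive_harmonic_def using assms mkern_pos by simp
qed

end

section \<open>Representation of harmonic functions by the heat semigroup\<close>

text \<open>
  The equation at a single point, with second derivative along the noise direction \<open>(1,
  - 1)\<close> and first derivative along the drift \<open>(1 - \<gamma>, \<gamma>)\<close>.
  The minimum principle uses these two directional derivatives only, and they are easy to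
  compute for \<open>eigfun\<close>.
\<close>

definition heat_at :: "real \<Rightarrow> (real \<times> real \<Rightarrow> real) \<Rightarrow> real \<times> real \<Rightarrow> bool" where
  "heat_at \<gamma> F z \<longleftrightarrow> (\<exists>\<phi>' d1 d2.
     (\<forall>\<^sub>F h in nhds 0. ((\<lambda>h. F (fst z + h, snd z - h)) has_real_derivative \<phi>' h) (at h)) \<and>
     (\<phi>' has_real_derivative d2) (at 0) \<and>
     ((\<lambda>h. F (fst z + (1 - \<gamma>) * h, snd z + \<gamma> * h)) has_real_derivative d1) (at 0) \<and>
     d1 + d2 / 2 = 0)"

lemma heat_at_lincomb:
  assumes "heat_at \<gamma> F z" "heat_at \<gamma> G z"
  shows "heat_at \<gamma> (\<lambda>z. c * F z + d * G z) z"
proof -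
  obtain \<phi>' d1 d2 where F: "\<forall>\<^sub>F h in nhds 0. ((\<lambda>h. F (fst z + h, snd z - h)) has_real_derivative \<phi>' h) (at h)"
    "(\<phi>' has_real_derivative d2) (at 0)" "((\<lambda>h. F (fst z + (1 - \<gamma>) * h, snd z + \<gamma> * h)) has_real_derivative d1) (at 0)"
    "d1 + d2 / 2 = 0" using assms(1) unfolding heat_at_def by blast
  obtain \<psi>' e1 e2 where G: "\<forall>\<^sub>F h in nhds 0. ((\<lambda>h. G (fst z + h, snd z - h)) has_real_derivative \<psi>' h) (at h)"
    "(\<psi>' has_real_derivative e2) (at 0)" "((\<lambda>h. G (fst z + (1 - \<gamma>) * h, snd z + \<gamma> * h)) has_real_derivative e1) (at 0)"
    "e1 + e2 / 2 = 0" using assms(2) unfolding heat_at_def by blast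
  show ?thesis
    unfolding heat_at_def
  proof (intro exI conjI)
    show "\<forall>\<^sub>F h in nhds 0. ((\<lambda>h. c * F (fst z + h, snd z - h) + d * G (fst z + h, snd z - h)) has_real_derivative c * \<phi>' h + d * \<psi>' h) (at h)"
      using F(1) G(1) by eventually_elim (intro DERIV_add DERIV_cmult)
    show "((\<lambda>h. c * \<phi>' h + d * \<psi>' h) has_real_derivative c * d2 + d * e2) (at 0)"
      by (intro DERIV_add DERIV_cmult F G)
    show "((\<lambda>h. c * F (fst z + (1 - \<gamma>) * h, snd z + \<gamma> * h) + d * G (fst z + (1 - \<gamma>) * h, snd z + \<gamma> * h)) has_real_derivative c * d1 + d * e1) (at 0)"
      by (intro DERIV_add DERIV_cmult F G)
    have "c * d1 + d * e1 + (c * d2 + d * e2) / 2 = c * (d1 + d2 / 2) + d * (e1 + e2 / 2)" by (simp add: field_simps)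
    then show "c * d1 + d * e1 + (c * d2 + d * e2) / 2 = 0" using F(4) G(4) by simp
  qed
qed

lemma heat_at_cong:
  assumes "heat_at \<gamma> F z" "z \<in> quadrant" "\<And>w. w \<in> quadrant \<Longrightarrow> G w = F w"
  shows "heat_at \<gamma> G z"
proof -
  obtain \<phi>' d1 d2 where F: "\<forall>\<^sub>F h in nhds 0. ((\<lambda>h. F (fst z + h, snd z - h)) has_real_derivative \<phi>' h) (at h)"
    "(\<phi>' has_real_derivative d2) (at 0)" "((\<lambda>h. F (fst z + (1 - \<gamma>) * h, snd z + \<gamma> * h)) has_real_derivative d1) (at 0)"
    "d1 + d2 / 2 = 0" using assms(1) unfolding heat_at_def by blast
  define U where "U = (\<lambda>h. (fst z + h, snd z - h)) -` quadrant"
  define V where "V = (\<lambda>h. (fst z + (1 - \<gamma>) * h, snd z + \<gamma> * h)) -` quadrant"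
  have U: "open U" "0 \<in> U" and V: "open V" "0 \<in> V"
    unfolding U_def V_def using assms(2) by (auto intro!: open_vimage open_quadrant continuous_intros)
  show ?thesis
    unfolding heat_at_def
  proof (intro exI conjI)
    have "\<forall>\<^sub>F h in nhds 0. h \<in> U" by (rule eventually_nhds_in_open[OF U])
    with F(1) show "\<forall>\<^sub>F h in nhds 0. ((\<lambda>h. G (fst z + h, snd z - h)) has_real_derivative \<phi>' h) (at h)"
    proof eventually_elim
      case (elim h)
      show ?case
        by (rule has_field_derivative_transform_within_open[OF elim(1) U(1) elim(2)]) (auto simp: U_def assms(3))
    qed
    show "((\<lambda>h. G (fst z + (1 - \<gamma>) * h, snd z + \<gamma> * h)) has_real_derivative d1) (at 0)"
      by (rule has_field_derivative_transform_within_open[OF F(3) V]) (auto simp: V_def assms(3))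
  qed (use F in auto)
qed

lemma heat_at_classical:
  assumes C2: "C2_on quadrant v" and z: "z \<in> quadrant" and gen: "generator \<gamma> v z = 0"
  shows "heat_at \<gamma> v z"
proof -
  have d: "v differentiable_on quadrant" "partial_x v differentiable_on quadrant" "partial_y v differentiable_on quadrant"
    using C2 by (auto simp: C2_on_def C1_on_def)
  note dv = gradient_of_differentiable[OF d(1)] and dx = gradient_of_differentiable[OF d(2) z] and dy = gradient_of_differentiable[OF d(3) z]
  define Dv where "Dv = (\<lambda>w. partial_x v w - partial_y v w)"
  define a where "a = partial_x (partial_x v) z - partial_x (partial_y v) z"
  define b where "b = partial_y (partial_x v) z - partial_y (partial_y v) z"
  have dD: "(Dv has_derivative grad a b) (at z)"
    using has_derivative_lincomb[OF dx dy, of 1 "- 1"] by (simp add: Dv_def a_def b_def)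
  have line: "((\<lambda>h. f (fst z + p * h, snd z + q * h)) has_real_derivative (A * p + B * q)) (at t)"
    if "(f has_derivative grad A B) (at (fst z + p * t, snd z + q * t))" for f A B p q t
  proof -
    have "((f \<circ> (\<lambda>h. (fst z + p * h, snd z + q * h))) has_derivative (grad A B \<circ> (\<lambda>h. (p * h, q * h)))) (at t)"
      by (rule diff_chain_at) (use that in \<open>auto intro!: derivative_eq_intros\<close>)
    moreover have "grad A B \<circ> (\<lambda>h. (p * h, q * h)) = (*) (A * p + B * q)"
      by (auto simp: grad_def fun_eq_iff algebra_simps)
    ultimately show ?thesis by (simp add: has_field_derivative_def o_def)
  qed
  define U where "U = (\<lambda>h. (fst z + h, snd z - h)) -` quadrant"
  have U: "open U" "0 \<in> U"
    unfolding U_def using z by (auto intro!: open_vimage open_quadrant continuous_intros)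
  show ?thesis
    unfolding heat_at_def
  proof (intro exI conjI)
    have "\<forall>\<^sub>F h in nhds 0. h \<in> U" by (rule eventually_nhds_in_open[OF U])
    then show "\<forall>\<^sub>F h in nhds 0. ((\<lambda>h. v (fst z + h, snd z - h)) has_real_derivative Dv (fst z + h, snd z - h)) (at h)"
    proof eventually_elim
      case (elim h)
      then have "(fst z + h, snd z - h) \<in> quadrant" by (simp add: U_def)
      from dv[OF this] show ?case using line[of v _ _ 1 h "- 1"] by (simp add: Dv_def)
    qed
    show "((\<lambda>h. Dv (fst z + h, snd z - h)) has_real_derivative (a - b)) (at 0)"
      using line[of Dv a b 1 0 "- 1"] dD by simp
    show "((\<lambda>h. v (fst z + (1 - \<gamma>) * h, snd z + \<gamma> * h)) has_real_derivative (partial_x v z * (1 - \<gamma>) + partial_y v z * \<gamma>)) (at 0)"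
      using line[of v "partial_x v z" "partial_y v z" "1 - \<gamma>" 0 \<gamma>] dv[OF z] by simp
    have "generator \<gamma> v z = (a - b) / 2 + (1 - \<gamma>) * partial_x v z + \<gamma> * partial_y v z"
      using partials_of_gradient[OF dD] by (simp add: generator_def Let_def Dv_def)
    then show "partial_x v z * (1 - \<gamma>) + partial_y v z * \<gamma> + (a - b) / 2 = 0" using gen by (simp add: mult.commute)
  qed
qed

text \<open>
  In the direction \<open>(1, - 1)\<close> the level \<open>s\<close> is constant, and in the
  drift direction the deviation \<open>\<xi> = x - (1 - \<gamma>) s\<close> is constant; in
  each direction a one-variable computation remains.
\<close>

lemma heat_at_eigfun:
  assumes z: "z \<in> quadrant"
  shows "heat_at \<gamma> (eigfun \<gamma> k) z"
proof -
  define s where "s = sz z"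
  define \<xi> where "\<xi> = fst z - (1 - \<gamma>) * s"
  define \<kappa> where "\<kappa> = real k * pi"
  have s: "s > 0" using quadrant_sz_pos[OF z] by (simp add: s_def)
  define c where "c = eig (1 / s) k / sqrt s"
  define \<theta> where "\<theta> = \<kappa> * (\<xi> / s + (1 - \<gamma>))"
  define E where "E = exp (\<xi>\<^sup>2 / (2 * s))"
  have sum: "fst z + snd z = s" by (simp add: s_def sz_def)
  have along: "eigfun \<gamma> k (fst z + h, snd z - h) = c * (exp ((\<xi> + h)\<^sup>2 / (2 * s)) * sin (\<kappa> * ((\<xi> + h) / s + (1 - \<gamma>))))" for h
  proof -
    have sz: "sz (fst z + h, snd z - h) = s" using sum by (simp add: sz_def)
    have x: "fst z + h = \<xi> + h + (1 - \<gamma>) * s" by (simp add: \<xi>_def)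
    have sum': "fst z + h + (snd z - h) = s" using sum by simp
    have e: "prefactor \<gamma> (fst z + h, snd z - h) = exp ((\<xi> + h)\<^sup>2 / (2 * s))"
      unfolding prefactor_def fst_conv snd_conv sum' by (simp add: x)
    have u: "uz (fst z + h, snd z - h) = (\<xi> + h) / s + (1 - \<gamma>)"
      unfolding uz_def fst_conv snd_conv sum' using s by (simp add: x add_divide_distrib)
    show ?thesis unfolding eigfun_def sz e u by (simp add: c_def \<kappa>_def mult_ac)
  qed
  define \<phi>' where "\<phi>' = (\<lambda>h. c * (exp ((\<xi> + h)\<^sup>2 / (2 * s)) * ((\<xi> + h) / s) * sin (\<kappa> * ((\<xi> + h) / s + (1 - \<gamma>)))
     + exp ((\<xi> + h)\<^sup>2 / (2 * s)) * (\<kappa> / s * cos (\<kappa> * ((\<xi> + h) / s + (1 - \<gamma>))))))"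
  define d2 where "d2 = c * E * ((\<xi>\<^sup>2 / s\<^sup>2 + 1 / s - \<kappa>\<^sup>2 / s\<^sup>2) * sin \<theta> + 2 * \<xi> * \<kappa> / s\<^sup>2 * cos \<theta>)"
  define d1 where "d1 = c * E * ((\<kappa>\<^sup>2 / (2 * s\<^sup>2) - 1 / (2 * s) - \<xi>\<^sup>2 / (2 * s\<^sup>2)) * sin \<theta> - \<kappa> * \<xi> / s\<^sup>2 * cos \<theta>)"
  have D1: "((\<lambda>h. eigfun \<gamma> k (fst z + h, snd z - h)) has_real_derivative \<phi>' h) (at h)" for h
    unfolding along \<phi>'_def
    by (rule DERIV_cmult) (use s in \<open>auto intro!: derivative_eq_intros simp: field_simps\<close>)
  have D2: "(\<phi>' has_real_derivative d2) (at 0)"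
  proof -
    have "((\<lambda>h. exp ((\<xi> + h)\<^sup>2 / (2 * s)) * ((\<xi> + h) / s) * sin (\<kappa> * ((\<xi> + h) / s + (1 - \<gamma>)))
     + exp ((\<xi> + h)\<^sup>2 / (2 * s)) * (\<kappa> / s * cos (\<kappa> * ((\<xi> + h) / s + (1 - \<gamma>))))) has_real_derivative
      E * ((\<xi>\<^sup>2 / s\<^sup>2 + 1 / s - \<kappa>\<^sup>2 / s\<^sup>2) * sin \<theta> + 2 * \<xi> * \<kappa> / s\<^sup>2 * cos \<theta>)) (at 0)"
      using s by (auto intro!: derivative_eq_intros simp: E_def \<theta>_def) (simp add: power2_eq_square field_simps)
    from DERIV_cmult[OF this, of c] show ?thesis by (simp add: \<phi>'_def[abs_def] d2_def mult.assoc)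
  qed
  have D3: "((\<lambda>h. eigfun \<gamma> k (fst z + (1 - \<gamma>) * h, snd z + \<gamma> * h)) has_real_derivative d1) (at 0)"
  proof -
    define f where "f = (\<lambda>h. exp (\<xi>\<^sup>2 / (2 * (s + h))) / sqrt (s + h) * exp (- (\<kappa>\<^sup>2 / (2 * (s + h)))) * sin (\<kappa> * (\<xi> / (s + h) + (1 - \<gamma>))))"
    have "(f has_real_derivative d1) (at 0)"
    proof -
      define X where "X = exp (- (\<kappa>\<^sup>2 / (2 * s)))"
      define r where "r = 1 / sqrt s"
      have sq: "sqrt s * sqrt s = s" using s by simp
      have A1: "((\<lambda>h. exp (\<xi>\<^sup>2 / (2 * (s + h)))) has_real_derivative E * (- (\<xi>\<^sup>2 / (2 * s\<^sup>2)))) (at 0)"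
        using s by (auto intro!: derivative_eq_intros simp: E_def) (simp add: power2_eq_square field_simps)
      have A2: "((\<lambda>h. 1 / sqrt (s + h)) has_real_derivative - (r / (2 * s))) (at 0)"
        using s by (auto intro!: derivative_eq_intros simp: r_def sq) (simp add: field_simps)
      have A3: "((\<lambda>h. exp (- (\<kappa>\<^sup>2 / (2 * (s + h))))) has_real_derivative X * (\<kappa>\<^sup>2 / (2 * s\<^sup>2))) (at 0)"
        using s by (auto intro!: derivative_eq_intros simp: X_def) (simp add: power2_eq_square field_simps)
      have A4: "((\<lambda>h. sin (\<kappa> * (\<xi> / (s + h) + (1 - \<gamma>)))) has_real_derivative cos \<theta> * (- (\<kappa> * \<xi> / s\<^sup>2))) (at 0)"
        using s by (auto intro!: derivative_eq_intros simp: \<theta>_def power2_eq_square)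
      have c: "c = X * r" by (simp add: c_def eig_def X_def r_def \<kappa>_def)
      have "((\<lambda>h. exp (\<xi>\<^sup>2 / (2 * (s + h))) * (1 / sqrt (s + h)) * exp (- (\<kappa>\<^sup>2 / (2 * (s + h)))) * sin (\<kappa> * (\<xi> / (s + h) + (1 - \<gamma>)))) has_real_derivative d1) (at 0)"
      proof (rule DERIV_cong[OF DERIV_mult[OF DERIV_mult[OF DERIV_mult[OF A1 A2] A3] A4]])
        show "((E * - (\<xi>\<^sup>2 / (2 * s\<^sup>2)) * (1 / sqrt (s + 0)) + - (r / (2 * s)) * exp (\<xi>\<^sup>2 / (2 * (s + 0)))) * exp (- (\<kappa>\<^sup>2 / (2 * (s + 0)))) +
             X * (\<kappa>\<^sup>2 / (2 * s\<^sup>2)) * (exp (\<xi>\<^sup>2 / (2 * (s + 0))) * (1 / sqrt (s + 0)))) * sin (\<kappa> * (\<xi> / (s + 0) + (1 - \<gamma>))) +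
            cos \<theta> * - (\<kappa> * \<xi> / s\<^sup>2) * (exp (\<xi>\<^sup>2 / (2 * (s + 0))) * (1 / sqrt (s + 0)) * exp (- (\<kappa>\<^sup>2 / (2 * (s + 0))))) = d1"
          unfolding d1_def c add_0_right E_def[symmetric] X_def[symmetric] r_def[symmetric] \<theta>_def[symmetric]
          by (simp add: algebra_simps)
      qed
      then show ?thesis by (simp add: f_def)
    qed
    then show ?thesis
    proof (rule has_field_derivative_transform_within_open[where S = "{- s<..}"])
      fix h assume h: "h \<in> {- s<..}"
      define w where "w = (fst z + (1 - \<gamma>) * h, snd z + \<gamma> * h)"
      have sw: "fst w + snd w = s + h" using sum by (simp add: w_def algebra_simps)
      have x: "fst w = \<xi> + (1 - \<gamma>) * (s + h)" by (simp add: w_def \<xi>_def algebra_simps)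
      have "prefactor \<gamma> w = exp (\<xi>\<^sup>2 / (2 * (s + h)))" unfolding prefactor_def sw by (simp add: x)
      moreover have "uz w = \<xi> / (s + h) + (1 - \<gamma>)" unfolding uz_def sw using h by (simp add: x add_divide_distrib)
      moreover have "eig (1 / (s + h)) k = exp (- (\<kappa>\<^sup>2 / (2 * (s + h))))" by (simp add: eig_def \<kappa>_def)
      moreover have "sz w = s + h" using sw by (simp add: sz_def)
      ultimately show "f h = eigfun \<gamma> k (fst z + (1 - \<gamma>) * h, snd z + \<gamma> * h)"
        unfolding w_def[symmetric] by (simp add: eigfun_def f_def \<kappa>_def)
    qed (use s in auto)
  qed
  have "d1 + d2 / 2 = 0" unfolding d1_def d2_def using s by (simp add: field_simps)
  then show ?thesis
    unfolding heat_at_def using D1 D2 D3 by (intro exI[of _ \<phi>'] exI[of _ d1] exI[of _ d2] conjI always_eventually allI)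
qed

lemma second_derivative_at_local_min:
  fixes f f' :: "real \<Rightarrow> real"
  assumes "\<forall>\<^sub>F h in nhds 0. (f has_real_derivative f' h) (at h)" "(f' has_real_derivative d) (at 0)"
    and min: "\<forall>\<^sub>F h in nhds 0. f 0 \<le> f h"
  shows "0 \<le> d"
proof (rule ccontr)
  assume "\<not> 0 \<le> d"
  then have "d < 0" by simp
  obtain e where e: "e > 0" "\<And>h. \<bar>h\<bar> < e \<Longrightarrow> (f has_real_derivative f' h) (at h)" "\<And>h. \<bar>h\<bar> < e \<Longrightarrow> f 0 \<le> f h"
  proof -
    obtain e where "e > 0" "\<forall>h. dist h 0 < e \<longrightarrow> (f has_real_derivative f' h) (at h) \<and> f 0 \<le> f h"
      using eventually_conj[OF assms(1) min] unfolding eventually_nhds_metric by blast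
    then show ?thesis using that[of e] by (auto simp: dist_real_def)
  qed
  have f'0: "f' 0 = 0"
    by (rule DERIV_local_min[OF e(2)[of 0] e(1)]) (use e in auto)
  obtain \<delta> where \<delta>: "\<delta> > 0" "\<And>h. 0 < h \<Longrightarrow> h < \<delta> \<Longrightarrow> f' h < f' 0"
    using DERIV_neg_dec_right[OF assms(2) \<open>d < 0\<close>] by auto
  define t where "t = min e \<delta> / 2"
  have t: "0 < t" "t < e" "t < \<delta>" using e(1) \<delta>(1) by (auto simp: t_def)
  have "\<exists>x>0. x < t \<and> f t - f 0 = (t - 0) * f' x"
    by (rule MVT2) (use t e in auto)
  then obtain x where x: "0 < x" "x < t" "f t - f 0 = t * f' x" by auto
  then have "f' x < 0" using \<delta>(2)[of x] t f'0 by simp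
  then have "t * f' x < 0" using t by (simp add: mult_pos_neg)
  then have "f t < f 0" using x by linarith
  moreover have "f 0 \<le> f t" using e(3)[of t] t by simp
  ultimately show False by simp
qed

lemma derivative_at_right_min:
  fixes f :: "real \<Rightarrow> real"
  assumes "(f has_real_derivative d) (at 0)" and min: "\<forall>\<^sub>F h in at_right 0. f 0 \<le> f h"
  shows "0 \<le> d"
proof (rule ccontr)
  assume "\<not> 0 \<le> d"
  then obtain \<delta> where \<delta>: "\<delta> > 0" "\<And>h. 0 < h \<Longrightarrow> h < \<delta> \<Longrightarrow> f h < f 0"
    using DERIV_neg_dec_right[OF assms(1)] by auto
  then have "\<forall>\<^sub>F h in at_right 0. f h < f 0"
    by (intro eventually_at_rightI[of 0 \<delta>]) auto
  with min have "\<forall>\<^sub>F h in at_right (0::real). False" by eventually_elim simp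
  then show False by simp
qed

text \<open>
  The part of the closed quadrant between two levels. Its lower side \<open>sz z = s1\<close>
  plays the role of the final time: it carries no boundary condition.
\<close>

definition wedge :: "real \<Rightarrow> real \<Rightarrow> (real \<times> real) set" where
  "wedge s1 s2 = {z. 0 \<le> fst z \<and> 0 \<le> snd z \<and> s1 \<le> sz z \<and> sz z \<le> s2}"

lemma compact_wedge: "compact (wedge s1 s2)"
proof -
  have "wedge s1 s2 = ({0..s2} \<times> {0..s2}) \<inter> {z. s1 \<le> sz z} \<inter> {z. sz z \<le> s2}"
    by (auto simp: wedge_def sz_def)
  moreover have "closed {z. s1 \<le> sz z}" "closed {z. sz z \<le> s2}"
    by (intro closed_Collect_le continuous_intros)+
  moreover have "compact ({0..s2} \<times> {0..s2})" by (intro compact_Times compact_Icc)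
  ultimately show ?thesis by (simp add: compact_Int_closed)
qed

text \<open>
  At an interior minimum of \<open>F - \<eta> s\<close> the second derivative along the level
  is nonnegative, and the derivative in the drift direction, which raises \<open>s\<close>, is
  at least \<open>\<eta>\<close>. Together these contradict the equation.
\<close>

theorem heat_minimum_principle:
  assumes \<gamma>: "0 < \<gamma>" "\<gamma> < 1" and cont: "continuous_on (wedge s1 s2) F" and "0 < s1"
    and bd: "\<And>z. z \<in> wedge s1 s2 \<Longrightarrow> fst z = 0 \<or> snd z = 0 \<or> sz z = s2 \<Longrightarrow> - \<delta> \<le> F z"
    and int: "\<And>z. z \<in> quadrant \<Longrightarrow> s1 \<le> sz z \<Longrightarrow> sz z < s2 \<Longrightarrow> heat_at \<gamma> F z"
    and z: "z \<in> wedge s1 s2"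
  shows "- \<delta> \<le> F z"
proof (rule field_le_epsilon)
  fix e :: real assume "0 < e"
  define L where "L = s2 - s1 + 1"
  have L: "L > 0" using z by (auto simp: L_def wedge_def)
  define \<eta> where "\<eta> = e / L"
  have \<eta>: "\<eta> > 0" "\<eta> * L = e" using \<open>0 < e\<close> L by (auto simp: \<eta>_def)
  define G where "G = (\<lambda>z. F z - \<eta> * (sz z - s1))"
  have "continuous_on (wedge s1 s2) G" unfolding G_def by (intro continuous_intros cont)
  from continuous_attains_inf[OF compact_wedge _ this] z
  obtain w where w: "w \<in> wedge s1 s2" "\<And>y. y \<in> wedge s1 s2 \<Longrightarrow> G w \<le> G y" by blast
  have "fst w = 0 \<or> snd w = 0 \<or> sz w = s2"
  proof (rule ccontr)
    assume "\<not> (fst w = 0 \<or> snd w = 0 \<or> sz w = s2)"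
    then have wq: "w \<in> quadrant" "s1 \<le> sz w" "sz w < s2" using w(1) by (auto simp: wedge_def quadrant_def mem_Times_iff)
    obtain \<phi>' d1 d2 where F: "\<forall>\<^sub>F h in nhds 0. ((\<lambda>h. F (fst w + h, snd w - h)) has_real_derivative \<phi>' h) (at h)"
      "(\<phi>' has_real_derivative d2) (at 0)" "((\<lambda>h. F (fst w + (1 - \<gamma>) * h, snd w + \<gamma> * h)) has_real_derivative d1) (at 0)"
      "d1 + d2 / 2 = 0" using int[OF wq] unfolding heat_at_def by blast
    have pos: "fst w > 0" "snd w > 0" using wq by (auto simp: quadrant_def)
    have "0 \<le> d2"
    proof (rule second_derivative_at_local_min[OF F(1,2)])
      define m where "m = min (fst w) (snd w)"
      have m: "m > 0" using pos by (simp add: m_def)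
      have "\<forall>\<^sub>F h in nhds 0. h \<in> {- m<..<m}" by (rule eventually_nhds_in_open) (use m in auto)
      then show "\<forall>\<^sub>F h in nhds 0. F (fst w + 0, snd w - 0) \<le> F (fst w + h, snd w - h)"
      proof eventually_elim
        case (elim h)
        have sw: "sz (fst w + h, snd w - h) = sz w" by (simp add: sz_def)
        have "(fst w + h, snd w - h) \<in> wedge s1 s2" using elim wq w(1) sw by (auto simp: wedge_def m_def)
        from w(2)[OF this] show ?case by (simp add: G_def sw)
      qed
    qed
    moreover have "0 \<le> d1 - \<eta> * 1"
    proof (rule derivative_at_right_min)
      show "((\<lambda>h. F (fst w + (1 - \<gamma>) * h, snd w + \<gamma> * h) - \<eta> * h) has_real_derivative d1 - \<eta> * 1) (at 0)"
        by (intro DERIV_diff F DERIV_cmult DERIV_ident)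
      have "\<forall>\<^sub>F h in at_right 0. h \<in> {0<..<s2 - sz w}" by (rule eventually_at_right_less[THEN eventually_mono] eventually_at_rightI[of 0 "s2 - sz w"]) (use wq in auto)
      then show "\<forall>\<^sub>F h in at_right 0. F (fst w + (1 - \<gamma>) * 0, snd w + \<gamma> * 0) - \<eta> * 0
          \<le> F (fst w + (1 - \<gamma>) * h, snd w + \<gamma> * h) - \<eta> * h"
      proof eventually_elim
        case (elim h)
        define y where "y = (fst w + (1 - \<gamma>) * h, snd w + \<gamma> * h)"
        have sy: "sz y = sz w + h" by (simp add: y_def sz_def algebra_simps)
        have "0 \<le> (1 - \<gamma>) * h" "0 \<le> \<gamma> * h" using elim \<gamma> by auto
        then have "0 \<le> fst y" "0 \<le> snd y" using pos by (auto simp: y_def)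
        then have "y \<in> wedge s1 s2" using elim wq sy by (auto simp: wedge_def)
        from w(2)[OF this] have "F w \<le> F y - \<eta> * h" by (simp add: G_def sy algebra_simps)
        then show ?case by (simp add: y_def)
      qed
    qed
    ultimately show False using F(4) \<eta> by simp
  qed
  then have "- \<delta> \<le> F w" using bd[OF w(1)] by blast
  have "\<eta> * (sz w - s1) \<le> \<eta> * L" using \<eta> w(1) by (intro mult_left_mono) (auto simp: wedge_def L_def)
  then have "- \<delta> - e \<le> G w" using \<open>- \<delta> \<le> F w\<close> \<eta> by (simp add: G_def)
  also have "\<dots> \<le> G z" by (rule w(2)[OF z])
  also have "\<dots> \<le> F z" using \<eta> z by (simp add: G_def wedge_def)
  finally show "- \<delta> \<le> F z + e" by simp
qed

definition zero_ext :: "(real \<times> real \<Rightarrow> real) \<Rightarrow> real \<times> real \<Rightarrow> real" where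
  "zero_ext v z = (if z \<in> quadrant then v z else 0)"

lemma continuous_zero_ext:
  assumes "harmonic \<gamma> v" "0 < s1"
  shows "continuous_on (wedge s1 s2) (zero_ext v)"
  unfolding continuous_on_def
proof
  fix b assume b: "b \<in> wedge s1 s2"
  show "(zero_ext v \<longlongrightarrow> zero_ext v b) (at b within wedge s1 s2)"
  proof (cases "b \<in> quadrant")
    case True
    have "v differentiable_on quadrant" using assms by (auto simp: harmonic_def C2_on_def C1_on_def)
    from gradient_of_differentiable[OF this True] have "isCont v b" by (rule has_derivative_continuous)
    then have "(v \<longlongrightarrow> v b) (at b)" by (simp add: isCont_def)
    moreover have "\<forall>\<^sub>F z in at b. v z = zero_ext v z"
      using eventually_at_in_open'[OF open_quadrant True] by eventually_elim (simp add: zero_ext_def)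
    ultimately have "(zero_ext v \<longlongrightarrow> v b) (at b)" by (rule Lim_transform_eventually)
    then have "(zero_ext v \<longlongrightarrow> v b) (at b within wedge s1 s2)" by (rule tendsto_within_subset) simp
    then show ?thesis using True by (simp add: zero_ext_def)
  next
    case False
    then have "b \<in> {0<..} \<times> {0} \<union> {0} \<times> {0<..}"
      using b assms(2) by (auto simp: wedge_def quadrant_def sz_def mem_Times_iff)
    then have lim: "(v \<longlongrightarrow> 0) (at b within quadrant)" using assms(1) by (simp add: harmonic_def)
    have "(zero_ext v \<longlongrightarrow> 0) (at b within wedge s1 s2)"
    proof (rule tendstoI)
      fix e :: real assume e: "0 < e"
      have "\<forall>\<^sub>F z in at b within quadrant. dist (v z) 0 < e" by (rule tendstoD[OF lim e])
      then obtain d where "d > 0" "\<forall>z\<in>quadrant. z \<noteq> b \<and> dist z b < d \<longrightarrow> dist (v z) 0 < e"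
        unfolding eventually_at by blast
      then show "\<forall>\<^sub>F z in at b within wedge s1 s2. dist (zero_ext v z) 0 < e"
        unfolding eventually_at using e by (intro exI[of _ d]) (auto simp: zero_ext_def)
    qed
    then show ?thesis using False by (simp add: zero_ext_def)
  qed
qed

text \<open>
  The values of \<open>v\<close> on the level \<open>x + y = s\<close>, in the heat
  normalisation.
\<close>

definition wslice :: "real \<Rightarrow> (real \<times> real \<Rightarrow> real) \<Rightarrow> real \<Rightarrow> real \<Rightarrow> real" where
  "wslice \<gamma> v s u = sqrt s * zero_ext v (u * s, (1 - u) * s) / prefactor \<gamma> (u * s, (1 - u) * s)"

lemma slice_coords:
  assumes "0 < s"
  shows "sz (u * s, (1 - u) * s) = s" "uz (u * s, (1 - u) * s) = u"
  using assms by (simp_all add: sz_def uz_def algebra_simps)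

lemma slice_of_coords: "sz z > 0 \<Longrightarrow> (uz z * sz z, (1 - uz z) * sz z) = z"
  by (simp add: sz_def uz_def prod_eq_iff field_simps)

lemma continuous_on_eigfun:
  assumes "\<And>z. z \<in> S \<Longrightarrow> sz z > 0"
  shows "continuous_on S (eigfun \<gamma> k)"
proof -
  have ne: "sz z \<noteq> 0" "sqrt (sz z) \<noteq> 0" if "z \<in> S" for z using assms[OF that] by auto
  show ?thesis
    unfolding eigfun_def eig_def
    by (intro continuous_intros continuous_on_prefactor continuous_on_uz assms) (use ne in auto)
qed

text \<open>
  Boundary data that form a sine polynomial on the level \<open>s2\<close> are continued by
  the same combination of the \<open>eigfun\<close>. The closed form through the heat kernel
  holds strictly below the level.
\<close>

lemma sine_poly_extension:
  assumes "sine_poly p" "0 < s1" "s1 \<le> s2"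
  shows "\<exists>G. (\<forall>z\<in>quadrant. heat_at \<gamma> G z) \<and> continuous_on (wedge s1 s2) G \<and>
     (\<forall>z. 0 < sz z \<longrightarrow> fst z = 0 \<or> snd z = 0 \<longrightarrow> G z = 0) \<and>
     (\<forall>z. sz z = s2 \<longrightarrow> G z = prefactor \<gamma> z / sqrt s2 * p (uz z)) \<and>
     (\<forall>z\<in>quadrant. sz z < s2 \<longrightarrow> G z = prefactor \<gamma> z / sqrt (sz z) * integral {0..1} (\<lambda>v. heat (1 / sz z - 1 / s2) (uz z) v * p v))
     \<and> continuous_on {0..1} p"
  using assms(1)
proof induction
  case (basis k c)
  have s2: "s2 > 0" using assms by simp
  define G where "G = (\<lambda>z. c / eig (1 / s2) k * eigfun \<gamma> k z + 0 * eigfun \<gamma> k z)"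
  have e2: "eig (1 / s2) k \<noteq> 0" by (simp add: eig_def)
  show ?case
  proof (intro exI[of _ G] conjI ballI allI impI)
    show "heat_at \<gamma> G z" if "z \<in> quadrant" for z
      unfolding G_def by (intro heat_at_lincomb heat_at_eigfun that)
    show "continuous_on (wedge s1 s2) G"
      unfolding G_def using assms by (intro continuous_intros continuous_on_eigfun) (auto simp: wedge_def)
    fix z assume "0 < sz z" "fst z = 0 \<or> snd z = 0"
    then have "uz z = 0 \<or> uz z = 1" by (auto simp: uz_def sz_def)
    then show "G z = 0" by (auto simp: G_def eigfun_def)
  next
    fix z assume "sz z = s2"
    then show "G z = prefactor \<gamma> z / sqrt s2 * (c * sin (real k * pi * uz z))"
      using e2 by (simp add: G_def eigfun_def)
  next
    fix z assume z: "z \<in> quadrant" "sz z < s2"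
    have s: "sz z > 0" by (rule quadrant_sz_pos[OF z(1)])
    define \<tau> where "\<tau> = 1 / sz z - 1 / s2"
    have \<tau>: "\<tau> > 0" using s z by (simp add: \<tau>_def field_simps)
    have "eig (1 / sz z) k = eig \<tau> k * eig (1 / s2) k" by (simp add: \<tau>_def flip: eig_add)
    then have "G z = prefactor \<gamma> z / sqrt (sz z) * (c * (eig \<tau> k * sin (real k * pi * uz z)))"
      using e2 by (simp add: G_def eigfun_def)
    also have "c * (eig \<tau> k * sin (real k * pi * uz z)) = integral {0..1} (\<lambda>v. c * (heat \<tau> (uz z) v * sin (real k * pi * v)))"
      using integral_heat_sin[OF \<tau> basis, of "uz z"] by (simp only: Henstock_Kurzweil_Integration.integral_mult_right)
    also have "\<dots> = integral {0..1} (\<lambda>v. heat \<tau> (uz z) v * (c * sin (real k * pi * v)))" by (simp add: mult_ac)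
    finally show "G z = prefactor \<gamma> z / sqrt (sz z) * integral {0..1} (\<lambda>v. heat (1 / sz z - 1 / s2) (uz z) v * (c * sin (real k * pi * v)))"
      by (simp add: \<tau>_def)
  qed (intro continuous_intros)
next
  case (add p q)
  obtain G where G: "\<forall>z\<in>quadrant. heat_at \<gamma> G z" "continuous_on (wedge s1 s2) G"
     "\<forall>z. 0 < sz z \<longrightarrow> fst z = 0 \<or> snd z = 0 \<longrightarrow> G z = 0"
     "\<forall>z. sz z = s2 \<longrightarrow> G z = prefactor \<gamma> z / sqrt s2 * p (uz z)"
     "\<forall>z\<in>quadrant. sz z < s2 \<longrightarrow> G z = prefactor \<gamma> z / sqrt (sz z) * integral {0..1} (\<lambda>v. heat (1 / sz z - 1 / s2) (uz z) v * p v)"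
     "continuous_on {0..1} p" using add.IH(1) by blast
  obtain H where H: "\<forall>z\<in>quadrant. heat_at \<gamma> H z" "continuous_on (wedge s1 s2) H"
     "\<forall>z. 0 < sz z \<longrightarrow> fst z = 0 \<or> snd z = 0 \<longrightarrow> H z = 0"
     "\<forall>z. sz z = s2 \<longrightarrow> H z = prefactor \<gamma> z / sqrt s2 * q (uz z)"
     "\<forall>z\<in>quadrant. sz z < s2 \<longrightarrow> H z = prefactor \<gamma> z / sqrt (sz z) * integral {0..1} (\<lambda>v. heat (1 / sz z - 1 / s2) (uz z) v * q v)"
     "continuous_on {0..1} q" using add.IH(2) by blast
  show ?case
  proof (intro exI[of _ "\<lambda>z. 1 * G z + 1 * H z"] conjI ballI allI impI)
    show "heat_at \<gamma> (\<lambda>z. 1 * G z + 1 * H z) z" if "z \<in> quadrant" for z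
      using G(1) H(1) that by (intro heat_at_lincomb) auto
    show "continuous_on (wedge s1 s2) (\<lambda>z. 1 * G z + 1 * H z)" by (intro continuous_intros G H)
    show "1 * G z + 1 * H z = 0" if "0 < sz z" "fst z = 0 \<or> snd z = 0" for z using G(3)[rule_format, OF that] H(3)[rule_format, OF that] by simp
    show "1 * G z + 1 * H z = prefactor \<gamma> z / sqrt s2 * (p (uz z) + q (uz z))" if "sz z = s2" for z
      using G(4)[rule_format, OF that] H(4)[rule_format, OF that] by (simp add: distrib_left add_divide_distrib)
    show "continuous_on {0..1} (\<lambda>u. p u + q u)" by (intro continuous_intros G H)
    fix z assume z: "z \<in> quadrant" "sz z < s2"
    have s: "sz z > 0" by (rule quadrant_sz_pos[OF z(1)])
    define \<tau> where "\<tau> = 1 / sz z - 1 / s2"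
    have \<tau>: "\<tau> > 0" using s z by (simp add: \<tau>_def field_simps)
    have i: "(\<lambda>v. heat \<tau> (uz z) v * r v) integrable_on {0..1}" if "continuous_on {0..1} r" for r
      by (intro integrable_continuous_interval continuous_intros that) (use \<tau> in auto)
    have "integral {0..1} (\<lambda>v. heat \<tau> (uz z) v * (p v + q v)) = integral {0..1} (\<lambda>v. heat \<tau> (uz z) v * p v) + integral {0..1} (\<lambda>v. heat \<tau> (uz z) v * q v)"
      unfolding distrib_left by (rule Henstock_Kurzweil_Integration.integral_add[OF i[OF G(6)] i[OF H(6)]])
    then show "1 * G z + 1 * H z = prefactor \<gamma> z / sqrt (sz z) * integral {0..1} (\<lambda>v. heat (1 / sz z - 1 / s2) (uz z) v * (p v + q v))"
      using G(5) H(5) z by (simp add: \<tau>_def distrib_left)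
  qed
qed

text \<open>
  The slice is approximated by a sine polynomial, whose continuation stays close to
  \<open>v\<close> by the minimum principle applied to both signs of the difference.
\<close>

theorem harmonic_representation:
  assumes \<gamma>: "0 < \<gamma>" "\<gamma> < 1" and v: "harmonic \<gamma> v" and z0: "z0 \<in> quadrant" "sz z0 < s"
  shows "v z0 = prefactor \<gamma> z0 / sqrt (sz z0) * integral {0..1} (\<lambda>u. heat (1 / sz z0 - 1 / s) (uz z0) u * wslice \<gamma> v s u)"
    and "continuous_on {0..1} (wslice \<gamma> v s)"
proof -
  define s1 where "s1 = sz z0"
  have s1: "0 < s1" "s1 < s" using quadrant_sz_pos[OF z0(1)] z0 by (auto simp: s1_def)
  then have s: "0 < s" by simp
  define w where "w = wslice \<gamma> v s"
  define \<tau> where "\<tau> = 1 / s1 - 1 / s"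
  have \<tau>: "\<tau> > 0" using s1 s by (simp add: \<tau>_def field_simps)
  have vc: "continuous_on (wedge s1 s) (zero_ext v)" by (rule continuous_zero_ext[OF v s1(1)])
  have ene: "prefactor \<gamma> z \<noteq> 0" for z by (simp add: prefactor_def)
  show wc: "continuous_on {0..1} (wslice \<gamma> v s)"
    unfolding wslice_def
  proof (intro continuous_intros)
    show "continuous_on {0..1} (\<lambda>u. zero_ext v (u * s, (1 - u) * s))"
      by (rule continuous_on_compose2[OF vc]) (use s1 s in \<open>auto intro!: continuous_intros simp: wedge_def slice_coords[OF s]\<close>)
    show "continuous_on {0..1} (\<lambda>u. prefactor \<gamma> (u * s, (1 - u) * s))"
      by (rule continuous_on_compose2[OF continuous_on_prefactor[of "{z. sz z = s}"]])
         (use s in \<open>auto intro!: continuous_intros simp: slice_coords[OF s]\<close>)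
  qed (simp add: ene)
  have w01: "w 0 = 0" "w 1 = 0" by (simp_all add: w_def wslice_def zero_ext_def quadrant_def)
  have prefactor_le: "prefactor \<gamma> z / sqrt s \<le> exp s / sqrt s" if "z \<in> wedge s1 s" "sz z = s" for z
  proof -
    have "0 \<le> uz z" "uz z \<le> 1" using that s by (auto simp: uz_def wedge_def sz_def)
    then have "(uz z - (1 - \<gamma>))\<^sup>2 \<le> 1" unfolding abs_square_le_1 using \<gamma> by auto
    then have "s * (uz z - (1 - \<gamma>))\<^sup>2 \<le> s * 1" using s by (intro mult_left_mono) auto
    then have "prefactor \<gamma> z \<le> exp s" using prefactor_alt[of z \<gamma>] that s by simp
    then show ?thesis using s by (intro divide_right_mono) auto
  qed
  define c where "c = prefactor \<gamma> z0 / sqrt s1"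
  have c: "c > 0" using s1 by (simp add: c_def)
  have hc: "continuous_on {0..1} (\<lambda>u. heat \<tau> (uz z0) u)" by (intro continuous_intros) (use \<tau> in auto)
  obtain B where B: "B > 0" "\<And>u. u \<in> {0..1} \<Longrightarrow> \<bar>heat \<tau> (uz z0) u\<bar> \<le> B"
  proof -
    have "bounded ((\<lambda>u. heat \<tau> (uz z0) u) ` {0..1})"
      by (intro compact_imp_bounded compact_continuous_image hc) auto
    then obtain B where "\<forall>x\<in>(\<lambda>u. heat \<tau> (uz z0) u) ` {0..1}. norm x \<le> B" "B > 0" unfolding bounded_pos by blast
    then show ?thesis using that[of B] by auto
  qed
  have i: "(\<lambda>u. heat \<tau> (uz z0) u * r u) integrable_on {0..1}" if "continuous_on {0..1} r" for r
    by (intro integrable_continuous_interval continuous_intros hc that)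
  define I where "I = (\<lambda>r. c * integral {0..1} (\<lambda>u. heat \<tau> (uz z0) u * r u))"
  define K where "K = exp s / sqrt s + c * B"
  have K: "K > 0" using s c B by (auto simp: K_def intro!: add_pos_pos)
  have close: "\<bar>v z0 - I w\<bar> \<le> \<delta> * K" if \<delta>: "0 < \<delta>" for \<delta>
  proof -
    obtain p where p: "sine_poly p" "\<And>u. u \<in> {0..1} \<Longrightarrow> \<bar>w u - p u\<bar> \<le> \<delta>"
      using sine_poly_dense[OF wc[folded w_def] w01 \<delta>] by auto
    obtain G where G: "\<And>z. z \<in> quadrant \<Longrightarrow> heat_at \<gamma> G z" "continuous_on (wedge s1 s) G"
       "\<And>z. 0 < sz z \<Longrightarrow> fst z = 0 \<or> snd z = 0 \<Longrightarrow> G z = 0"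
       "\<And>z. sz z = s \<Longrightarrow> G z = prefactor \<gamma> z / sqrt s * p (uz z)"
       "\<And>z. z \<in> quadrant \<Longrightarrow> sz z < s \<Longrightarrow> G z = prefactor \<gamma> z / sqrt (sz z) * integral {0..1} (\<lambda>v. heat (1 / sz z - 1 / s) (uz z) v * p v)"
       "continuous_on {0..1} p"
      using sine_poly_extension[OF p(1) s1(1) less_imp_le[OF s1(2)], of \<gamma>] by blast
    define \<delta>' where "\<delta>' = \<delta> * (exp s / sqrt s)"
    have \<delta>': "\<delta>' \<ge> 0" using \<delta> s by (simp add: \<delta>'_def)
    have top: "\<bar>zero_ext v z - G z\<bar> \<le> \<delta>'" if z: "z \<in> wedge s1 s" "fst z = 0 \<or> snd z = 0 \<or> sz z = s" for z
    proof (cases "sz z = s")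
      case True
      have u: "uz z \<in> {0..1}" using z s True by (auto simp: uz_def wedge_def sz_def)
      have zx: "zero_ext v z = prefactor \<gamma> z / sqrt s * w (uz z)"
        using slice_of_coords[of z] True s ene[of z] by (simp add: w_def wslice_def)
      have "\<bar>zero_ext v z - G z\<bar> = prefactor \<gamma> z / sqrt s * \<bar>w (uz z) - p (uz z)\<bar>"
        unfolding zx G(4)[OF True] right_diff_distrib[symmetric] abs_mult using s by (simp add: abs_of_pos[OF prefactor_pos])
      also have "\<dots> \<le> exp s / sqrt s * \<delta>"
        using prefactor_le[OF z(1) True] p(2)[OF u] s by (intro mult_mono) auto
      finally show ?thesis by (simp add: \<delta>'_def mult.commute)
    next
      case False
      then have z0': "fst z = 0 \<or> snd z = 0" using z by auto
      then have "zero_ext v z = 0" by (auto simp: zero_ext_def quadrant_def)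
      moreover have "G z = 0" using G(3)[OF _ z0'] z(1) s1 by (auto simp: wedge_def)
      ultimately show ?thesis using \<delta>' by simp
    qed
    have hz: "heat_at \<gamma> (zero_ext v) z" if "z \<in> quadrant" for z
    proof (rule heat_at_cong[OF heat_at_classical that])
      show "C2_on quadrant v" "generator \<gamma> v z = 0" using v that by (auto simp: harmonic_def)
    qed (auto simp: zero_ext_def that)
    have zw: "z0 \<in> wedge s1 s" using z0 by (auto simp: wedge_def s1_def quadrant_def)
    have "- \<delta>' \<le> 1 * zero_ext v z0 + (- 1) * G z0"
    proof (rule heat_minimum_principle[OF \<gamma> _ s1(1) _ _ zw])
      show "continuous_on (wedge s1 s) (\<lambda>z. 1 * zero_ext v z + (- 1) * G z)" by (intro continuous_intros vc G)
      show "- \<delta>' \<le> 1 * zero_ext v z + (- 1) * G z" if "z \<in> wedge s1 s" "fst z = 0 \<or> snd z = 0 \<or> sz z = s" for z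
        using top[OF that] by simp
      show "heat_at \<gamma> (\<lambda>z. 1 * zero_ext v z + (- 1) * G z) z" if "z \<in> quadrant" for z
        by (intro heat_at_lincomb hz G that)
    qed
    moreover have "- \<delta>' \<le> (- 1) * zero_ext v z0 + 1 * G z0"
    proof (rule heat_minimum_principle[OF \<gamma> _ s1(1) _ _ zw])
      show "continuous_on (wedge s1 s) (\<lambda>z. (- 1) * zero_ext v z + 1 * G z)" by (intro continuous_intros vc G)
      show "- \<delta>' \<le> (- 1) * zero_ext v z + 1 * G z" if "z \<in> wedge s1 s" "fst z = 0 \<or> snd z = 0 \<or> sz z = s" for z
        using top[OF that] by simp
      show "heat_at \<gamma> (\<lambda>z. (- 1) * zero_ext v z + 1 * G z) z" if "z \<in> quadrant" for z
        by (intro heat_at_lincomb hz G that)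
    qed
    ultimately have 1: "\<bar>v z0 - G z0\<bar> \<le> \<delta>'" using z0 by (simp add: zero_ext_def abs_le_iff)
    have "G z0 = I p" using G(5)[OF z0] by (simp add: I_def c_def \<tau>_def s1_def)
    moreover have "\<bar>I p - I w\<bar> \<le> \<delta> * (c * B)"
    proof -
      have "I p - I w = c * integral {0..1} (\<lambda>u. heat \<tau> (uz z0) u * p u - heat \<tau> (uz z0) u * w u)"
        unfolding I_def using i[OF G(6)] i[OF wc] by (simp add: w_def Henstock_Kurzweil_Integration.integral_diff right_diff_distrib)
      moreover have "norm (integral {0..1} (\<lambda>u. heat \<tau> (uz z0) u * p u - heat \<tau> (uz z0) u * w u)) \<le> integral {0..1} (\<lambda>u::real. B * \<delta>)"
      proof (rule integral_norm_bound_integral)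
        show "(\<lambda>u. heat \<tau> (uz z0) u * p u - heat \<tau> (uz z0) u * w u) integrable_on {0..1}"
          unfolding w_def by (intro integrable_diff i G wc)
        show "(\<lambda>u::real. B * \<delta>) integrable_on {0..1}" by (intro integrable_continuous_interval continuous_intros)
        fix u :: real assume u: "u \<in> {0..1}"
        have "norm (heat \<tau> (uz z0) u * p u - heat \<tau> (uz z0) u * w u) = \<bar>heat \<tau> (uz z0) u\<bar> * \<bar>w u - p u\<bar>"
          by (simp add: abs_mult abs_minus_commute flip: right_diff_distrib)
        also have "\<dots> \<le> B * \<delta>" using B p(2)[OF u] u by (intro mult_mono) auto
        finally show "norm (heat \<tau> (uz z0) u * p u - heat \<tau> (uz z0) u * w u) \<le> B * \<delta>" .
      qed
      ultimately show ?thesis using c by (simp add: abs_mult mult_ac)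
    qed
    ultimately show ?thesis using 1 by (simp add: K_def \<delta>'_def algebra_simps)
  qed
  have "v z0 = I w"
  proof (rule ccontr)
    assume ne: "v z0 \<noteq> I w"
    have "\<bar>v z0 - I w\<bar> \<le> \<bar>v z0 - I w\<bar> / (2 * K) * K"
      using close[of "\<bar>v z0 - I w\<bar> / (2 * K)"] ne K by simp
    then show False using ne K by simp
  qed
  then show "v z0 = prefactor \<gamma> z0 / sqrt (sz z0) * integral {0..1} (\<lambda>u. heat (1 / sz z0 - 1 / s) (uz z0) u * wslice \<gamma> v s u)"
    by (simp add: I_def c_def \<tau>_def s1_def w_def)
qed

section \<open>Minimality and the Martin boundary\<close>

lemma abs_qheat_le:
  assumes "0 < \<tau>" "\<tau> \<le> \<sigma>"
  shows "\<bar>qheat \<sigma> u v\<bar> \<le> suminf (qheat_bound \<tau>)"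
proof -
  have sm: "summable (\<lambda>k. norm (qheat_term k \<sigma> u v))"
    by (rule summable_comparison_test[OF _ summable_qheat_bound[OF assms(1)]]) (use qheat_term_le[OF assms] in auto)
  have "\<bar>qheat \<sigma> u v\<bar> \<le> (\<Sum>k. norm (qheat_term k \<sigma> u v))"
    unfolding qheat_def using summable_norm[OF sm] by simp
  also have "\<dots> \<le> suminf (qheat_bound \<tau>)"
    by (rule suminf_le[OF _ sm summable_qheat_bound[OF assms(1)]]) (use qheat_term_le[OF assms] in auto)
  finally show ?thesis .
qed

lemma integral_qheat_mass:
  assumes "0 < \<epsilon>"
  shows "integral {0..1} (\<lambda>u. sin (pi * u) * qheat \<epsilon> u a) = eig \<epsilon> 1"
  using integral_qheat_sin[OF assms, of 1 a] by (simp add: mult.commute)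

text \<open>
  The second moment of \<open>cos (pi u)\<close> about \<open>cos (pi a)\<close> involves only
  the first three sine coefficients. As \<open>\<epsilon>\<close> tends to \<open>0\<close> it
  tends to \<open>0\<close>: the kernel concentrates at \<open>a\<close>.
\<close>

lemma integral_qheat_spread:
  fixes a :: real
  assumes "0 < \<epsilon>"
  defines "c \<equiv> cos (pi * a)"
  shows "integral {0..1} (\<lambda>u. sin (pi * u) * qheat \<epsilon> u a * (cos (pi * u) - c)\<^sup>2)
    = eig \<epsilon> 3 * ((4 * c\<^sup>2 - 1) / 4) - eig \<epsilon> 2 * (2 * c\<^sup>2) + eig \<epsilon> 1 * (c\<^sup>2 + 1 / 4)"
proof -
  have i: "(\<lambda>u. A * (qheat \<epsilon> u a * sin (real k * pi * u))) integrable_on {0..1}" for A k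
    by (intro integrable_continuous_interval continuous_intros) (use assms in auto)
  have eq: "sin (pi * u) * qheat \<epsilon> u a * (cos (pi * u) - c)\<^sup>2
     = (1 / 4) * (qheat \<epsilon> u a * sin (real 3 * pi * u)) + (- c) * (qheat \<epsilon> u a * sin (real 2 * pi * u))
       + (c\<^sup>2 + 1 / 4) * (qheat \<epsilon> u a * sin (real 1 * pi * u))" for u
  proof -
    have s: "sin (real 3 * pi * u) = sin (pi * u) * (4 * cos (pi * u) ^ 2 - 1)"
      "sin (real 2 * pi * u) = sin (pi * u) * (2 * cos (pi * u))" "sin (real 1 * pi * u) = sin (pi * u)"
      using sin_mult_chU[of u 3] sin_mult_chU[of u 2] by (simp_all add: chU_3 chU_2)
    show ?thesis unfolding s by (simp add: power2_eq_square field_simps)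
  qed
  have I: "integral {0..1} (\<lambda>u. A * (qheat \<epsilon> u a * sin (real k * pi * u))) = A * (eig \<epsilon> k * chU k a)" if "k \<ge> 1" for A k
    unfolding Henstock_Kurzweil_Integration.integral_mult_right integral_qheat_sin[OF assms(1) that] ..
  have "integral {0..1} (\<lambda>u. sin (pi * u) * qheat \<epsilon> u a * (cos (pi * u) - c)\<^sup>2)
      = (1 / 4) * (eig \<epsilon> 3 * chU 3 a) + (- c) * (eig \<epsilon> 2 * chU 2 a) + (c\<^sup>2 + 1 / 4) * (eig \<epsilon> 1 * chU 1 a)"
    unfolding eq
    by (subst Henstock_Kurzweil_Integration.integral_add, intro integrable_add i, rule i,
        subst Henstock_Kurzweil_Integration.integral_add, rule i, rule i, subst I, simp, subst I, simp, subst I, simp, rule refl)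
  also have "\<dots> = eig \<epsilon> 3 * ((4 * c\<^sup>2 - 1) / 4) - eig \<epsilon> 2 * (2 * c\<^sup>2) + eig \<epsilon> 1 * (c\<^sup>2 + 1 / 4)"
    by (simp add: chU_3 chU_2 flip: c_def) (simp add: power2_eq_square field_simps)
  finally show ?thesis .
qed

text \<open>
  Near \<open>(0, a)\<close> the difference is small by continuity; elsewhere it is bounded
  while \<open>(cos (pi u) - cos (pi a))\<^sup>2\<close> stays away from \<open>0\<close>.
\<close>

lemma qheat_oscillation:
  fixes a u\<^sub>0 :: real
  assumes "0 < \<tau>" "0 < \<eta>" "a \<in> {0..1}"
  shows "\<exists>N\<ge>0. \<exists>\<epsilon>\<^sub>0>0. \<forall>\<epsilon>\<in>{0<..<\<epsilon>\<^sub>0}. \<forall>u\<in>{0..1}.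
     \<bar>qheat (\<tau> - \<epsilon>) u\<^sub>0 u - qheat \<tau> u\<^sub>0 a\<bar> \<le> \<eta> + N * (cos (pi * u) - cos (pi * a))\<^sup>2"
proof -
  have "((\<lambda>p::real \<times> real. qheat (\<tau> - fst p) u\<^sub>0 (snd p)) \<longlongrightarrow> qheat \<tau> u\<^sub>0 a) (nhds (0, a))"
  proof (rule tendsto_qheat[OF _ _ _ assms(1)])
    show "((\<lambda>p::real \<times> real. \<tau> - fst p) \<longlongrightarrow> \<tau>) (nhds (0, a))"
      using tendsto_diff[OF tendsto_const[of \<tau>] tendsto_fst[OF filterlim_ident[of "nhds (0::real, a)"]]] by simp
    show "((\<lambda>p::real \<times> real. snd p) \<longlongrightarrow> a) (nhds (0, a))"
      using tendsto_snd[OF filterlim_ident[of "nhds (0::real, a)"]] by simp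
  qed (rule tendsto_const)
  from tendstoD[OF this assms(2)] obtain d where d: "d > 0"
    "\<And>p. dist p (0, a) < d \<Longrightarrow> \<bar>qheat (\<tau> - fst p) u\<^sub>0 (snd p) - qheat \<tau> u\<^sub>0 a\<bar> < \<eta>"
    unfolding eventually_nhds_metric dist_real_def by blast
  have "\<exists>m>0. \<forall>u\<in>{0..1} \<inter> {u. d / 2 \<le> \<bar>u - a\<bar>}. m \<le> (cos (pi * u) - cos (pi * a))\<^sup>2"
  proof (cases "{0..1} \<inter> {u. d / 2 \<le> \<bar>u - a\<bar>} = {}")
    case True
    show ?thesis unfolding True by (intro exI[of _ 1]) simp
  next
    case False
    have "compact ({0..1} \<inter> {u. d / 2 \<le> \<bar>u - a\<bar>})"
      by (intro compact_Int_closed closed_Collect_le continuous_intros) auto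
    moreover have "continuous_on ({0..1} \<inter> {u. d / 2 \<le> \<bar>u - a\<bar>}) (\<lambda>u. (cos (pi * u) - cos (pi * a))\<^sup>2)"
      by (intro continuous_intros)
    ultimately obtain w where w: "w \<in> {0..1} \<inter> {u. d / 2 \<le> \<bar>u - a\<bar>}"
      "\<And>u. u \<in> {0..1} \<inter> {u. d / 2 \<le> \<bar>u - a\<bar>} \<Longrightarrow> (cos (pi * w) - cos (pi * a))\<^sup>2 \<le> (cos (pi * u) - cos (pi * a))\<^sup>2"
      using continuous_attains_inf[OF _ False] by blast
    have "w \<noteq> a" using w d by auto
    then have "cos (pi * w) \<noteq> cos (pi * a)"
      using cos_inj_pi[of "pi * w" "pi * a"] w(1) assms(3) by auto
    then have "0 < (cos (pi * w) - cos (pi * a))\<^sup>2" by simp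
    then show ?thesis using w(2) by blast
  qed
  then obtain m where m: "m > 0" "\<And>u. u \<in> {0..1} \<Longrightarrow> d / 2 \<le> \<bar>u - a\<bar> \<Longrightarrow> m \<le> (cos (pi * u) - cos (pi * a))\<^sup>2"
    by blast
  define B where "B = suminf (qheat_bound (\<tau> / 2))"
  have B: "\<bar>qheat \<sigma> u v\<bar> \<le> B" if "\<tau> / 2 \<le> \<sigma>" for \<sigma> u v
    unfolding B_def by (rule abs_qheat_le) (use assms that in auto)
  have B0: "B \<ge> 0" using B[of \<tau> 0 0] assms by simp
  have "\<forall>\<epsilon>\<in>{0<..<min (d / 2) (\<tau> / 2)}. \<forall>u\<in>{0..1}.
     \<bar>qheat (\<tau> - \<epsilon>) u\<^sub>0 u - qheat \<tau> u\<^sub>0 a\<bar> \<le> \<eta> + 2 * B / m * (cos (pi * u) - cos (pi * a))\<^sup>2"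
  proof (intro ballI)
    fix \<epsilon> u :: real assume \<epsilon>: "\<epsilon> \<in> {0<..<min (d / 2) (\<tau> / 2)}" and u: "u \<in> {0..1}"
    have nn: "0 \<le> 2 * B / m * (cos (pi * u) - cos (pi * a))\<^sup>2" using B0 m by simp
    show "\<bar>qheat (\<tau> - \<epsilon>) u\<^sub>0 u - qheat \<tau> u\<^sub>0 a\<bar> \<le> \<eta> + 2 * B / m * (cos (pi * u) - cos (pi * a))\<^sup>2"
    proof (cases "\<bar>u - a\<bar> < d / 2")
      case True
      have "dist (\<epsilon>, u) (0, a) \<le> \<bar>\<epsilon>\<bar> + \<bar>u - a\<bar>"
        unfolding dist_Pair_Pair dist_real_def using sqrt_sum_squares_le_sum_abs[of "\<epsilon> - 0" "u - a"] by simp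
      also have "\<dots> < d" using True \<epsilon> by auto
      finally show ?thesis using d(2)[of "(\<epsilon>, u)"] nn by simp
    next
      case False
      have "\<bar>qheat (\<tau> - \<epsilon>) u\<^sub>0 u - qheat \<tau> u\<^sub>0 a\<bar> \<le> B + B"
        using B[of "\<tau> - \<epsilon>" u\<^sub>0 u] B[of \<tau> u\<^sub>0 a] \<epsilon> assms(1) by (simp add: abs_le_iff)
      also have "\<dots> = 2 * B / m * m" using m by simp
      also have "\<dots> \<le> 2 * B / m * (cos (pi * u) - cos (pi * a))\<^sup>2"
        using m B0 u False by (intro mult_left_mono) auto
      finally show ?thesis using assms(2) by simp
    qed
  qed
  moreover have "0 \<le> 2 * B / m" "0 < min (d / 2) (\<tau> / 2)" using B0 m d assms by auto
  ultimately show ?thesis by blast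
qed

context standard_brownian_motion begin

text \<open>
  By \<open>harmonic_representation\<close> on the level \<open>s = 1 / \<epsilon>\<close>,
  the value of \<open>v\<close> at \<open>z\<close> is, up to the prefactor, the integral of
  the kernel \<open>qheat (\<tau> - \<epsilon>) (uz z) u\<close> against a measure dominated
  by \<open>c\<close> times a kernel concentrating at \<open>a\<close>. In the limit the
  integrand may be frozen at \<open>u = a\<close>, so that \<open>v z\<close> is \<open>mkern
  \<gamma> a z\<close> times the limiting mass, which does not depend on \<open>z\<close>.
\<close>

theorem dominated_by_mkern:
  assumes \<gamma>: "0 < \<gamma>" "\<gamma> < 1" and a: "a \<in> {0..1}" and v: "positive_harmonic \<gamma> v" and c: "0 < c"
    and le: "\<And>z. z \<in> quadrant \<Longrightarrow> v z \<le> c * mkern \<gamma> a z"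
  shows "\<exists>L. \<forall>z\<in>quadrant. v z = L * mkern \<gamma> a z"
proof -
  have harm: "harmonic \<gamma> v" and vpos: "\<And>z. z \<in> quadrant \<Longrightarrow> 0 < v z"
    using v by (auto simp: positive_harmonic_def)
  define \<epsilon> :: "nat \<Rightarrow> real" where "\<epsilon> = (\<lambda>n. 1 / real (Suc n))"
  define w where "w = (\<lambda>n. wslice \<gamma> v (real (Suc n)))"
  have \<epsilon>: "\<epsilon> n > 0" for n by (simp add: \<epsilon>_def)
  have \<epsilon>0: "\<epsilon> \<longlonglongrightarrow> 0" unfolding \<epsilon>_def by real_asymp
  have wc: "continuous_on {0..1} (w n)" if "sz z < real (Suc n)" "z \<in> quadrant" for n z
    unfolding w_def by (rule harmonic_representation(2)[OF \<gamma> harm that(2,1)])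
  have wb: "0 \<le> w n u \<and> w n u \<le> c * qheat (\<epsilon> n) u a" if u: "u \<in> {0..1}" for n u
  proof (cases "u \<in> {0<..<1}")
    case True
    define s where "s = real (Suc n)"
    have s: "s > 0" by (simp add: s_def)
    define z where "z = (u * s, (1 - u) * s)"
    have zq: "z \<in> quadrant" using True s by (simp add: z_def quadrant_def)
    have co: "sz z = s" "uz z = u" unfolding z_def by (rule slice_coords[OF s])+
    have "w n u = sqrt s * v z / prefactor \<gamma> z" using zq by (simp add: w_def wslice_def zero_ext_def z_def s_def)
    moreover have "sqrt s * v z / prefactor \<gamma> z \<le> sqrt s * (c * mkern \<gamma> a z) / prefactor \<gamma> z"
      using le[OF zq] s by (intro divide_right_mono mult_left_mono) (auto simp: less_imp_le[OF prefactor_pos])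
    moreover have "prefactor \<gamma> z \<noteq> 0" using prefactor_pos[of \<gamma> z] by linarith
    then have "sqrt s * (c * mkern \<gamma> a z) / prefactor \<gamma> z = c * qheat (1 / s) u a"
      unfolding mkern_def co using s by simp
    moreover have "0 \<le> sqrt s * v z / prefactor \<gamma> z" using vpos[OF zq] s by (simp add: less_imp_le)
    ultimately show ?thesis by (simp add: \<epsilon>_def s_def)
  next
    case False
    then have "u = 0 \<or> u = 1" using u by auto
    then have "w n u = 0" by (auto simp: w_def wslice_def zero_ext_def quadrant_def)
    then show ?thesis using qheat_nonneg[OF \<epsilon> u a] c by simp
  qed
  \<comment> \<open>The total mass \<open>C\<close> does not involve \<open>z\<close>; \<open>J\<close>
      measures the spread of the dominating kernel about \<open>a\<close>.\<close>
  define C where "C = (\<lambda>n. integral {0..1} (\<lambda>u. sin (pi * u) * w n u))"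
  define J where "J = (\<lambda>n. integral {0..1} (\<lambda>u. sin (pi * u) * qheat (\<epsilon> n) u a * (cos (pi * u) - cos (pi * a))\<^sup>2))"
  have "(\<lambda>n. eig (\<epsilon> n) k) \<longlonglongrightarrow> eig 0 k" for k
    unfolding eig_def by (intro tendsto_intros \<epsilon>0) auto
  then have e1: "(\<lambda>n. eig (\<epsilon> n) k) \<longlonglongrightarrow> 1" for k by (simp add: eig_def)
  have J0: "J \<longlonglongrightarrow> 0"
  proof -
    have "J \<longlonglongrightarrow> 1 * ((4 * (cos (pi * a))\<^sup>2 - 1) / 4) - 1 * (2 * (cos (pi * a))\<^sup>2) + 1 * ((cos (pi * a))\<^sup>2 + 1 / 4)"
      unfolding J_def integral_qheat_spread[OF \<epsilon>] by (intro tendsto_intros e1)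
    also have "1 * ((4 * (cos (pi * a))\<^sup>2 - 1) / 4) - 1 * (2 * (cos (pi * a))\<^sup>2) + 1 * ((cos (pi * a))\<^sup>2 + 1 / 4) = 0"
      by (simp add: field_simps)
    finally show ?thesis .
  qed
  define Q where "Q = (\<lambda>z. qheat (1 / sz z) (uz z) a)"
  define r where "r = (\<lambda>z. v z * sqrt (sz z) / prefactor \<gamma> z)"
  have Qpos: "Q z > 0" if "z \<in> quadrant" for z
    unfolding Q_def using quadrant_sz_pos[OF that] uz_quadrant[OF that] a by (intro qheat_pos) auto
  have lim: "(\<lambda>n. Q z * C n) \<longlonglongrightarrow> r z" if z: "z \<in> quadrant" for z
  proof (rule tendstoI)
    fix e :: real assume e: "0 < e"
    define \<tau> where "\<tau> = 1 / sz z"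
    have \<tau>: "\<tau> > 0" using quadrant_sz_pos[OF z] by (simp add: \<tau>_def)
    define \<eta> where "\<eta> = e / (2 * c)"
    have \<eta>: "\<eta> > 0" "c * \<eta> = e / 2" using e c by (auto simp: \<eta>_def)
    obtain N \<epsilon>\<^sub>0 where N: "N \<ge> 0" "\<epsilon>\<^sub>0 > 0" "\<And>\<epsilon> u. \<epsilon> \<in> {0<..<\<epsilon>\<^sub>0} \<Longrightarrow> u \<in> {0..1} \<Longrightarrow>
       \<bar>qheat (\<tau> - \<epsilon>) (uz z) u - qheat \<tau> (uz z) a\<bar> \<le> \<eta> + N * (cos (pi * u) - cos (pi * a))\<^sup>2"
      using qheat_oscillation[OF \<tau> \<eta>(1) a, of "uz z"] by blast
    have "(\<lambda>n. c * N * J n) \<longlonglongrightarrow> c * N * 0" by (intro tendsto_intros J0)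
    then have "\<forall>\<^sub>F n in sequentially. c * N * J n < e / 2" using e by (intro order_tendstoD(2)) auto
    moreover have "\<forall>\<^sub>F n in sequentially. \<epsilon> n < min \<epsilon>\<^sub>0 \<tau>"
      using \<epsilon>0 N(2) \<tau> by (intro order_tendstoD(2)) auto
    ultimately show "\<forall>\<^sub>F n in sequentially. dist (Q z * C n) (r z) < e"
    proof eventually_elim
      case (elim n)
      have \<tau>\<epsilon>: "\<tau> - \<epsilon> n > 0" using elim by simp
      have sn: "sz z < real (Suc n)"
        using elim quadrant_sz_pos[OF z] by (simp add: \<tau>_def \<epsilon>_def field_simps del: of_nat_Suc)
      note wcn = wc[OF sn z]
      have i1: "(\<lambda>u. sin (pi * u) * qheat (\<tau> - \<epsilon> n) (uz z) u * w n u) integrable_on {0..1}"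
        by (intro integrable_continuous_interval continuous_intros wcn) (use \<tau>\<epsilon> in auto)
      have i2: "(\<lambda>u. Q z * (sin (pi * u) * w n u)) integrable_on {0..1}"
        by (intro integrable_continuous_interval continuous_intros wcn)
      have i3: "(\<lambda>u. c * \<eta> * (sin (pi * u) * qheat (\<epsilon> n) u a)) integrable_on {0..1}"
        "(\<lambda>u. c * N * (sin (pi * u) * qheat (\<epsilon> n) u a * (cos (pi * u) - cos (pi * a))\<^sup>2)) integrable_on {0..1}"
        by (intro integrable_continuous_interval continuous_intros; use \<epsilon> in auto)+
      have "v z = prefactor \<gamma> z / sqrt (sz z) * integral {0..1} (\<lambda>u. heat (1 / sz z - 1 / real (Suc n)) (uz z) u * w n u)"
        unfolding w_def by (rule harmonic_representation(1)[OF \<gamma> harm z sn])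
      then have "r z = integral {0..1} (\<lambda>u. heat (1 / sz z - 1 / real (Suc n)) (uz z) u * w n u)"
        using quadrant_sz_pos[OF z] less_imp_neq[OF prefactor_pos[of \<gamma> z]] unfolding r_def by simp
      then have "r z = integral {0..1} (\<lambda>u. sin (pi * u) * qheat (\<tau> - \<epsilon> n) (uz z) u * w n u)"
        by (simp only: heat_def \<tau>_def \<epsilon>_def)
      moreover have "Q z * C n = integral {0..1} (\<lambda>u. Q z * (sin (pi * u) * w n u))"
        unfolding C_def by (simp only: Henstock_Kurzweil_Integration.integral_mult_right)
      ultimately have "\<bar>r z - Q z * C n\<bar> = norm (integral {0..1} (\<lambda>u. sin (pi * u) * qheat (\<tau> - \<epsilon> n) (uz z) u * w n u - Q z * (sin (pi * u) * w n u)))"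
        by (simp only: real_norm_def Henstock_Kurzweil_Integration.integral_diff[OF i1 i2])
      also have "\<dots> \<le> integral {0..1} (\<lambda>u. c * \<eta> * (sin (pi * u) * qheat (\<epsilon> n) u a) + c * N * (sin (pi * u) * qheat (\<epsilon> n) u a * (cos (pi * u) - cos (pi * a))\<^sup>2))"
      proof (rule integral_norm_bound_integral[OF integrable_diff[OF i1 i2] integrable_add[OF i3]])
        fix u :: real assume u: "u \<in> {0..1}"
        have sn: "0 \<le> sin (pi * u)" using u by (intro sin_ge_zero) (auto simp: mult_left_le)
        have q: "\<bar>qheat (\<tau> - \<epsilon> n) (uz z) u - Q z\<bar> \<le> \<eta> + N * (cos (pi * u) - cos (pi * a))\<^sup>2"
          using N(3)[of "\<epsilon> n" u] elim \<epsilon> u by (simp add: Q_def \<tau>_def)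
        have "norm (sin (pi * u) * qheat (\<tau> - \<epsilon> n) (uz z) u * w n u - Q z * (sin (pi * u) * w n u))
           = \<bar>(sin (pi * u) * w n u) * (qheat (\<tau> - \<epsilon> n) (uz z) u - Q z)\<bar>"
          by (simp add: algebra_simps)
        also have "\<dots> = sin (pi * u) * w n u * \<bar>qheat (\<tau> - \<epsilon> n) (uz z) u - Q z\<bar>"
          using sn wb[OF u, of n] by (simp add: abs_mult)
        also have "\<dots> \<le> sin (pi * u) * (c * qheat (\<epsilon> n) u a) * (\<eta> + N * (cos (pi * u) - cos (pi * a))\<^sup>2)"
          using sn wb[OF u, of n] q by (intro mult_mono mult_left_mono) auto
        finally show "norm (sin (pi * u) * qheat (\<tau> - \<epsilon> n) (uz z) u * w n u - Q z * (sin (pi * u) * w n u))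
          \<le> c * \<eta> * (sin (pi * u) * qheat (\<epsilon> n) u a) + c * N * (sin (pi * u) * qheat (\<epsilon> n) u a * (cos (pi * u) - cos (pi * a))\<^sup>2)"
          by (simp add: algebra_simps)
      qed
      also have "\<dots> = c * \<eta> * eig (\<epsilon> n) 1 + c * N * J n"
      proof -
        have "integral {0..1} (\<lambda>u. c * \<eta> * (sin (pi * u) * qheat (\<epsilon> n) u a)) = c * \<eta> * eig (\<epsilon> n) 1"
          by (simp only: Henstock_Kurzweil_Integration.integral_mult_right integral_qheat_mass[OF \<epsilon>])
        moreover have "integral {0..1} (\<lambda>u. c * N * (sin (pi * u) * qheat (\<epsilon> n) u a * (cos (pi * u) - cos (pi * a))\<^sup>2)) = c * N * J n"
          unfolding J_def by (rule Henstock_Kurzweil_Integration.integral_mult_right)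
        ultimately show ?thesis using Henstock_Kurzweil_Integration.integral_add[OF i3] by (simp only:)
      qed
      also have "\<dots> < e"
      proof -
        have "eig (\<epsilon> n) 1 \<le> 1" using \<epsilon>[of n] by (simp add: eig_def)
        then have "c * \<eta> * eig (\<epsilon> n) 1 \<le> c * \<eta> * 1" using c \<eta>(1) by (intro mult_left_mono) auto
        then show ?thesis using \<eta>(2) elim(1) by linarith
      qed
      finally show ?case unfolding dist_real_def by (simp only: abs_minus_commute)
    qed
  qed
  have Cl: "C \<longlonglongrightarrow> r z / Q z" if "z \<in> quadrant" for z
    using tendsto_divide[OF lim[OF that] tendsto_const[of "Q z"]] Qpos[OF that] by simp
  define L where "L = r (1, 1) / Q (1, 1)"
  have one: "(1, 1) \<in> quadrant" by (simp add: quadrant_def)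
  show ?thesis
  proof (intro exI[of _ L] ballI)
    fix z assume z: "z \<in> quadrant"
    have "r z / Q z = L" unfolding L_def by (rule LIMSEQ_unique[OF Cl[OF z] Cl[OF one]])
    then have "r z = L * Q z" using Qpos[OF z] by (simp add: field_simps)
    moreover have "v z = prefactor \<gamma> z / sqrt (sz z) * r z"
      using quadrant_sz_pos[OF z] less_imp_neq[OF prefactor_pos[of \<gamma> z]] by (simp add: r_def)
    ultimately show "v z = L * mkern \<gamma> a z" by (simp add: mkern_def Q_def)
  qed
qed

end

text \<open>
  Normalised at the reference point; restricted so as to be a point of the product space.
\<close>

definition martin_fun :: "real \<Rightarrow> real \<Rightarrow> real \<times> real \<Rightarrow> real" where
  "martin_fun \<gamma> a = (\<lambda>z\<in>quadrant. mkern \<gamma> a z / mkern \<gamma> a (1, 1))"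

lemma one_one_quadrant [simp]: "(1, 1) \<in> quadrant" by (simp add: quadrant_def)

lemma norm_le_sz: "z \<in> quadrant \<Longrightarrow> norm z \<le> sz z"
  by (cases z) (auto simp: norm_Pair sz_def quadrant_def intro!: sqrt_sum_squares_le_sum)

lemma sz_le_norm: "sz z \<le> 2 * norm z"
  using norm_fst_le[of "fst z" "snd z"] norm_snd_le[of "snd z" "fst z"] by (simp add: sz_def abs_le_iff)

context standard_brownian_motion begin

text \<open>
  The factors of the Green density that depend on \<open>\<zeta> n\<close> only cancel in the
  quotient, among them \<open>sin (pi * uz (\<zeta> n))\<close>, which may tend to
  \<open>0\<close>. What is left is continuous up to \<open>\<tau> = 0\<close> and \<open>u =
  a\<close>.
\<close>

lemma martin_kernel_limit:
  assumes \<gamma>: "0 < \<gamma>" "\<gamma> < 1" and g: "\<And>z0. z0 \<in> quadrant \<Longrightarrow> is_green_density M W \<gamma> z0 (g z0)"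
    and \<zeta>: "\<And>n. \<zeta> n \<in> quadrant" "filterlim (\<lambda>n. sz (\<zeta> n)) at_top sequentially" "(\<lambda>n. uz (\<zeta> n)) \<longlonglongrightarrow> a"
    and a: "a \<in> {0..1}" and z: "z \<in> quadrant"
  shows "(\<lambda>n. martin_kernel g z (\<zeta> n)) \<longlonglongrightarrow> martin_fun \<gamma> a z"
proof -
  define A where "A = (\<lambda>z n. prefactor \<gamma> z / sqrt (sz z) * qheat (1 / sz z - 1 / sz (\<zeta> n)) (uz z) (uz (\<zeta> n)))"
  have A: "A z \<longlonglongrightarrow> mkern \<gamma> a z" if z: "z \<in> quadrant" for z
  proof -
    have "(\<lambda>n. 1 / sz (\<zeta> n)) \<longlonglongrightarrow> 0" using \<zeta>(2) by (simp add: divide_inverse tendsto_inverse_0_at_top)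
    from tendsto_diff[OF tendsto_const[of "1 / sz z"] this] have "(\<lambda>n. 1 / sz z - 1 / sz (\<zeta> n)) \<longlonglongrightarrow> 1 / sz z" by simp
    then show ?thesis
      unfolding A_def mkern_def using quadrant_sz_pos[OF z] by (intro tendsto_mult tendsto_const tendsto_qheat \<zeta>(3)) auto
  qed
  have h: "\<forall>\<^sub>F n in sequentially. g z (\<zeta> n) = A z n * (sin (pi * uz (\<zeta> n)) / (prefactor \<gamma> (\<zeta> n) * sqrt (sz (\<zeta> n))))" if z: "z \<in> quadrant" for z
  proof -
    have "\<forall>\<^sub>F n in sequentially. sz z < sz (\<zeta> n)" using \<zeta>(2) by (simp add: filterlim_at_top_dense)
    then show ?thesis
    proof eventually_elim
      case (elim n)
      have "g z (\<zeta> n) = green_kernel \<gamma> z (\<zeta> n)" by (rule green_eq_kernel[OF z \<gamma> g[OF z] \<zeta>(1) elim])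
      then show ?case by (simp add: green_kernel_def A_def heat_def real_sqrt_mult mult_ac)
    qed
  qed
  have "(\<lambda>n. A z n / A (1, 1) n) \<longlonglongrightarrow> mkern \<gamma> a z / mkern \<gamma> a (1, 1)"
    by (intro tendsto_divide A z) (use mkern_pos[OF one_one_quadrant a, of \<gamma>] in auto)
  moreover have "\<forall>\<^sub>F n in sequentially. A z n / A (1, 1) n = martin_kernel g z (\<zeta> n)"
    using h[OF z] h[OF one_one_quadrant]
  proof eventually_elim
    case (elim n)
    have "0 < sin (pi * uz (\<zeta> n))" using uz_quadrant[OF \<zeta>(1)[of n]] by (intro sin_gt_zero) auto
    then have "sin (pi * uz (\<zeta> n)) / (prefactor \<gamma> (\<zeta> n) * sqrt (sz (\<zeta> n))) > 0"
      using quadrant_sz_pos[OF \<zeta>(1)[of n]] by (intro divide_pos_pos mult_pos_pos) auto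
    then show ?case unfolding martin_kernel_def elim by (subst mult_divide_mult_cancel_right) auto
  qed
  ultimately have "(\<lambda>n. martin_kernel g z (\<zeta> n)) \<longlonglongrightarrow> mkern \<gamma> a z / mkern \<gamma> a (1, 1)"
    by (rule Lim_transform_eventually)
  then show ?thesis using z by (simp add: martin_fun_def)
qed

text \<open>
  Compactness of \<open>[0, 1]\<close> gives a limit point of \<open>uz (\<zeta> n)\<close>
  for every sequence that tends to infinity. Conversely every \<open>a\<close> is approached
  from inside, the end points included.
\<close>

theorem martin_boundary_eq:
  assumes \<gamma>: "0 < \<gamma>" "\<gamma> < 1" and g: "\<And>z0. z0 \<in> quadrant \<Longrightarrow> is_green_density M W \<gamma> z0 (g z0)"
  shows "martin_boundary g = martin_fun \<gamma> ` {0..1}"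
proof (intro subset_antisym subsetI)
  fix u assume "u \<in> martin_boundary g"
  then obtain \<zeta> where u: "u \<in> extensional quadrant" and \<zeta>: "range \<zeta> \<subseteq> quadrant"
    "filterlim (\<lambda>n. norm (\<zeta> n)) at_top sequentially" "\<And>z. z \<in> quadrant \<Longrightarrow> (\<lambda>n. martin_kernel g z (\<zeta> n)) \<longlonglongrightarrow> u z"
    unfolding martin_boundary_def by blast
  have \<zeta>q: "\<zeta> n \<in> quadrant" for n using \<zeta>(1) by blast
  have "\<forall>n. uz (\<zeta> n) \<in> {0..1}" using uz_quadrant[OF \<zeta>q] by (simp add: less_imp_le)
  then obtain a \<rho> where a: "a \<in> {0..1}" "strict_mono \<rho>" "((\<lambda>n. uz (\<zeta> n)) \<circ> \<rho>) \<longlonglongrightarrow> a"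
    using compact_imp_seq_compact[OF compact_Icc[of "0::real" 1]] unfolding seq_compact_def by meson
  have sz: "filterlim (\<lambda>n. sz (\<zeta> n)) at_top sequentially"
    by (rule filterlim_at_top_mono[OF \<zeta>(2)]) (use norm_le_sz[OF \<zeta>q] in auto)
  have "u z = martin_fun \<gamma> a z" if z: "z \<in> quadrant" for z
  proof (rule LIMSEQ_unique)
    show "(\<lambda>n. martin_kernel g z (\<zeta> (\<rho> n))) \<longlonglongrightarrow> u z"
      using LIMSEQ_subseq_LIMSEQ[OF \<zeta>(3)[OF z] a(2)] by (simp add: o_def)
    show "(\<lambda>n. martin_kernel g z (\<zeta> (\<rho> n))) \<longlonglongrightarrow> martin_fun \<gamma> a z"
      by (rule martin_kernel_limit[OF \<gamma> g _ filterlim_compose[OF sz filterlim_subseq[OF a(2)]] _ a(1) z])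
         (use \<zeta>q a(3) in \<open>auto simp: o_def\<close>)
  qed
  moreover have "martin_fun \<gamma> a \<in> extensional quadrant" by (simp add: martin_fun_def)
  ultimately have "u = martin_fun \<gamma> a" using u by (intro extensionalityI[of _ quadrant]) auto
  then show "u \<in> martin_fun \<gamma> ` {0..1}" using a(1) by blast
next
  fix u assume "u \<in> martin_fun \<gamma> ` {0..1}"
  then obtain a where a: "a \<in> {0..1}" and u: "u = martin_fun \<gamma> a" by blast
  \<comment> \<open>The mean of \<open>n + 1\<close> copies of \<open>a\<close>, one \<open>1\<close>
      and one \<open>0\<close>: strictly inside the interval and convergent to
      \<open>a\<close>.\<close>
  define b where "b = (\<lambda>n. (a * (real n + 1) + 1) / (real n + 3))"
  define \<zeta> where "\<zeta> = (\<lambda>n. (b n * real (Suc n), (1 - b n) * real (Suc n)))"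
  have b: "0 < b n" "b n < 1" for n
  proof -
    have "0 \<le> a * (real n + 1)" "a * (real n + 1) \<le> 1 * (real n + 1)" using a by (auto intro!: mult_right_mono)
    then show "0 < b n" "b n < 1" by (auto simp: b_def field_simps)
  qed
  have ba: "b \<longlonglongrightarrow> a" unfolding b_def by real_asymp
  have co: "sz (\<zeta> n) = real (Suc n)" "uz (\<zeta> n) = b n" for n
    unfolding \<zeta>_def by (rule slice_coords, simp)+
  have \<zeta>q: "\<zeta> n \<in> quadrant" for n
    unfolding \<zeta>_def quadrant_def using b[of n] by simp
  have "filterlim (\<lambda>n. real (Suc n) / 2) at_top sequentially" by real_asymp
  then have "filterlim (\<lambda>n. norm (\<zeta> n)) at_top sequentially"
    by (rule filterlim_at_top_mono) (intro always_eventually allI, use sz_le_norm[of "\<zeta> _"] in \<open>simp add: co(1) mult.commute del: of_nat_Suc\<close>)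
  moreover have "(\<lambda>n. martin_kernel g z (\<zeta> n)) \<longlonglongrightarrow> martin_fun \<gamma> a z" if z: "z \<in> quadrant" for z
  proof (rule martin_kernel_limit[OF \<gamma> g \<zeta>q _ _ a z])
    show "filterlim (\<lambda>n. sz (\<zeta> n)) at_top sequentially" unfolding co by real_asymp
    show "(\<lambda>n. uz (\<zeta> n)) \<longlonglongrightarrow> a" unfolding co by (rule ba)
  qed
  moreover have "martin_fun \<gamma> a \<in> extensional quadrant" by (simp add: martin_fun_def)
  ultimately show "u \<in> martin_boundary g" unfolding martin_boundary_def u using \<zeta>q by blast
qed

text \<open>
  On the level \<open>s = 1\<close> the first sine coefficient shows that the normalising
  constants agree, and the second one is \<open>2 cos (pi a)\<close>.
\<close>

lemma inj_on_martin_fun: "inj_on (martin_fun \<gamma>) {0..1}"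
proof (rule inj_onI)
  fix a b :: real assume ab: "a \<in> {0..1}" "b \<in> {0..1}" and eq: "martin_fun \<gamma> a = martin_fun \<gamma> b"
  define l where "l = mkern \<gamma> a (1, 1) / mkern \<gamma> b (1, 1)"
  have m: "mkern \<gamma> a z = l * mkern \<gamma> b z" if "z \<in> quadrant" for z
    using fun_cong[OF eq, of z] that mkern_pos[OF one_one_quadrant ab(1), of \<gamma>] mkern_pos[OF one_one_quadrant ab(2), of \<gamma>]
    by (simp add: martin_fun_def l_def field_simps)
  have q: "qheat 1 u a = l * qheat 1 u b" if u: "u \<in> {0..1}" for u
  proof (cases "u \<in> {0<..<1}")
    case True
    define z where "z = (u * 1, (1 - u) * 1)"
    have "sz z = 1" "uz z = u" unfolding z_def by (rule slice_coords, simp)+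
    moreover have "z \<in> quadrant" using True by (simp add: z_def quadrant_def)
    ultimately show ?thesis using m[of z] prefactor_pos[of \<gamma> z] by (simp add: mkern_def)
  next
    case False
    then have "u = 0 \<or> u = 1" using u by auto
    then show ?thesis by auto
  qed
  have mom: "chU k a = l * chU k b" if "k \<ge> 1" for k
  proof -
    have "eig 1 k * chU k a = integral {0..1} (\<lambda>u. qheat 1 u a * sin (real k * pi * u))"
      using integral_qheat_sin[of 1 k a] that by simp
    also have "\<dots> = integral {0..1} (\<lambda>u. l * (qheat 1 u b * sin (real k * pi * u)))"
      by (intro Henstock_Kurzweil_Integration.integral_cong) (simp add: q)
    also have "\<dots> = l * (eig 1 k * chU k b)"
      unfolding Henstock_Kurzweil_Integration.integral_mult_right using integral_qheat_sin[of 1 k b] that by simp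
    finally show ?thesis using eig_pos[of 1 k] by simp
  qed
  have "l = 1" using mom[of 1] by simp
  then have "cos (pi * a) = cos (pi * b)" using mom[of 2] by (simp add: chU_2)
  then show "a = b" using cos_inj_pi[of "pi * a" "pi * b"] ab by auto
qed

lemma htilde_normalized:
  assumes "a \<in> {0..1}"
  shows "(\<lambda>z\<in>quadrant. htilde \<gamma> (parab \<gamma> a) z / htilde \<gamma> (parab \<gamma> a) (1, 1)) = martin_fun \<gamma> a"
  unfolding martin_fun_def
  by (intro restrict_ext) (use hconst_pos[OF assms] in \<open>simp add: htilde_eq_mkern[OF assms]\<close>)

lemma martin_fun_minimal:
  assumes \<gamma>: "0 < \<gamma>" "\<gamma> < 1" and a: "a \<in> {0..1}"
  shows "minimal_harmonic \<gamma> (martin_fun \<gamma> a)"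
proof -
  define c where "c = 1 / mkern \<gamma> a (1, 1)"
  have c: "c > 0" using mkern_pos[OF one_one_quadrant a] by (simp add: c_def)
  have k: "martin_fun \<gamma> a z = c * mkern \<gamma> a z" if "z \<in> quadrant" for z
    using that by (simp add: martin_fun_def c_def)
  show ?thesis
    unfolding minimal_harmonic_def
  proof (intro conjI allI impI)
    show "positive_harmonic \<gamma> (martin_fun \<gamma> a)" by (rule positive_harmonic_mkern[OF a c k])
    fix v assume v: "positive_harmonic \<gamma> v \<and> (\<forall>z\<in>quadrant. v z \<le> martin_fun \<gamma> a z)"
    obtain L where L: "\<forall>z\<in>quadrant. v z = L * mkern \<gamma> a z"
      using dominated_by_mkern[OF \<gamma> a conjunct1[OF v] c] v by (auto simp: k)
    show "\<exists>d. \<forall>z\<in>quadrant. v z = d * martin_fun \<gamma> a z"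
    proof (intro exI[of _ "L / c"] ballI)
      fix z assume z: "z \<in> quadrant"
      have "v z = L * mkern \<gamma> a z" using L z by blast
      then show "v z = L / c * martin_fun \<gamma> a z" unfolding k[OF z] using c by simp
    qed
  qed
qed

text \<open>
  A continuous bijection from a compact to a Hausdorff space. The parameter \<open>a\<close>
  is the affine function \<open>p - q + 1 - \<gamma>\<close> on the parabola, which gives
  continuity for each \<open>z\<close>.
\<close>

lemma homeomorphic_map_martin_boundary:
  assumes \<gamma>: "0 < \<gamma>" "\<gamma> < 1" and g: "\<And>z0. z0 \<in> quadrant \<Longrightarrow> is_green_density M W \<gamma> z0 (g z0)"
  shows "homeomorphic_map (top_of_set (saddle_arc \<gamma>)) (martin_topology g)
     (\<lambda>pq. \<lambda>z\<in>quadrant. htilde \<gamma> pq z / htilde \<gamma> pq (1, 1))"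
proof -
  define f where "f = (\<lambda>pq. \<lambda>z\<in>quadrant. htilde \<gamma> pq z / htilde \<gamma> pq (1, 1))"
  define \<pi> where "\<pi> = (\<lambda>pq. fst pq - snd pq + 1 - \<gamma>)"
  have \<pi>: "\<pi> (parab \<gamma> a) = a" for a
    by (simp add: \<pi>_def parab_def power2_eq_square field_simps)
  have f: "f pq = martin_fun \<gamma> (\<pi> pq)" "\<pi> pq \<in> {0..1}" if "pq \<in> saddle_arc \<gamma>" for pq
  proof -
    obtain a where a: "a \<in> {0..1}" "pq = parab \<gamma> a" using \<open>pq \<in> saddle_arc \<gamma>\<close> unfolding saddle_arc_eq by blast
    then show "f pq = martin_fun \<gamma> (\<pi> pq)" "\<pi> pq \<in> {0..1}" using htilde_normalized[OF a(1)] by (simp_all only: f_def \<pi>)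
  qed
  have img: "f ` saddle_arc \<gamma> = martin_boundary g"
  proof -
    have "martin_boundary g = martin_fun \<gamma> ` {0..1}" by (rule martin_boundary_eq[OF \<gamma>]) (rule g)
    then show ?thesis unfolding saddle_arc_eq image_image f_def by (simp add: htilde_normalized)
  qed
  have top: "topspace (martin_topology g) = martin_boundary g"
    by (auto simp: martin_topology_def martin_boundary_def PiE_def)
  show ?thesis
    unfolding f_def[symmetric]
  proof (rule continuous_imp_homeomorphic_map)
    have "continuous_on {0..1} (parab \<gamma>)" unfolding parab_def by (intro continuous_intros) auto
    then have "compact (saddle_arc \<gamma>)" unfolding saddle_arc_eq by (intro compact_continuous_image) auto
    then show "compact_space (top_of_set (saddle_arc \<gamma>))" by (simp add: compact_space_subtopology)
    show "Hausdorff_space (martin_topology g)"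
      unfolding martin_topology_def by (intro Hausdorff_space_subtopology) (simp add: Hausdorff_space_product_topology)
    show "f ` topspace (top_of_set (saddle_arc \<gamma>)) = topspace (martin_topology g)" by (simp add: top img)
    show "inj_on f (topspace (top_of_set (saddle_arc \<gamma>)))"
    proof (rule inj_onI)
      fix p q assume "p \<in> topspace (top_of_set (saddle_arc \<gamma>))" "q \<in> topspace (top_of_set (saddle_arc \<gamma>))" and e: "f p = f q"
      then have pq: "p \<in> saddle_arc \<gamma>" "q \<in> saddle_arc \<gamma>" by auto
      have "\<pi> p = \<pi> q" by (rule inj_onD[OF inj_on_martin_fun[of \<gamma>]]) (use e f pq in auto)
      then show "p = q" using pq \<pi> by (auto simp: saddle_arc_eq)
    qed
    have "continuous_on (saddle_arc \<gamma>) (\<lambda>pq. f pq z)" if z: "z \<in> quadrant" for z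
    proof -
      have c: "continuous_on S (\<lambda>pq. mkern \<gamma> (\<pi> pq) z)" if "z \<in> quadrant" for S z
        unfolding mkern_def \<pi>_def using quadrant_sz_pos[OF that] by (intro continuous_intros) auto
      have "continuous_on (saddle_arc \<gamma>) (\<lambda>pq. mkern \<gamma> (\<pi> pq) z / mkern \<gamma> (\<pi> pq) (1, 1))"
        using mkern_pos[OF one_one_quadrant f(2), of _ \<gamma>] by (intro continuous_intros c z) (auto simp: less_le)
      then show ?thesis by (rule continuous_on_eq) (simp add: f martin_fun_def z)
    qed
    then have co: "\<forall>z\<in>quadrant. continuous_map (top_of_set (saddle_arc \<gamma>)) euclideanreal (\<lambda>pq. f pq z)" by simp
    have ext: "f ` saddle_arc \<gamma> \<subseteq> extensional quadrant" by (auto simp: f_def)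
    have img': "f \<in> saddle_arc \<gamma> \<rightarrow> martin_boundary g" using img by blast
    show "continuous_map (top_of_set (saddle_arc \<gamma>)) (martin_topology g) f"
      unfolding martin_topology_def continuous_map_in_subtopology continuous_map_componentwise
      using co ext img' by simp
  qed
qed

end

theorem theorem13:
  fixes M :: "'a measure" and W :: "real \<Rightarrow> 'a \<Rightarrow> real" and \<gamma> :: real
    and g :: "real \<times> real \<Rightarrow> real \<times> real \<Rightarrow> real"
  assumes "0 < \<gamma>" "\<gamma> < 1"
    and "standard_brownian_motion M W"
    and "\<And>z0. z0 \<in> quadrant \<Longrightarrow> is_green_density M W \<gamma> z0 (g z0)"
  shows "(\<forall>\<alpha>\<in>{0..pi / 2}. \<forall>z\<in>quadrant.
             complex_of_real (htilde \<gamma> (saddle \<gamma> \<alpha>) z) = h M W \<gamma> \<alpha> z) \<and>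
         (\<forall>u\<in>martin_boundary g. minimal_harmonic \<gamma> u) \<and>
         homeomorphic_map (top_of_set (saddle_arc \<gamma>)) (martin_topology g)
           (\<lambda>pq. \<lambda>z\<in>quadrant. htilde \<gamma> pq z / htilde \<gamma> pq (1, 1))"
proof -
  interpret standard_brownian_motion M W by (rule assms(3))
  note \<gamma> = assms(1,2) and g = assms(4)
  show ?thesis
  proof (intro conjI ballI)
    show "complex_of_real (htilde \<gamma> (saddle \<gamma> \<alpha>) z) = h M W \<gamma> \<alpha> z"
      if "\<alpha> \<in> {0..pi / 2}" "z \<in> quadrant" for \<alpha> z
      by (rule h_eq_htilde[OF \<gamma> that(2,1)])
    have boundary: "martin_boundary g = martin_fun \<gamma> ` {0..1}" by (rule martin_boundary_eq[OF \<gamma>]) (rule g)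
    show "minimal_harmonic \<gamma> u" if "u \<in> martin_boundary g" for u
      using that martin_fun_minimal[OF \<gamma>] unfolding boundary by blast
    show "homeomorphic_map (top_of_set (saddle_arc \<gamma>)) (martin_topology g)
           (\<lambda>pq. \<lambda>z\<in>quadrant. htilde \<gamma> pq z / htilde \<gamma> pq (1, 1))"
      by (rule homeomorphic_map_martin_boundary[OF \<gamma>]) (rule g)
  qed
qed

end
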